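(* Let $\mathcal K$ denote the class of $\mathcal D$-rings $(R,\partial)$ such that $R$ is an integral domain of characteristic zero and the associated endomorphisms $\sigma_1,\dots,\sigma_t$ of $R$ are injective. Then $(K,\partial)\in\mathcal K$ is existentially closed in $\mathcal K$ if and only if the following three conditions hold: I. $K$ is an algebraically closed field; II. $(K,\partial)$ is inversive; III. if $X$ is an irreducible affine variety over $K$ and $Y\subseteq\tau(X,\mathcal D,e)$ is an irreducible subvariety over $K$ such that $\widehat{\pi_i}(Y)$ is Zariski dense in $X^{\sigma_i}$ for all $i=0,\dots,t$, then there exists $a\in X(K)$ with $\nabla(a)\in Y(K)$.
   Context: Setting. $A$ is a field of characteristic zero, $\mathcal D(A)$ is a commutative unital finite-dimensional $A$-algebra, $\pi^A:\mathcal D(A)\to A$ is an $A$-algebra homomorphism, and $(\epsilon_0,\dots,\epsilon_{\ell-1})$ is an $A$-basis of $\mathcal D(A)$ with $\pi^A(\epsilon_0)=1$ and $\pi^A(\epsilon_j)=0$ for $1\le j\le\ell-1$. For an $A$-algebra $R$ put $\mathcal D(R)=R\otimes_A\mathcal D(A)$ and $\pi^R=\mathrm{id}_R\otimes\pi^A$. Write $\mathcal D(A)=\prod_{i=0}^tB_i$ with each $B_i$ a local finite $A$-algebra; it is assumed that the residue field of each $B_i$ is $A$. The indexing is such that the maximal ideal of $\mathcal D(A)$ corresponding to $B_0$ is $\ker\pi^A$. Let $\pi_i^A:\mathcal D(A)\to B_i\to A$ be projection followed by the residue map, and $\pi_i^R:\mathcal D(R)\to R$ its base change (so $\pi_0=\pi$).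 A $\mathcal D$-ring is an $A$-algebra $R$ with operators $\partial=(\partial_1,\dots,\partial_{\ell-1})$, $\partial_j:R\to R$, such that $e:R\to\mathcal D(R)$, $e(r)=r\epsilon_0+\partial_1(r)\epsilon_1+\cdots+\partial_{\ell-1}(r)\epsilon_{\ell-1}$, is an $A$-algebra homomorphism. The language is $\mathcal L_{\mathcal D}=\{0,1,+,-,\times,(\lambda_a)_{a\in A},\partial_1,\dots,\partial_{\ell-1}\}$, with $\lambda_a$ scalar multiplication by $a$. The associated endomorphisms of $(R,\partial)$ are $\sigma_i:=\pi_i^R\circ e:R\to R$ for $i=1,\dots,t$ (and $\sigma_0=\mathrm{id}$); they are $A$-linear combinations of $\mathrm{id},\partial_1,\dots,\partial_{\ell-1}$. A $\mathcal D$-ring is inversive if all its associated endomorphisms are surjective. $(K,\partial)\in\mathcal K$ is existentially closed in $\mathcal K$ if every existential $\mathcal L_{\mathcal D}$-sentence with parameters from $K$ that is true in some extension of $(K,\partial)$ belonging to $\mathcal K$ is true in $(K,\partial)$. Prolongations. Let $X=\mathrm{Spec}(K[x]/I)\subseteq\mathbb A^n_K$, $x=(x_1,\dots,x_n)$. For $P\in I$ let $P^e\in\mathcal D(K)[x]$ be obtained by applying $e$ to the coefficients, and write $P^e\big(\sum_{j=0}^{\ell-1}x^{(j)}\epsilon_j\big)=\sum_{j=0}^{\ell-1}P^{(j)}(x^{(0)},\dots,x^{(\ell-1)})\epsilon_j$ with $P^{(j)}$ having coefficients in $K$. The prolongation $\tau(X,\mathcal D,e)\subseteq\mathbb A_K^{n\ell}$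 is the closed subscheme defined by all $P^{(0)},\dots,P^{(\ell-1)}$, $P\in I$. Its $K$-points are identified with $X(\mathcal D(K))$, where $X$ is base changed to $\mathcal D(K)$ via $e$. The map $\nabla:X(K)\to\tau(X,\mathcal D,e)(K)$ is $\nabla(a)=(a,\partial_1(a),\dots,\partial_{\ell-1}(a))$. $X^{\sigma_i}$ is the variety obtained from $X$ by applying $\sigma_i$ to the coefficients of the defining polynomials, and $\widehat{\pi_i}:\tau(X,\mathcal D,e)\to X^{\sigma_i}$ is the morphism induced by $\pi_i$, i.e. $(x^{(0)},\dots,x^{(\ell-1)})\mapsto\sum_j\pi_i^A(\epsilon_j)x^{(j)}$. *)

theory Defs
  imports "HOL-Algebra.Algebraic_Closure" "HOL-Algebra.Module" "HOL-Algebra.QuotRing"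
begin

section \<open>Algebras over a field\<close>

definition char_zero :: "('r, 'm) ring_scheme \<Rightarrow> bool" where
  "char_zero R \<longleftrightarrow> (\<forall>n::nat. n > 0 \<longrightarrow> [n] \<cdot>\<^bsub>R\<^esub> \<one>\<^bsub>R\<^esub> \<noteq> \<zero>\<^bsub>R\<^esub>)"

definition algebra_hom :: "'a ring \<Rightarrow> ('a, 'r) module \<Rightarrow> ('a, 's) module \<Rightarrow> ('r \<Rightarrow> 's) set" where
  "algebra_hom A R S =
     {h \<in> ring_hom R S. \<forall>a\<in>carrier A. \<forall>x\<in>carrier R. h (a \<odot>\<^bsub>R\<^esub> x) = a \<odot>\<^bsub>S\<^esub> h x}"

definition self_algebra :: "'a ring \<Rightarrow> ('a, 'a) module" where
  "self_algebra A = \<lparr>carrier = carrier A, monoid.mult = monoid.mult A, one = \<one>\<^bsub>A\<^esub>,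
     zero = \<zero>\<^bsub>A\<^esub>, add = add A, smult = monoid.mult A\<rparr>"

definition is_basis :: "'a ring \<Rightarrow> ('a, 'd) module \<Rightarrow> nat \<Rightarrow> (nat \<Rightarrow> 'd) \<Rightarrow> bool" where
  "is_basis A M l b \<longleftrightarrow> (\<forall>j<l. b j \<in> carrier M) \<and>
     (\<forall>x\<in>carrier M. \<exists>!c. c \<in> {..<l} \<rightarrow>\<^sub>E carrier A \<and> x = (\<Oplus>\<^bsub>M\<^esub>j\<in>{..<l}. c j \<odot>\<^bsub>M\<^esub> b j))"

definition coordinates :: "'a ring \<Rightarrow> ('a, 'd) module \<Rightarrow> nat \<Rightarrow> (nat \<Rightarrow> 'd) \<Rightarrow> 'd \<Rightarrow> nat \<Rightarrow> 'a" where
  "coordinates A M l b x =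
     (THE c. c \<in> {..<l} \<rightarrow>\<^sub>E carrier A \<and> x = (\<Oplus>\<^bsub>M\<^esub>j\<in>{..<l}. c j \<odot>\<^bsub>M\<^esub> b j))"

definition local_ring :: "('r, 'm) ring_scheme \<Rightarrow> bool" where
  "local_ring R \<longleftrightarrow> cring R \<and> (\<exists>!m. maximalideal m R)"

definition max_ideal :: "('r, 'm) ring_scheme \<Rightarrow> 'r set" where
  "max_ideal R = (THE m. maximalideal m R)"

definition to_residue_field :: "('a, 'b) module \<Rightarrow> 'a \<Rightarrow> 'b set" where
  "to_residue_field B a = max_ideal B +>\<^bsub>B\<^esub> (a \<odot>\<^bsub>B\<^esub> \<one>\<^bsub>B\<^esub>)"

definition residue_field_is_base :: "'a ring \<Rightarrow> ('a, 'b) module \<Rightarrow> bool" where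
  "residue_field_is_base A B \<longleftrightarrow>
     bij_betw (to_residue_field B) (carrier A) (carrier (B Quot max_ideal B))"

definition residue_map :: "'a ring \<Rightarrow> ('a, 'b) module \<Rightarrow> 'b \<Rightarrow> 'a" where
  "residue_map A B b = inv_into (carrier A) (to_residue_field B) (max_ideal B +>\<^bsub>B\<^esub> b)"


section \<open>The data defining the operators\<close>

text \<open>The field \<open>A\<close>, the finite-dimensional algebra \<open>\<D>(A)\<close> with its map \<open>\<pi>\<close> to \<open>A\<close> and its
  basis \<open>\<epsilon>\<close> of length \<open>\<l>\<close>, and the decomposition of \<open>\<D>(A)\<close> into local algebras
  \<open>B 0, \<dots>, B t\<close>, given by the projections onto the factors.\<close>

record ('a, 'd, 'b) operator_data =
  Base :: "'a ring"
  Alg :: "('a, 'd) module"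
  Aug :: "'d \<Rightarrow> 'a"
  Len :: nat
  Eps :: "nat \<Rightarrow> 'd"
  Last :: nat
  Factor :: "nat \<Rightarrow> ('a, 'b) module"
  Proj :: "nat \<Rightarrow> 'd \<Rightarrow> 'b"

text \<open>Finite-dimensionality of the factors is automatic, since the projections are surjective.\<close>

definition operator_data :: "('a, 'd, 'b) operator_data \<Rightarrow> bool" where
  "operator_data \<D> \<longleftrightarrow>
     field (Base \<D>) \<and> char_zero (Base \<D>) \<and>
     algebra (Base \<D>) (Alg \<D>) \<and>
     Aug \<D> \<in> algebra_hom (Base \<D>) (Alg \<D>) (self_algebra (Base \<D>)) \<and>
     0 < Len \<D> \<and> is_basis (Base \<D>) (Alg \<D>) (Len \<D>) (Eps \<D>) \<and>
     Aug \<D> (Eps \<D> 0) = \<one>\<^bsub>Base \<D>\<^esub> \<and>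
     (\<forall>j\<in>{1..<Len \<D>}. Aug \<D> (Eps \<D> j) = \<zero>\<^bsub>Base \<D>\<^esub>) \<and>
     (\<forall>i\<le>Last \<D>. algebra (Base \<D>) (Factor \<D> i) \<and> local_ring (Factor \<D> i) \<and>
        residue_field_is_base (Base \<D>) (Factor \<D> i) \<and>
        Proj \<D> i \<in> algebra_hom (Base \<D>) (Alg \<D>) (Factor \<D> i)) \<and>
     bij_betw (\<lambda>x. \<lambda>i\<in>{..Last \<D>}. Proj \<D> i x)
       (carrier (Alg \<D>)) (\<Pi>\<^sub>E i\<in>{..Last \<D>}. carrier (Factor \<D> i)) \<and>
     {x \<in> carrier (Alg \<D>). Proj \<D> 0 x \<in> max_ideal (Factor \<D> 0)} =
       {x \<in> carrier (Alg \<D>). Aug \<D> x = \<zero>\<^bsub>Base \<D>\<^esub>}"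

text \<open>The maps \<open>\<pi>\<^sub>i : \<D>(A) \<rightarrow> B i \<rightarrow> A\<close>.\<close>

definition pi_base :: "('a, 'd, 'b) operator_data \<Rightarrow> nat \<Rightarrow> 'd \<Rightarrow> 'a" where
  "pi_base \<D> i x = residue_map (Base \<D>) (Factor \<D> i) (Proj \<D> i x)"

text \<open>\<open>\<D>(R)\<close> is the tensor product of \<open>R\<close> and \<open>\<D>(A)\<close> over \<open>A\<close>. It is free over \<open>R\<close> on the basis
  \<open>\<epsilon>\<close>, so it is represented by coordinate vectors over \<open>R\<close>: \<open>x\<close> stands for the sum of the
  \<open>x j \<epsilon> j\<close>, and multiplication is given by the structure constants of the basis. Note that
  \<open>\<epsilon> 0\<close> need not be the unit of \<open>\<D>(A)\<close>.\<close>

definition eps_coord :: "('a, 'd, 'b) operator_data \<Rightarrow> 'd \<Rightarrow> nat \<Rightarrow> 'a" where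
  "eps_coord \<D> = coordinates (Base \<D>) (Alg \<D>) (Len \<D>) (Eps \<D>)"

definition D_of :: "('a, 'd, 'b) operator_data \<Rightarrow> ('a, 'r) module \<Rightarrow> ('a, nat \<Rightarrow> 'r) module" where
  "D_of \<D> R =
    \<lparr>carrier = {..<Len \<D>} \<rightarrow>\<^sub>E carrier R,
     monoid.mult = (\<lambda>x y. \<lambda>k\<in>{..<Len \<D>}. \<Oplus>\<^bsub>R\<^esub>i\<in>{..<Len \<D>}. \<Oplus>\<^bsub>R\<^esub>j\<in>{..<Len \<D>}.
               eps_coord \<D> (Eps \<D> i \<otimes>\<^bsub>Alg \<D>\<^esub> Eps \<D> j) k \<odot>\<^bsub>R\<^esub> (x i \<otimes>\<^bsub>R\<^esub> y j)),
     one = (\<lambda>k\<in>{..<Len \<D>}. eps_coord \<D> \<one>\<^bsub>Alg \<D>\<^esub> k \<odot>\<^bsub>R\<^esub> \<one>\<^bsub>R\<^esub>),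
     zero = (\<lambda>k\<in>{..<Len \<D>}. \<zero>\<^bsub>R\<^esub>),
     add = (\<lambda>x y. \<lambda>k\<in>{..<Len \<D>}. x k \<oplus>\<^bsub>R\<^esub> y k),
     smult = (\<lambda>a x. \<lambda>k\<in>{..<Len \<D>}. a \<odot>\<^bsub>R\<^esub> x k)\<rparr>"

text \<open>The base change of \<open>\<pi>\<^sub>i\<close> to a map \<open>\<D>(R) \<rightarrow> R\<close>.\<close>

definition pi_over :: "('a, 'd, 'b) operator_data \<Rightarrow> ('a, 'r) module \<Rightarrow> nat \<Rightarrow> (nat \<Rightarrow> 'r) \<Rightarrow> 'r" where
  "pi_over \<D> R i x = (\<Oplus>\<^bsub>R\<^esub>j\<in>{..<Len \<D>}. pi_base \<D> i (Eps \<D> j) \<odot>\<^bsub>R\<^esub> x j)"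


section \<open>Rings with operators\<close>

text \<open>The operators are \<open>\<delta> 1, \<dots>, \<delta> (\<l> - 1)\<close>; other values of \<open>\<delta>\<close>, and values outside the
  carrier, are irrelevant.\<close>

definition D_exp :: "('a, 'd, 'b) operator_data \<Rightarrow> (nat \<Rightarrow> 'r \<Rightarrow> 'r) \<Rightarrow> 'r \<Rightarrow> nat \<Rightarrow> 'r" where
  "D_exp \<D> \<delta> r = (\<lambda>j\<in>{..<Len \<D>}. if j = 0 then r else \<delta> j r)"

definition D_ring :: "('a, 'd, 'b) operator_data \<Rightarrow> ('a, 'r) module \<Rightarrow> (nat \<Rightarrow> 'r \<Rightarrow> 'r) \<Rightarrow> bool" where
  "D_ring \<D> R \<delta> \<longleftrightarrow> algebra (Base \<D>) R \<and>
     (\<forall>j\<in>{1..<Len \<D>}. \<delta> j \<in> carrier R \<rightarrow> carrier R) \<and>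
     D_exp \<D> \<delta> \<in> algebra_hom (Base \<D>) R (D_of \<D> R)"

definition assoc_endo ::
    "('a, 'd, 'b) operator_data \<Rightarrow> ('a, 'r) module \<Rightarrow> (nat \<Rightarrow> 'r \<Rightarrow> 'r) \<Rightarrow> nat \<Rightarrow> 'r \<Rightarrow> 'r" where
  "assoc_endo \<D> R \<delta> i r = pi_over \<D> R i (D_exp \<D> \<delta> r)"

definition inversive :: "('a, 'd, 'b) operator_data \<Rightarrow> ('a, 'r) module \<Rightarrow> (nat \<Rightarrow> 'r \<Rightarrow> 'r) \<Rightarrow> bool" where
  "inversive \<D> R \<delta> \<longleftrightarrow> (\<forall>i\<in>{1..Last \<D>}. assoc_endo \<D> R \<delta> i ` carrier R = carrier R)"

definition class_K :: "('a, 'd, 'b) operator_data \<Rightarrow> ('a, 'r) module \<Rightarrow> (nat \<Rightarrow> 'r \<Rightarrow> 'r) \<Rightarrow> bool" where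
  "class_K \<D> R \<delta> \<longleftrightarrow> D_ring \<D> R \<delta> \<and> domain R \<and> char_zero R \<and>
     (\<forall>i\<in>{1..Last \<D>}. inj_on (assoc_endo \<D> R \<delta> i) (carrier R))"

definition D_embedding ::
    "('a, 'd, 'b) operator_data \<Rightarrow> ('a, 'k) module \<Rightarrow> (nat \<Rightarrow> 'k \<Rightarrow> 'k) \<Rightarrow>
      ('a, 'r) module \<Rightarrow> (nat \<Rightarrow> 'r \<Rightarrow> 'r) \<Rightarrow> ('k \<Rightarrow> 'r) \<Rightarrow> bool" where
  "D_embedding \<D> K \<delta> R \<delta>' \<iota> \<longleftrightarrow>
     \<iota> \<in> algebra_hom (Base \<D>) K R \<and> inj_on \<iota> (carrier K) \<and>
     (\<forall>j\<in>{1..<Len \<D>}. \<forall>x\<in>carrier K. \<iota> (\<delta> j x) = \<delta>' j (\<iota> x))"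


section \<open>The language and existential closedness\<close>

datatype ('a, 'k) dterm =
    Var nat
  | Param 'k
  | Zero
  | One
  | Plus "('a, 'k) dterm" "('a, 'k) dterm"
  | Minus "('a, 'k) dterm" "('a, 'k) dterm"
  | Times "('a, 'k) dterm" "('a, 'k) dterm"
  | Scale 'a "('a, 'k) dterm"
  | Deriv nat "('a, 'k) dterm"

datatype ('a, 'k) qf_formula =
    Eq "('a, 'k) dterm" "('a, 'k) dterm"
  | Neg "('a, 'k) qf_formula"
  | Conj "('a, 'k) qf_formula" "('a, 'k) qf_formula"
  | Disj "('a, 'k) qf_formula" "('a, 'k) qf_formula"

primrec dterm_over :: "('a, 'd, 'b) operator_data \<Rightarrow> 'k set \<Rightarrow> ('a, 'k) dterm \<Rightarrow> bool" where
  "dterm_over \<D> C (Var i) \<longleftrightarrow> True"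
| "dterm_over \<D> C (Param c) \<longleftrightarrow> c \<in> C"
| "dterm_over \<D> C Zero \<longleftrightarrow> True"
| "dterm_over \<D> C One \<longleftrightarrow> True"
| "dterm_over \<D> C (Plus s u) \<longleftrightarrow> dterm_over \<D> C s \<and> dterm_over \<D> C u"
| "dterm_over \<D> C (Minus s u) \<longleftrightarrow> dterm_over \<D> C s \<and> dterm_over \<D> C u"
| "dterm_over \<D> C (Times s u) \<longleftrightarrow> dterm_over \<D> C s \<and> dterm_over \<D> C u"
| "dterm_over \<D> C (Scale a s) \<longleftrightarrow> a \<in> carrier (Base \<D>) \<and> dterm_over \<D> C s"
| "dterm_over \<D> C (Deriv j s) \<longleftrightarrow> j \<in> {1..<Len \<D>} \<and> dterm_over \<D> C s"

primrec qf_over :: "('a, 'd, 'b) operator_data \<Rightarrow> 'k set \<Rightarrow> ('a, 'k) qf_formula \<Rightarrow> bool" where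
  "qf_over \<D> C (Eq s u) \<longleftrightarrow> dterm_over \<D> C s \<and> dterm_over \<D> C u"
| "qf_over \<D> C (Neg \<phi>) \<longleftrightarrow> qf_over \<D> C \<phi>"
| "qf_over \<D> C (Conj \<phi> \<psi>) \<longleftrightarrow> qf_over \<D> C \<phi> \<and> qf_over \<D> C \<psi>"
| "qf_over \<D> C (Disj \<phi> \<psi>) \<longleftrightarrow> qf_over \<D> C \<phi> \<and> qf_over \<D> C \<psi>"

text \<open>In the following, \<open>\<iota>\<close> interprets the parameters and \<open>v\<close> the variables.\<close>

primrec dterm_val ::
    "('a, 'r) module \<Rightarrow> (nat \<Rightarrow> 'r \<Rightarrow> 'r) \<Rightarrow> ('k \<Rightarrow> 'r) \<Rightarrow> (nat \<Rightarrow> 'r) \<Rightarrow> ('a, 'k) dterm \<Rightarrow> 'r" where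
  "dterm_val R \<delta> \<iota> v (Var i) = v i"
| "dterm_val R \<delta> \<iota> v (Param c) = \<iota> c"
| "dterm_val R \<delta> \<iota> v Zero = \<zero>\<^bsub>R\<^esub>"
| "dterm_val R \<delta> \<iota> v One = \<one>\<^bsub>R\<^esub>"
| "dterm_val R \<delta> \<iota> v (Plus s u) = dterm_val R \<delta> \<iota> v s \<oplus>\<^bsub>R\<^esub> dterm_val R \<delta> \<iota> v u"
| "dterm_val R \<delta> \<iota> v (Minus s u) = dterm_val R \<delta> \<iota> v s \<ominus>\<^bsub>R\<^esub> dterm_val R \<delta> \<iota> v u"
| "dterm_val R \<delta> \<iota> v (Times s u) = dterm_val R \<delta> \<iota> v s \<otimes>\<^bsub>R\<^esub> dterm_val R \<delta> \<iota> v u"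
| "dterm_val R \<delta> \<iota> v (Scale a s) = a \<odot>\<^bsub>R\<^esub> dterm_val R \<delta> \<iota> v s"
| "dterm_val R \<delta> \<iota> v (Deriv j s) = \<delta> j (dterm_val R \<delta> \<iota> v s)"

primrec qf_holds ::
    "('a, 'r) module \<Rightarrow> (nat \<Rightarrow> 'r \<Rightarrow> 'r) \<Rightarrow> ('k \<Rightarrow> 'r) \<Rightarrow> (nat \<Rightarrow> 'r) \<Rightarrow> ('a, 'k) qf_formula \<Rightarrow> bool" where
  "qf_holds R \<delta> \<iota> v (Eq s u) \<longleftrightarrow> dterm_val R \<delta> \<iota> v s = dterm_val R \<delta> \<iota> v u"
| "qf_holds R \<delta> \<iota> v (Neg \<phi>) \<longleftrightarrow> \<not> qf_holds R \<delta> \<iota> v \<phi>"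
| "qf_holds R \<delta> \<iota> v (Conj \<phi> \<psi>) \<longleftrightarrow> qf_holds R \<delta> \<iota> v \<phi> \<and> qf_holds R \<delta> \<iota> v \<psi>"
| "qf_holds R \<delta> \<iota> v (Disj \<phi> \<psi>) \<longleftrightarrow> qf_holds R \<delta> \<iota> v \<phi> \<or> qf_holds R \<delta> \<iota> v \<psi>"

text \<open>Truth of the existential sentence obtained from the quantifier-free formula \<open>\<phi>\<close> by
  existentially quantifying all of its (finitely many) variables.\<close>

definition ex_sentence_true ::
    "('a, 'r) module \<Rightarrow> (nat \<Rightarrow> 'r \<Rightarrow> 'r) \<Rightarrow> ('k \<Rightarrow> 'r) \<Rightarrow> ('a, 'k) qf_formula \<Rightarrow> bool" where
  "ex_sentence_true R \<delta> \<iota> \<phi> \<longleftrightarrow> (\<exists>v. (\<forall>i. v i \<in> carrier R) \<and> qf_holds R \<delta> \<iota> v \<phi>)"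

text \<open>HOL cannot quantify over extensions of \<open>K\<close> of arbitrary type, so the type \<open>'u\<close> in which the
  extensions live is a parameter. By the downward Loewenheim-Skolem theorem, as soon as \<open>'u\<close> is
  at least as large as \<open>K\<close> (which is infinite and has at least as many elements as \<open>A\<close>), the
  notion does not depend on \<open>'u\<close>.\<close>

definition existentially_closed ::
    "'u itself \<Rightarrow> ('a, 'd, 'b) operator_data \<Rightarrow> ('a, 'k) module \<Rightarrow> (nat \<Rightarrow> 'k \<Rightarrow> 'k) \<Rightarrow> bool" where
  "existentially_closed U \<D> K \<delta> \<longleftrightarrow>
     (\<forall>(R :: ('a, 'u) module) \<delta>' \<iota> \<phi>.
        class_K \<D> R \<delta>' \<and> D_embedding \<D> K \<delta> R \<delta>' \<iota> \<and> qf_over \<D> (carrier K) \<phi> \<and>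
        ex_sentence_true R \<delta>' \<iota> \<phi> \<longrightarrow> ex_sentence_true K \<delta> (\<lambda>c. c) \<phi>)"


section \<open>Polynomial rings\<close>

text \<open>Polynomials over \<open>R\<close> in variables indexed by \<open>V\<close>: a monomial is a multiset of variables and
  a polynomial maps monomials to coefficients.\<close>

definition mpoly :: "('a, 'r) module \<Rightarrow> 'v set \<Rightarrow> ('a, 'v multiset \<Rightarrow> 'r) module" where
  "mpoly R V =
    \<lparr>carrier = ring.indexed_pset R V (carrier R),
     monoid.mult = (\<lambda>P Q m. \<Oplus>\<^bsub>R\<^esub>m'\<in>{m'. m' \<subseteq># m}. P m' \<otimes>\<^bsub>R\<^esub> Q (m - m')),
     one = ring.indexed_const R \<one>\<^bsub>R\<^esub>,
     zero = ring.indexed_const R \<zero>\<^bsub>R\<^esub>,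
     add = ring.indexed_padd R,
     smult = (\<lambda>a P m. a \<odot>\<^bsub>R\<^esub> P m)\<rparr>"

text \<open>The value in \<open>S\<close> of a polynomial over \<open>R\<close> at the point \<open>y\<close>, the coefficients being sent to
  \<open>S\<close> by \<open>h\<close>.\<close>

definition mpoly_eval ::
    "('a, 'r) module \<Rightarrow> ('a, 's) module \<Rightarrow> ('r \<Rightarrow> 's) \<Rightarrow> ('v \<Rightarrow> 's) \<Rightarrow> ('v multiset \<Rightarrow> 'r) \<Rightarrow> 's" where
  "mpoly_eval R S h y P =
     (\<Oplus>\<^bsub>S\<^esub>m\<in>{m. P m \<noteq> \<zero>\<^bsub>R\<^esub>}. h (P m) \<otimes>\<^bsub>S\<^esub> (\<Otimes>\<^bsub>S\<^esub>i\<in>set_mset m. y i [^]\<^bsub>S\<^esub> count m i))"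


section \<open>Affine varieties\<close>

text \<open>Closed subschemes of affine space are given by ideals of the polynomial ring, and their
  underlying spaces are closed subsets of the prime spectrum. Varieties are reduced.\<close>

definition spec_zeros :: "('r, 'm) ring_scheme \<Rightarrow> 'r set \<Rightarrow> 'r set set" where
  "spec_zeros R S = {p. primeideal p R \<and> S \<subseteq> p}"

definition spec_closed :: "('r, 'm) ring_scheme \<Rightarrow> 'r set set \<Rightarrow> bool" where
  "spec_closed R Z \<longleftrightarrow> (\<exists>S\<subseteq>carrier R. Z = spec_zeros R S)"

definition spec_closure :: "('r, 'm) ring_scheme \<Rightarrow> 'r set set \<Rightarrow> 'r set set" where
  "spec_closure R W = \<Inter>{Z. spec_closed R Z \<and> W \<subseteq> Z}"

definition zariski_dense :: "('r, 'm) ring_scheme \<Rightarrow> 'r set set \<Rightarrow> 'r set set \<Rightarrow> bool" where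
  "zariski_dense R W Z \<longleftrightarrow> W \<subseteq> Z \<and> Z \<subseteq> spec_closure R W"

definition spec_irreducible :: "('r, 'm) ring_scheme \<Rightarrow> 'r set set \<Rightarrow> bool" where
  "spec_irreducible R Z \<longleftrightarrow> Z \<noteq> {} \<and>
     (\<forall>F G. spec_closed R F \<and> spec_closed R G \<and> Z \<subseteq> F \<union> G \<longrightarrow> Z \<subseteq> F \<or> Z \<subseteq> G)"

definition radical_ideal :: "'r set \<Rightarrow> ('r, 'm) ring_scheme \<Rightarrow> bool" where
  "radical_ideal I R \<longleftrightarrow> ideal I R \<and> (\<forall>x\<in>carrier R. \<forall>k::nat. x [^]\<^bsub>R\<^esub> k \<in> I \<longrightarrow> x \<in> I)"

definition irreducible_variety :: "('r, 'm) ring_scheme \<Rightarrow> 'r set \<Rightarrow> bool" where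
  "irreducible_variety R I \<longleftrightarrow> radical_ideal I R \<and> spec_irreducible R (spec_zeros R I)"

definition rational_points :: "('a, 'k) module \<Rightarrow> 'v set \<Rightarrow> ('v multiset \<Rightarrow> 'k) set \<Rightarrow> ('v \<Rightarrow> 'k) set" where
  "rational_points K V I =
     {a \<in> V \<rightarrow>\<^sub>E carrier K. \<forall>P\<in>I. mpoly_eval K K (\<lambda>c. c) a P = \<zero>\<^bsub>K\<^esub>}"


section \<open>Prolongations\<close>

text \<open>The prolongation of a subscheme of affine \<open>n\<close>-space lives in the affine space with coordinates
  \<open>x\<^sub>k\<^sup>(\<^sup>j\<^sup>)\<close>, represented by the variables \<open>(j, k)\<close> with \<open>j < \<l>\<close> and \<open>k < n\<close>.\<close>

definition prol_vars :: "('a, 'd, 'b) operator_data \<Rightarrow> nat \<Rightarrow> (nat \<times> nat) set" where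
  "prol_vars \<D> n = {..<Len \<D>} \<times> {..<n}"

definition prol_ring ::
    "('a, 'd, 'b) operator_data \<Rightarrow> ('a, 'k) module \<Rightarrow> nat \<Rightarrow> ('a, (nat \<times> nat) multiset \<Rightarrow> 'k) module" where
  "prol_ring \<D> K n = mpoly K (prol_vars \<D> n)"

text \<open>The point whose \<open>k\<close>-th entry is the sum of the \<open>x\<^sub>k\<^sup>(\<^sup>j\<^sup>) \<epsilon> j\<close>, an element of \<open>\<D>(prol_ring)\<close>.\<close>

definition generic_point ::
    "('a, 'd, 'b) operator_data \<Rightarrow> ('a, 'k) module \<Rightarrow> nat \<Rightarrow> nat \<Rightarrow> (nat \<times> nat) multiset \<Rightarrow> 'k" where
  "generic_point \<D> K k = (\<lambda>j\<in>{..<Len \<D>}. ring.indexed_var K (j, k))"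

text \<open>\<open>prol_coeff \<D> K \<delta> n P j\<close> is \<open>P\<^sup>(\<^sup>j\<^sup>)\<close>: polynomials over \<open>\<D>(K)\<close> in the \<open>x\<^sub>k\<^sup>(\<^sup>j\<^sup>)\<close> are elements of
  \<open>\<D>(prol_ring)\<close>, and \<open>P\<^sup>(\<^sup>j\<^sup>)\<close> is the \<open>j\<close>-th coordinate of the value of \<open>P\<^sup>e\<close> at the generic
  point.\<close>

definition prol_coeff ::
    "('a, 'd, 'b) operator_data \<Rightarrow> ('a, 'k) module \<Rightarrow> (nat \<Rightarrow> 'k \<Rightarrow> 'k) \<Rightarrow> nat \<Rightarrow>
      (nat multiset \<Rightarrow> 'k) \<Rightarrow> nat \<Rightarrow> (nat \<times> nat) multiset \<Rightarrow> 'k" where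
  "prol_coeff \<D> K \<delta> n P =
     mpoly_eval K (D_of \<D> (prol_ring \<D> K n))
       (\<lambda>c. \<lambda>j\<in>{..<Len \<D>}. ring.indexed_const K (D_exp \<D> \<delta> c j)) (generic_point \<D> K) P"

definition prol_ideal ::
    "('a, 'd, 'b) operator_data \<Rightarrow> ('a, 'k) module \<Rightarrow> (nat \<Rightarrow> 'k \<Rightarrow> 'k) \<Rightarrow> nat \<Rightarrow>
      (nat multiset \<Rightarrow> 'k) set \<Rightarrow> ((nat \<times> nat) multiset \<Rightarrow> 'k) set" where
  "prol_ideal \<D> K \<delta> n I =
     Idl\<^bsub>prol_ring \<D> K n\<^esub> {prol_coeff \<D> K \<delta> n P j | P j. P \<in> I \<and> j < Len \<D>}"

definition nabla ::
    "('a, 'd, 'b) operator_data \<Rightarrow> (nat \<Rightarrow> 'k \<Rightarrow> 'k) \<Rightarrow> nat \<Rightarrow> (nat \<Rightarrow> 'k) \<Rightarrow> nat \<times> nat \<Rightarrow> 'k" where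
  "nabla \<D> \<delta> n a = (\<lambda>(j, k)\<in>prol_vars \<D> n. if j = 0 then a k else \<delta> j (a k))"

text \<open>The underlying space of the conjugate variety \<open>X\<^sup>\<sigma>\<close>, where \<open>\<sigma>\<close> is the \<open>i\<close>-th associated
  endomorphism and \<open>X\<close> is given by the ideal \<open>I\<close>.\<close>

definition conj_space ::
    "('a, 'd, 'b) operator_data \<Rightarrow> ('a, 'k) module \<Rightarrow> (nat \<Rightarrow> 'k \<Rightarrow> 'k) \<Rightarrow> nat \<Rightarrow> nat \<Rightarrow>
      (nat multiset \<Rightarrow> 'k) set \<Rightarrow> (nat multiset \<Rightarrow> 'k) set set" where
  "conj_space \<D> K \<delta> n i I =
     spec_zeros (mpoly K {..<n}) ((\<lambda>P m. assoc_endo \<D> K \<delta> i (P m)) ` I)"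

text \<open>The map on prime spectra induced by the morphism \<open>(x\<^sup>(\<^sup>0\<^sup>), \<dots>) \<mapsto> \<Sum>\<^sub>j \<pi>\<^sub>i(\<epsilon> j) x\<^sup>(\<^sup>j\<^sup>)\<close>, that is,
  contraction of primes along the homomorphism sending \<open>x\<^sub>k\<close> to \<open>\<Sum>\<^sub>j \<pi>\<^sub>i(\<epsilon> j) x\<^sub>k\<^sup>(\<^sup>j\<^sup>)\<close>.\<close>

definition pi_hat ::
    "('a, 'd, 'b) operator_data \<Rightarrow> ('a, 'k) module \<Rightarrow> nat \<Rightarrow> nat \<Rightarrow>
      ((nat \<times> nat) multiset \<Rightarrow> 'k) set \<Rightarrow> (nat multiset \<Rightarrow> 'k) set" where
  "pi_hat \<D> K n i p =
     {P \<in> carrier (mpoly K {..<n}).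
        mpoly_eval K (prol_ring \<D> K n) (ring.indexed_const K)
          (\<lambda>k. pi_over \<D> (prol_ring \<D> K n) i (generic_point \<D> K k)) P \<in> p}"

definition geometric_axiom ::
    "('a, 'd, 'b) operator_data \<Rightarrow> ('a, 'k) module \<Rightarrow> (nat \<Rightarrow> 'k \<Rightarrow> 'k) \<Rightarrow> bool" where
  "geometric_axiom \<D> K \<delta> \<longleftrightarrow>
     (\<forall>n I J.
        irreducible_variety (mpoly K {..<n}) I \<and>
        irreducible_variety (prol_ring \<D> K n) J \<and>
        prol_ideal \<D> K \<delta> n I \<subseteq> J \<and>
        (\<forall>i\<le>Last \<D>. zariski_dense (mpoly K {..<n})
           (pi_hat \<D> K n i ` spec_zeros (prol_ring \<D> K n) J) (conj_space \<D> K \<delta> n i I)) \<longrightarrow>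
        (\<exists>a\<in>rational_points K {..<n} I.
           nabla \<D> \<delta> n a \<in> rational_points K (prol_vars \<D> n) J))"

end

theory Submission
  imports Defs "HOL-Library.Multiset_Order" "HOL-Library.Product_Lexorder"
begin

text \<open>Operators on a domain \<open>R\<close> amount to a homomorphism \<open>e : R \<rightarrow> \<D>(R)\<close> with \<open>\<pi>\<^sub>0 \<circ> e = id\<close>. The
  common kernel of \<open>\<pi>\<^sub>0, \<dots>, \<pi>\<^sub>t : \<D>(F) \<rightarrow> F\<close> is nilpotent, so if \<open>F\<close> is an algebraically closed field
  then \<open>e\<close> extends from a subring to any algebraic element by Newton approximation, once a root of the
  conjugate minimal polynomial is chosen for each \<open>\<pi>\<^sub>i \<circ> e\<close>. By Zorn's lemma it suffices to prescribe
  \<open>e\<close> on a subring over which \<open>F\<close> is algebraic. In particular every member of the class embeds in one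
  that is an algebraically closed field.

  If the axioms hold and a quantifier-free formula is satisfied in such an extension \<open>F\<close>, let \<open>c\<close> be
  the tuple of the values of all its subterms and of the inverses of their nonzero differences. The
  vanishing ideals of \<open>c\<close> and of \<open>\<nabla>(c)\<close> satisfy the hypotheses of the geometric axiom: density is the
  injectivity of the \<open>\<sigma>\<^sub>i\<close> on \<open>F\<close>. The point of \<open>K\<close> that the axiom provides satisfies the formula.

  Conversely, roots and \<open>\<sigma>\<^sub>i\<close>-preimages exist in suitable extensions. For the geometric axiom let \<open>b\<close> be
  the generic point of \<open>Y\<close> and \<open>a\<close> its image in \<open>X\<close>. Then \<open>e(a) = b\<close> defines \<open>e\<close> on \<open>K[a]\<close>, and density makes
  all \<open>\<pi>\<^sub>i \<circ> e\<close> injective. Let \<open>F\<close> be the algebraic closure of \<open>K(b)\<close> with infinitely many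
  indeterminates adjoined; mapping a transcendence basis of \<open>F\<close> over \<open>K[a]\<close> to indeterminates under
  each \<open>\<pi>\<^sub>i \<circ> e\<close>, \<open>i > 0\<close>, extends \<open>e\<close> to \<open>F\<close>. As the ideal of \<open>Y\<close> is finitely generated, that
  \<open>Y\<close> has a point \<open>\<nabla>(a)\<close> is an existential sentence.\<close>

subsection \<open>Ideals disjoint from a set\<close>

text \<open>One invariant is carried through every extension of \<open>e\<close>: no \<pi>_i kills
  \<open>e s\<close> for a nonzero \<open>s\<close>. It makes \<open>e s\<close> a unit of \<D>(F),
  so that pseudo-division can replace division; it keeps conjugate minimal polynomials at full
  degree; and in the end it is the injectivity of the endomorphisms. Characteristic zero enters as
  separability: the derivative of a minimal polynomial does not vanish at the root, so Newton's
  correction is defined. The obstacle in the geometric axiom is where \<pi>_i o e should send a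
  transcendence basis. The images must be independent over \<pi>_i(e(K[a])), which may be spread
  over all of K[b], so only indeterminates foreign to K[b] are safe. These indeterminates belong to
  the basis themselves; when b has positive transcendence degree over a, finitely many of them could
  never receive the whole basis, while an infinite sequence leaves room for a shift. The other
  obstacle is size: hulls live in types of their own, whereas existential closedness quantifies over
  one type. The values of terms form a substructure no larger than K, which can be copied
  back.\<close>

lemma (in ring) exists_maximal_disjoint_ideal:
  assumes "ideal I R" "I \<inter> S = {}"
  obtains M where "ideal M R" "I \<subseteq> M" "M \<inter> S = {}"
    "\<And>J. \<lbrakk>ideal J R; M \<subseteq> J; J \<inter> S = {}\<rbrakk> \<Longrightarrow> J = M"
proof -
  let ?A = "{J. ideal J R \<and> I \<subseteq> J \<and> J \<inter> S = {}}"
  have "\<exists>M\<in>?A. \<forall>J\<in>?A. M \<subseteq> J \<longrightarrow> J = M"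
  proof (rule subset_Zorn_nonempty)
    show "?A \<noteq> {}" using assms by blast
  next
    fix C assume C: "C \<noteq> {}" "subset.chain ?A C"
    then have "subset.chain {J. ideal J R} C"
      unfolding pred_on.chain_def by auto
    then have "ideal (\<Union>C) R"
      using chain_Union_is_ideal[of C] C(1) by simp
    moreover have "I \<subseteq> \<Union>C" "\<Union>C \<inter> S = {}"
      using C unfolding pred_on.chain_def by blast+
    ultimately show "\<Union>C \<in> ?A" by simp
  qed
  then obtain M where M: "M \<in> ?A" "\<forall>J\<in>?A. M \<subseteq> J \<longrightarrow> J = M" by (elim bexE)
  show thesis
  proof (rule that[of M])
    show "ideal M R" "I \<subseteq> M" "M \<inter> S = {}" using M(1) by auto
    fix J assume J: "ideal J R" "M \<subseteq> J" "J \<inter> S = {}"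
    then have "J \<in> ?A" using M(1) by auto
    then show "J = M" using M(2) J(2) by simp
  qed
qed

text \<open>If neither \<open>a\<close> nor \<open>b\<close> lies in \<open>M\<close>, maximality
  yields elements of \<open>S\<close> in the ideals generated by \<open>M\<close> with
  \<open>a\<close> and by \<open>M\<close> with \<open>b\<close>. Their product lies in
  \<open>S\<close>, and it would lie in \<open>M\<close> if the product of \<open>a\<close> and
  \<open>b\<close> did.\<close>

lemma (in cring) maximal_disjoint_ideal_prime:
  assumes M: "ideal M R" "M \<inter> S = {}"
    and S: "S \<subseteq> carrier R" "\<one> \<in> S" "\<And>a b. \<lbrakk>a \<in> S; b \<in> S\<rbrakk> \<Longrightarrow> a \<otimes> b \<in> S"
    and max: "\<And>J. \<lbrakk>ideal J R; M \<subseteq> J; J \<inter> S = {}\<rbrakk> \<Longrightarrow> J = M"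
  shows "primeideal M R"
proof (rule primeidealI[OF M(1) is_cring])
  interpret M: ideal M R by fact
  show "carrier R \<noteq> M" using M(2) S by auto
  have key: "\<exists>s\<in>S. \<exists>m\<in>M. \<exists>r\<in>carrier R. s = m \<oplus> r \<otimes> a"
    if a: "a \<in> carrier R" "a \<notin> M" for a
  proof -
    interpret P: ideal "PIdl a" R by (rule cgenideal_ideal[OF a(1)])
    have I: "ideal (M <+>\<^bsub>R\<^esub> PIdl a) R" by (rule add_ideals[OF M(1) P.is_ideal])
    have sub: "M \<subseteq> M <+>\<^bsub>R\<^esub> PIdl a"
    proof
      fix m assume m: "m \<in> M"
      then have "m = m \<oplus> \<zero>" using M.a_subset by auto
      then show "m \<in> M <+>\<^bsub>R\<^esub> PIdl a"
        using m P.zero_closed unfolding set_add_def' by blast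
    qed
    have "a \<in> M <+>\<^bsub>R\<^esub> PIdl a"
    proof -
      have "a = \<zero> \<oplus> a" using a by simp
      then show ?thesis
        using M.zero_closed cgenideal_self[OF a(1)] unfolding set_add_def' by blast
    qed
    then have "M <+>\<^bsub>R\<^esub> PIdl a \<noteq> M" using a by blast
    then obtain s where "s \<in> S" "s \<in> M <+>\<^bsub>R\<^esub> PIdl a" using max[OF I sub] by blast
    then show ?thesis unfolding set_add_def' cgenideal_def by blast
  qed
  fix a b assume ab: "a \<in> carrier R" "b \<in> carrier R" "a \<otimes> b \<in> M"
  show "a \<in> M \<or> b \<in> M"
  proof (rule ccontr)
    assume "\<not> ?thesis"
    then obtain s m r s' m' r' where *: "s \<in> S" "m \<in> M" "r \<in> carrier R" "s = m \<oplus> r \<otimes> a"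
      "s' \<in> S" "m' \<in> M" "r' \<in> carrier R" "s' = m' \<oplus> r' \<otimes> b"
      using key[OF ab(1)] key[OF ab(2)] by blast
    have mc: "m \<in> carrier R" "m' \<in> carrier R" using * M.a_subset by auto
    have "s \<otimes> s' = m \<otimes> (m' \<oplus> r' \<otimes> b) \<oplus> (r \<otimes> a) \<otimes> m' \<oplus> (r \<otimes> r') \<otimes> (a \<otimes> b)"
      unfolding * using mc *(3,7) ab(1,2) by algebra
    moreover have "\<dots> \<in> M"
      using mc *(2,3,6,7) ab by (intro M.a_closed M.I_r_closed[OF *(2)] M.I_l_closed[OF *(6)] M.I_l_closed[OF ab(3)]) auto
    ultimately show False using S(3)[OF *(1) *(5)] M(2) by auto
  qed
qed

text \<open>The powers of \<open>x\<close> are closed under products and miss a radical ideal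
  without \<open>x\<close>, so an ideal maximal among those missing them is prime.\<close>

lemma (in cring) radical_eq_Inter_primes:
  assumes "radical_ideal I R" "x \<in> carrier R" "x \<notin> I"
  shows "\<exists>p. primeideal p R \<and> I \<subseteq> p \<and> x \<notin> p"
proof -
  let ?S = "range (\<lambda>k::nat. x [^] k)"
  have "ideal I R" "I \<inter> ?S = {}"
    using assms unfolding radical_ideal_def by auto
  then obtain M where M: "ideal M R" "I \<subseteq> M" "M \<inter> ?S = {}"
    "\<And>J. \<lbrakk>ideal J R; M \<subseteq> J; J \<inter> ?S = {}\<rbrakk> \<Longrightarrow> J = M"
    by (rule exists_maximal_disjoint_ideal) blast
  have "primeideal M R"
  proof (rule maximal_disjoint_ideal_prime[OF M(1,3) _ _ _ M(4)])
    show "?S \<subseteq> carrier R" using assms(2) by auto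
    show "\<one> \<in> ?S" by (rule range_eqI[of _ _ 0]) simp
    show "a \<otimes> b \<in> ?S" if "a \<in> ?S" "b \<in> ?S" for a b
      using that assms(2) by (auto simp: nat_pow_mult)
  qed
  moreover have "x \<notin> M"
  proof -
    have "x [^] (1::nat) \<in> ?S" by blast
    then show ?thesis using M(3) assms(2) by auto
  qed
  ultimately show ?thesis using M(2) by blast
qed

text \<open>Proper ideals are those that miss \<one>, so this is the case of a maximal ideal
  disjoint from \<open>{\<one>}\<close>.\<close>

lemma (in cring) not_unit_in_maximal:
  assumes "x \<in> carrier R" "x \<notin> Units R"
  shows "\<exists>m. maximalideal m R \<and> x \<in> m"
proof -
  have "PIdl x \<inter> {\<one>} = {}"
    using assms unfolding cgenideal_def Units_def by (auto simp: m_comm)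
  then obtain M where M: "ideal M R" "PIdl x \<subseteq> M" "M \<inter> {\<one>} = {}"
    "\<And>J. \<lbrakk>ideal J R; M \<subseteq> J; J \<inter> {\<one>} = {}\<rbrakk> \<Longrightarrow> J = M"
    by (rule exists_maximal_disjoint_ideal[OF cgenideal_ideal[OF assms(1)]]) blast
  have "maximalideal M R"
  proof (rule maximalidealI[OF M(1)])
    show "carrier R \<noteq> M" using M(3) by auto
    show "J = M \<or> J = carrier R" if "ideal J R" "M \<subseteq> J" for J
      using M(4)[OF that] ideal.one_imp_carrier[OF that(1)] by blast
  qed
  then show ?thesis using M(2) cgenideal_self[OF assms(1)] by blast
qed

section \<open>Irreducible closed sets and prime ideals\<close>

text \<open>When \<open>a \<otimes> b\<close> lies in \<open>I\<close>, the zero sets of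
  \<open>a\<close> and \<open>b\<close> cover that of \<open>I\<close>, so one of them contains it.
  A radical ideal is the intersection of the primes above it, which turns this containment into
  membership of \<open>a\<close> or \<open>b\<close>.\<close>

lemma (in cring) irreducible_variety_prime:
  assumes "irreducible_variety R I"
  shows "primeideal I R"
proof -
  have rad: "radical_ideal I R" and irr: "spec_irreducible R (spec_zeros R I)"
    using assms unfolding irreducible_variety_def by auto
  interpret I: ideal I R using rad unfolding radical_ideal_def by simp
  show ?thesis
  proof (rule primeidealI[OF I.is_ideal is_cring])
    obtain p where "primeideal p R" "I \<subseteq> p"
      using irr unfolding spec_irreducible_def spec_zeros_def by auto
    then show "carrier R \<noteq> I"
      using primeideal.I_notcarr[of p R] I.a_subset ideal.axioms(1)[OF primeideal.axioms(1), of p R]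
        additive_subgroup.a_subset[of p R] by blast
  next
    fix a b assume ab: "a \<in> carrier R" "b \<in> carrier R" "a \<otimes> b \<in> I"
    have "spec_zeros R I \<subseteq> spec_zeros R {a} \<union> spec_zeros R {b}"
      using ab primeideal.I_prime unfolding spec_zeros_def by fastforce
    moreover have "spec_closed R (spec_zeros R {a})" "spec_closed R (spec_zeros R {b})"
      using ab unfolding spec_closed_def by blast+
    ultimately have "spec_zeros R I \<subseteq> spec_zeros R {a} \<or> spec_zeros R I \<subseteq> spec_zeros R {b}"
      using irr unfolding spec_irreducible_def by blast
    then show "a \<in> I \<or> b \<in> I"
      using radical_eq_Inter_primes[OF rad] ab(1,2) unfolding spec_zeros_def by blast
  qed
qed

text \<open>\<open>I\<close> is itself a point of its zero set, and a closed set containing this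
  generic point contains the whole zero set.\<close>

lemma prime_irreducible_variety:
  assumes "primeideal I R"
  shows "irreducible_variety R I"
proof -
  interpret primeideal I R by fact
  have "x \<in> I" if "x \<in> carrier R" "x [^]\<^bsub>R\<^esub> k \<in> I" for x and k :: nat
    using that(2)
  proof (induction k)
    case 0 then show ?case using I_notcarr one_imp_carrier by auto
  next
    case (Suc k) then show ?case using I_prime[of "x [^]\<^bsub>R\<^esub> k" x] that(1) by auto
  qed
  then have "radical_ideal I R" unfolding radical_ideal_def using is_ideal by blast
  moreover have "spec_irreducible R (spec_zeros R I)"
    unfolding spec_irreducible_def
  proof (intro conjI allI impI)
    have "I \<in> spec_zeros R I" using assms unfolding spec_zeros_def by simp
    then show "spec_zeros R I \<noteq> {}" by blast
    fix F G assume *: "spec_closed R F \<and> spec_closed R G \<and> spec_zeros R I \<subseteq> F \<union> G"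
    then have "I \<in> F \<or> I \<in> G" using \<open>I \<in> spec_zeros R I\<close> by blast
    then show "spec_zeros R I \<subseteq> F \<or> spec_zeros R I \<subseteq> G"
      using * unfolding spec_closed_def spec_zeros_def by blast
  qed
  ultimately show ?thesis unfolding irreducible_variety_def ..
qed

subsection \<open>Nilpotent elements and Newton approximation\<close>

text \<open>The binomial formula reduced to what nilpotence arguments use: modulo \<open>y\<close>
  only the power of \<open>x\<close> survives.\<close>

lemma (in cring) pow_add_expand:
  assumes "x \<in> carrier R" "y \<in> carrier R"
  shows "\<exists>z\<in>carrier R. (x \<oplus> y) [^] (m::nat) = x [^] m \<oplus> y \<otimes> z"
proof (induction m)
  case 0 then show ?case using assms by (intro bexI[of _ \<zero>]) auto
next
  case (Suc m)
  then obtain z where z: "z \<in> carrier R" "(x \<oplus> y) [^] m = x [^] m \<oplus> y \<otimes> z" by blast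
  have xm: "x [^] m \<in> carrier R" using assms by simp
  have "(x \<oplus> y) [^] Suc m = (x [^] m \<oplus> y \<otimes> z) \<otimes> (x \<oplus> y)" using z by simp
  also have "\<dots> = x [^] m \<otimes> x \<oplus> y \<otimes> (x [^] m \<oplus> z \<otimes> (x \<oplus> y))"
    using xm z(1) assms by algebra
  finally show ?case using xm z(1) assms
    by (intro bexI[of _ "x [^] m \<oplus> z \<otimes> (x \<oplus> y)"]) auto
qed

definition (in ring) nilpotent :: "'a \<Rightarrow> bool" where
  "nilpotent x \<longleftrightarrow> (\<exists>n::nat. x [^] n = \<zero>)"

lemma (in cring) nilpotent_add:
  assumes "x \<in> carrier R" "y \<in> carrier R" "nilpotent x" "nilpotent y"
  shows "nilpotent (x \<oplus> y)"
proof -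
  obtain m n :: nat where mn: "x [^] m = \<zero>" "y [^] n = \<zero>" using assms unfolding nilpotent_def by blast
  obtain z where z: "z \<in> carrier R" "(x \<oplus> y) [^] m = x [^] m \<oplus> y \<otimes> z"
    using pow_add_expand assms by blast
  have "(x \<oplus> y) [^] (m * n) = (y \<otimes> z) [^] n"
    using z mn assms by (simp add: nat_pow_pow[symmetric])
  also have "\<dots> = \<zero>" using mn z assms by (simp add: nat_pow_distrib)
  finally show ?thesis unfolding nilpotent_def by blast
qed

lemma (in cring) nilpotent_mult:
  assumes "x \<in> carrier R" "y \<in> carrier R" "nilpotent x"
  shows "nilpotent (x \<otimes> y)"
  using assms unfolding nilpotent_def by (metis nat_pow_closed nat_pow_distrib l_null)

lemma (in cring) nilpotent_minus:
  assumes "x \<in> carrier R" "nilpotent x"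
  shows "nilpotent (\<ominus> x)"
  using nilpotent_mult[of x "\<ominus> \<one>"] assms by (simp add: r_minus)

lemma (in cring) unit_dvd:
  assumes "x \<in> carrier R" "y \<in> carrier R" "x \<otimes> y \<in> Units R"
  shows "x \<in> Units R"
  using assms by (metis prod_unit_l unit_factor)

text \<open>Expanding u = -x + (u + x) to a power that kills -x shows that u + x divides a power of
  u.\<close>

lemma (in cring) unit_plus_nilpotent:
  assumes "u \<in> Units R" "x \<in> carrier R" "nilpotent x"
  shows "u \<oplus> x \<in> Units R"
proof -
  have u: "u \<in> carrier R" using assms by auto
  have "nilpotent (\<ominus> x)" using assms nilpotent_minus by simp
  then obtain m :: nat where m: "(\<ominus> x) [^] m = \<zero>" unfolding nilpotent_def by blast
  obtain z where z: "z \<in> carrier R" "(\<ominus> x \<oplus> (u \<oplus> x)) [^] m = (\<ominus> x) [^] m \<oplus> (u \<oplus> x) \<otimes> z"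
    using pow_add_expand[of "\<ominus> x" "u \<oplus> x" m] u assms by auto
  have "\<ominus> x \<oplus> (u \<oplus> x) = u" using u assms(2) by algebra
  then have "(u \<oplus> x) \<otimes> z = u [^] m" using z m u assms(2) by simp
  then have "(u \<oplus> x) \<otimes> z \<in> Units R" using assms(1) Units_pow_closed by simp
  then show ?thesis using unit_dvd[of "u \<oplus> x" z] z(1) u assms(2) by simp
qed

text \<open>Newton's iteration, with the derivative known only through Taylor expansions. The
  iterates differ from \<open>y0\<close> by multiples of the nilpotent \<open>a = f y0\<close>, so
  \<open>f'\<close> stays a unit along them. Each step only has to gain one factor \<open>a\<close>,
  and after finitely many steps the power of \<open>a\<close> is zero.\<close>

lemma (in cring) newton_approximation:
  fixes f f' :: "'a \<Rightarrow> 'a"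
  assumes closed: "\<And>y. y \<in> carrier R \<Longrightarrow> f y \<in> carrier R" "\<And>y. y \<in> carrier R \<Longrightarrow> f' y \<in> carrier R"
    and taylor: "\<And>y h. \<lbrakk>y \<in> carrier R; h \<in> carrier R\<rbrakk> \<Longrightarrow>
        \<exists>w\<in>carrier R. f (y \<oplus> h) = f y \<oplus> h \<otimes> f' y \<oplus> h \<otimes> h \<otimes> w"
      "\<And>y h. \<lbrakk>y \<in> carrier R; h \<in> carrier R\<rbrakk> \<Longrightarrow> \<exists>w\<in>carrier R. f' (y \<oplus> h) = f' y \<oplus> h \<otimes> w"
    and start: "y0 \<in> carrier R" "nilpotent (f y0)" "f' y0 \<in> Units R"
  shows "\<exists>y\<in>carrier R. f y = \<zero> \<and> nilpotent (y \<ominus> y0)"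
proof -
  define a where "a = f y0"
  have a: "a \<in> carrier R" "nilpotent a" using closed start unfolding a_def by auto
  have step: "\<exists>y\<in>carrier R. \<exists>c\<in>carrier R. \<exists>w\<in>carrier R. y = y0 \<oplus> a \<otimes> c \<and> f y = a [^] Suc k \<otimes> w" for k
  proof (induction k)
    case 0
    show ?case using start a by (intro bexI[of _ y0] bexI[of _ \<zero>] bexI[of _ \<one>]) (auto simp: a_def)
  next
    case (Suc k)
    then obtain y c w where y: "y \<in> carrier R" "c \<in> carrier R" "w \<in> carrier R" "y = y0 \<oplus> a \<otimes> c"
      "f y = a [^] Suc k \<otimes> w" by blast
    have "\<exists>v\<in>carrier R. f' (y0 \<oplus> a \<otimes> c) = f' y0 \<oplus> a \<otimes> c \<otimes> v"
      using taylor(2)[of y0 "a \<otimes> c"] start(1) a(1) y(2) by simp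
    then have "f' y \<in> Units R"
      
      using y(1,2,4) a start(1,3) unit_plus_nilpotent[of "f' y0"] nilpotent_mult by (metis m_closed)
    then obtain u where u: "u \<in> carrier R" "f' y \<otimes> u = \<one>"
      using Units_r_inv by blast
    \<comment> \<open>Newton's correction: it cancels the terms of order at most one in the
      expansion of \<open>f (y \<oplus> h)\<close>.\<close>
    define h where "h = \<ominus> (f y \<otimes> u)"
    have h: "h \<in> carrier R" "f y \<oplus> h \<otimes> f' y = \<zero>"
    proof -
      have fy: "f y \<in> carrier R" "f' y \<in> carrier R" using closed y(1) by auto
      show "h \<in> carrier R" unfolding h_def using fy u by simp
      have "h \<otimes> f' y = \<ominus> (f y \<otimes> (f' y \<otimes> u))"
        unfolding h_def using fy u(1) by (simp add: l_minus r_minus m_ac)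
      then show "f y \<oplus> h \<otimes> f' y = \<zero>" using u fy by (simp add: r_neg)
    qed
    obtain v where v: "v \<in> carrier R" "f (y \<oplus> h) = f y \<oplus> h \<otimes> f' y \<oplus> h \<otimes> h \<otimes> v"
      using taylor(1)[OF y(1) h(1)] by blast
    \<comment> \<open>\<open>h\<close> is divisible by \<open>a \<otimes> b\<close>, so the
      quadratic error term contains the square of this product, which supplies the additional factor
      \<open>a\<close>.\<close>
    define b where "b = a [^] k"
    have b: "b \<in> carrier R" using a by (simp add: b_def)
    have hb: "h = a \<otimes> (b \<otimes> \<ominus> (w \<otimes> u))"
      unfolding h_def y(5) using a(1) b y(3) u(1) by (simp add: b_def[symmetric] r_minus m_ac)
    have "f (y \<oplus> h) = \<zero> \<oplus> h \<otimes> h \<otimes> v" using v h by simp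
    also have "\<dots> = a [^] Suc (Suc k) \<otimes> (b \<otimes> (w \<otimes> u) \<otimes> (w \<otimes> u) \<otimes> v)"
      unfolding hb using a(1) b y(3) u(1) v(1) by (simp add: b_def[symmetric] r_minus l_minus m_ac)
    finally have 1: "f (y \<oplus> h) = a [^] Suc (Suc k) \<otimes> (b \<otimes> (w \<otimes> u) \<otimes> (w \<otimes> u) \<otimes> v)" .
    have 2: "y \<oplus> h = y0 \<oplus> a \<otimes> (c \<oplus> b \<otimes> \<ominus> (w \<otimes> u))"
      unfolding y(4) hb using a(1) b y(2,3) u(1) start(1) by algebra
    have "y \<oplus> h \<in> carrier R" "c \<oplus> b \<otimes> \<ominus> (w \<otimes> u) \<in> carrier R"
      "b \<otimes> (w \<otimes> u) \<otimes> (w \<otimes> u) \<otimes> v \<in> carrier R"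
      using y(1-3) h(1) u(1) b v(1) by auto
    then show ?case using 1 2 by blast
  qed
  obtain n :: nat where n: "a [^] n = \<zero>" using a unfolding nilpotent_def by blast
  obtain y c w where y: "y \<in> carrier R" "c \<in> carrier R" "w \<in> carrier R" "y = y0 \<oplus> a \<otimes> c"
      "f y = a [^] Suc n \<otimes> w" using step by blast
  have "f y = \<zero>" using y(3,5) n a(1) by simp
  moreover have "y \<ominus> y0 = a \<otimes> c" unfolding y(4) using a y start by algebra
  ultimately show ?thesis using y(1,2) nilpotent_mult a by auto
qed


subsection \<open>Fraction fields and algebraically closed hulls\<close>

text \<open>The whole equivalence class of a pair, so that equal quotients are equal sets. The
  operations of \<open>fractions\<close> pick arbitrary representatives;
  \<open>fractions_mult\<close> and \<open>fractions_add\<close> show that the choice is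
  immaterial.\<close>

definition (in ring) fraction :: "'a \<Rightarrow> 'a \<Rightarrow> ('a \<times> 'a) set" where
  "fraction a b = {(c, d). c \<in> carrier R \<and> d \<in> carrier R - {\<zero>} \<and> a \<otimes> d = c \<otimes> b}"

definition (in ring) fractions :: "('a \<times> 'a) set ring" where
  "fractions = \<lparr>carrier = {fraction a b | a b. a \<in> carrier R \<and> b \<in> carrier R - {\<zero>}},
     monoid.mult = (\<lambda>x y. case (SOME p. p \<in> x, SOME q. q \<in> y) of ((a, b), (c, d)) \<Rightarrow> fraction (a \<otimes> c) (b \<otimes> d)),
     one = fraction \<one> \<one>, zero = fraction \<zero> \<one>,
     add = (\<lambda>x y. case (SOME p. p \<in> x, SOME q. q \<in> y) of ((a, b), (c, d)) \<Rightarrow>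
       fraction (a \<otimes> d \<oplus> c \<otimes> b) (b \<otimes> d))\<rparr>"

context domain
begin

lemma fraction_eq_iff:
  assumes "a \<in> carrier R" "b \<in> carrier R - {\<zero>}" "c \<in> carrier R" "d \<in> carrier R - {\<zero>}"
  shows "fraction a b = fraction c d \<longleftrightarrow> a \<otimes> d = c \<otimes> b"
proof
  assume "fraction a b = fraction c d"
  moreover have "(c, d) \<in> fraction c d" using assms unfolding fraction_def by auto
  ultimately have "(c, d) \<in> fraction a b" by simp
  then show "a \<otimes> d = c \<otimes> b" unfolding fraction_def by auto
next
  assume *: "a \<otimes> d = c \<otimes> b"
  have "a \<otimes> y = x \<otimes> b \<longleftrightarrow> c \<otimes> y = x \<otimes> d" if "x \<in> carrier R" "y \<in> carrier R" for x y
  proof -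
    have "a \<otimes> y = x \<otimes> b \<longleftrightarrow> d \<otimes> (a \<otimes> y) = d \<otimes> (x \<otimes> b)"
      using assms that m_lcancel[of d "a \<otimes> y" "x \<otimes> b"] by auto
    also have "d \<otimes> (a \<otimes> y) = b \<otimes> (c \<otimes> y)"
      using * assms that by (metis DiffD1 m_assoc m_comm)
    also have "d \<otimes> (x \<otimes> b) = b \<otimes> (x \<otimes> d)" using assms that by (simp add: m_ac)
    also have "b \<otimes> (c \<otimes> y) = b \<otimes> (x \<otimes> d) \<longleftrightarrow> c \<otimes> y = x \<otimes> d"
      using assms that m_lcancel[of b "c \<otimes> y" "x \<otimes> d"] by auto
    finally show ?thesis .
  qed
  then show "fraction a b = fraction c d" unfolding fraction_def by auto
qed

lemma fraction_rep:
  assumes "a \<in> carrier R" "b \<in> carrier R - {\<zero>}"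
  obtains c d where "(SOME p. p \<in> fraction a b) = (c, d)" "c \<in> carrier R" "d \<in> carrier R - {\<zero>}"
    "a \<otimes> d = c \<otimes> b"
proof -
  have "(a, b) \<in> fraction a b" using assms unfolding fraction_def by auto
  then have "(SOME p. p \<in> fraction a b) \<in> fraction a b" by (rule someI)
  then show thesis using that unfolding fraction_def by auto
qed

lemma fractions_mult:
  assumes "a \<in> carrier R" "b \<in> carrier R - {\<zero>}" "c \<in> carrier R" "d \<in> carrier R - {\<zero>}"
  shows "fraction a b \<otimes>\<^bsub>fractions\<^esub> fraction c d = fraction (a \<otimes> c) (b \<otimes> d)"
proof -
  obtain a' b' where 1: "(SOME p. p \<in> fraction a b) = (a', b')" "a' \<in> carrier R" "b' \<in> carrier R - {\<zero>}"
    "a \<otimes> b' = a' \<otimes> b" using fraction_rep[OF assms(1,2)] by metis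
  obtain c' d' where 2: "(SOME p. p \<in> fraction c d) = (c', d')" "c' \<in> carrier R" "d' \<in> carrier R - {\<zero>}"
    "c \<otimes> d' = c' \<otimes> d" using fraction_rep[OF assms(3,4)] by metis
  have nz: "b' \<otimes> d' \<noteq> \<zero>" "b \<otimes> d \<noteq> \<zero>" using integral assms 1 2 by blast+
  have "(a' \<otimes> c') \<otimes> (b \<otimes> d) = (a' \<otimes> b) \<otimes> (c' \<otimes> d)" using assms 1 2 by (simp add: m_ac)
  also have "\<dots> = (a \<otimes> c) \<otimes> (b' \<otimes> d')" using assms 1(2,3) 2(2,3) by (simp add: 1(4)[symmetric] 2(4)[symmetric] m_ac)
  finally have "fraction (a' \<otimes> c') (b' \<otimes> d') = fraction (a \<otimes> c) (b \<otimes> d)"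
    using fraction_eq_iff nz assms 1 2 by auto
  then show ?thesis unfolding fractions_def using 1(1) 2(1) by simp
qed

lemma fractions_add:
  assumes "a \<in> carrier R" "b \<in> carrier R - {\<zero>}" "c \<in> carrier R" "d \<in> carrier R - {\<zero>}"
  shows "fraction a b \<oplus>\<^bsub>fractions\<^esub> fraction c d = fraction (a \<otimes> d \<oplus> c \<otimes> b) (b \<otimes> d)"
proof -
  obtain a' b' where 1: "(SOME p. p \<in> fraction a b) = (a', b')" "a' \<in> carrier R" "b' \<in> carrier R - {\<zero>}"
    "a \<otimes> b' = a' \<otimes> b" using fraction_rep[OF assms(1,2)] by metis
  obtain c' d' where 2: "(SOME p. p \<in> fraction c d) = (c', d')" "c' \<in> carrier R" "d' \<in> carrier R - {\<zero>}"
    "c \<otimes> d' = c' \<otimes> d" using fraction_rep[OF assms(3,4)] by metis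
  have nz: "b' \<otimes> d' \<noteq> \<zero>" "b \<otimes> d \<noteq> \<zero>" using integral assms 1 2 by blast+
  have "(a' \<otimes> d' \<oplus> c' \<otimes> b') \<otimes> (b \<otimes> d) = (a' \<otimes> b) \<otimes> (d' \<otimes> d) \<oplus> (c' \<otimes> d) \<otimes> (b' \<otimes> b)"
    using assms 1 2 by (simp add: m_ac l_distr r_distr)
  also have "\<dots> = (a \<otimes> d \<oplus> c \<otimes> b) \<otimes> (b' \<otimes> d')"
    using assms 1(2,3) 2(2,3) by (simp add: 1(4)[symmetric] 2(4)[symmetric] m_ac l_distr r_distr)
  finally have "fraction (a' \<otimes> d' \<oplus> c' \<otimes> b') (b' \<otimes> d') = fraction (a \<otimes> d \<oplus> c \<otimes> b) (b \<otimes> d)"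
    using fraction_eq_iff nz assms 1 2 by auto
  then show ?thesis unfolding fractions_def using 1(1) 2(1) by simp
qed

lemma fractions_carrier:
  "x \<in> carrier fractions \<longleftrightarrow> (\<exists>a\<in>carrier R. \<exists>b\<in>carrier R - {\<zero>}. x = fraction a b)"
  unfolding fractions_def by auto

lemma fraction_closed:
  "\<lbrakk>a \<in> carrier R; b \<in> carrier R - {\<zero>}\<rbrakk> \<Longrightarrow> fraction a b \<in> carrier fractions"
  using fractions_carrier by blast

lemma nonzero_mult_closed:
  "\<lbrakk>b \<in> carrier R - {\<zero>}; d \<in> carrier R - {\<zero>}\<rbrakk> \<Longrightarrow> b \<otimes> d \<in> carrier R - {\<zero>}"
  using integral by auto

lemma fractions_one: "\<one>\<^bsub>fractions\<^esub> = fraction \<one> \<one>"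
  and fractions_zero: "\<zero>\<^bsub>fractions\<^esub> = fraction \<zero> \<one>"
  unfolding fractions_def by simp_all

lemma field_fractions: "field fractions"
proof -
  have one: "\<one> \<in> carrier R - {\<zero>}" by auto
  note nm = nonzero_mult_closed
  have cr: "cring fractions"
  proof (rule cringI[OF abelian_groupI comm_monoidI])
    fix x y assume "x \<in> carrier fractions" "y \<in> carrier fractions"
    then obtain a b c d where [simp]: "x = fraction a b" "y = fraction c d"
      and *: "a \<in> carrier R" "b \<in> carrier R - {\<zero>}" "c \<in> carrier R" "d \<in> carrier R - {\<zero>}"
      unfolding fractions_carrier by blast
    have **: "b \<in> carrier R" "d \<in> carrier R" using * by auto
    show "x \<oplus>\<^bsub>fractions\<^esub> y \<in> carrier fractions" "x \<otimes>\<^bsub>fractions\<^esub> y \<in> carrier fractions"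
      using * ** nm[OF *(2,4)] by (auto simp: fractions_add fractions_mult fractions_carrier)
    show "x \<oplus>\<^bsub>fractions\<^esub> y = y \<oplus>\<^bsub>fractions\<^esub> x" "x \<otimes>\<^bsub>fractions\<^esub> y = y \<otimes>\<^bsub>fractions\<^esub> x"
      using * ** by (simp_all add: fractions_add fractions_mult m_ac a_ac)
    fix z assume "z \<in> carrier fractions"
    then obtain e f where [simp]: "z = fraction e f" and ef: "e \<in> carrier R" "f \<in> carrier R - {\<zero>}"
      unfolding fractions_carrier by blast
    have ef': "f \<in> carrier R" using ef by auto
    note n = nm[OF *(2,4)] nm[OF *(4) ef(2)] nm[OF *(2) ef(2)]
    show "x \<oplus>\<^bsub>fractions\<^esub> y \<oplus>\<^bsub>fractions\<^esub> z = x \<oplus>\<^bsub>fractions\<^esub> (y \<oplus>\<^bsub>fractions\<^esub> z)"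
      using * ** ef ef' n by (simp add: fractions_add m_ac a_ac l_distr r_distr)
    show "x \<otimes>\<^bsub>fractions\<^esub> y \<otimes>\<^bsub>fractions\<^esub> z = x \<otimes>\<^bsub>fractions\<^esub> (y \<otimes>\<^bsub>fractions\<^esub> z)"
      using * ** ef ef' n by (simp add: fractions_mult m_ac)
    have "fraction ((a \<otimes> d \<oplus> c \<otimes> b) \<otimes> e) ((b \<otimes> d) \<otimes> f) =
      fraction ((a \<otimes> e) \<otimes> (d \<otimes> f) \<oplus> (c \<otimes> e) \<otimes> (b \<otimes> f)) ((b \<otimes> f) \<otimes> (d \<otimes> f))"
      using * ** ef ef' n nm[OF n(1) ef(2)] nm[OF n(3,2)]
      by (subst fraction_eq_iff) (auto simp: m_ac l_distr r_distr)
    then show "(x \<oplus>\<^bsub>fractions\<^esub> y) \<otimes>\<^bsub>fractions\<^esub> z =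
        x \<otimes>\<^bsub>fractions\<^esub> z \<oplus>\<^bsub>fractions\<^esub> y \<otimes>\<^bsub>fractions\<^esub> z"
      using * ** ef ef' n by (simp add: fractions_add fractions_mult)
  next
    fix x assume "x \<in> carrier fractions"
    then obtain a b where [simp]: "x = fraction a b" and *: "a \<in> carrier R" "b \<in> carrier R - {\<zero>}"
      unfolding fractions_carrier by blast
    have **: "b \<in> carrier R" using * by auto
    show "\<zero>\<^bsub>fractions\<^esub> \<oplus>\<^bsub>fractions\<^esub> x = x" "\<one>\<^bsub>fractions\<^esub> \<otimes>\<^bsub>fractions\<^esub> x = x"
      using * ** one by (simp_all add: fractions_zero fractions_one fractions_add fractions_mult)
    have "fraction (\<ominus> a) b \<oplus>\<^bsub>fractions\<^esub> x = fraction (\<ominus> a \<otimes> b \<oplus> a \<otimes> b) (b \<otimes> b)"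
      using * ** by (simp add: fractions_add)
    also have "\<dots> = \<zero>\<^bsub>fractions\<^esub>"
      unfolding fractions_zero using * ** one nm[OF *(2,2)]
      by (subst fraction_eq_iff) (auto simp: l_minus l_neg)
    finally show "\<exists>y\<in>carrier fractions. y \<oplus>\<^bsub>fractions\<^esub> x = \<zero>\<^bsub>fractions\<^esub>"
      using * ** by (intro bexI[of _ "fraction (\<ominus> a) b"]) (auto simp: fractions_carrier)
  next
    show "\<zero>\<^bsub>fractions\<^esub> \<in> carrier fractions" "\<one>\<^bsub>fractions\<^esub> \<in> carrier fractions"
      using one unfolding fractions_carrier fractions_zero fractions_one by blast+
  qed
  then interpret Q: cring fractions .
  have "x \<in> Units fractions \<longleftrightarrow> x \<in> carrier fractions - {\<zero>\<^bsub>fractions\<^esub>}" for x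
  proof
    assume x: "x \<in> carrier fractions - {\<zero>\<^bsub>fractions\<^esub>}"
    then obtain a b where [simp]: "x = fraction a b" and *: "a \<in> carrier R" "b \<in> carrier R - {\<zero>}"
      using fractions_carrier[of x] by blast
    have a: "a \<in> carrier R - {\<zero>}"
      using x * one fraction_eq_iff[of a b \<zero> \<one>] by (auto simp: fractions_zero)
    have "x \<otimes>\<^bsub>fractions\<^esub> fraction b a = fraction (a \<otimes> b) (b \<otimes> a)" using * a by (simp add: fractions_mult)
    also have "\<dots> = \<one>\<^bsub>fractions\<^esub>"
      unfolding fractions_one using * a one nm[OF *(2) a] by (subst fraction_eq_iff) (auto simp: m_ac)
    finally have "x \<otimes>\<^bsub>fractions\<^esub> fraction b a = \<one>\<^bsub>fractions\<^esub>" .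
    moreover have "fraction b a \<in> carrier fractions" using * a by (auto simp: fractions_carrier)
    ultimately show "x \<in> Units fractions" using x Q.m_comm unfolding Units_def by fastforce
  next
    assume x: "x \<in> Units fractions"
    have "\<one>\<^bsub>fractions\<^esub> \<noteq> \<zero>\<^bsub>fractions\<^esub>"
      unfolding fractions_one fractions_zero using one fraction_eq_iff[of \<one> \<one> \<zero> \<one>] by auto
    moreover obtain y where "y \<in> carrier fractions" "x \<otimes>\<^bsub>fractions\<^esub> y = \<one>\<^bsub>fractions\<^esub>"
      using Q.Units_r_inv_ex[OF x] by blast
    ultimately have "x \<noteq> \<zero>\<^bsub>fractions\<^esub>" using Q.l_null by metis
    then show "x \<in> carrier fractions - {\<zero>\<^bsub>fractions\<^esub>}" using x by auto
  qed
  then show ?thesis by (intro Q.cring_fieldI) blast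
qed

lemma fraction_hom: "(\<lambda>a. fraction a \<one>) \<in> ring_hom R fractions"
proof (rule ring_hom_memI)
  show "fraction x \<one> \<in> carrier fractions" if "x \<in> carrier R" for x
    using that one_not_zero unfolding fractions_carrier by blast
qed (auto simp: fractions_mult fractions_add fractions_one)

lemma fraction_inj: "inj_on (\<lambda>a. fraction a \<one>) (carrier R)"
  by (rule inj_onI) (auto simp: fraction_eq_iff)

text \<open>Read as a linear equation, this exhibits a fraction as a root of a polynomial over the
  image of the ring; \<open>hull_minimal\<close> starts from it.\<close>

lemma fraction_quotient:
  assumes "a \<in> carrier R" "b \<in> carrier R - {\<zero>}"
  shows "fraction a b \<otimes>\<^bsub>fractions\<^esub> fraction b \<one> = fraction a \<one>"
  using assms nonzero_mult_closed by (auto simp: fractions_mult fraction_eq_iff)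

end

section \<open>Algebraic elements and the algebraically closed hull\<close>

text \<open>Phrased with a coefficient function and a finite sum in \<open>F\<close> rather than
  with a polynomial ring over \<open>M\<close>, so that \<open>M\<close> can be enlarged and
  \<open>F\<close> replaced by a record with other scalars without further conversion.\<close>

definition algebraic_rel :: "('a, 'm) ring_scheme \<Rightarrow> 'a set \<Rightarrow> 'a \<Rightarrow> bool" where
  "algebraic_rel F M x \<longleftrightarrow> (\<exists>n::nat. \<exists>c. (\<forall>i\<le>n. c i \<in> M) \<and> c n \<noteq> \<zero>\<^bsub>F\<^esub> \<and>
     (\<Oplus>\<^bsub>F\<^esub>i\<in>{..n}. c i \<otimes>\<^bsub>F\<^esub> x [^]\<^bsub>F\<^esub> i) = \<zero>\<^bsub>F\<^esub>)"

lemma (in cring) eval_eq_finsum: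
  assumes "set p \<subseteq> carrier R" "x \<in> carrier R"
  shows "eval p x = (\<Oplus>i\<in>{..<length p}. coeff p i \<otimes> x [^] i)"
  using assms(1)
proof (induction p)
  case Nil then show ?case by simp
next
  case (Cons a p)
  have "(\<Oplus>i\<in>{..<length p}. coeff (a # p) i \<otimes> x [^] i) = (\<Oplus>i\<in>{..<length p}. coeff p i \<otimes> x [^] i)"
    using Cons assms by (intro finsum_cong') auto
  then show ?case using Cons assms
    by (simp add: lessThan_Suc Pi_def a_comm)
qed

lemma (in algebraically_closed) exists_root_finsum:
  assumes "0 < (n::nat)" "\<And>i. i \<le> n \<Longrightarrow> c i \<in> carrier L" "c n \<noteq> \<zero>"
  shows "\<exists>x\<in>carrier L. (\<Oplus>i\<in>{..n}. c i \<otimes> x [^] i) = \<zero>"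
proof -
  \<comment> \<open>List polynomials carry the leading coefficient first, hence the
    reversal.\<close>
  define p where "p = map c (rev [0..<Suc n])"
  have co: "coeff (map c (rev [0..<m])) i = (if i < m then c i else \<zero>)" for m i
    by (induction m) auto
  have p: "set p \<subseteq> carrier L" "p \<noteq> []" "lead_coeff p \<noteq> \<zero>" "length p = Suc n"
    using assms unfolding p_def by auto
  then have pc: "p \<in> carrier (poly_ring L)"
    unfolding univ_poly_carrier[symmetric] polynomial_def by simp
  then have "splitted p" by (rule roots_over_carrier)
  then have "roots p \<noteq> {#}" using p(4) assms(1) unfolding splitted_def by auto
  then obtain x where "x \<in> carrier L" "eval p x = \<zero>"
    using not_empty_rootsE[OF pc] roots_mem_iff_is_root[OF pc] unfolding is_root_def by blast
  moreover have "eval p x = (\<Oplus>i\<in>{..n}. c i \<otimes> x [^] i)" if "x \<in> carrier L"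
    unfolding eval_eq_finsum[OF p(1) that] p(4)
    using that assms(2) by (intro finsum_cong') (auto simp: p_def co simp del: upt_Suc)
  ultimately show ?thesis by auto
qed

definition (in domain) ac_hull :: "((('a \<times> 'a) set list \<times> nat) multiset \<Rightarrow> ('a \<times> 'a) set) ring" where
  "ac_hull = field.alg_closure fractions"

definition (in domain) hull_emb :: "'a \<Rightarrow> (('a \<times> 'a) set list \<times> nat) multiset \<Rightarrow> ('a \<times> 'a) set" where
  "hull_emb a = ring.indexed_const fractions (fraction a \<one>)"

context domain
begin

lemma hull_closure: "algebraic_closure ac_hull (ring.indexed_const fractions ` carrier fractions)"
  and hull_const_hom: "ring.indexed_const fractions \<in> ring_hom fractions ac_hull"
  unfolding ac_hull_def using field.alg_closureE[OF field_fractions] by auto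

lemma hull_algebraically_closed: "algebraically_closed ac_hull"
proof -
  interpret C: algebraic_closure ac_hull "ring.indexed_const fractions ` carrier fractions"
    by (rule hull_closure)
  show ?thesis by (rule C.algebraically_closed_axioms)
qed

lemma hull_field: "field ac_hull"
  using hull_algebraically_closed unfolding algebraically_closed_def by simp

lemma hull_emb_hom: "hull_emb \<in> ring_hom R ac_hull"
  using ring_hom_trans[OF fraction_hom hull_const_hom] by (simp add: hull_emb_def[abs_def] comp_def)

lemma hull_emb_inj: "inj_on hull_emb (carrier R)"
proof -
  interpret Q: field fractions by (rule field_fractions)
  have "x = y" if "x \<in> carrier R" "y \<in> carrier R" "hull_emb x = hull_emb y" for x y
    using inj_onD[OF fraction_inj injD[OF Q.indexed_const_is_inj that(3)[unfolded hull_emb_def]] that(1,2)] .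
  then show ?thesis by (rule inj_onI)
qed

text \<open>A subring that contains the ring and is closed under algebraic elements contains every
  quotient a/b, a root of b X - a, and then everything algebraic over the quotients. Hence a partial
  operator structure whose domain is closed in this sense is defined on the whole hull.\<close>

lemma hull_minimal:
  assumes M: "subring M ac_hull" "hull_emb ` carrier R \<subseteq> M"
    and closed: "\<And>x. \<lbrakk>x \<in> carrier ac_hull; algebraic_rel ac_hull M x\<rbrakk> \<Longrightarrow> x \<in> M"
  shows "M = carrier ac_hull"
proof -
  interpret Q: field fractions by (rule field_fractions)
  interpret H: field ac_hull by (rule hull_field)
  interpret M: subring M ac_hull by (rule M)
  let ?c = "ring.indexed_const fractions :: ('a \<times> 'a) set \<Rightarrow> ((('a \<times> 'a) set list \<times> nat) multiset \<Rightarrow> ('a \<times> 'a) set)"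
  interpret C: ring_hom_cring fractions ac_hull ?c
    by unfold_locales (rule hull_const_hom)
  interpret E: ring_hom_cring R ac_hull hull_emb
    by unfold_locales (rule hull_emb_hom)
  have Mc: "x \<in> carrier ac_hull" if "x \<in> M" for x using that subringE(1)[OF M(1)] by auto
  have frac: "?c q \<in> M" if q: "q \<in> carrier fractions" for q
  proof -
    obtain a b where ab: "a \<in> carrier R" "b \<in> carrier R - {\<zero>}" "q = fraction a b"
      using q fractions_carrier[of q] by blast
    have eb: "hull_emb b \<in> carrier ac_hull" "hull_emb b \<noteq> \<zero>\<^bsub>ac_hull\<^esub>"
      using ab(2) inj_onD[OF hull_emb_inj, of b \<zero>] by auto
    have qb: "?c q \<otimes>\<^bsub>ac_hull\<^esub> hull_emb b = hull_emb a"
    proof -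
      have "fraction b \<one> \<in> carrier fractions" using ab(2) fraction_closed[of b \<one>] by simp
      then have "?c q \<otimes>\<^bsub>ac_hull\<^esub> ?c (fraction b \<one>) = ?c (q \<otimes>\<^bsub>fractions\<^esub> fraction b \<one>)"
        using that by simp
      then show ?thesis using fraction_quotient[OF ab(1,2)] ab(3) unfolding hull_emb_def by simp
    qed
    have cq: "?c q \<in> carrier ac_hull" "hull_emb a \<in> carrier ac_hull" using that ab(1) by auto
    have "algebraic_rel ac_hull M (?c q)"
      unfolding algebraic_rel_def
    proof (intro exI[of _ 1] exI[of _ "\<lambda>i. if i = 0 then \<ominus>\<^bsub>ac_hull\<^esub> hull_emb a else hull_emb b"] conjI allI impI)
      show "(if (i::nat) = 0 then \<ominus>\<^bsub>ac_hull\<^esub> hull_emb a else hull_emb b) \<in> M" for i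
        using M(2) ab(1,2) subringE(5)[OF M(1)] by auto
      have "(\<Oplus>\<^bsub>ac_hull\<^esub>i\<in>{..1::nat}. (if i = 0 then \<ominus>\<^bsub>ac_hull\<^esub> hull_emb a else hull_emb b) \<otimes>\<^bsub>ac_hull\<^esub> ?c q [^]\<^bsub>ac_hull\<^esub> i) =
        hull_emb b \<otimes>\<^bsub>ac_hull\<^esub> ?c q \<oplus>\<^bsub>ac_hull\<^esub> \<ominus>\<^bsub>ac_hull\<^esub> hull_emb a"
        using cq eb(1) by (simp add: Pi_def)
      then show "(\<Oplus>\<^bsub>ac_hull\<^esub>i\<in>{..1::nat}. (if i = 0 then \<ominus>\<^bsub>ac_hull\<^esub> hull_emb a else hull_emb b) \<otimes>\<^bsub>ac_hull\<^esub> ?c q [^]\<^bsub>ac_hull\<^esub> i) = \<zero>\<^bsub>ac_hull\<^esub>"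
        using qb cq eb(1) H.m_comm[of "hull_emb b" "?c q"] by (simp add: H.r_neg)
    qed (use eb in simp)
    then show ?thesis using closed cq(1) by simp
  qed
  have "x \<in> M" if x: "x \<in> carrier ac_hull" for x
  proof -
    interpret AC: algebraic_closure ac_hull "?c ` carrier fractions" by (rule hull_closure)
    obtain p where p: "p \<in> carrier ((?c ` carrier fractions)[X]\<^bsub>ac_hull\<^esub>)" "p \<noteq> []" "H.eval p x = \<zero>\<^bsub>ac_hull\<^esub>"
      using H.algebraicE[OF subfieldE(1)[OF AC.subfield_axioms] x AC.algebraic_extension[OF x]] by blast
    have p': "set p \<subseteq> ?c ` carrier fractions" "lead_coeff p \<noteq> \<zero>\<^bsub>ac_hull\<^esub>"
      using p(1,2) unfolding univ_poly_carrier[symmetric] polynomial_def by auto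
    then have pM: "set p \<subseteq> M" using frac by blast
    then have pc: "set p \<subseteq> carrier ac_hull" using Mc by blast
    have "algebraic_rel ac_hull M x"
      unfolding algebraic_rel_def
    proof (intro exI[of _ "degree p"] exI[of _ "H.coeff p"] conjI allI impI)
      show "H.coeff p i \<in> M" if "i \<le> degree p" for i
      proof -
        have "i < length p" using that p(2) by (cases p) auto
        then have "H.coeff p i \<in> set p" using H.coeff_img_restrict[of p] by blast
        then show ?thesis using pM by blast
      qed
      show "H.coeff p (degree p) \<noteq> \<zero>\<^bsub>ac_hull\<^esub>" 
        unfolding H.lead_coeff_simp[OF p(2)] by (rule p'(2))
      have "{..degree p} = {..<length p}" using p(2) by (cases p) (auto simp: lessThan_Suc_atMost)
      then show "(\<Oplus>\<^bsub>ac_hull\<^esub>i\<in>{..degree p}. H.coeff p i \<otimes>\<^bsub>ac_hull\<^esub> x [^]\<^bsub>ac_hull\<^esub> i) = \<zero>\<^bsub>ac_hull\<^esub>"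
        using p(3) H.eval_eq_finsum[OF pc x] by simp
    qed
    then show ?thesis using closed x by blast
  qed
  then show ?thesis using Mc by blast
qed

end

subsection \<open>Derivatives and minimal polynomials\<close>

definition up_deriv :: "('a, 'm) ring_scheme \<Rightarrow> (nat \<Rightarrow> 'a) \<Rightarrow> nat \<Rightarrow> 'a" where
  "up_deriv R p = (\<lambda>n. [Suc n] \<cdot>\<^bsub>R\<^esub> p (Suc n))"

lemma carrier_UP: "carrier (UP R) = up R"
  by (simp add: UP_def)

lemma coeff_UP: "p \<in> up R \<Longrightarrow> up_ring.coeff (UP R) p = p"
  by (simp add: UP_def)

context UP_cring
begin

lemma carrier_eq_up: "carrier P = up R"
  unfolding P_def by (rule carrier_UP)

lemma coeff_eq: "p \<in> carrier P \<Longrightarrow> up_ring.coeff P p = p"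
  unfolding P_def carrier_UP by (rule coeff_UP)

lemma up_deriv_closed:
  assumes "p \<in> carrier P"
  shows "up_deriv R p \<in> carrier P"
proof -
  have p: "p \<in> up R" using assms unfolding carrier_eq_up .
  obtain n where n: "bound \<zero> n p" using R.bound_upD[OF p] by blast
  have "up_deriv R p \<in> up R"
  proof (rule mem_upI)
    show "up_deriv R p k \<in> carrier R" for k
      unfolding up_deriv_def by (rule R.add.nat_pow_closed) (rule mem_upD[OF p])
    have "bound \<zero> n (up_deriv R p)"
    proof (rule bound.intro)
      fix m assume "n < m"
      then have "p (Suc m) = \<zero>" using bound.bound[OF n, of "Suc m"] by simp
      then show "up_deriv R p m = \<zero>" unfolding up_deriv_def by (simp only: R.add.nat_pow_one)
    qed
    then show "\<exists>n. bound \<zero> n (up_deriv R p)" ..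
  qed
  then show ?thesis unfolding carrier_eq_up .
qed

lemma deg_up_deriv:
  assumes "p \<in> carrier P" "0 < deg R p"
  shows "deg R (up_deriv R p) < deg R p"
proof -
  have "deg R (up_deriv R p) \<le> deg R p - 1"
  proof (rule deg_aboveI[OF _ up_deriv_closed[OF assms(1)]])
    fix m assume "deg R p - 1 < m"
    then have "deg R p < Suc m" using assms(2) by linarith
    then have "p (Suc m) = \<zero>" 
      using deg_aboveD[OF _ assms(1)] unfolding coeff_eq[OF assms(1)] by blast
    then show "up_ring.coeff P (up_deriv R p) m = \<zero>"
      unfolding coeff_eq[OF up_deriv_closed[OF assms(1)]] unfolding up_deriv_def
      by (simp only: R.add.nat_pow_one)
  qed
  then show ?thesis using assms(2) by simp
qed

end

context UP_pre_univ_prop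
begin

text \<open>A summation bound independent of the degree lets the sums of a polynomial and of its
  derivative be combined term by term.\<close>

lemma eval_le:
  assumes "p \<in> carrier P" "s \<in> carrier S" "deg R p \<le> n"
  shows "UnivPoly.eval R S h s p = (\<Oplus>\<^bsub>S\<^esub>i\<in>{..n}. h (p i) \<otimes>\<^bsub>S\<^esub> s [^]\<^bsub>S\<^esub> i)"
proof -
  have "UnivPoly.eval R S h s p = (\<Oplus>\<^bsub>S\<^esub>i\<in>{..deg R p}. h (p i) \<otimes>\<^bsub>S\<^esub> s [^]\<^bsub>S\<^esub> i)"
    unfolding eval_on_carrier[OF assms(1)] coeff_eq[OF assms(1)] ..
  also have "\<dots> = (\<Oplus>\<^bsub>S\<^esub>i\<in>{..n}. h (p i) \<otimes>\<^bsub>S\<^esub> s [^]\<^bsub>S\<^esub> i)"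
  proof (intro S.add.finprod_mono_neutral_cong_left ballI)
    have pc: "p i \<in> carrier R" for i using assms(1) coeff_closed[of p i] by (simp add: coeff_eq)
    show "{..deg R p} \<subseteq> {..n}" using assms(3) by auto
    show "h (p i) \<otimes>\<^bsub>S\<^esub> s [^]\<^bsub>S\<^esub> i = \<zero>\<^bsub>S\<^esub>" if "i \<in> {..n} - {..deg R p}" for i
      using deg_aboveD[of p i, unfolded coeff_eq[OF assms(1)]] assms(1,2) that by simp
    show "(\<lambda>i. h (p i) \<otimes>\<^bsub>S\<^esub> s [^]\<^bsub>S\<^esub> i) \<in> {..n} \<rightarrow> carrier S" using pc assms(2) by simp
  qed simp_all
  finally show ?thesis .
qed

lemma pow_taylor:
  assumes "s \<in> carrier S" "t \<in> carrier S"
  shows "\<exists>w\<in>carrier S. (s \<oplus>\<^bsub>S\<^esub> t) [^]\<^bsub>S\<^esub> Suc i =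
    s [^]\<^bsub>S\<^esub> Suc i \<oplus>\<^bsub>S\<^esub> t \<otimes>\<^bsub>S\<^esub> ([Suc i] \<cdot>\<^bsub>S\<^esub> (s [^]\<^bsub>S\<^esub> i)) \<oplus>\<^bsub>S\<^esub> t \<otimes>\<^bsub>S\<^esub> t \<otimes>\<^bsub>S\<^esub> w"
proof (induction i)
  case 0 then show ?case using assms by (intro bexI[of _ "\<zero>\<^bsub>S\<^esub>"]) auto
next
  case (Suc i)
  then obtain w where w: "w \<in> carrier S" "(s \<oplus>\<^bsub>S\<^esub> t) [^]\<^bsub>S\<^esub> Suc i =
    s [^]\<^bsub>S\<^esub> Suc i \<oplus>\<^bsub>S\<^esub> t \<otimes>\<^bsub>S\<^esub> ([Suc i] \<cdot>\<^bsub>S\<^esub> (s [^]\<^bsub>S\<^esub> i)) \<oplus>\<^bsub>S\<^esub> t \<otimes>\<^bsub>S\<^esub> t \<otimes>\<^bsub>S\<^esub> w" by blast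
  define a where "a = s [^]\<^bsub>S\<^esub> Suc i"
  define d where "d = [Suc i] \<cdot>\<^bsub>S\<^esub> (s [^]\<^bsub>S\<^esub> i)"
  have c: "a \<in> carrier S" "d \<in> carrier S" using assms unfolding a_def d_def by auto
  have ds: "d \<otimes>\<^bsub>S\<^esub> s = [Suc i] \<cdot>\<^bsub>S\<^esub> a"
    unfolding d_def a_def using assms by (simp add: S.add_pow_ldistr del: S.add.nat_pow_Suc)
  have "(s \<oplus>\<^bsub>S\<^esub> t) [^]\<^bsub>S\<^esub> Suc (Suc i) = (a \<oplus>\<^bsub>S\<^esub> t \<otimes>\<^bsub>S\<^esub> d \<oplus>\<^bsub>S\<^esub> t \<otimes>\<^bsub>S\<^esub> t \<otimes>\<^bsub>S\<^esub> w) \<otimes>\<^bsub>S\<^esub> (s \<oplus>\<^bsub>S\<^esub> t)"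
    using w(2) unfolding a_def d_def by simp
  also have "\<dots> = a \<otimes>\<^bsub>S\<^esub> s \<oplus>\<^bsub>S\<^esub> t \<otimes>\<^bsub>S\<^esub> (d \<otimes>\<^bsub>S\<^esub> s \<oplus>\<^bsub>S\<^esub> a)
      \<oplus>\<^bsub>S\<^esub> t \<otimes>\<^bsub>S\<^esub> t \<otimes>\<^bsub>S\<^esub> (w \<otimes>\<^bsub>S\<^esub> (s \<oplus>\<^bsub>S\<^esub> t) \<oplus>\<^bsub>S\<^esub> d)"
    using c w(1) assms by (simp add: S.l_distr S.r_distr S.m_ac S.a_ac)
  also have "d \<otimes>\<^bsub>S\<^esub> s \<oplus>\<^bsub>S\<^esub> a = [Suc (Suc i)] \<cdot>\<^bsub>S\<^esub> a" unfolding ds using c by simp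
  finally show ?case using c w(1) assms unfolding a_def
    by (intro bexI[of _ "w \<otimes>\<^bsub>S\<^esub> (s \<oplus>\<^bsub>S\<^esub> t) \<oplus>\<^bsub>S\<^esub> d"]) auto
qed

lemma hom_add_pow: "x \<in> carrier R \<Longrightarrow> h ([n] \<cdot> x) = [(n::nat)] \<cdot>\<^bsub>S\<^esub> h x"
proof (induction n)
  case (Suc n)
  then show ?case using R.add.nat_pow_closed[OF Suc.prems, of n] by simp
qed simp

lemma eval_taylor:
  assumes "p \<in> carrier P" "s \<in> carrier S" "t \<in> carrier S"
  shows "\<exists>w\<in>carrier S. UnivPoly.eval R S h (s \<oplus>\<^bsub>S\<^esub> t) p =
    UnivPoly.eval R S h s p \<oplus>\<^bsub>S\<^esub> t \<otimes>\<^bsub>S\<^esub> UnivPoly.eval R S h s (up_deriv R p) \<oplus>\<^bsub>S\<^esub> t \<otimes>\<^bsub>S\<^esub> t \<otimes>\<^bsub>S\<^esub> w"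
proof -
  define n where "n = max (deg R p) (deg R (up_deriv R p))"
  have pc: "p i \<in> carrier R" for i using assms(1) coeff_closed[of p i] by (simp add: coeff_eq)
  have "\<exists>w. \<forall>i. w i \<in> carrier S \<and> (s \<oplus>\<^bsub>S\<^esub> t) [^]\<^bsub>S\<^esub> Suc i =
    s [^]\<^bsub>S\<^esub> Suc i \<oplus>\<^bsub>S\<^esub> t \<otimes>\<^bsub>S\<^esub> ([Suc i] \<cdot>\<^bsub>S\<^esub> (s [^]\<^bsub>S\<^esub> i)) \<oplus>\<^bsub>S\<^esub> t \<otimes>\<^bsub>S\<^esub> t \<otimes>\<^bsub>S\<^esub> w i"
    using pow_taylor[OF assms(2,3)] by (intro choice) blast
  then obtain w where w: "\<And>i. w i \<in> carrier S" "\<And>i. (s \<oplus>\<^bsub>S\<^esub> t) [^]\<^bsub>S\<^esub> Suc i =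
    s [^]\<^bsub>S\<^esub> Suc i \<oplus>\<^bsub>S\<^esub> t \<otimes>\<^bsub>S\<^esub> ([Suc i] \<cdot>\<^bsub>S\<^esub> (s [^]\<^bsub>S\<^esub> i)) \<oplus>\<^bsub>S\<^esub> t \<otimes>\<^bsub>S\<^esub> t \<otimes>\<^bsub>S\<^esub> w i"
    by blast
  define A where "A = (\<lambda>i. h (p (Suc i)) \<otimes>\<^bsub>S\<^esub> s [^]\<^bsub>S\<^esub> Suc i)"
  define D where "D = (\<lambda>i. h (up_deriv R p i) \<otimes>\<^bsub>S\<^esub> s [^]\<^bsub>S\<^esub> i)"
  define W where "W = (\<lambda>i. h (p (Suc i)) \<otimes>\<^bsub>S\<^esub> w i)"
  define H where "H = (\<lambda>x i. h (p (Suc i)) \<otimes>\<^bsub>S\<^esub> x [^]\<^bsub>S\<^esub> Suc i)"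
  have cl: "A i \<in> carrier S" "D i \<in> carrier S" "W i \<in> carrier S" "h (p i) \<in> carrier S" for i
    using pc assms w(1) by (auto simp: up_deriv_def A_def D_def W_def simp del: S.nat_pow_Suc)
  \<comment> \<open>The constant coefficient is split off because the remaining terms are indexed by
    \<open>Suc i\<close>, the index at which \<open>pow_taylor\<close> produces the i-th coefficient
    of the derivative.\<close>
  have split: "UnivPoly.eval R S h x p = (\<Oplus>\<^bsub>S\<^esub>i\<in>{..n}. H x i) \<oplus>\<^bsub>S\<^esub> h (p 0)" if "x \<in> carrier S" for x
    using eval_le[OF assms(1) that, of "Suc n"] S.finsum_Suc2[of "\<lambda>i. h (p i) \<otimes>\<^bsub>S\<^esub> x [^]\<^bsub>S\<^esub> i" n] pc that
    by (simp add: n_def Pi_def H_def del: S.finsum_Suc S.nat_pow_Suc)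
  have HA: "H s = A" unfolding H_def A_def ..
  have tm: "H (s \<oplus>\<^bsub>S\<^esub> t) i = A i \<oplus>\<^bsub>S\<^esub> t \<otimes>\<^bsub>S\<^esub> D i \<oplus>\<^bsub>S\<^esub> (t \<otimes>\<^bsub>S\<^esub> t) \<otimes>\<^bsub>S\<^esub> W i" for i
  proof -
    have "D i = h (p (Suc i)) \<otimes>\<^bsub>S\<^esub> ([Suc i] \<cdot>\<^bsub>S\<^esub> (s [^]\<^bsub>S\<^esub> i))"
      using pc assms(2) unfolding up_deriv_def D_def hom_add_pow[OF pc]
      by (simp add: S.add_pow_ldistr S.add_pow_rdistr del: S.add.nat_pow_Suc)
    then show ?thesis unfolding H_def w(2) A_def W_def
      using pc assms w(1) by (simp add: S.r_distr S.m_ac del: S.nat_pow_Suc S.add.nat_pow_Suc)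
  qed
  define sA sD sW where "sA = (\<Oplus>\<^bsub>S\<^esub>i\<in>{..n}. A i)" and "sD = (\<Oplus>\<^bsub>S\<^esub>i\<in>{..n}. D i)"
    and "sW = (\<Oplus>\<^bsub>S\<^esub>i\<in>{..n}. W i)"
  have sc: "sA \<in> carrier S" "sD \<in> carrier S" "sW \<in> carrier S"
    unfolding sA_def sD_def sW_def using cl by auto
  have main: "(\<Oplus>\<^bsub>S\<^esub>i\<in>{..n}. H (s \<oplus>\<^bsub>S\<^esub> t) i) = sA \<oplus>\<^bsub>S\<^esub> t \<otimes>\<^bsub>S\<^esub> sD \<oplus>\<^bsub>S\<^esub> (t \<otimes>\<^bsub>S\<^esub> t) \<otimes>\<^bsub>S\<^esub> sW"
    unfolding tm sA_def sD_def sW_def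
    using cl assms(2,3) by (simp add: S.finsum_addf S.finsum_rdistr Pi_def)
  have sDe: "sD = UnivPoly.eval R S h s (up_deriv R p)"
    using eval_le[OF up_deriv_closed[OF assms(1)] assms(2), of n] by (simp add: n_def sD_def D_def)
  have "UnivPoly.eval R S h (s \<oplus>\<^bsub>S\<^esub> t) p = sA \<oplus>\<^bsub>S\<^esub> t \<otimes>\<^bsub>S\<^esub> sD \<oplus>\<^bsub>S\<^esub> (t \<otimes>\<^bsub>S\<^esub> t) \<otimes>\<^bsub>S\<^esub> sW \<oplus>\<^bsub>S\<^esub> h (p 0)"
    unfolding main[symmetric] using assms by (intro split) simp
  also have "\<dots> = (sA \<oplus>\<^bsub>S\<^esub> h (p 0)) \<oplus>\<^bsub>S\<^esub> t \<otimes>\<^bsub>S\<^esub> sD \<oplus>\<^bsub>S\<^esub> (t \<otimes>\<^bsub>S\<^esub> t) \<otimes>\<^bsub>S\<^esub> sW"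
    using sc assms(2,3) cl(4)[of 0] by (simp add: S.a_ac)
  also have "sA \<oplus>\<^bsub>S\<^esub> h (p 0) = UnivPoly.eval R S h s p" using split[OF assms(2)] unfolding HA sA_def by simp
  finally show ?thesis unfolding sDe using sc(3) by (rule bexI)
qed

lemma eval_smult:
  assumes "c \<in> carrier R" "p \<in> carrier P" "s \<in> carrier S"
  shows "UnivPoly.eval R S h s (c \<odot>\<^bsub>P\<^esub> p) = h c \<otimes>\<^bsub>S\<^esub> UnivPoly.eval R S h s p"
proof -
  interpret E: ring_hom_cring P S "UnivPoly.eval R S h s"
    by unfold_locales (rule eval_ring_hom[OF assms(3)])
  show ?thesis
    using E.hom_mult[of "up_ring.monom P c 0" p] assms by (simp add: monom_mult_is_smult eval_const)
qed

text \<open>Newton's iteration for a polynomial. The first-order expansion that it requires of the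
  derivative is \<open>eval_taylor\<close> for the derivative, with the second derivative absorbed
  into the remainder.\<close>

lemma eval_hensel:
  assumes "p \<in> carrier P" "s \<in> carrier S"
    and "S.nilpotent (UnivPoly.eval R S h s p)" "UnivPoly.eval R S h s (up_deriv R p) \<in> Units S"
  shows "\<exists>y\<in>carrier S. UnivPoly.eval R S h y p = \<zero>\<^bsub>S\<^esub> \<and> S.nilpotent (y \<ominus>\<^bsub>S\<^esub> s)"
proof (rule S.newton_approximation[where f' = "\<lambda>y. UnivPoly.eval R S h y (up_deriv R p)"])
  have cl: "UnivPoly.eval R S h y q \<in> carrier S" if "y \<in> carrier S" "q \<in> carrier P" for y q
    using ring_hom_closed[OF eval_ring_hom[OF that(1)] that(2)] .
  note d = up_deriv_closed[OF assms(1)] up_deriv_closed[OF up_deriv_closed[OF assms(1)]]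
  fix y assume y: "y \<in> carrier S"
  show "UnivPoly.eval R S h y p \<in> carrier S" "UnivPoly.eval R S h y (up_deriv R p) \<in> carrier S"
    using cl y assms d by auto
  fix t assume t: "t \<in> carrier S"
  show "\<exists>w\<in>carrier S. UnivPoly.eval R S h (y \<oplus>\<^bsub>S\<^esub> t) p =
    UnivPoly.eval R S h y p \<oplus>\<^bsub>S\<^esub> t \<otimes>\<^bsub>S\<^esub> UnivPoly.eval R S h y (up_deriv R p) \<oplus>\<^bsub>S\<^esub> t \<otimes>\<^bsub>S\<^esub> t \<otimes>\<^bsub>S\<^esub> w"
    by (rule eval_taylor[OF assms(1) y t])
  obtain w where w: "w \<in> carrier S" "UnivPoly.eval R S h (y \<oplus>\<^bsub>S\<^esub> t) (up_deriv R p) = UnivPoly.eval R S h y (up_deriv R p)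
     \<oplus>\<^bsub>S\<^esub> t \<otimes>\<^bsub>S\<^esub> UnivPoly.eval R S h y (up_deriv R (up_deriv R p)) \<oplus>\<^bsub>S\<^esub> t \<otimes>\<^bsub>S\<^esub> t \<otimes>\<^bsub>S\<^esub> w"
    using eval_taylor[OF d(1) y t] by blast
  let ?d = "UnivPoly.eval R S h y (up_deriv R (up_deriv R p))"
  have "UnivPoly.eval R S h (y \<oplus>\<^bsub>S\<^esub> t) (up_deriv R p) =
      UnivPoly.eval R S h y (up_deriv R p) \<oplus>\<^bsub>S\<^esub> t \<otimes>\<^bsub>S\<^esub> (?d \<oplus>\<^bsub>S\<^esub> t \<otimes>\<^bsub>S\<^esub> w)"
    unfolding w(2) using cl[OF y d(1)] cl[OF y d(2)] w(1) t by (simp add: S.r_distr S.m_assoc S.a_assoc)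
  then show "\<exists>w\<in>carrier S. UnivPoly.eval R S h (y \<oplus>\<^bsub>S\<^esub> t) (up_deriv R p) =
      UnivPoly.eval R S h y (up_deriv R p) \<oplus>\<^bsub>S\<^esub> t \<otimes>\<^bsub>S\<^esub> w"
    using cl[OF y d(2)] w(1) t by (metis S.a_closed S.m_closed)
qed (rule assms)+

end

text \<open>Sending \<open>x\<close> to \<open>y\<close> becomes a well-defined map on S[x] that
  takes nonzero elements to units, although \<open>S\<close> need not be a field: pseudo-division
  only multiplies by powers of leading coefficients, and \<open>\<phi>\<close> makes these
  invertible. For the first claim divide by \<open>f\<close>; the remainder vanishes at
  \<open>x\<close> and is zero by minimality. The second claim is Euclid's algorithm on the
  remainders. It is applied with target F, for the derivative at conjugate roots, and with target
  \<D>(F), for the extension itself.\<close>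

lemma min_poly_transfer:
  fixes S :: "('s, 'm) ring_scheme" and F :: "('f, 'n) ring_scheme" and T :: "('t, 'k) ring_scheme"
  assumes S: "domain S" and F: "domain F" and T: "cring T"
    and hom: "\<theta> \<in> ring_hom S F" "\<phi> \<in> ring_hom S T"
    and pts: "x \<in> carrier F" "y \<in> carrier T"
    and f: "f \<in> carrier (UP S)" "f \<noteq> \<zero>\<^bsub>UP S\<^esub>" "UnivPoly.eval S F \<theta> x f = \<zero>\<^bsub>F\<^esub>"
    and min: "\<And>g. \<lbrakk>g \<in> carrier (UP S); g \<noteq> \<zero>\<^bsub>UP S\<^esub>; UnivPoly.eval S F \<theta> x g = \<zero>\<^bsub>F\<^esub>\<rbrakk> \<Longrightarrow> deg S f \<le> deg S g"
    and fy: "UnivPoly.eval S T \<phi> y f = \<zero>\<^bsub>T\<^esub>"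
    and unit: "\<And>s. \<lbrakk>s \<in> carrier S; s \<noteq> \<zero>\<^bsub>S\<^esub>\<rbrakk> \<Longrightarrow> \<phi> s \<in> Units T"
    and inj: "inj_on \<theta> (carrier S)"
    and p: "p \<in> carrier (UP S)"
  shows "UnivPoly.eval S F \<theta> x p = \<zero>\<^bsub>F\<^esub> \<Longrightarrow> UnivPoly.eval S T \<phi> y p = \<zero>\<^bsub>T\<^esub>"
    and "UnivPoly.eval S F \<theta> x p \<noteq> \<zero>\<^bsub>F\<^esub> \<Longrightarrow> UnivPoly.eval S T \<phi> y p \<in> Units T"
proof -
  interpret S: domain S by fact
  interpret F: domain F by fact
  interpret T: cring T by fact
  define P where "P = UP S"
  interpret U: UP_domain S P by unfold_locales (rule P_def[THEN eq_reflection])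
  interpret E: UP_pre_univ_prop S F \<theta> P by unfold_locales (rule hom)
  interpret G: UP_pre_univ_prop S T \<phi> P by unfold_locales (rule hom)
  interpret Ex: ring_hom_cring P F "UnivPoly.eval S F \<theta> x" by unfold_locales (rule E.eval_ring_hom[OF pts(1)])
  interpret Gy: ring_hom_cring P T "UnivPoly.eval S T \<phi> y" by unfold_locales (rule G.eval_ring_hom[OF pts(2)])
  let ?x = "UnivPoly.eval S F \<theta> x" and ?y = "UnivPoly.eval S T \<phi> y"
  note f = f[folded P_def] and min = min[folded P_def] and p = p[folded P_def]
  have th: "\<theta> s \<noteq> \<zero>\<^bsub>F\<^esub>" if "s \<in> carrier S" "s \<noteq> \<zero>\<^bsub>S\<^esub>" for s
    using inj_onD[OF inj, of s "\<zero>\<^bsub>S\<^esub>"] that by auto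
  have pow: "a [^]\<^bsub>S\<^esub> k \<noteq> \<zero>\<^bsub>S\<^esub>" if "a \<in> carrier S" "a \<noteq> \<zero>\<^bsub>S\<^esub>" for a and k :: nat
    using that by (induction k) (auto dest: S.integral)
  have lc: "up_ring.coeff P g (deg S g) [^]\<^bsub>S\<^esub> k \<in> carrier S" "up_ring.coeff P g (deg S g) [^]\<^bsub>S\<^esub> k \<noteq> \<zero>\<^bsub>S\<^esub>"
    if "g \<in> carrier P" "g \<noteq> \<zero>\<^bsub>P\<^esub>" for g and k :: nat
    using that(1) pow[OF _ U.lcoeff_nonzero[OF that(2,1)]] by simp_all
  have T_unit: "b \<in> Units T" if "a \<in> Units T" "a \<otimes>\<^bsub>T\<^esub> b \<in> Units T" "b \<in> carrier T" for a b
    using that T.unit_dvd[of b a] T.m_comm[of a b] by auto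
  \<comment> \<open>Dividing \<open>f\<close> by \<open>r\<close> and evaluating at \<open>y\<close>
    gives 0 = r(y) q(y) + r2(y). By induction r2(y) is a unit, so r(y) divides a unit.\<close>
  have low: "?y r \<in> Units T" if "r \<in> carrier P" "?x r \<noteq> \<zero>\<^bsub>F\<^esub>" "deg S r < deg S f" for r
    using that
  proof (induction "deg S r" arbitrary: r rule: less_induct)
    case less
    show ?case
    proof (cases "deg S r = 0")
      case True
      have r: "r = up_ring.monom P (up_ring.coeff P r 0) 0" by (rule U.deg_zero_impl_monom[OF less(2) True])
      have c: "up_ring.coeff P r 0 \<in> carrier S" using less(2) by simp
      have "\<theta> (up_ring.coeff P r 0) \<noteq> \<zero>\<^bsub>F\<^esub>" using less(3) r E.eval_const[OF pts(1) c] by simp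
      then have "up_ring.coeff P r 0 \<noteq> \<zero>\<^bsub>S\<^esub>" by (metis E.hom_zero)
      then have "\<phi> (up_ring.coeff P r 0) \<in> Units T" using unit[OF c] by blast
      then show ?thesis using r G.eval_const[OF pts(2) c] by simp
    next
      case False
      have r0: "r \<noteq> \<zero>\<^bsub>P\<^esub>" using False by auto
      let ?l = "\<lambda>k::nat. up_ring.coeff P r (deg S r) [^]\<^bsub>S\<^esub> k"
      obtain q r2 k where q: "q \<in> carrier P" "r2 \<in> carrier P" "?l k \<odot>\<^bsub>P\<^esub> f = r \<otimes>\<^bsub>P\<^esub> q \<oplus>\<^bsub>P\<^esub> r2"
        "r2 = \<zero>\<^bsub>P\<^esub> \<or> deg S r2 < deg S r"
        using U.long_div_theorem[OF less(2) f(1) r0] by blast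
      note l = lc[OF less(2) r0, of k]
      have ex: "\<zero>\<^bsub>F\<^esub> = ?x r \<otimes>\<^bsub>F\<^esub> ?x q \<oplus>\<^bsub>F\<^esub> ?x r2"
        using arg_cong[OF q(3), of ?x] q(1,2) less(2) f l E.eval_smult[OF l(1) f(1) pts(1)] by simp
      have ey: "\<zero>\<^bsub>T\<^esub> = ?y r \<otimes>\<^bsub>T\<^esub> ?y q \<oplus>\<^bsub>T\<^esub> ?y r2"
        using arg_cong[OF q(3), of ?y] q(1,2) less(2) f(1) fy l G.eval_smult[OF l(1) f(1) pts(2)] by simp
      \<comment> \<open>Otherwise \<open>r2\<close> is zero by minimality, and then \<open>q\<close>
        vanishes at \<open>x\<close> although its degree is below that of \<open>f\<close>.\<close>
      have "?x r2 \<noteq> \<zero>\<^bsub>F\<^esub>"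
      proof
        assume r2: "?x r2 = \<zero>\<^bsub>F\<^esub>"
        have r20: "r2 = \<zero>\<^bsub>P\<^esub>"
        proof (rule ccontr)
          assume "r2 \<noteq> \<zero>\<^bsub>P\<^esub>"
          then show False using min[OF q(2) _ r2] q(4) less(4) by simp
        qed
        then have "?x q = \<zero>\<^bsub>F\<^esub>" using ex less(2,3) q(1) F.integral[of "?x r" "?x q"] by auto
        have eq: "?l k \<odot>\<^bsub>P\<^esub> f = r \<otimes>\<^bsub>P\<^esub> q" using q r20 less(2) by simp
        have "?l k \<odot>\<^bsub>P\<^esub> f \<noteq> \<zero>\<^bsub>P\<^esub>"
        proof
          assume "?l k \<odot>\<^bsub>P\<^esub> f = \<zero>\<^bsub>P\<^esub>"
          then have "up_ring.monom P (?l k) 0 \<otimes>\<^bsub>P\<^esub> f = \<zero>\<^bsub>P\<^esub>" using U.monom_mult_is_smult[OF l(1) f(1)] by simp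
          then have "up_ring.monom P (?l k) 0 = \<zero>\<^bsub>P\<^esub>" using U.integral[of "up_ring.monom P (?l k) 0" f] f l by auto
          then show False using l U.coeff_monom[OF l(1), of 0 0] by simp
        qed
        then have q0: "q \<noteq> \<zero>\<^bsub>P\<^esub>" using eq less(2) by auto
        have "deg S f \<le> deg S q" using min[OF q(1) q0 \<open>?x q = \<zero>\<^bsub>F\<^esub>\<close>] .
        moreover have "deg S f = deg S r + deg S q"
          using arg_cong[OF eq, of "deg S"] U.deg_smult[OF l(1) f(1)] l(2) U.deg_mult[OF r0 q0 less(2) q(1)]
          by simp
        ultimately show False using False by simp
      qed
      moreover have "deg S r2 < deg S r" using q(4) False calculation by auto
      ultimately have u: "?y r2 \<in> Units T" using less(1)[OF _ q(2)] less(4) by simp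
      have c: "?y r \<in> carrier T" "?y q \<in> carrier T" "?y r2 \<in> carrier T" using q less(2) by auto
      have "?y r2 = ?y r \<otimes>\<^bsub>T\<^esub> (\<ominus>\<^bsub>T\<^esub> ?y q)"
        using ey c by (metis T.add.inv_equality T.a_comm T.add.inv_inv T.m_closed T.r_minus T.minus_equality)
      then show ?thesis using u c T.unit_dvd[of "?y r" "\<ominus>\<^bsub>T\<^esub> ?y q"] by simp
    qed
  qed
  let ?l = "\<lambda>k::nat. up_ring.coeff P f (deg S f) [^]\<^bsub>S\<^esub> k"
  obtain q r k where q: "q \<in> carrier P" "r \<in> carrier P" "?l k \<odot>\<^bsub>P\<^esub> p = f \<otimes>\<^bsub>P\<^esub> q \<oplus>\<^bsub>P\<^esub> r"
    "r = \<zero>\<^bsub>P\<^esub> \<or> deg S r < deg S f"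
    using U.long_div_theorem[OF f(1) p f(2)] by blast
  note l = lc[OF f(1,2), of k]
  have ex: "\<theta> (?l k) \<otimes>\<^bsub>F\<^esub> ?x p = ?x r"
    using arg_cong[OF q(3), of ?x] q(1,2) f E.eval_smult[OF l(1) p pts(1)] by simp
  have ey: "\<phi> (?l k) \<otimes>\<^bsub>T\<^esub> ?y p = ?y r"
    using arg_cong[OF q(3), of ?y] q(1,2) f fy G.eval_smult[OF l(1) p pts(2)] by simp
  have lu: "\<phi> (?l k) \<in> Units T" using unit l by blast
  { assume "?x p = \<zero>\<^bsub>F\<^esub>"
    then have "?x r = \<zero>\<^bsub>F\<^esub>" using ex l by simp
    then have "r = \<zero>\<^bsub>P\<^esub>" using min[OF q(2)] q(4) by fastforce
    then have "\<phi> (?l k) \<otimes>\<^bsub>T\<^esub> ?y p = \<phi> (?l k) \<otimes>\<^bsub>T\<^esub> \<zero>\<^bsub>T\<^esub>" using ey l by simp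
    then show "?y p = \<zero>\<^bsub>T\<^esub>" using T.Units_l_cancel[OF lu, of "?y p" "\<zero>\<^bsub>T\<^esub>"] p by simp }
  { assume "?x p \<noteq> \<zero>\<^bsub>F\<^esub>"
    then have xr: "?x r \<noteq> \<zero>\<^bsub>F\<^esub>" using ex F.integral[of "\<theta> (?l k)" "?x p"] th l p by auto
    then have "r \<noteq> \<zero>\<^bsub>P\<^esub>" by auto
    then have "?y r \<in> Units T" using low[OF q(2) xr] q(4) by simp
    then show "?y p \<in> Units T" using T_unit[OF lu, of "?y p"] ey p by simp }
qed

subsection \<open>Polynomial rings in several variables\<close>

lemma finite_submultisets: "finite {m'. m' \<subseteq># m}"
proof (induction m)
  case (add x m)
  have "{m'. m' \<subseteq># add_mset x m} \<subseteq> {m'. m' \<subseteq># m} \<union> add_mset x ` {m'. m' \<subseteq># m}"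
  proof
    fix m' assume "m' \<in> {m'. m' \<subseteq># add_mset x m}"
    then have m': "m' \<subseteq># add_mset x m" by simp
    show "m' \<in> {m'. m' \<subseteq># m} \<union> add_mset x ` {m'. m' \<subseteq># m}"
    proof (cases "x \<in># m'")
      case True
      then obtain n where n: "m' = add_mset x n" by (metis insert_DiffM)
      then show ?thesis using m' by simp
    next
      case False
      then have "m' \<subseteq># m" using m' by (metis diff_add_mset_swap add_mset_remove_trivial diff_subset_eq_self subset_eq_diff_conv union_mset_add_mset_right add.right_neutral diff_single_trivial)
      then show ?thesis by simp
    qed
  qed
  then show ?case using add finite_subset by blast
qed simp

definition mmono :: "('a, 'r) module \<Rightarrow> 'r \<Rightarrow> 'v multiset \<Rightarrow> 'v multiset \<Rightarrow> 'r" where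
  "mmono R c m = (\<lambda>m'. if m' = m then c else \<zero>\<^bsub>R\<^esub>)"

definition mset_pow :: "('s, 'm) ring_scheme \<Rightarrow> ('v \<Rightarrow> 's) \<Rightarrow> 'v multiset \<Rightarrow> 's" where
  "mset_pow S y m = (\<Otimes>\<^bsub>S\<^esub>i\<in>set_mset m. y i [^]\<^bsub>S\<^esub> count m i)"

lemma (in cring) mset_pow_superset:
  assumes "finite A" "set_mset m \<subseteq> A" "y \<in> A \<rightarrow> carrier R"
  shows "mset_pow R y m = (\<Otimes>i\<in>A. y i [^] count m i)"
  unfolding mset_pow_def
proof (rule finprod_mono_neutral_cong_left)
  show "y i [^] count m i = \<one>" if "i \<in> A - set_mset m" for i
    using that by (simp add: not_in_iff)
qed (use assms in auto)

lemma (in cring) mset_pow_closed: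
  "y \<in> set_mset m \<rightarrow> carrier R \<Longrightarrow> mset_pow R y m \<in> carrier R"
  unfolding mset_pow_def by (rule finprod_closed) auto

lemma (in cring) mset_pow_add:
  assumes "y \<in> V \<rightarrow> carrier R" "set_mset m \<subseteq> V" "set_mset n \<subseteq> V"
  shows "mset_pow R y (m + n) = mset_pow R y m \<otimes> mset_pow R y n"
proof -
  let ?A = "set_mset m \<union> set_mset n"
  have y: "y \<in> ?A \<rightarrow> carrier R" using assms by auto
  have "mset_pow R y (m + n) = (\<Otimes>i\<in>?A. y i [^] count m i \<otimes> y i [^] count n i)"
    by (rule trans[OF mset_pow_superset[of ?A "m + n" y]])
      (use y in simp_all, rule finprod_cong', use y in \<open>auto simp: nat_pow_mult Pi_def\<close>)
  also have "\<dots> = (\<Otimes>i\<in>?A. y i [^] count m i) \<otimes> (\<Otimes>i\<in>?A. y i [^] count n i)"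
    using y by (intro finprod_multf) auto
  finally show ?thesis using mset_pow_superset[of ?A _ y] y by simp
qed

lemma (in cring) mset_pow_empty [simp]: "mset_pow R y {#} = \<one>"
  unfolding mset_pow_def by simp

lemma (in cring) mset_pow_single: "y i \<in> carrier R \<Longrightarrow> mset_pow R y {#i#} = y i"
  unfolding mset_pow_def by simp

locale mpoly_base = cring R for R :: "('a, 'r) module" (structure)
begin

lemma mono_closed:
  fixes V :: "'b set"
  assumes "c \<in> carrier R" "set_mset m \<subseteq> V"
  shows "mmono R c m \<in> carrier (mpoly R V)"
  using assms(2)
proof (induction m)
  case empty
  have "mmono R c ({#} :: 'b multiset) = indexed_const c" unfolding mmono_def indexed_const_def ..
  then show ?case using assms(1) indexed_pset.indexed_const[of c "carrier R" V] unfolding mpoly_def by simp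
next
  case (add v m)
  have "mmono R c (add_mset v m) = indexed_pmult (mmono R c m) v"
    unfolding mmono_def indexed_pmult_def by (auto simp: fun_eq_iff)
  then show ?case using add indexed_pset.indexed_pmult[of "mmono R c m" V "carrier R" v] unfolding mpoly_def by simp
qed

lemma mpoly_add: "P \<oplus>\<^bsub>mpoly R V\<^esub> Q = (\<lambda>m. P m \<oplus> Q m)"
  unfolding mpoly_def indexed_padd_def by simp

lemma mpoly_zero: "\<zero>\<^bsub>mpoly R V\<^esub> = (\<lambda>m. \<zero>)"
  unfolding mpoly_def indexed_zero_def[symmetric] by simp

lemma mpoly_one: "\<one>\<^bsub>mpoly R V\<^esub> = mmono R \<one> {#}"
  unfolding mpoly_def mmono_def indexed_const_def by simp

lemma mpoly_mult: "(P \<otimes>\<^bsub>mpoly R V\<^esub> Q) m = (\<Oplus>m'\<in>{m'. m' \<subseteq># m}. P m' \<otimes> Q (m - m'))"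
  unfolding mpoly_def by simp

lemma indexed_const_mono: "indexed_const c = mmono R c {#}"
  unfolding mmono_def indexed_const_def ..

lemma indexed_var_mono: "indexed_var v = mmono R \<one> {#v#}"
  unfolding mmono_def indexed_var_def indexed_pmult_def indexed_const_def
  by (auto simp: fun_eq_iff) (metis empty_iff insert_DiffM set_mset_empty)

lemma mpoly_carrierD:
  assumes "P \<in> carrier (mpoly R V)"
  shows "finite {m. P m \<noteq> \<zero>}" "P m \<in> carrier R" "P m \<noteq> \<zero> \<Longrightarrow> set_mset m \<subseteq> V"
proof -
  have "P \<in> indexed_pset V (carrier R)" using assms unfolding mpoly_def by simp
  then have "finite {m. P m \<noteq> \<zero>} \<and> (\<forall>m. P m \<in> carrier R) \<and> (\<forall>m. P m \<noteq> \<zero> \<longrightarrow> set_mset m \<subseteq> V)"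
  proof induction
    case (indexed_const k)
    have "{m. indexed_const k m \<noteq> \<zero>} \<subseteq> {{#}}" unfolding indexed_const_def by auto
    then have "finite {m. indexed_const k m \<noteq> \<zero>}" using finite_subset by blast
    then show ?case using indexed_const unfolding indexed_const_def by auto
  next
    case (indexed_padd P Q)
    have "{m. indexed_padd P Q m \<noteq> \<zero>} \<subseteq> {m. P m \<noteq> \<zero>} \<union> {m. Q m \<noteq> \<zero>}"
      unfolding indexed_padd_def by auto
    then have "finite {m. indexed_padd P Q m \<noteq> \<zero>}" using indexed_padd finite_subset by blast
    moreover have "set_mset m \<subseteq> V" if "indexed_padd P Q m \<noteq> \<zero>" for m
      using that indexed_padd unfolding indexed_padd_def by (metis l_zero zero_closed)
    ultimately show ?case using indexed_padd unfolding indexed_padd_def by auto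
  next
    case (indexed_pmult P i)
    have "{m. indexed_pmult P i m \<noteq> \<zero>} \<subseteq> add_mset i ` {m. P m \<noteq> \<zero>}"
    proof
      fix m assume "m \<in> {m. indexed_pmult P i m \<noteq> \<zero>}"
      then have "i \<in># m" "P (m - {#i#}) \<noteq> \<zero>" unfolding indexed_pmult_def by (auto split: if_splits)
      then show "m \<in> add_mset i ` {m. P m \<noteq> \<zero>}" by (intro image_eqI[of _ _ "m - {#i#}"]) auto
    qed
    then have "finite {m. indexed_pmult P i m \<noteq> \<zero>}" using indexed_pmult finite_subset by blast
    moreover have "set_mset m \<subseteq> V" if "indexed_pmult P i m \<noteq> \<zero>" for m
    proof -
      have "i \<in># m" "P (m - {#i#}) \<noteq> \<zero>" using that unfolding indexed_pmult_def by (auto split: if_splits)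
      then have "set_mset (m - {#i#}) \<subseteq> V" "m = add_mset i (m - {#i#})" using indexed_pmult by auto
      then show ?thesis using indexed_pmult(2) by (metis insert_subset set_mset_add_mset_insert)
    qed
    ultimately show ?case using indexed_pmult unfolding indexed_pmult_def by auto
  qed
  then show "finite {m. P m \<noteq> \<zero>}" "P m \<in> carrier R" "P m \<noteq> \<zero> \<Longrightarrow> set_mset m \<subseteq> V" by blast+
qed

lemma mono_in_carrier: "c \<in> carrier R \<Longrightarrow> mmono R c m m' \<in> carrier R"
  unfolding mmono_def by simp

text \<open>The carrier is generated by constants, sums and multiplication by variables; here
  polynomials are built from terms instead. The ring laws are additive in each argument, so it is
  enough to see them on terms, where they are laws of coefficients and multisets.\<close>

lemma mpoly_induct [consumes 1, case_names mono add]: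
  assumes "P \<in> carrier (mpoly R V)"
    and mono: "\<And>c m. \<lbrakk>c \<in> carrier R; set_mset m \<subseteq> V\<rbrakk> \<Longrightarrow> T (mmono R c m)"
    and add: "\<And>P Q. \<lbrakk>P \<in> carrier (mpoly R V); Q \<in> carrier (mpoly R V); T P; T Q\<rbrakk> \<Longrightarrow> T (P \<oplus>\<^bsub>mpoly R V\<^esub> Q)"
  shows "T P"
proof -
  have "finite A \<Longrightarrow> (\<And>m. P m \<in> carrier R) \<Longrightarrow> (\<And>m. P m \<noteq> \<zero> \<Longrightarrow> set_mset m \<subseteq> V) \<Longrightarrow>
      {m. P m \<noteq> \<zero>} = A \<Longrightarrow> P \<in> carrier (mpoly R V) \<and> T P" for A P
  proof (induction A arbitrary: P rule: finite_induct)
    case empty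
    then have "P = mmono R \<zero> {#}" unfolding mmono_def by auto
    then show ?case using mono[of \<zero> "{#}"] mono_closed[of \<zero> "{#}" V] by simp
  next
    case (insert m A)
    define Q where "Q = P(m := \<zero>)"
    have Q: "Q \<in> carrier (mpoly R V) \<and> T Q"
    proof (rule insert.IH)
      show "Q m' \<in> carrier R" for m' using insert unfolding Q_def by simp
      show "set_mset m' \<subseteq> V" if "Q m' \<noteq> \<zero>" for m' using that insert unfolding Q_def by (auto split: if_splits)
      show "{m. Q m \<noteq> \<zero>} = A" using insert unfolding Q_def by auto
    qed
    have m: "set_mset m \<subseteq> V" using insert.prems(2)[of m] insert.prems(3) by blast
    have "P = Q \<oplus>\<^bsub>mpoly R V\<^esub> mmono R (P m) m"
      unfolding mpoly_add Q_def mmono_def using insert.prems(1) by (auto simp: fun_eq_iff)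
    moreover have "Q \<oplus>\<^bsub>mpoly R V\<^esub> mmono R (P m) m \<in> carrier (mpoly R V)"
      using indexed_pset.indexed_padd[of Q V "carrier R" "mmono R (P m) m"] Q mono_closed[OF insert.prems(1) m]
      unfolding mpoly_def by simp
    ultimately show ?case using Q add mono m insert.prems(1) mono_closed by metis
  qed
  then show ?thesis using mpoly_carrierD[OF assms(1)] by blast
qed

lemma mpoly_add_closed:
  "\<lbrakk>P \<in> carrier (mpoly R V); Q \<in> carrier (mpoly R V)\<rbrakk> \<Longrightarrow> P \<oplus>\<^bsub>mpoly R V\<^esub> Q \<in> carrier (mpoly R V)"
  using indexed_pset.indexed_padd unfolding mpoly_def by auto

lemma mono_mult:
  assumes "c \<in> carrier R" "d \<in> carrier R"
  shows "mmono R c m \<otimes>\<^bsub>mpoly R V\<^esub> mmono R d n = mmono R (c \<otimes> d) (m + n)"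
proof
  fix k
  have "(mmono R c m \<otimes>\<^bsub>mpoly R V\<^esub> mmono R d n) k
      = (\<Oplus>m'\<in>{m'. m' \<subseteq># k}. if m = m' then c \<otimes> mmono R d n (k - m') else \<zero>)"
    unfolding mpoly_mult using assms mono_in_carrier[OF assms(2)]
    by (intro finsum_cong') (auto simp: mmono_def)
  also have "\<dots> = mmono R (c \<otimes> d) (m + n) k"
  proof (cases "m \<subseteq># k")
    case True
    then have "(\<Oplus>m'\<in>{m'. m' \<subseteq># k}. if m = m' then c \<otimes> mmono R d n (k - m') else \<zero>) = c \<otimes> mmono R d n (k - m)"
      using finsum_singleton[of m "{m'. m' \<subseteq># k}" "\<lambda>m'. c \<otimes> mmono R d n (k - m')"]
        finite_submultisets assms mono_in_carrier[OF assms(2)] by auto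
    moreover have "k - m = n \<longleftrightarrow> k = m + n" using True by (auto simp: subset_mset.add_diff_inverse)
    ultimately show ?thesis using assms unfolding mmono_def by auto
  next
    case False
    then have "(\<Oplus>m'\<in>{m'. m' \<subseteq># k}. if m = m' then c \<otimes> mmono R d n (k - m') else \<zero>) = (\<Oplus>m'\<in>{m'. m' \<subseteq># k}. \<zero>)"
      by (intro finsum_cong') auto
    then show ?thesis using False unfolding mmono_def by auto
  qed
  finally show "(mmono R c m \<otimes>\<^bsub>mpoly R V\<^esub> mmono R d n) k = mmono R (c \<otimes> d) (m + n) k" .
qed

lemma mpoly_distrib:
  assumes "P \<in> carrier (mpoly R V)" "Q \<in> carrier (mpoly R V)" "S \<in> carrier (mpoly R V)"
  shows "(P \<oplus>\<^bsub>mpoly R V\<^esub> Q) \<otimes>\<^bsub>mpoly R V\<^esub> S = P \<otimes>\<^bsub>mpoly R V\<^esub> S \<oplus>\<^bsub>mpoly R V\<^esub> Q \<otimes>\<^bsub>mpoly R V\<^esub> S"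
    and "S \<otimes>\<^bsub>mpoly R V\<^esub> (P \<oplus>\<^bsub>mpoly R V\<^esub> Q) = S \<otimes>\<^bsub>mpoly R V\<^esub> P \<oplus>\<^bsub>mpoly R V\<^esub> S \<otimes>\<^bsub>mpoly R V\<^esub> Q"
proof -
  note c = mpoly_carrierD(2)[OF assms(1)] mpoly_carrierD(2)[OF assms(2)] mpoly_carrierD(2)[OF assms(3)]
  show "(P \<oplus>\<^bsub>mpoly R V\<^esub> Q) \<otimes>\<^bsub>mpoly R V\<^esub> S = P \<otimes>\<^bsub>mpoly R V\<^esub> S \<oplus>\<^bsub>mpoly R V\<^esub> Q \<otimes>\<^bsub>mpoly R V\<^esub> S"
    by (rule ext) (use c in \<open>simp add: mpoly_mult mpoly_add l_distr finsum_addf Pi_def\<close>)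
  show "S \<otimes>\<^bsub>mpoly R V\<^esub> (P \<oplus>\<^bsub>mpoly R V\<^esub> Q) = S \<otimes>\<^bsub>mpoly R V\<^esub> P \<oplus>\<^bsub>mpoly R V\<^esub> S \<otimes>\<^bsub>mpoly R V\<^esub> Q"
    by (rule ext) (use c in \<open>simp add: mpoly_mult mpoly_add r_distr finsum_addf Pi_def\<close>)
qed

lemma mpoly_mult_closed:
  assumes "P \<in> carrier (mpoly R V)" "Q \<in> carrier (mpoly R V)"
  shows "P \<otimes>\<^bsub>mpoly R V\<^esub> Q \<in> carrier (mpoly R V)"
  using assms(1)
proof (induction rule: mpoly_induct)
  case (mono c m)
  show ?case using assms(2)
  proof (induction rule: mpoly_induct)
    case (mono d n)
    then show ?case using \<open>c \<in> carrier R\<close> \<open>set_mset m \<subseteq> V\<close> by (simp add: mono_mult mono_closed)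
  next
    case (add P Q)
    then show ?case using mpoly_distrib(2)[OF add(1,2) mono_closed[OF mono]] by (simp add: mpoly_add_closed)
  qed
next
  case (add P1 P2)
  then show ?case using mpoly_distrib(1)[OF add(1,2) assms(2)] by (simp add: mpoly_add_closed)
qed

lemma mpoly_mult_comm:
  assumes "P \<in> carrier (mpoly R V)" "Q \<in> carrier (mpoly R V)"
  shows "P \<otimes>\<^bsub>mpoly R V\<^esub> Q = Q \<otimes>\<^bsub>mpoly R V\<^esub> P"
  using assms(1)
proof (induction rule: mpoly_induct)
  case (mono c m)
  show ?case using assms(2)
  proof (induction rule: mpoly_induct)
    case (mono d n)
    then show ?case using \<open>c \<in> carrier R\<close> mono_mult m_comm add.commute by metis
  next
    case (add P Q)
    then show ?case using mpoly_distrib[OF add(1,2) mono_closed[OF mono]] by simp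
  qed
next
  case (add P1 P2)
  then show ?case using mpoly_distrib[OF add(1,2) assms(2)] by simp
qed

lemma mpoly_mult_assoc:
  assumes "P \<in> carrier (mpoly R V)" "Q \<in> carrier (mpoly R V)" "S \<in> carrier (mpoly R V)"
  shows "(P \<otimes>\<^bsub>mpoly R V\<^esub> Q) \<otimes>\<^bsub>mpoly R V\<^esub> S = P \<otimes>\<^bsub>mpoly R V\<^esub> (Q \<otimes>\<^bsub>mpoly R V\<^esub> S)"
  using assms(1)
proof (induction rule: mpoly_induct)
  case P: (mono c m)
  note Pc = mono_closed[OF P]
  show ?case using assms(2)
  proof (induction rule: mpoly_induct)
    case Q: (mono d n)
    note Qc = mono_closed[OF Q]
    show ?case using assms(3)
    proof (induction rule: mpoly_induct)
      case (mono e k)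
      then show ?case using P(1) Q(1) by (simp add: mono_mult m_assoc add.assoc)
    next
      case (add S1 S2)
      show ?case
        unfolding mpoly_distrib(2)[OF add(1,2) mpoly_mult_closed[OF Pc Qc]] mpoly_distrib(2)[OF add(1,2) Qc]
          mpoly_distrib(2)[OF mpoly_mult_closed[OF Qc add(1)] mpoly_mult_closed[OF Qc add(2)] Pc] add(3,4) ..
    qed
  next
    case (add Q1 Q2)
    show ?case
      unfolding mpoly_distrib(2)[OF add(1,2) Pc] mpoly_distrib(1)[OF add(1,2) assms(3)]
        mpoly_distrib(1)[OF mpoly_mult_closed[OF Pc add(1)] mpoly_mult_closed[OF Pc add(2)] assms(3)]
        mpoly_distrib(2)[OF mpoly_mult_closed[OF add(1) assms(3)] mpoly_mult_closed[OF add(2) assms(3)] Pc] add(3,4) ..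
  qed
next
  case (add P1 P2)
  show ?case
    unfolding mpoly_distrib(1)[OF add(1,2) assms(2)] mpoly_distrib(1)[OF add(1,2) mpoly_mult_closed[OF assms(2,3)]]
      mpoly_distrib(1)[OF mpoly_mult_closed[OF add(1) assms(2)] mpoly_mult_closed[OF add(2) assms(2)] assms(3)] add(3,4) ..
qed

lemma const_mult:
  assumes "c \<in> carrier R" "P \<in> carrier (mpoly R V)"
  shows "mmono R c {#} \<otimes>\<^bsub>mpoly R V\<^esub> P = (\<lambda>m. c \<otimes> P m)"
  using assms(2)
proof (induction rule: mpoly_induct)
  case (mono d n)
  then show ?case using assms(1) by (simp add: mono_mult) (auto simp: mmono_def)
next
  case (add P Q)
  then show ?case
    using mpoly_distrib(2)[OF add(1,2) mono_closed[OF assms(1), of "{#}"]] assms(1)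
      mpoly_carrierD(2)[OF add(1)] mpoly_carrierD(2)[OF add(2)]
    by (simp add: mpoly_add r_distr)
qed

lemma mpoly_cring: "cring (mpoly R V)"
proof (rule cringI[OF abelian_groupI comm_monoidI])
  fix P Q S assume c: "P \<in> carrier (mpoly R V)" "Q \<in> carrier (mpoly R V)" "S \<in> carrier (mpoly R V)"
  note cc = mpoly_carrierD(2)[OF c(1)] mpoly_carrierD(2)[OF c(2)] mpoly_carrierD(2)[OF c(3)]
  show "P \<oplus>\<^bsub>mpoly R V\<^esub> Q \<oplus>\<^bsub>mpoly R V\<^esub> S = P \<oplus>\<^bsub>mpoly R V\<^esub> (Q \<oplus>\<^bsub>mpoly R V\<^esub> S)"
    using cc by (simp add: mpoly_add a_assoc)
  show "(P \<otimes>\<^bsub>mpoly R V\<^esub> Q) \<otimes>\<^bsub>mpoly R V\<^esub> S = P \<otimes>\<^bsub>mpoly R V\<^esub> (Q \<otimes>\<^bsub>mpoly R V\<^esub> S)"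
    by (rule mpoly_mult_assoc[OF c])
  show "(P \<oplus>\<^bsub>mpoly R V\<^esub> Q) \<otimes>\<^bsub>mpoly R V\<^esub> S = P \<otimes>\<^bsub>mpoly R V\<^esub> S \<oplus>\<^bsub>mpoly R V\<^esub> Q \<otimes>\<^bsub>mpoly R V\<^esub> S"
    by (rule mpoly_distrib(1)[OF c])
next
  fix P Q assume c: "P \<in> carrier (mpoly R V)" "Q \<in> carrier (mpoly R V)"
  note cc = mpoly_carrierD(2)[OF c(1)] mpoly_carrierD(2)[OF c(2)]
  show "P \<oplus>\<^bsub>mpoly R V\<^esub> Q = Q \<oplus>\<^bsub>mpoly R V\<^esub> P" using cc by (simp add: mpoly_add a_comm)
  show "P \<otimes>\<^bsub>mpoly R V\<^esub> Q = Q \<otimes>\<^bsub>mpoly R V\<^esub> P" by (rule mpoly_mult_comm[OF c])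
  show "P \<oplus>\<^bsub>mpoly R V\<^esub> Q \<in> carrier (mpoly R V)" by (rule mpoly_add_closed[OF c])
  show "P \<otimes>\<^bsub>mpoly R V\<^esub> Q \<in> carrier (mpoly R V)" by (rule mpoly_mult_closed[OF c])
next
  fix P assume P: "P \<in> carrier (mpoly R V)"
  note cc = mpoly_carrierD(2)[OF P]
  show "\<zero>\<^bsub>mpoly R V\<^esub> \<oplus>\<^bsub>mpoly R V\<^esub> P = P" using cc by (simp add: mpoly_add mpoly_zero)
  show "\<one>\<^bsub>mpoly R V\<^esub> \<otimes>\<^bsub>mpoly R V\<^esub> P = P" unfolding mpoly_one const_mult[OF one_closed P] using cc by simp
  have "mmono R (\<ominus> \<one>) {#} \<otimes>\<^bsub>mpoly R V\<^esub> P \<in> carrier (mpoly R V)"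
    by (rule mpoly_mult_closed[OF mono_closed P]) auto
  moreover have "(mmono R (\<ominus> \<one>) {#} \<otimes>\<^bsub>mpoly R V\<^esub> P) \<oplus>\<^bsub>mpoly R V\<^esub> P = \<zero>\<^bsub>mpoly R V\<^esub>"
    using cc by (simp add: const_mult[OF _ P] mpoly_add mpoly_zero l_minus l_neg)
  ultimately show "\<exists>Q\<in>carrier (mpoly R V). Q \<oplus>\<^bsub>mpoly R V\<^esub> P = \<zero>\<^bsub>mpoly R V\<^esub>" by blast
next
  show "\<zero>\<^bsub>mpoly R V\<^esub> \<in> carrier (mpoly R V)"
    using mono_closed[OF zero_closed, of "{#}" V] unfolding mpoly_zero mmono_def by simp
  show "\<one>\<^bsub>mpoly R V\<^esub> \<in> carrier (mpoly R V)"
    using mono_closed[OF one_closed, of "{#}" V] unfolding mpoly_one by simp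
qed

lemma const_closed: "c \<in> carrier R \<Longrightarrow> indexed_const c \<in> carrier (mpoly R V)"
  unfolding indexed_const_mono by (rule mono_closed) auto

lemma var_closed: "v \<in> V \<Longrightarrow> indexed_var v \<in> carrier (mpoly R V)"
  unfolding indexed_var_mono by (rule mono_closed) auto

lemma const_hom: "indexed_const \<in> ring_hom R (mpoly R V)"
proof (rule ring_hom_memI)
  show "indexed_const (x \<oplus> y) = indexed_const x \<oplus>\<^bsub>mpoly R V\<^esub> indexed_const y" for x y
    unfolding mpoly_add indexed_const_def by auto
qed (simp_all add: const_closed mpoly_one, simp_all add: indexed_const_mono mono_mult)

section \<open>Evaluation homomorphisms\<close>

text \<open>The support varies with the polynomial; over a fixed larger index set the sums of two
  polynomials can be added.\<close>

lemma mpoly_eval_superset: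
  assumes "P \<in> carrier (mpoly R V)" "cring S" "h \<in> ring_hom R S" "y \<in> V \<rightarrow> carrier S"
    and "finite A" "{m. P m \<noteq> \<zero>} \<subseteq> A" "\<And>m. m \<in> A \<Longrightarrow> set_mset m \<subseteq> V"
  shows "mpoly_eval R S h y P = (\<Oplus>\<^bsub>S\<^esub>m\<in>A. h (P m) \<otimes>\<^bsub>S\<^esub> mset_pow S y m)"
proof -
  interpret S: cring S by fact
  interpret h: ring_hom_cring R S h by unfold_locales fact
  have y: "mset_pow S y m \<in> carrier S" if "m \<in> A" for m
    using assms(7)[OF that] assms(4) by (intro S.mset_pow_closed) auto
  show ?thesis
    unfolding mpoly_eval_def mset_pow_def[symmetric]
    using mpoly_carrierD(2)[OF assms(1)] y assms(5,6)
    by (intro S.add.finprod_mono_neutral_cong_left) auto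
qed

lemma mpoly_eval_mono:
  assumes "cring S" "h \<in> ring_hom R S" "y \<in> V \<rightarrow> carrier S" "c \<in> carrier R" "set_mset m \<subseteq> V"
  shows "mpoly_eval R S h y (mmono R c m) = h c \<otimes>\<^bsub>S\<^esub> mset_pow S y m"
proof -
  interpret S: cring S by fact
  interpret h: ring_hom_cring R S h by unfold_locales fact
  have y: "mset_pow S y m \<in> carrier S"
    using assms by (intro S.mset_pow_closed) auto
  have "mpoly_eval R S h y (mmono R c m) = (\<Oplus>\<^bsub>S\<^esub>m'\<in>{m}. h (mmono R c m m') \<otimes>\<^bsub>S\<^esub> mset_pow S y m')"
    using assms by (intro mpoly_eval_superset[where V = V] mono_closed) (auto simp: mmono_def split: if_splits)
  then show ?thesis using y assms by (simp add: mmono_def)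
qed

lemma mpoly_eval_add:
  assumes "cring S" "h \<in> ring_hom R S" "y \<in> V \<rightarrow> carrier S"
    and PQ: "P \<in> carrier (mpoly R V)" "Q \<in> carrier (mpoly R V)"
  shows "mpoly_eval R S h y (P \<oplus>\<^bsub>mpoly R V\<^esub> Q) = mpoly_eval R S h y P \<oplus>\<^bsub>S\<^esub> mpoly_eval R S h y Q"
proof -
  interpret S: cring S by fact
  interpret h: ring_hom_cring R S h by unfold_locales fact
  let ?A = "{m. P m \<noteq> \<zero>} \<union> {m. Q m \<noteq> \<zero>}"
  have A: "finite ?A" "\<And>m. m \<in> ?A \<Longrightarrow> set_mset m \<subseteq> V"
    using mpoly_carrierD(1,3)[OF PQ(1)] mpoly_carrierD(1,3)[OF PQ(2)] by auto
  have y: "mset_pow S y m \<in> carrier S" if "m \<in> ?A" for m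
    using A(2)[OF that] assms(3) by (intro S.mset_pow_closed) auto
  have sub: "{m. (P \<oplus>\<^bsub>mpoly R V\<^esub> Q) m \<noteq> \<zero>} \<subseteq> ?A" unfolding mpoly_add by auto
  note c = mpoly_carrierD(2)[OF PQ(1)] mpoly_carrierD(2)[OF PQ(2)]
  have "mpoly_eval R S h y (P \<oplus>\<^bsub>mpoly R V\<^esub> Q) =
      (\<Oplus>\<^bsub>S\<^esub>m\<in>?A. h (P m) \<otimes>\<^bsub>S\<^esub> mset_pow S y m \<oplus>\<^bsub>S\<^esub> h (Q m) \<otimes>\<^bsub>S\<^esub> mset_pow S y m)"
    using mpoly_eval_superset[OF mpoly_add_closed[OF PQ] assms(1-3) A(1) sub A(2)]
    by (rule trans) (assumption, rule S.finsum_cong', use c y in \<open>auto simp: mpoly_add S.l_distr\<close>)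
  also have "\<dots> = (\<Oplus>\<^bsub>S\<^esub>m\<in>?A. h (P m) \<otimes>\<^bsub>S\<^esub> mset_pow S y m) \<oplus>\<^bsub>S\<^esub> (\<Oplus>\<^bsub>S\<^esub>m\<in>?A. h (Q m) \<otimes>\<^bsub>S\<^esub> mset_pow S y m)"
    using c y by (intro S.finsum_addf) auto
  also have "\<dots> = mpoly_eval R S h y P \<oplus>\<^bsub>S\<^esub> mpoly_eval R S h y Q"
    using mpoly_eval_superset[OF PQ(1) assms(1-3) A(1) _ A(2)] mpoly_eval_superset[OF PQ(2) assms(1-3) A(1) _ A(2)]
    by simp
  finally show ?thesis .
qed

lemma mpoly_eval_closed:
  assumes "cring S" "h \<in> ring_hom R S" "y \<in> V \<rightarrow> carrier S" "P \<in> carrier (mpoly R V)"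
  shows "mpoly_eval R S h y P \<in> carrier S"
proof -
  interpret S: cring S by fact
  show ?thesis using assms(4)
  proof (induction rule: mpoly_induct)
    case (mono c m)
    have "mset_pow S y m \<in> carrier S" using mono assms by (intro S.mset_pow_closed) auto
    then show ?case using mpoly_eval_mono[OF assms(1-3) mono] ring_hom_closed[OF assms(2) mono(1)] by simp
  next
    case (add P Q)
    then show ?case using mpoly_eval_add[OF assms(1-3) add(1,2)] by simp
  qed
qed

lemma mpoly_eval_hom:
  assumes "cring S" "h \<in> ring_hom R S" "y \<in> V \<rightarrow> carrier S"
  shows "mpoly_eval R S h y \<in> ring_hom (mpoly R V) S"
proof (rule ring_hom_memI)
  interpret S: cring S by fact
  interpret h: ring_hom_cring R S h by unfold_locales fact
  note cl = mpoly_eval_closed[OF assms] and ad = mpoly_eval_add[OF assms] and mo = mpoly_eval_mono[OF assms]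
  fix P assume P: "P \<in> carrier (mpoly R V)"
  show "mpoly_eval R S h y P \<in> carrier S" by (rule cl[OF P])
  fix Q assume Q: "Q \<in> carrier (mpoly R V)"
  show "mpoly_eval R S h y (P \<oplus>\<^bsub>mpoly R V\<^esub> Q) = mpoly_eval R S h y P \<oplus>\<^bsub>S\<^esub> mpoly_eval R S h y Q"
    by (rule ad[OF P Q])
  show "mpoly_eval R S h y (P \<otimes>\<^bsub>mpoly R V\<^esub> Q) = mpoly_eval R S h y P \<otimes>\<^bsub>S\<^esub> mpoly_eval R S h y Q"
    using P
  proof (induction rule: mpoly_induct)
    case P: (mono c m)
    show ?case using Q
    proof (induction rule: mpoly_induct)
      case (mono d n)
      have "mset_pow S y m \<in> carrier S" "mset_pow S y n \<in> carrier S"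
        using P mono assms by (auto intro!: S.mset_pow_closed)
      then show ?case using P mono
        by (simp add: mono_mult mo S.mset_pow_add[OF assms(3)] S.m_ac)
    next
      case (add Q1 Q2)
      then show ?case
        using mpoly_distrib(2)[OF add(1,2) mono_closed[OF P]] mpoly_mult_closed[OF mono_closed[OF P]]
          cl[OF mono_closed[OF P]] by (simp add: ad cl S.r_distr)
    qed
  next
    case (add P1 P2)
    then show ?case
      using mpoly_distrib(1)[OF add(1,2) Q] mpoly_mult_closed[OF _ Q] cl[OF Q] by (simp add: ad cl S.l_distr)
  qed
next
  interpret S: cring S by fact
  interpret h: ring_hom_cring R S h by unfold_locales fact
  show "mpoly_eval R S h y \<one>\<^bsub>mpoly R V\<^esub> = \<one>\<^bsub>S\<^esub>"
    unfolding mpoly_one using mpoly_eval_mono[OF assms, of \<one> "{#}"] by simp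
qed

lemma mpoly_eval_const:
  assumes "cring S" "h \<in> ring_hom R S" "c \<in> carrier R"
  shows "mpoly_eval R S h y (indexed_const c) = h c"
proof -
  interpret S: cring S by fact
  show ?thesis
    using mpoly_eval_mono[OF assms(1,2), of y "{}" c "{#}"] assms(3) ring_hom_closed[OF assms(2,3)]
    by (simp add: indexed_const_mono)
qed

lemma mpoly_eval_var:
  assumes "cring S" "h \<in> ring_hom R S" "y v \<in> carrier S"
  shows "mpoly_eval R S h y (indexed_var v) = y v"
proof -
  interpret S: cring S by fact
  show ?thesis
    using mpoly_eval_mono[OF assms(1,2), of y "{v}" \<one> "{#v#}"] assms(3) ring_hom_one[OF assms(2)]
    by (simp add: indexed_var_mono S.mset_pow_single)
qed

text \<open>Identities between composites of evaluations are proved below by this comparison on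
  constants and variables.\<close>

lemma mpoly_hom_unique:
  assumes "ring S" "f \<in> ring_hom (mpoly R V) S" "g \<in> ring_hom (mpoly R V) S"
    and const: "\<And>c. c \<in> carrier R \<Longrightarrow> f (indexed_const c) = g (indexed_const c)"
    and var: "\<And>v. v \<in> V \<Longrightarrow> f (indexed_var v) = g (indexed_var v)"
    and P: "P \<in> carrier (mpoly R V)"
  shows "f P = g P"
  using P
proof (induction rule: mpoly_induct)
  case (mono c m)
  then show ?case
  proof (induction m)
    case empty then show ?case using const by (simp add: indexed_const_mono)
  next
    case (add v m)
    have "mmono R c (add_mset v m) = mmono R c m \<otimes>\<^bsub>mpoly R V\<^esub> indexed_var v"
      using add by (simp add: indexed_var_mono mono_mult)
    moreover have "mmono R c m \<in> carrier (mpoly R V)" "indexed_var v \<in> carrier (mpoly R V)"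
      using add mono_closed var_closed by auto
    ultimately show ?case
      using ring_hom_mult[OF assms(2)] ring_hom_mult[OF assms(3)] add var by simp
  qed
next
  case (add P Q)
  then show ?case using ring_hom_add[OF assms(2)] ring_hom_add[OF assms(3)] by simp
qed

lemma mpoly_algebra:
  assumes "algebra A R"
  shows "algebra A (mpoly R V)"
proof -
  interpret A: algebra A R by fact
  interpret M: cring "mpoly R V" by (rule mpoly_cring)
  have smult: "a \<odot>\<^bsub>mpoly R V\<^esub> P = mmono R (a \<odot> \<one>) {#} \<otimes>\<^bsub>mpoly R V\<^esub> P"
    if "a \<in> carrier A" "P \<in> carrier (mpoly R V)" for a P
  proof -
    have "a \<odot> P m = (a \<odot> \<one>) \<otimes> P m" for m
      using that mpoly_carrierD(2)[OF that(2)] A.smult_assoc2[of a \<one> "P m"] by simp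
    then show ?thesis using that by (subst const_mult) (auto simp: mpoly_def)
  qed
  have c: "mmono R (a \<odot> \<one>) {#} \<in> carrier (mpoly R V)" if "a \<in> carrier A" for a
    using that by (intro mono_closed) auto
  show ?thesis
  proof (rule algebraI)
    fix a b P Q assume ab: "a \<in> carrier A" "b \<in> carrier A"
      and PQ: "P \<in> carrier (mpoly R V)" "Q \<in> carrier (mpoly R V)"
    show "a \<odot>\<^bsub>mpoly R V\<^esub> P \<in> carrier (mpoly R V)" using smult ab PQ c by simp
    show "a \<odot>\<^bsub>mpoly R V\<^esub> (P \<oplus>\<^bsub>mpoly R V\<^esub> Q) = a \<odot>\<^bsub>mpoly R V\<^esub> P \<oplus>\<^bsub>mpoly R V\<^esub> a \<odot>\<^bsub>mpoly R V\<^esub> Q"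
      using smult ab PQ c by (simp add: M.r_distr)
    show "(a \<odot>\<^bsub>mpoly R V\<^esub> P) \<otimes>\<^bsub>mpoly R V\<^esub> Q = a \<odot>\<^bsub>mpoly R V\<^esub> (P \<otimes>\<^bsub>mpoly R V\<^esub> Q)"
      using smult ab PQ c by (simp add: M.m_assoc)
    show "(a \<oplus>\<^bsub>A\<^esub> b) \<odot>\<^bsub>mpoly R V\<^esub> P = a \<odot>\<^bsub>mpoly R V\<^esub> P \<oplus>\<^bsub>mpoly R V\<^esub> b \<odot>\<^bsub>mpoly R V\<^esub> P"
      unfolding mpoly_add using ab mpoly_carrierD(2)[OF PQ(1)] by (simp add: mpoly_def A.smult_l_distr)
    show "(a \<otimes>\<^bsub>A\<^esub> b) \<odot>\<^bsub>mpoly R V\<^esub> P = a \<odot>\<^bsub>mpoly R V\<^esub> (b \<odot>\<^bsub>mpoly R V\<^esub> P)"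
      using ab mpoly_carrierD(2)[OF PQ(1)] by (simp add: mpoly_def A.smult_assoc1)
  next
    fix P assume "P \<in> carrier (mpoly R V)"
    then show "\<one>\<^bsub>A\<^esub> \<odot>\<^bsub>mpoly R V\<^esub> P = P" using mpoly_carrierD(2)[of P V] by (simp add: mpoly_def)
  qed (use A.R_cring mpoly_cring in auto)
qed

lemma mpoly_map_hom:
  fixes S :: "('a, 's) module"
  assumes "cring S" "g \<in> ring_hom R S"
  shows "(\<lambda>P m. g (P m)) \<in> ring_hom (mpoly R V) (mpoly S V)"
proof -
  interpret S: mpoly_base S unfolding mpoly_base_def by fact
  interpret h: ring_hom_cring R S g by unfold_locales fact
  have mono: "(\<lambda>k. g (mmono R c m k)) = mmono S (g c) m" for c m
    unfolding mmono_def by (auto simp: fun_eq_iff)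
  have cl: "(\<lambda>m. g (P m)) \<in> carrier (mpoly S V)" if "P \<in> carrier (mpoly R V)" for P
    using that
  proof (induction rule: mpoly_induct)
    case (mono c m) then show ?case by (simp add: \<open>(\<lambda>k. g (mmono R c m k)) = mmono S (g c) m\<close> S.mono_closed)
  next
    case (add P Q)
    have "(\<lambda>m. g ((P \<oplus>\<^bsub>mpoly R V\<^esub> Q) m)) = (\<lambda>m. g (P m)) \<oplus>\<^bsub>mpoly S V\<^esub> (\<lambda>m. g (Q m))"
      using mpoly_carrierD(2)[OF add(1)] mpoly_carrierD(2)[OF add(2)] by (simp add: mpoly_add S.mpoly_add)
    then show ?case using add S.mpoly_add_closed by simp
  qed
  show ?thesis
  proof (rule ring_hom_memI)
    fix P Q assume PQ: "P \<in> carrier (mpoly R V)" "Q \<in> carrier (mpoly R V)"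
    note c = mpoly_carrierD(2)[OF PQ(1)] mpoly_carrierD(2)[OF PQ(2)]
    show "(\<lambda>m. g ((P \<oplus>\<^bsub>mpoly R V\<^esub> Q) m)) = (\<lambda>m. g (P m)) \<oplus>\<^bsub>mpoly S V\<^esub> (\<lambda>m. g (Q m))"
      using c by (simp add: mpoly_add S.mpoly_add)
    show "(\<lambda>m. g ((P \<otimes>\<^bsub>mpoly R V\<^esub> Q) m)) = (\<lambda>m. g (P m)) \<otimes>\<^bsub>mpoly S V\<^esub> (\<lambda>m. g (Q m))"
      using c by (intro ext) (simp add: mpoly_mult S.mpoly_mult comp_def Pi_def)
  qed (auto simp: cl mpoly_one S.mpoly_one mono)
qed

end

text \<open>A linear order on the variables induces one on monomials that is compatible with
  addition of multisets. In a product the sum \<open>m + n\<close> of the leading monomials arises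
  only from \<open>m\<close> and \<open>n\<close>, so its coefficient is the product of the leading
  coefficients.\<close>

lemma mpoly_domain:
  fixes R :: "('a, 'r) module" and V :: "'v::linorder set"
  assumes "domain R"
  shows "domain (mpoly R V)"
proof -
  interpret R: domain R by fact
  interpret B: mpoly_base R by unfold_locales
  interpret M: cring "mpoly R V" by (rule B.mpoly_cring)
  have lead: "\<exists>m. P m \<noteq> \<zero>\<^bsub>R\<^esub> \<and> (\<forall>m'. P m' \<noteq> \<zero>\<^bsub>R\<^esub> \<longrightarrow> m' \<le> m)"
    if P: "P \<in> carrier (mpoly R V)" "P \<noteq> \<zero>\<^bsub>mpoly R V\<^esub>" for P
  proof -
    have fin: "finite {m. P m \<noteq> \<zero>\<^bsub>R\<^esub>}" "{m. P m \<noteq> \<zero>\<^bsub>R\<^esub>} \<noteq> {}"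
      using B.mpoly_carrierD(1)[OF P(1)] P(2) unfolding B.mpoly_zero by auto
    show ?thesis using Max_in[OF fin] Max_ge[OF fin(1)] by blast
  qed
  show ?thesis
  proof (rule domainI[OF M.is_cring])
    show "\<one>\<^bsub>mpoly R V\<^esub> \<noteq> \<zero>\<^bsub>mpoly R V\<^esub>"
      unfolding B.mpoly_one B.mpoly_zero mmono_def by (auto simp: fun_eq_iff)
    fix P Q assume PQ: "P \<otimes>\<^bsub>mpoly R V\<^esub> Q = \<zero>\<^bsub>mpoly R V\<^esub>" "P \<in> carrier (mpoly R V)" "Q \<in> carrier (mpoly R V)"
    note c = B.mpoly_carrierD(2)[OF PQ(2)] B.mpoly_carrierD(2)[OF PQ(3)]
    show "P = \<zero>\<^bsub>mpoly R V\<^esub> \<or> Q = \<zero>\<^bsub>mpoly R V\<^esub>"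
    proof (rule ccontr)
      assume "\<not> ?thesis"
      then obtain m n where m: "P m \<noteq> \<zero>\<^bsub>R\<^esub>" "\<And>m'. P m' \<noteq> \<zero>\<^bsub>R\<^esub> \<Longrightarrow> m' \<le> m"
        and n: "Q n \<noteq> \<zero>\<^bsub>R\<^esub>" "\<And>m'. Q m' \<noteq> \<zero>\<^bsub>R\<^esub> \<Longrightarrow> m' \<le> n"
        using lead[OF PQ(2)] lead[OF PQ(3)] by blast
      have "P m' \<otimes>\<^bsub>R\<^esub> Q (m + n - m') = (if m = m' then P m' \<otimes>\<^bsub>R\<^esub> Q (m + n - m') else \<zero>\<^bsub>R\<^esub>)" if "m' \<subseteq># m + n" for m'
      proof -
        have "P m' = \<zero>\<^bsub>R\<^esub> \<or> Q (m + n - m') = \<zero>\<^bsub>R\<^esub>" if "m \<noteq> m'"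
        proof (rule ccontr)
          assume nz: "\<not> ?thesis"
          then have "m' < m" using m(2)[of m'] that by auto
          moreover have "m + n - m' \<le> n" using n(2) nz by blast
          ultimately have "m' + (m + n - m') < m + n" by (rule add_less_le_mono)
          then show False using \<open>m' \<subseteq># m + n\<close> by (simp add: subset_mset.add_diff_inverse)
        qed
        then show ?thesis using c by auto
      qed
      then have "(P \<otimes>\<^bsub>mpoly R V\<^esub> Q) (m + n) =
          (\<Oplus>\<^bsub>R\<^esub>m'\<in>{m'. m' \<subseteq># m + n}. if m = m' then P m' \<otimes>\<^bsub>R\<^esub> Q (m + n - m') else \<zero>\<^bsub>R\<^esub>)"
        unfolding B.mpoly_mult using c by (intro R.finsum_cong') auto
      also have "\<dots> = P m \<otimes>\<^bsub>R\<^esub> Q n"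
        using R.finsum_singleton[of m "{m'. m' \<subseteq># m + n}" "\<lambda>m'. P m' \<otimes>\<^bsub>R\<^esub> Q (m + n - m')"]
          finite_submultisets[of "m + n"] c by simp
      finally show False using PQ(1) m(1) n(1) c R.integral unfolding B.mpoly_zero by metis
    qed
  qed
qed

subsection \<open>Linear dependence\<close>

text \<open>Gaussian elimination. A vector with nonzero last coordinate serves as pivot: multiples
  of it are subtracted from the others, the induction hypothesis handles the remaining coordinates,
  and the coefficient of the pivot compensates for what was subtracted.\<close>

lemma (in field) linear_dependence:
  assumes "finite I" "card I = Suc l" "\<And>k j. \<lbrakk>k \<in> I; j < l\<rbrakk> \<Longrightarrow> v k j \<in> carrier R"
  shows "\<exists>a. (\<forall>k\<in>I. a k \<in> carrier R) \<and> (\<exists>k\<in>I. a k \<noteq> \<zero>) \<and> (\<forall>j<l. (\<Oplus>k\<in>I. a k \<otimes> v k j) = \<zero>)"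
  using assms
proof (induction l arbitrary: I v)
  case 0
  then obtain k where "I = {k}" by (auto simp: card_1_singleton_iff)
  then show ?case by (intro exI[of _ "\<lambda>_. \<one>"]) auto
next
  case (Suc l)
  show ?case
  proof (cases "\<forall>k\<in>I. v k l = \<zero>")
    case True
    obtain k0 where k0: "k0 \<in> I" using Suc.prems(2) by (metis card.empty equals0I nat.distinct(1))
    let ?I = "I - {k0}"
    have "finite ?I" "card ?I = Suc l" using Suc.prems k0 by auto
    moreover have "v k j \<in> carrier R" if "k \<in> ?I" "j < l" for k j using Suc.prems(3)[of k j] that by auto
    ultimately obtain a where a: "\<forall>k\<in>?I. a k \<in> carrier R" "\<exists>k\<in>?I. a k \<noteq> \<zero>" "\<forall>j<l. (\<Oplus>k\<in>?I. a k \<otimes> v k j) = \<zero>"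
      using Suc.IH[of ?I v] by blast
    define b where "b = a(k0 := \<zero>)"
    have b: "\<forall>k\<in>I. b k \<in> carrier R" "\<exists>k\<in>I. b k \<noteq> \<zero>" using a unfolding b_def by auto
    have "(\<Oplus>k\<in>I. b k \<otimes> v k j) = \<zero>" if j: "j < Suc l" for j
    proof (cases "j = l")
      case True
      have "(\<Oplus>k\<in>I. b k \<otimes> v k j) = (\<Oplus>k\<in>I. \<zero>)"
        using \<open>\<forall>k\<in>I. v k l = \<zero>\<close> b(1) True by (intro finsum_cong') auto
      then show ?thesis by simp
    next
      case False
      then have "j < l" using j by simp
      have "(\<Oplus>k\<in>I. b k \<otimes> v k j) = b k0 \<otimes> v k0 j \<oplus> (\<Oplus>k\<in>?I. b k \<otimes> v k j)"
        using finsum_insert[of ?I k0 "\<lambda>k. b k \<otimes> v k j"] k0 Suc.prems(1) b(1) Suc.prems(3)[OF _ j]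
        by (auto simp: insert_absorb)
      also have "(\<Oplus>k\<in>?I. b k \<otimes> v k j) = (\<Oplus>k\<in>?I. a k \<otimes> v k j)"
        using a(1) Suc.prems(3)[OF _ j] by (intro finsum_cong') (auto simp: b_def)
      also have "\<dots> = \<zero>" using a(3) \<open>j < l\<close> by blast
      finally show ?thesis using Suc.prems(3)[OF k0 j] by (simp add: b_def)
    qed
    then show ?thesis using b by blast
  next
    case False
    then obtain k0 where k0: "k0 \<in> I" "v k0 l \<noteq> \<zero>" by blast
    let ?I = "I - {k0}"
    define p where "p = inv (v k0 l)"
    have vc: "v k j \<in> carrier R" if "k \<in> I" "j < Suc l" for k j using Suc.prems(3) that by auto
    have p: "p \<in> carrier R" "p \<otimes> v k0 l = \<one>"
      unfolding p_def using k0 vc[of k0 l] field_Units Units_inv_closed Units_l_inv by auto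
    define w where "w = (\<lambda>k j. v k j \<ominus> v k l \<otimes> p \<otimes> v k0 j)"
    have wc: "w k j \<in> carrier R" if "k \<in> I" "j < Suc l" for k j
      unfolding w_def using vc that p k0 by auto
    have "finite ?I" "card ?I = Suc l" using Suc.prems k0 by auto
    moreover have "w k j \<in> carrier R" if "k \<in> ?I" "j < l" for k j using wc that by auto
    ultimately obtain a where a: "\<forall>k\<in>?I. a k \<in> carrier R" "\<exists>k\<in>?I. a k \<noteq> \<zero>" "\<forall>j<l. (\<Oplus>k\<in>?I. a k \<otimes> w k j) = \<zero>"
      using Suc.IH[of ?I w] by blast
    define c where "c = (\<Oplus>k\<in>?I. a k \<otimes> (v k l \<otimes> p))"
    have cc: "c \<in> carrier R" unfolding c_def using a(1) vc p by (intro finsum_closed) auto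
    define b where "b = a(k0 := \<ominus> c)"
    have b: "\<forall>k\<in>I. b k \<in> carrier R" "\<exists>k\<in>I. b k \<noteq> \<zero>" using a cc unfolding b_def by auto
    have "(\<Oplus>k\<in>I. b k \<otimes> v k j) = \<zero>" if j: "j < Suc l" for j
    proof -
      have w0: "(\<Oplus>k\<in>?I. a k \<otimes> w k j) = \<zero>"
      proof (cases "j = l")
        case True
        have "w k l = \<zero>" if "k \<in> I" for k
          unfolding w_def using vc[OF that, of l] vc[OF k0(1), of l] p by (simp add: m_assoc)
        then have "(\<Oplus>k\<in>?I. a k \<otimes> w k j) = (\<Oplus>k\<in>?I. \<zero>)" using a(1) True by (intro finsum_cong') auto
        then show ?thesis by simp
      qed (use a(3) j in auto)
      have "(\<Oplus>k\<in>?I. a k \<otimes> v k j) = (\<Oplus>k\<in>?I. a k \<otimes> w k j \<oplus> a k \<otimes> (v k l \<otimes> p) \<otimes> v k0 j)"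
      proof (rule finsum_cong')
        fix k assume k: "k \<in> ?I"
        have c: "a k \<in> carrier R" "v k j \<in> carrier R" "v k l \<in> carrier R" "v k0 j \<in> carrier R"
          using k a(1) vc j k0 by auto
        have "v k j = w k j \<oplus> (v k l \<otimes> p) \<otimes> v k0 j" unfolding w_def
          using c p by (simp add: minus_eq a_assoc l_neg)
        then show "a k \<otimes> v k j = a k \<otimes> w k j \<oplus> a k \<otimes> (v k l \<otimes> p) \<otimes> v k0 j"
          using c p wc[of k j] k j by (simp add: r_distr m_assoc)
      qed (use a(1) vc wc p j k0 in auto)
      also have "\<dots> = (\<Oplus>k\<in>?I. a k \<otimes> w k j) \<oplus> (\<Oplus>k\<in>?I. a k \<otimes> (v k l \<otimes> p) \<otimes> v k0 j)"
        using a(1) vc wc p j k0 by (intro finsum_addf) auto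
      also have "(\<Oplus>k\<in>?I. a k \<otimes> (v k l \<otimes> p) \<otimes> v k0 j) = c \<otimes> v k0 j"
        unfolding c_def using a(1) vc p j k0 Suc.prems(1) by (intro finsum_ldistr[symmetric]) auto
      finally have s: "(\<Oplus>k\<in>?I. a k \<otimes> v k j) = c \<otimes> v k0 j" using w0 cc vc[OF k0(1) j] by simp
      have "(\<Oplus>k\<in>I. b k \<otimes> v k j) = b k0 \<otimes> v k0 j \<oplus> (\<Oplus>k\<in>?I. b k \<otimes> v k j)"
        using finsum_insert[of ?I k0 "\<lambda>k. b k \<otimes> v k j"] k0 Suc.prems(1) b(1) vc[OF _ j]
        by (auto simp: insert_absorb)
      also have "(\<Oplus>k\<in>?I. b k \<otimes> v k j) = (\<Oplus>k\<in>?I. a k \<otimes> v k j)"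
        using a(1) vc[OF _ j] by (intro finsum_cong') (auto simp: b_def)
      finally show ?thesis unfolding s using cc vc[OF k0(1) j] by (simp add: b_def l_minus l_neg)
    qed
    then show ?thesis using b by blast
  qed
qed

lemma (in module) finsum_smult_scalar:
  assumes "finite I" "f \<in> I \<rightarrow> carrier R" "x \<in> carrier M"
  shows "(\<Oplus>i\<in>I. f i) \<odot>\<^bsub>M\<^esub> x = (\<Oplus>\<^bsub>M\<^esub>i\<in>I. f i \<odot>\<^bsub>M\<^esub> x)"
  using assms(1,2)
proof (induction I rule: finite_induct)
  case (insert i I)
  then have "f \<in> I \<rightarrow> carrier R" "f i \<in> carrier R" by auto
  moreover have "(\<lambda>i. f i \<odot>\<^bsub>M\<^esub> x) \<in> I \<rightarrow> carrier M" using insert assms(3) by auto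
  ultimately show ?case using insert assms(3) by (simp add: smult_l_distr)
qed (use assms(3) in simp)

lemma (in module) finsum_smult:
  assumes "finite I" "f \<in> I \<rightarrow> carrier M" "a \<in> carrier R"
  shows "a \<odot>\<^bsub>M\<^esub> (\<Oplus>\<^bsub>M\<^esub>i\<in>I. f i) = (\<Oplus>\<^bsub>M\<^esub>i\<in>I. a \<odot>\<^bsub>M\<^esub> f i)"
  using assms(1,2)
proof (induction I rule: finite_induct)
  case (insert i I)
  then have "f \<in> I \<rightarrow> carrier M" "f i \<in> carrier M" by auto
  moreover have "(\<lambda>i. a \<odot>\<^bsub>M\<^esub> f i) \<in> I \<rightarrow> carrier M" using insert assms(3) by auto
  ultimately show ?case using insert assms(3) by (simp add: smult_r_distr)
qed (use assms(3) in simp)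

subsection \<open>The finite-dimensional algebra\<close>

locale op_data =
  fixes \<D> :: "('a, 'd, 'b) operator_data"
  assumes op: "operator_data \<D>"
begin

abbreviation "len \<equiv> {..<Len \<D>}"
abbreviation "cd \<equiv> eps_coord \<D>"
abbreviation "res i \<equiv> residue_map (Base \<D>) (Factor \<D> i)"

lemma fieldA: "field (Base \<D>)" and algA: "algebra (Base \<D>) (Alg \<D>)"
  and basisA: "is_basis (Base \<D>) (Alg \<D>) (Len \<D>) (Eps \<D>)" and len_pos: "0 < Len \<D>"
  using op unfolding operator_data_def by auto

sublocale A: field "Base \<D>" by (rule fieldA)
sublocale DM: cring "Alg \<D>" by (rule algebra.M_cring[OF algA])
sublocale DA: algebra "Base \<D>" "Alg \<D>" by (rule algA)

lemma eps_closed: "j < Len \<D> \<Longrightarrow> Eps \<D> j \<in> carrier (Alg \<D>)"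
  using basisA unfolding is_basis_def by blast

lemma coord_ex1:
  assumes "x \<in> carrier (Alg \<D>)"
  shows "\<exists>!c. c \<in> len \<rightarrow>\<^sub>E carrier (Base \<D>) \<and> x = (\<Oplus>\<^bsub>Alg \<D>\<^esub>j\<in>len. c j \<odot>\<^bsub>Alg \<D>\<^esub> Eps \<D> j)"
  using basisA assms unfolding is_basis_def by blast

lemma coord:
  assumes "x \<in> carrier (Alg \<D>)"
  shows "cd x \<in> len \<rightarrow>\<^sub>E carrier (Base \<D>)" "x = (\<Oplus>\<^bsub>Alg \<D>\<^esub>j\<in>len. cd x j \<odot>\<^bsub>Alg \<D>\<^esub> Eps \<D> j)"
  using theI'[OF coord_ex1[OF assms]] unfolding eps_coord_def coordinates_def by auto

lemma coord_closed: "\<lbrakk>x \<in> carrier (Alg \<D>); j < Len \<D>\<rbrakk> \<Longrightarrow> cd x j \<in> carrier (Base \<D>)"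
  using coord(1) by (blast dest: PiE_mem)

lemma coord_unique:
  assumes "\<And>j. j < Len \<D> \<Longrightarrow> c j \<in> carrier (Base \<D>)"
    and "x = (\<Oplus>\<^bsub>Alg \<D>\<^esub>j\<in>len. c j \<odot>\<^bsub>Alg \<D>\<^esub> Eps \<D> j)" and "k < Len \<D>"
  shows "cd x k = c k"
proof -
  have x: "x \<in> carrier (Alg \<D>)"
    unfolding assms(2) using assms(1) eps_closed by (intro DM.finsum_closed) auto
  let ?c = "restrict c len"
  have "?c \<in> len \<rightarrow>\<^sub>E carrier (Base \<D>)" using assms(1) by auto
  moreover have "x = (\<Oplus>\<^bsub>Alg \<D>\<^esub>j\<in>len. ?c j \<odot>\<^bsub>Alg \<D>\<^esub> Eps \<D> j)"
    unfolding assms(2) using assms(1) eps_closed by (intro DM.finsum_cong') auto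
  ultimately have "cd x = ?c"
    unfolding eps_coord_def coordinates_def by (intro the1_equality[OF coord_ex1[OF x]] conjI)
  then show ?thesis using assms(3) by simp
qed

lemma coord_add:
  assumes "x \<in> carrier (Alg \<D>)" "y \<in> carrier (Alg \<D>)" "k < Len \<D>"
  shows "cd (x \<oplus>\<^bsub>Alg \<D>\<^esub> y) k = cd x k \<oplus>\<^bsub>Base \<D>\<^esub> cd y k"
proof (rule coord_unique[OF _ _ assms(3)])
  show "x \<oplus>\<^bsub>Alg \<D>\<^esub> y = (\<Oplus>\<^bsub>Alg \<D>\<^esub>j\<in>len. (cd x j \<oplus>\<^bsub>Base \<D>\<^esub> cd y j) \<odot>\<^bsub>Alg \<D>\<^esub> Eps \<D> j)"
  proof -
    have "(\<Oplus>\<^bsub>Alg \<D>\<^esub>j\<in>len. (cd x j \<oplus>\<^bsub>Base \<D>\<^esub> cd y j) \<odot>\<^bsub>Alg \<D>\<^esub> Eps \<D> j) =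
      (\<Oplus>\<^bsub>Alg \<D>\<^esub>j\<in>len. cd x j \<odot>\<^bsub>Alg \<D>\<^esub> Eps \<D> j \<oplus>\<^bsub>Alg \<D>\<^esub> cd y j \<odot>\<^bsub>Alg \<D>\<^esub> Eps \<D> j)"
      using assms coord_closed eps_closed
      by (intro DM.finsum_cong') (auto simp: DA.smult_l_distr)
    also have "\<dots> = (\<Oplus>\<^bsub>Alg \<D>\<^esub>j\<in>len. cd x j \<odot>\<^bsub>Alg \<D>\<^esub> Eps \<D> j) \<oplus>\<^bsub>Alg \<D>\<^esub> (\<Oplus>\<^bsub>Alg \<D>\<^esub>j\<in>len. cd y j \<odot>\<^bsub>Alg \<D>\<^esub> Eps \<D> j)"
      using assms coord_closed eps_closed by (intro DM.finsum_addf) auto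
    finally show ?thesis using coord(2)[OF assms(1)] coord(2)[OF assms(2)] by simp
  qed
qed (use assms coord_closed in auto)

lemma coord_smult:
  assumes "x \<in> carrier (Alg \<D>)" "a \<in> carrier (Base \<D>)" "k < Len \<D>"
  shows "cd (a \<odot>\<^bsub>Alg \<D>\<^esub> x) k = a \<otimes>\<^bsub>Base \<D>\<^esub> cd x k"
proof (rule coord_unique[OF _ _ assms(3)])
  have "a \<odot>\<^bsub>Alg \<D>\<^esub> (\<Oplus>\<^bsub>Alg \<D>\<^esub>j\<in>len. cd x j \<odot>\<^bsub>Alg \<D>\<^esub> Eps \<D> j) = (\<Oplus>\<^bsub>Alg \<D>\<^esub>j\<in>len. a \<odot>\<^bsub>Alg \<D>\<^esub> (cd x j \<odot>\<^bsub>Alg \<D>\<^esub> Eps \<D> j))"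
    using assms coord_closed eps_closed by (intro DA.finsum_smult) auto
  also have "\<dots> = (\<Oplus>\<^bsub>Alg \<D>\<^esub>j\<in>len. (a \<otimes>\<^bsub>Base \<D>\<^esub> cd x j) \<odot>\<^bsub>Alg \<D>\<^esub> Eps \<D> j)"
    using assms coord_closed eps_closed by (intro DM.finsum_cong') (auto simp: DA.smult_assoc1)
  finally show "a \<odot>\<^bsub>Alg \<D>\<^esub> x = (\<Oplus>\<^bsub>Alg \<D>\<^esub>j\<in>len. (a \<otimes>\<^bsub>Base \<D>\<^esub> cd x j) \<odot>\<^bsub>Alg \<D>\<^esub> Eps \<D> j)"
    using coord(2)[OF assms(1)] by simp
qed (use assms coord_closed in auto)

lemma coord_zero: "k < Len \<D> \<Longrightarrow> cd \<zero>\<^bsub>Alg \<D>\<^esub> k = \<zero>\<^bsub>Base \<D>\<^esub>"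
  using coord_smult[of "\<zero>\<^bsub>Alg \<D>\<^esub>" "\<zero>\<^bsub>Base \<D>\<^esub>" k] coord_closed[of "\<zero>\<^bsub>Alg \<D>\<^esub>" k] by simp

lemma coord_finsum:
  assumes "finite I" "f \<in> I \<rightarrow> carrier (Alg \<D>)" "k < Len \<D>"
  shows "cd (\<Oplus>\<^bsub>Alg \<D>\<^esub>i\<in>I. f i) k = (\<Oplus>\<^bsub>Base \<D>\<^esub>i\<in>I. cd (f i) k)"
  using assms(1,2)
proof (induction I rule: finite_induct)
  case (insert i I)
  then have *: "f \<in> I \<rightarrow> carrier (Alg \<D>)" "f i \<in> carrier (Alg \<D>)" by auto
  then have "(\<lambda>i. cd (f i) k) \<in> I \<rightarrow> carrier (Base \<D>)" using coord_closed assms(3) by auto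
  then show ?case using insert * coord_add[OF *(2) _ assms(3)] coord_closed[OF *(2) assms(3)]
    DM.finsum_closed[OF *(1)] by simp
qed (use assms(3) coord_zero in simp)

lemma coord_eps: "\<lbrakk>j < Len \<D>; k < Len \<D>\<rbrakk> \<Longrightarrow>
    cd (Eps \<D> j) k = (if k = j then \<one>\<^bsub>Base \<D>\<^esub> else \<zero>\<^bsub>Base \<D>\<^esub>)"
proof (rule coord_unique)
  assume j: "j < Len \<D>"
  have "(\<Oplus>\<^bsub>Alg \<D>\<^esub>k\<in>len. (if k = j then \<one>\<^bsub>Base \<D>\<^esub> else \<zero>\<^bsub>Base \<D>\<^esub>) \<odot>\<^bsub>Alg \<D>\<^esub> Eps \<D> k) =
    (\<Oplus>\<^bsub>Alg \<D>\<^esub>k\<in>len. if j = k then Eps \<D> k else \<zero>\<^bsub>Alg \<D>\<^esub>)"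
    using eps_closed by (intro DM.finsum_cong') auto
  also have "\<dots> = Eps \<D> j" using j eps_closed by (intro DM.finsum_singleton) auto
  finally show "Eps \<D> j = (\<Oplus>\<^bsub>Alg \<D>\<^esub>k\<in>len. (if k = j then \<one>\<^bsub>Base \<D>\<^esub> else \<zero>\<^bsub>Base \<D>\<^esub>) \<odot>\<^bsub>Alg \<D>\<^esub> Eps \<D> k)"
    by simp
qed auto

lemma coord_mult:
  assumes x: "x \<in> carrier (Alg \<D>)" and y: "y \<in> carrier (Alg \<D>)" and k: "k < Len \<D>"
  shows "cd (x \<otimes>\<^bsub>Alg \<D>\<^esub> y) k = (\<Oplus>\<^bsub>Base \<D>\<^esub>i\<in>len. \<Oplus>\<^bsub>Base \<D>\<^esub>j\<in>len.
    cd (Eps \<D> i \<otimes>\<^bsub>Alg \<D>\<^esub> Eps \<D> j) k \<otimes>\<^bsub>Base \<D>\<^esub> (cd x i \<otimes>\<^bsub>Base \<D>\<^esub> cd y j))"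
proof -
  let ?t = "\<lambda>i j. (cd x i \<otimes>\<^bsub>Base \<D>\<^esub> cd y j) \<odot>\<^bsub>Alg \<D>\<^esub> (Eps \<D> i \<otimes>\<^bsub>Alg \<D>\<^esub> Eps \<D> j)"
  note c = coord_closed[OF x] coord_closed[OF y] eps_closed
  have tc: "?t i j \<in> carrier (Alg \<D>)" if "i < Len \<D>" "j < Len \<D>" for i j using c that by auto
  have t: "(cd x i \<odot>\<^bsub>Alg \<D>\<^esub> Eps \<D> i) \<otimes>\<^bsub>Alg \<D>\<^esub> (cd y j \<odot>\<^bsub>Alg \<D>\<^esub> Eps \<D> j) = ?t i j"
    if "i < Len \<D>" "j < Len \<D>" for i j
  proof -
    have "(cd x i \<odot>\<^bsub>Alg \<D>\<^esub> Eps \<D> i) \<otimes>\<^bsub>Alg \<D>\<^esub> (cd y j \<odot>\<^bsub>Alg \<D>\<^esub> Eps \<D> j) =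
        cd x i \<odot>\<^bsub>Alg \<D>\<^esub> ((cd y j \<odot>\<^bsub>Alg \<D>\<^esub> Eps \<D> j) \<otimes>\<^bsub>Alg \<D>\<^esub> Eps \<D> i)"
      using c that by (simp add: DA.smult_assoc2 DM.m_comm)
    also have "\<dots> = ?t i j" using c that
      by (simp add: DA.smult_assoc2 DA.smult_assoc1 DM.m_comm[of "Eps \<D> j" "Eps \<D> i"])
    finally show ?thesis .
  qed
  have "x \<otimes>\<^bsub>Alg \<D>\<^esub> y = (\<Oplus>\<^bsub>Alg \<D>\<^esub>i\<in>len. cd x i \<odot>\<^bsub>Alg \<D>\<^esub> Eps \<D> i) \<otimes>\<^bsub>Alg \<D>\<^esub> y"
    using coord(2)[OF x] by simp
  also have "\<dots> = (\<Oplus>\<^bsub>Alg \<D>\<^esub>i\<in>len. (cd x i \<odot>\<^bsub>Alg \<D>\<^esub> Eps \<D> i) \<otimes>\<^bsub>Alg \<D>\<^esub> y)"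
    using c y by (intro DM.finsum_ldistr) auto
  also have "\<dots> = (\<Oplus>\<^bsub>Alg \<D>\<^esub>i\<in>len. \<Oplus>\<^bsub>Alg \<D>\<^esub>j\<in>len. ?t i j)"
  proof (rule DM.finsum_cong')
    fix i assume i: "i \<in> len"
    have "(cd x i \<odot>\<^bsub>Alg \<D>\<^esub> Eps \<D> i) \<otimes>\<^bsub>Alg \<D>\<^esub> y =
      (cd x i \<odot>\<^bsub>Alg \<D>\<^esub> Eps \<D> i) \<otimes>\<^bsub>Alg \<D>\<^esub> (\<Oplus>\<^bsub>Alg \<D>\<^esub>j\<in>len. cd y j \<odot>\<^bsub>Alg \<D>\<^esub> Eps \<D> j)"
      using coord(2)[OF y] by simp
    also have "\<dots> = (\<Oplus>\<^bsub>Alg \<D>\<^esub>j\<in>len. (cd x i \<odot>\<^bsub>Alg \<D>\<^esub> Eps \<D> i) \<otimes>\<^bsub>Alg \<D>\<^esub> (cd y j \<odot>\<^bsub>Alg \<D>\<^esub> Eps \<D> j))"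
      using c i by (intro DM.finsum_rdistr) auto
    also have "\<dots> = (\<Oplus>\<^bsub>Alg \<D>\<^esub>j\<in>len. ?t i j)"
      using t tc i by (intro DM.finsum_cong') auto
    finally show "(cd x i \<odot>\<^bsub>Alg \<D>\<^esub> Eps \<D> i) \<otimes>\<^bsub>Alg \<D>\<^esub> y = (\<Oplus>\<^bsub>Alg \<D>\<^esub>j\<in>len. ?t i j)" .
  qed (use tc in \<open>auto intro!: DM.finsum_closed\<close>)
  finally have "cd (x \<otimes>\<^bsub>Alg \<D>\<^esub> y) k = (\<Oplus>\<^bsub>Base \<D>\<^esub>i\<in>len. cd (\<Oplus>\<^bsub>Alg \<D>\<^esub>j\<in>len. ?t i j) k)"
    using tc k by (auto intro!: coord_finsum DM.finsum_closed)
  also have "\<dots> = (\<Oplus>\<^bsub>Base \<D>\<^esub>i\<in>len. \<Oplus>\<^bsub>Base \<D>\<^esub>j\<in>len.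
    cd (Eps \<D> i \<otimes>\<^bsub>Alg \<D>\<^esub> Eps \<D> j) k \<otimes>\<^bsub>Base \<D>\<^esub> (cd x i \<otimes>\<^bsub>Base \<D>\<^esub> cd y j))"
  proof (rule A.finsum_cong')
    fix i assume i: "i \<in> len"
    have "cd (\<Oplus>\<^bsub>Alg \<D>\<^esub>j\<in>len. ?t i j) k = (\<Oplus>\<^bsub>Base \<D>\<^esub>j\<in>len. cd (?t i j) k)"
      using tc i k by (intro coord_finsum) auto
    also have "\<dots> = (\<Oplus>\<^bsub>Base \<D>\<^esub>j\<in>len. cd (Eps \<D> i \<otimes>\<^bsub>Alg \<D>\<^esub> Eps \<D> j) k \<otimes>\<^bsub>Base \<D>\<^esub> (cd x i \<otimes>\<^bsub>Base \<D>\<^esub> cd y j))"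
      using c i k coord_closed by (intro A.finsum_cong') (auto simp: coord_smult A.m_comm)
    finally show "cd (\<Oplus>\<^bsub>Alg \<D>\<^esub>j\<in>len. ?t i j) k = (\<Oplus>\<^bsub>Base \<D>\<^esub>j\<in>len.
      cd (Eps \<D> i \<otimes>\<^bsub>Alg \<D>\<^esub> Eps \<D> j) k \<otimes>\<^bsub>Base \<D>\<^esub> (cd x i \<otimes>\<^bsub>Base \<D>\<^esub> cd y j))" .
  qed (use c k coord_closed in \<open>auto intro!: A.finsum_closed\<close>)
  finally show ?thesis .
qed

lemma coord_eqI:
  assumes "x \<in> carrier (Alg \<D>)" "y \<in> carrier (Alg \<D>)" "\<And>k. k < Len \<D> \<Longrightarrow> cd x k = cd y k"
  shows "x = y"
proof -
  have "cd x = cd y" using coord(1)[OF assms(1)] coord(1)[OF assms(2)] assms(3) by (intro PiE_ext) auto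
  then show ?thesis using coord(2)[OF assms(1)] coord(2)[OF assms(2)] by simp
qed

subsection \<open>The residue maps\<close>

lemma factor:
  assumes "i \<le> Last \<D>"
  shows "algebra (Base \<D>) (Factor \<D> i)" "local_ring (Factor \<D> i)" "residue_field_is_base (Base \<D>) (Factor \<D> i)"
    "Proj \<D> i \<in> algebra_hom (Base \<D>) (Alg \<D>) (Factor \<D> i)"
  using op assms unfolding operator_data_def by auto

lemma max_ideal_maximal:
  assumes "i \<le> Last \<D>"
  shows "maximalideal (max_ideal (Factor \<D> i)) (Factor \<D> i)"
    "maximalideal m (Factor \<D> i) \<Longrightarrow> m = max_ideal (Factor \<D> i)"
proof -
  have ex: "\<exists>!m. maximalideal m (Factor \<D> i)" using factor(2)[OF assms] unfolding local_ring_def by blast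
  then show "maximalideal (max_ideal (Factor \<D> i)) (Factor \<D> i)" unfolding max_ideal_def by (rule theI')
  then show "maximalideal m (Factor \<D> i) \<Longrightarrow> m = max_ideal (Factor \<D> i)" using ex by blast
qed

text \<open>The scalars map bijectively onto the quotient by the maximal ideal, and this map
  respects sums and products. Its inverse after the quotient map is therefore an A-algebra
  homomorphism with the maximal ideal as kernel.\<close>

lemma residue:
  assumes i: "i \<le> Last \<D>"
  shows "\<And>b. b \<in> carrier (Factor \<D> i) \<Longrightarrow> res i b \<in> carrier (Base \<D>)"
    and "\<And>b c. \<lbrakk>b \<in> carrier (Factor \<D> i); c \<in> carrier (Factor \<D> i)\<rbrakk> \<Longrightarrow>
      res i (b \<oplus>\<^bsub>Factor \<D> i\<^esub> c) =
      res i b \<oplus>\<^bsub>Base \<D>\<^esub> res i c"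
    and "\<And>b c. \<lbrakk>b \<in> carrier (Factor \<D> i); c \<in> carrier (Factor \<D> i)\<rbrakk> \<Longrightarrow>
      res i (b \<otimes>\<^bsub>Factor \<D> i\<^esub> c) =
      res i b \<otimes>\<^bsub>Base \<D>\<^esub> res i c"
    and "\<And>a b. \<lbrakk>a \<in> carrier (Base \<D>); b \<in> carrier (Factor \<D> i)\<rbrakk> \<Longrightarrow>
      res i (a \<odot>\<^bsub>Factor \<D> i\<^esub> b) = a \<otimes>\<^bsub>Base \<D>\<^esub> res i b"
    and "res i \<one>\<^bsub>Factor \<D> i\<^esub> = \<one>\<^bsub>Base \<D>\<^esub>"
    and "\<And>b. b \<in> carrier (Factor \<D> i) \<Longrightarrow>
      res i b = \<zero>\<^bsub>Base \<D>\<^esub> \<longleftrightarrow> b \<in> max_ideal (Factor \<D> i)"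
proof -
  define B where "B = Factor \<D> i"
  define m where "m = max_ideal B"
  define r where "r = residue_map (Base \<D>) B"
  define q where "q = (\<lambda>b. m +>\<^bsub>B\<^esub> b)"
  define \<tau> where "\<tau> = to_residue_field B"
  interpret BM: cring B using algebra.M_cring[OF factor(1)[OF i]] unfolding B_def .
  interpret B: algebra "Base \<D>" B using factor(1)[OF i] unfolding B_def .
  interpret m: maximalideal m B using max_ideal_maximal(1)[OF i] unfolding B_def m_def .
  interpret Q: cring "B Quot m" by (rule m.quotient_is_cring[OF BM.is_cring])
  have qh: "q \<in> ring_hom B (B Quot m)" unfolding q_def by (rule m.rcos_ring_hom)
  interpret q: ring_hom_cring B "B Quot m" q by unfold_locales (rule qh)
  have tq: "\<tau> a = q (a \<odot>\<^bsub>B\<^esub> \<one>\<^bsub>B\<^esub>)" for a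
    unfolding \<tau>_def q_def m_def to_residue_field_def ..
  have bij: "bij_betw \<tau> (carrier (Base \<D>)) (carrier (B Quot m))"
    using factor(3)[OF i] unfolding residue_field_is_base_def B_def[symmetric] m_def \<tau>_def .
  have rc: "r b \<in> carrier (Base \<D>)" "\<tau> (r b) = q b" if "b \<in> carrier B" for b
  proof -
    have "q b \<in> \<tau> ` carrier (Base \<D>)" using bij that by (simp add: bij_betw_def)
    then show "r b \<in> carrier (Base \<D>)" "\<tau> (r b) = q b"
      unfolding r_def residue_map_def \<tau>_def[symmetric] m_def[symmetric] q_def[symmetric]
      by (rule inv_into_into, rule f_inv_into_f)
  qed
  have r_eq: "r b = a" if "b \<in> carrier B" "a \<in> carrier (Base \<D>)" "\<tau> a = q b" for a b
    by (rule inj_onD[OF bij_betw_imp_inj_on[OF bij]]) (use rc[OF that(1)] that in auto)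
  have t_add: "\<tau> (a \<oplus>\<^bsub>Base \<D>\<^esub> a') = \<tau> a \<oplus>\<^bsub>B Quot m\<^esub> \<tau> a'" if "a \<in> carrier (Base \<D>)" "a' \<in> carrier (Base \<D>)" for a a'
    unfolding tq using that by (simp add: B.smult_l_distr)
  have t_mult: "\<tau> (a \<otimes>\<^bsub>Base \<D>\<^esub> a') = \<tau> a \<otimes>\<^bsub>B Quot m\<^esub> \<tau> a'" if "a \<in> carrier (Base \<D>)" "a' \<in> carrier (Base \<D>)" for a a'
    unfolding tq using that by (simp add: B.smult_assoc1 B.smult_assoc2 flip: q.hom_mult)
  show "res i b \<in> carrier (Base \<D>)" if "b \<in> carrier (Factor \<D> i)" for b
    using rc that unfolding r_def B_def by simp
  have "r (a \<odot>\<^bsub>B\<^esub> b) = a \<otimes>\<^bsub>Base \<D>\<^esub> r b" if a: "a \<in> carrier (Base \<D>)" and b: "b \<in> carrier B" for a b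
  proof (rule r_eq)
    have "\<tau> (a \<otimes>\<^bsub>Base \<D>\<^esub> r b) = q (a \<odot>\<^bsub>B\<^esub> \<one>\<^bsub>B\<^esub>) \<otimes>\<^bsub>B Quot m\<^esub> q b" using t_mult[OF a] rc[OF b] tq by simp
    also have "\<dots> = q (a \<odot>\<^bsub>B\<^esub> b)" using a b by (simp add: B.smult_assoc2 flip: q.hom_mult)
    finally show "\<tau> (a \<otimes>\<^bsub>Base \<D>\<^esub> r b) = q (a \<odot>\<^bsub>B\<^esub> b)" .
  qed (use a b rc in auto)
  then show "res i (a \<odot>\<^bsub>Factor \<D> i\<^esub> b) = a \<otimes>\<^bsub>Base \<D>\<^esub> res i b"
    if "a \<in> carrier (Base \<D>)" "b \<in> carrier (Factor \<D> i)" for a b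
    using that unfolding r_def B_def by blast
  have "r b = \<zero>\<^bsub>Base \<D>\<^esub> \<longleftrightarrow> b \<in> m" if b: "b \<in> carrier B" for b
  proof -
    have "r b = \<zero>\<^bsub>Base \<D>\<^esub> \<longleftrightarrow> q b = \<zero>\<^bsub>B Quot m\<^esub>"
    proof
      assume "r b = \<zero>\<^bsub>Base \<D>\<^esub>"
      then show "q b = \<zero>\<^bsub>B Quot m\<^esub>" using rc[OF b] tq[of "\<zero>\<^bsub>Base \<D>\<^esub>"] by simp
    next
      assume "q b = \<zero>\<^bsub>B Quot m\<^esub>"
      then show "r b = \<zero>\<^bsub>Base \<D>\<^esub>" using tq[of "\<zero>\<^bsub>Base \<D>\<^esub>"] b by (intro r_eq) auto
    qed
    also have "\<dots> \<longleftrightarrow> b \<in> m"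
      unfolding q_def FactRing_def using m.rcos_const_imp_mem[OF b] m.a_rcos_const[of b] by auto
    finally show ?thesis .
  qed
  then show "res i b = \<zero>\<^bsub>Base \<D>\<^esub> \<longleftrightarrow> b \<in> max_ideal (Factor \<D> i)"
    if "b \<in> carrier (Factor \<D> i)" for b
    using that unfolding r_def m_def B_def by blast
  have "r (b \<oplus>\<^bsub>B\<^esub> c) = r b \<oplus>\<^bsub>Base \<D>\<^esub> r c" if "b \<in> carrier B" "c \<in> carrier B" for b c
    using that rc[OF that(1)] rc[OF that(2)] t_add by (intro r_eq) auto
  then show "res i (b \<oplus>\<^bsub>Factor \<D> i\<^esub> c) =
      res i b \<oplus>\<^bsub>Base \<D>\<^esub> res i c"
    if "b \<in> carrier (Factor \<D> i)" "c \<in> carrier (Factor \<D> i)" for b c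
    using that unfolding r_def B_def by blast
  have "r (b \<otimes>\<^bsub>B\<^esub> c) = r b \<otimes>\<^bsub>Base \<D>\<^esub> r c" if "b \<in> carrier B" "c \<in> carrier B" for b c
    using that rc[OF that(1)] rc[OF that(2)] t_mult by (intro r_eq) auto
  then show "res i (b \<otimes>\<^bsub>Factor \<D> i\<^esub> c) =
      res i b \<otimes>\<^bsub>Base \<D>\<^esub> res i c"
    if "b \<in> carrier (Factor \<D> i)" "c \<in> carrier (Factor \<D> i)" for b c
    using that unfolding r_def B_def by blast
next
  define B where "B = Factor \<D> i"
  interpret BM: cring B using algebra.M_cring[OF factor(1)[OF i]] unfolding B_def .
  interpret B: algebra "Base \<D>" B using factor(1)[OF i] unfolding B_def .
  have "bij_betw (to_residue_field B) (carrier (Base \<D>)) (carrier (B Quot max_ideal B))"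
    using factor(3)[OF i] unfolding residue_field_is_base_def B_def[symmetric] .
  then have "inj_on (to_residue_field B) (carrier (Base \<D>))" by (simp add: bij_betw_def)
  moreover have "to_residue_field B \<one>\<^bsub>Base \<D>\<^esub> = max_ideal B +>\<^bsub>B\<^esub> \<one>\<^bsub>B\<^esub>"
    unfolding to_residue_field_def by simp
  ultimately have "residue_map (Base \<D>) B \<one>\<^bsub>B\<^esub> = \<one>\<^bsub>Base \<D>\<^esub>"
    unfolding residue_map_def by (metis inv_into_f_f A.one_closed)
  then show "res i \<one>\<^bsub>Factor \<D> i\<^esub> = \<one>\<^bsub>Base \<D>\<^esub>" unfolding B_def .
qed

lemma proj:
  assumes "i \<le> Last \<D>"
  shows "Proj \<D> i \<in> ring_hom (Alg \<D>) (Factor \<D> i)"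
    "\<And>a x. \<lbrakk>a \<in> carrier (Base \<D>); x \<in> carrier (Alg \<D>)\<rbrakk> \<Longrightarrow> Proj \<D> i (a \<odot>\<^bsub>Alg \<D>\<^esub> x) = a \<odot>\<^bsub>Factor \<D> i\<^esub> Proj \<D> i x"
  using factor(4)[OF assms] unfolding algebra_hom_def by auto

lemma pi_base_hom:
  assumes "i \<le> Last \<D>"
  shows "pi_base \<D> i \<in> ring_hom (Alg \<D>) (Base \<D>)"
  unfolding pi_base_def[abs_def]
  by (rule ring_hom_memI)
    (use residue[OF assms] proj[OF assms] ring_hom_closed[OF proj(1)[OF assms]] ring_hom_add[OF proj(1)[OF assms]]
      ring_hom_mult[OF proj(1)[OF assms]] ring_hom_one[OF proj(1)[OF assms]] in simp_all)

lemma pi_base_smult: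
  assumes "i \<le> Last \<D>" "a \<in> carrier (Base \<D>)" "x \<in> carrier (Alg \<D>)"
  shows "pi_base \<D> i (a \<odot>\<^bsub>Alg \<D>\<^esub> x) = a \<otimes>\<^bsub>Base \<D>\<^esub> pi_base \<D> i x"
  unfolding pi_base_def using proj(2)[OF assms] residue(4)[OF assms(1,2)] ring_hom_closed[OF proj(1)[OF assms(1)] assms(3)]
  by simp

text \<open>Both maps are A-algebra homomorphisms to A, and they have the same kernel: x minus
  Aug(x) times the unit lies in the kernel of \<open>Aug \<D>\<close>, hence in that of
  \<open>pi_base \<D> 0\<close>.\<close>

lemma pi_base_0:
  assumes "x \<in> carrier (Alg \<D>)"
  shows "pi_base \<D> 0 x = Aug \<D> x"
proof -
  have hom: "Aug \<D> \<in> algebra_hom (Base \<D>) (Alg \<D>) (self_algebra (Base \<D>))"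
    and ker: "{x \<in> carrier (Alg \<D>). Proj \<D> 0 x \<in> max_ideal (Factor \<D> 0)} = {x \<in> carrier (Alg \<D>). Aug \<D> x = \<zero>\<^bsub>Base \<D>\<^esub>}"
    using op unfolding operator_data_def by auto
  interpret p: ring_hom_cring "Alg \<D>" "Base \<D>" "pi_base \<D> 0" by unfold_locales (rule pi_base_hom[OF le0])
  have "Aug \<D> \<in> ring_hom (Alg \<D>) (Base \<D>)"
    using hom unfolding algebra_hom_def self_algebra_def ring_hom_def by auto
  then interpret g: ring_hom_cring "Alg \<D>" "Base \<D>" "Aug \<D>" by unfold_locales
  have gs: "Aug \<D> (a \<odot>\<^bsub>Alg \<D>\<^esub> x) = a \<otimes>\<^bsub>Base \<D>\<^esub> Aug \<D> x" if "a \<in> carrier (Base \<D>)" "x \<in> carrier (Alg \<D>)" for a x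
    using hom that unfolding algebra_hom_def self_algebra_def by auto
  define a where "a = Aug \<D> x"
  have a: "a \<in> carrier (Base \<D>)" unfolding a_def using assms by simp
  define y where "y = x \<ominus>\<^bsub>Alg \<D>\<^esub> a \<odot>\<^bsub>Alg \<D>\<^esub> \<one>\<^bsub>Alg \<D>\<^esub>"
  have y: "y \<in> carrier (Alg \<D>)" unfolding y_def using a assms by simp
  have "Aug \<D> y = a \<ominus>\<^bsub>Base \<D>\<^esub> a"
    unfolding y_def using a assms by (simp add: a_minus_def gs a_def[symmetric])
  then have "Aug \<D> y = \<zero>\<^bsub>Base \<D>\<^esub>" using a by (simp add: A.r_neg a_minus_def)
  then have "Proj \<D> 0 y \<in> max_ideal (Factor \<D> 0)" using ker y by blast
  then have "pi_base \<D> 0 y = \<zero>\<^bsub>Base \<D>\<^esub>"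
    unfolding pi_base_def using residue(6)[OF le0] ring_hom_closed[OF proj(1)[OF le0] y] by simp
  moreover have "x = y \<oplus>\<^bsub>Alg \<D>\<^esub> a \<odot>\<^bsub>Alg \<D>\<^esub> \<one>\<^bsub>Alg \<D>\<^esub>"
    unfolding y_def using a assms by (simp add: a_minus_def DM.a_assoc DM.l_neg)
  ultimately have "pi_base \<D> 0 x = a"
    using y a pi_base_smult[OF le0 a DM.one_closed] by simp
  then show ?thesis unfolding a_def .
qed

lemma factor_bij: "bij_betw (\<lambda>x. \<lambda>i\<in>{..Last \<D>}. Proj \<D> i x) (carrier (Alg \<D>)) (\<Pi>\<^sub>E i\<in>{..Last \<D>}. carrier (Factor \<D> i))"
  using op unfolding operator_data_def by auto

lemma proj_surj:
  assumes "\<And>i. i \<le> Last \<D> \<Longrightarrow> f i \<in> carrier (Factor \<D> i)"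
  shows "\<exists>x\<in>carrier (Alg \<D>). \<forall>i\<le>Last \<D>. Proj \<D> i x = f i"
proof -
  have "restrict f {..Last \<D>} \<in> (\<Pi>\<^sub>E i\<in>{..Last \<D>}. carrier (Factor \<D> i))" using assms by auto
  then obtain x where x: "x \<in> carrier (Alg \<D>)" "(\<lambda>i\<in>{..Last \<D>}. Proj \<D> i x) = restrict f {..Last \<D>}"
    using factor_bij unfolding bij_betw_def by (metis (no_types, lifting) imageE)
  have "Proj \<D> i x = f i" if "i \<le> Last \<D>" for i using fun_cong[OF x(2), of i] that by simp
  then show ?thesis using x(1) by blast
qed

lemma proj_inj:
  assumes "x \<in> carrier (Alg \<D>)" "y \<in> carrier (Alg \<D>)" "\<And>i. i \<le> Last \<D> \<Longrightarrow> Proj \<D> i x = Proj \<D> i y"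
  shows "x = y"
proof (rule inj_onD[OF bij_betw_imp_inj_on[OF factor_bij] _ assms(1,2)])
  show "(\<lambda>i\<in>{..Last \<D>}. Proj \<D> i x) = (\<lambda>i\<in>{..Last \<D>}. Proj \<D> i y)" using assms(3) by auto
qed

text \<open>In a local ring the elements outside the maximal ideal are units, and inverses in the
  factors assemble to an inverse in the product.\<close>

lemma alg_unit:
  assumes x: "x \<in> carrier (Alg \<D>)" and nz: "\<And>i. i \<le> Last \<D> \<Longrightarrow> pi_base \<D> i x \<noteq> \<zero>\<^bsub>Base \<D>\<^esub>"
  shows "x \<in> Units (Alg \<D>)"
proof -
  have u: "\<exists>y\<in>carrier (Factor \<D> i). Proj \<D> i x \<otimes>\<^bsub>Factor \<D> i\<^esub> y = \<one>\<^bsub>Factor \<D> i\<^esub>" if i: "i \<le> Last \<D>" for i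
  proof -
    interpret BM: cring "Factor \<D> i" by (rule algebra.M_cring[OF factor(1)[OF i]])
    interpret B: algebra "Base \<D>" "Factor \<D> i" by (rule factor(1)[OF i])
    have c: "Proj \<D> i x \<in> carrier (Factor \<D> i)" using ring_hom_closed[OF proj(1)[OF i] x] .
    have "Proj \<D> i x \<notin> max_ideal (Factor \<D> i)"
      using nz[OF i] residue(6)[OF i c] unfolding pi_base_def by simp
    then have "Proj \<D> i x \<in> Units (Factor \<D> i)"
      using BM.not_unit_in_maximal[OF c] max_ideal_maximal(2)[OF i] by blast
    then show ?thesis using BM.Units_r_inv_ex by blast
  qed
  then obtain f where f: "\<And>i. i \<le> Last \<D> \<Longrightarrow> f i \<in> carrier (Factor \<D> i) \<and> Proj \<D> i x \<otimes>\<^bsub>Factor \<D> i\<^esub> f i = \<one>\<^bsub>Factor \<D> i\<^esub>"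
    by metis
  obtain y where y: "y \<in> carrier (Alg \<D>)" "\<And>i. i \<le> Last \<D> \<Longrightarrow> Proj \<D> i y = f i"
    using proj_surj[of f] f by blast
  have "x \<otimes>\<^bsub>Alg \<D>\<^esub> y = \<one>\<^bsub>Alg \<D>\<^esub>"
  proof (rule proj_inj)
    show "Proj \<D> i (x \<otimes>\<^bsub>Alg \<D>\<^esub> y) = Proj \<D> i \<one>\<^bsub>Alg \<D>\<^esub>" if "i \<le> Last \<D>" for i
      using ring_hom_mult[OF proj(1)[OF that] x y(1)] ring_hom_one[OF proj(1)[OF that]] y(2)[OF that] f[OF that] by simp
  qed (use x y in auto)
  then have "x \<otimes>\<^bsub>Alg \<D>\<^esub> y \<in> Units (Alg \<D>)" by simp
  then show ?thesis using DM.unit_dvd[OF x y(1)] by blast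
qed

text \<open>By dimension some nontrivial A-linear combination of powers of \<open>x\<close> is zero.
  With \<open>a m\<close> its lowest nonzero coefficient, the combination factors as the m-th power
  of \<open>x\<close> times (a m + x g). The second factor is a unit because every \<pi>_i sends it
  to \<open>a m\<close>, so the power of \<open>x\<close> is zero.\<close>

lemma alg_nilpotent:
  assumes x: "x \<in> carrier (Alg \<D>)" and ker: "\<And>i. i \<le> Last \<D> \<Longrightarrow> pi_base \<D> i x = \<zero>\<^bsub>Base \<D>\<^esub>"
  shows "\<exists>n::nat. x [^]\<^bsub>Alg \<D>\<^esub> n = \<zero>\<^bsub>Alg \<D>\<^esub>"
proof -
  let ?M = "Alg \<D>"
  have xk: "x [^]\<^bsub>?M\<^esub> (k::nat) \<in> carrier ?M" for k using x by simp
  obtain a where a: "\<forall>k\<in>{..Len \<D>}. a k \<in> carrier (Base \<D>)" "\<exists>k\<in>{..Len \<D>}. a k \<noteq> \<zero>\<^bsub>Base \<D>\<^esub>"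
    "\<forall>j<Len \<D>. (\<Oplus>\<^bsub>Base \<D>\<^esub>k\<in>{..Len \<D>}. a k \<otimes>\<^bsub>Base \<D>\<^esub> cd (x [^]\<^bsub>?M\<^esub> k) j) = \<zero>\<^bsub>Base \<D>\<^esub>"
    using A.linear_dependence[of "{..Len \<D>}" "Len \<D>" "\<lambda>k j. cd (x [^]\<^bsub>?M\<^esub> k) j"] coord_closed[OF xk] by auto
  have s0: "(\<Oplus>\<^bsub>?M\<^esub>k\<in>{..Len \<D>}. a k \<odot>\<^bsub>?M\<^esub> x [^]\<^bsub>?M\<^esub> k) = \<zero>\<^bsub>?M\<^esub>"
  proof (rule coord_eqI)
    fix j assume j: "j < Len \<D>"
    have "cd (\<Oplus>\<^bsub>?M\<^esub>k\<in>{..Len \<D>}. a k \<odot>\<^bsub>?M\<^esub> x [^]\<^bsub>?M\<^esub> k) j = (\<Oplus>\<^bsub>Base \<D>\<^esub>k\<in>{..Len \<D>}. cd (a k \<odot>\<^bsub>?M\<^esub> x [^]\<^bsub>?M\<^esub> k) j)"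
      using a(1) x j by (intro coord_finsum) auto
    also have "\<dots> = (\<Oplus>\<^bsub>Base \<D>\<^esub>k\<in>{..Len \<D>}. a k \<otimes>\<^bsub>Base \<D>\<^esub> cd (x [^]\<^bsub>?M\<^esub> k) j)"
      using a(1) coord_smult[OF xk _ j] coord_closed[OF xk j] by (intro A.finsum_cong') auto
    finally show "cd (\<Oplus>\<^bsub>?M\<^esub>k\<in>{..Len \<D>}. a k \<odot>\<^bsub>?M\<^esub> x [^]\<^bsub>?M\<^esub> k) j = cd \<zero>\<^bsub>?M\<^esub> j"
      using a(3) j coord_zero by simp
  qed (use a(1) x in \<open>auto intro!: DM.finsum_closed\<close>)
  define m where "m = (LEAST k. a k \<noteq> \<zero>\<^bsub>Base \<D>\<^esub>)"
  obtain k0 where k0: "k0 \<le> Len \<D>" "a k0 \<noteq> \<zero>\<^bsub>Base \<D>\<^esub>" using a(2) by auto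
  have m: "a m \<noteq> \<zero>\<^bsub>Base \<D>\<^esub>" "\<And>k. k < m \<Longrightarrow> a k = \<zero>\<^bsub>Base \<D>\<^esub>" "m \<le> Len \<D>"
  proof -
    show "a m \<noteq> \<zero>\<^bsub>Base \<D>\<^esub>" unfolding m_def by (rule LeastI[of _ k0]) (rule k0(2))
    show "a k = \<zero>\<^bsub>Base \<D>\<^esub>" if "k < m" for k
      using not_less_Least[of k "\<lambda>k. a k \<noteq> \<zero>\<^bsub>Base \<D>\<^esub>"] that unfolding m_def by blast
    have "m \<le> k0" unfolding m_def by (rule Least_le) (rule k0(2))
    then show "m \<le> Len \<D>" using k0(1) by simp
  qed
  have am: "a m \<in> carrier (Base \<D>)" using a(1) m(3) by auto
  have "\<exists>g\<in>carrier ?M. (\<Oplus>\<^bsub>?M\<^esub>k\<in>{..n}. a k \<odot>\<^bsub>?M\<^esub> x [^]\<^bsub>?M\<^esub> k) =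
      x [^]\<^bsub>?M\<^esub> m \<otimes>\<^bsub>?M\<^esub> (a m \<odot>\<^bsub>?M\<^esub> \<one>\<^bsub>?M\<^esub> \<oplus>\<^bsub>?M\<^esub> x \<otimes>\<^bsub>?M\<^esub> g)" if "m \<le> n" "n \<le> Len \<D>" for n
    using that
  proof (induction n rule: dec_induct)
    case base
    have "(\<Oplus>\<^bsub>?M\<^esub>k\<in>{..m}. a k \<odot>\<^bsub>?M\<^esub> x [^]\<^bsub>?M\<^esub> k) = (\<Oplus>\<^bsub>?M\<^esub>k\<in>{..m}. if m = k then a k \<odot>\<^bsub>?M\<^esub> x [^]\<^bsub>?M\<^esub> k else \<zero>\<^bsub>?M\<^esub>)"
      using m(2) am xk by (intro DM.finsum_cong') auto
    also have "\<dots> = a m \<odot>\<^bsub>?M\<^esub> x [^]\<^bsub>?M\<^esub> m"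
      using a(1) m(3) xk by (intro DM.finsum_singleton) auto
    also have "\<dots> = x [^]\<^bsub>?M\<^esub> m \<otimes>\<^bsub>?M\<^esub> (a m \<odot>\<^bsub>?M\<^esub> \<one>\<^bsub>?M\<^esub>)"
      using am xk by (simp add: DA.smult_assoc2 DM.m_comm[of "x [^]\<^bsub>?M\<^esub> m"])
    finally show ?case using am xk x by (intro bexI[of _ "\<zero>\<^bsub>?M\<^esub>"]) auto
  next
    case (step n)
    then obtain g where g: "g \<in> carrier ?M" "(\<Oplus>\<^bsub>?M\<^esub>k\<in>{..n}. a k \<odot>\<^bsub>?M\<^esub> x [^]\<^bsub>?M\<^esub> k) =
      x [^]\<^bsub>?M\<^esub> m \<otimes>\<^bsub>?M\<^esub> (a m \<odot>\<^bsub>?M\<^esub> \<one>\<^bsub>?M\<^esub> \<oplus>\<^bsub>?M\<^esub> x \<otimes>\<^bsub>?M\<^esub> g)" by auto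
    have an: "a (Suc n) \<in> carrier (Base \<D>)" using a(1) step by auto
    define h where "h = a (Suc n) \<odot>\<^bsub>?M\<^esub> x [^]\<^bsub>?M\<^esub> (n - m)"
    have h: "h \<in> carrier ?M" unfolding h_def using an xk by simp
    have "x [^]\<^bsub>?M\<^esub> Suc n = x [^]\<^bsub>?M\<^esub> (n - m) \<otimes>\<^bsub>?M\<^esub> (x [^]\<^bsub>?M\<^esub> m \<otimes>\<^bsub>?M\<^esub> x)"
      using step(1) x DM.nat_pow_mult[OF x, of "n - m" m] by (simp add: DM.m_assoc[symmetric])
    then have "a (Suc n) \<odot>\<^bsub>?M\<^esub> x [^]\<^bsub>?M\<^esub> Suc n = x [^]\<^bsub>?M\<^esub> m \<otimes>\<^bsub>?M\<^esub> (x \<otimes>\<^bsub>?M\<^esub> h)"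
      unfolding h_def using an xk x DA.smult_assoc2[OF an xk[of "n - m"], of "x [^]\<^bsub>?M\<^esub> m \<otimes>\<^bsub>?M\<^esub> x"]
      by (simp add: DM.m_ac del: DM.nat_pow_Suc)
    moreover have "(\<Oplus>\<^bsub>?M\<^esub>k\<in>{..Suc n}. a k \<odot>\<^bsub>?M\<^esub> x [^]\<^bsub>?M\<^esub> k) =
        a (Suc n) \<odot>\<^bsub>?M\<^esub> x [^]\<^bsub>?M\<^esub> Suc n \<oplus>\<^bsub>?M\<^esub> (\<Oplus>\<^bsub>?M\<^esub>k\<in>{..n}. a k \<odot>\<^bsub>?M\<^esub> x [^]\<^bsub>?M\<^esub> k)"
      using a(1) step.prems xk an by (intro DM.finsum_Suc) (auto simp del: DM.nat_pow_Suc)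
    ultimately have "(\<Oplus>\<^bsub>?M\<^esub>k\<in>{..Suc n}. a k \<odot>\<^bsub>?M\<^esub> x [^]\<^bsub>?M\<^esub> k) =
       x [^]\<^bsub>?M\<^esub> m \<otimes>\<^bsub>?M\<^esub> (x \<otimes>\<^bsub>?M\<^esub> h) \<oplus>\<^bsub>?M\<^esub> x [^]\<^bsub>?M\<^esub> m \<otimes>\<^bsub>?M\<^esub> (a m \<odot>\<^bsub>?M\<^esub> \<one>\<^bsub>?M\<^esub> \<oplus>\<^bsub>?M\<^esub> x \<otimes>\<^bsub>?M\<^esub> g)"
      using g(2) by simp
    also have "\<dots> = x [^]\<^bsub>?M\<^esub> m \<otimes>\<^bsub>?M\<^esub> (a m \<odot>\<^bsub>?M\<^esub> \<one>\<^bsub>?M\<^esub> \<oplus>\<^bsub>?M\<^esub> x \<otimes>\<^bsub>?M\<^esub> (g \<oplus>\<^bsub>?M\<^esub> h))"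
      using g(1) h x am xk by (simp add: DM.r_distr DM.a_ac)
    finally show ?case using g(1) h by blast
  qed
  from this[OF m(3) order_refl] obtain g where g: "g \<in> carrier ?M"
    "\<zero>\<^bsub>?M\<^esub> = x [^]\<^bsub>?M\<^esub> m \<otimes>\<^bsub>?M\<^esub> (a m \<odot>\<^bsub>?M\<^esub> \<one>\<^bsub>?M\<^esub> \<oplus>\<^bsub>?M\<^esub> x \<otimes>\<^bsub>?M\<^esub> g)"
    unfolding s0 by blast
  let ?u = "a m \<odot>\<^bsub>?M\<^esub> \<one>\<^bsub>?M\<^esub> \<oplus>\<^bsub>?M\<^esub> x \<otimes>\<^bsub>?M\<^esub> g"
  have uc: "?u \<in> carrier ?M" using am x g by simp
  have "?u \<in> Units ?M"
  proof (rule alg_unit[OF uc])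
    fix i assume i: "i \<le> Last \<D>"
    interpret p: ring_hom_cring "Alg \<D>" "Base \<D>" "pi_base \<D> i" by unfold_locales (rule pi_base_hom[OF i])
    have "pi_base \<D> i ?u = a m" using ker[OF i] pi_base_smult[OF i am DM.one_closed] am x g(1) by simp
    then show "pi_base \<D> i ?u \<noteq> \<zero>\<^bsub>Base \<D>\<^esub>" using m(1) by simp
  qed
  then have "x [^]\<^bsub>?M\<^esub> m = \<zero>\<^bsub>?M\<^esub>"
    using g(2) xk[of m] uc by (metis DM.Units_r_inv_ex DM.l_null DM.m_assoc DM.r_one)
  then show ?thesis by blast
qed

text \<open>Take one in the j-th factor and zero in the others. These elements are the partition of
  unity with which residues are lifted to \<D>(R).\<close>

lemma alg_lift: "\<exists>e. \<forall>j\<le>Last \<D>. e j \<in> carrier (Alg \<D>) \<and>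
    (\<forall>i\<le>Last \<D>. pi_base \<D> i (e j) = (if i = j then \<one>\<^bsub>Base \<D>\<^esub> else \<zero>\<^bsub>Base \<D>\<^esub>))"
proof -
  have "\<exists>x. x \<in> carrier (Alg \<D>) \<and>
    (\<forall>i\<le>Last \<D>. pi_base \<D> i x = (if i = j then \<one>\<^bsub>Base \<D>\<^esub> else \<zero>\<^bsub>Base \<D>\<^esub>))" for j
  proof -
    let ?f = "\<lambda>i. if i = j then \<one>\<^bsub>Factor \<D> i\<^esub> else \<zero>\<^bsub>Factor \<D> i\<^esub>"
    have c: "\<one>\<^bsub>Factor \<D> i\<^esub> \<in> carrier (Factor \<D> i)" "\<zero>\<^bsub>Factor \<D> i\<^esub> \<in> carrier (Factor \<D> i)"
      "res i \<zero>\<^bsub>Factor \<D> i\<^esub> = \<zero>\<^bsub>Base \<D>\<^esub>" if i: "i \<le> Last \<D>" for i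
    proof -
      interpret BM: cring "Factor \<D> i" by (rule algebra.M_cring[OF factor(1)[OF i]])
    interpret B: algebra "Base \<D>" "Factor \<D> i" by (rule factor(1)[OF i])
      show "\<one>\<^bsub>Factor \<D> i\<^esub> \<in> carrier (Factor \<D> i)" "\<zero>\<^bsub>Factor \<D> i\<^esub> \<in> carrier (Factor \<D> i)" by auto
      show "res i \<zero>\<^bsub>Factor \<D> i\<^esub> = \<zero>\<^bsub>Base \<D>\<^esub>"
        using residue(4)[OF i A.zero_closed BM.one_closed] residue(1)[OF i BM.one_closed] by simp
    qed
    obtain x where x: "x \<in> carrier (Alg \<D>)" "\<And>i. i \<le> Last \<D> \<Longrightarrow> Proj \<D> i x = ?f i"
    proof -
      have "?f i \<in> carrier (Factor \<D> i)" if "i \<le> Last \<D>" for i using c[OF that] by (cases "i = j") auto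
      from proj_surj[OF this] show thesis using that by blast
    qed
    have "pi_base \<D> i x = (if i = j then \<one>\<^bsub>Base \<D>\<^esub> else \<zero>\<^bsub>Base \<D>\<^esub>)" if "i \<le> Last \<D>" for i
      unfolding pi_base_def x(2)[OF that] using c(3)[OF that] residue(5)[OF that] by (cases "i = j") auto
    then show ?thesis using x(1) by blast
  qed
  then show ?thesis by metis
qed

end

subsection \<open>The functor \<open>\<D>\<close>\<close>

text \<open>The pure tensor of \<open>r\<close> and \<open>d\<close> in coordinates. Pure tensors
  generate \<D>(R) additively, and \<open>ten_mult\<close> multiplies them without mentioning the
  structure constants.\<close>

definition ten :: "('a, 'd, 'b) operator_data \<Rightarrow> ('a, 'r) module \<Rightarrow> 'r \<Rightarrow> 'd \<Rightarrow> nat \<Rightarrow> 'r" where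
  "ten \<D> R r d = (\<lambda>k\<in>{..<Len \<D>}. eps_coord \<D> d k \<odot>\<^bsub>R\<^esub> r)"

lemma D_of_mult: "k < Len \<D> \<Longrightarrow> (x \<otimes>\<^bsub>D_of \<D> R\<^esub> y) k =
    (\<Oplus>\<^bsub>R\<^esub>i\<in>{..<Len \<D>}. \<Oplus>\<^bsub>R\<^esub>j\<in>{..<Len \<D>}.
      eps_coord \<D> (Eps \<D> i \<otimes>\<^bsub>Alg \<D>\<^esub> Eps \<D> j) k \<odot>\<^bsub>R\<^esub> (x i \<otimes>\<^bsub>R\<^esub> y j))"
  by (simp add: D_of_def)

lemma D_of_add: "k < Len \<D> \<Longrightarrow> (x \<oplus>\<^bsub>D_of \<D> R\<^esub> y) k = x k \<oplus>\<^bsub>R\<^esub> y k"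
  by (simp add: D_of_def)

lemma D_of_zero: "\<zero>\<^bsub>D_of \<D> R\<^esub> = (\<lambda>k\<in>{..<Len \<D>}. \<zero>\<^bsub>R\<^esub>)"
  by (simp add: D_of_def)

lemma D_of_one: "\<one>\<^bsub>D_of \<D> R\<^esub> = ten \<D> R \<one>\<^bsub>R\<^esub> \<one>\<^bsub>Alg \<D>\<^esub>"
  by (simp add: D_of_def ten_def)

locale op_alg = op_data \<D> + R?: cring R + RA: algebra "Base \<D>" R
  for \<D> :: "('a, 'd, 'b) operator_data" and R :: "('a, 'r) module" (structure)
begin

abbreviation "DR \<equiv> D_of \<D> R"
abbreviation "tn \<equiv> ten \<D> R"

lemma D_carrier: "carrier DR = len \<rightarrow>\<^sub>E carrier R"
  unfolding D_of_def by simp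

lemma D_add: "k < Len \<D> \<Longrightarrow> (x \<oplus>\<^bsub>DR\<^esub> y) k = x k \<oplus> y k"
  by (rule D_of_add)

lemma D_mult: "k < Len \<D> \<Longrightarrow> (x \<otimes>\<^bsub>DR\<^esub> y) k =
    (\<Oplus>i\<in>len. \<Oplus>j\<in>len. cd (Eps \<D> i \<otimes>\<^bsub>Alg \<D>\<^esub> Eps \<D> j) k \<odot> (x i \<otimes> y j))"
  by (rule D_of_mult)

lemma D_zero: "\<zero>\<^bsub>DR\<^esub> = (\<lambda>k\<in>len. \<zero>)" by (rule D_of_zero)

lemma D_one: "\<one>\<^bsub>DR\<^esub> = tn \<one> \<one>\<^bsub>Alg \<D>\<^esub>" by (rule D_of_one)

lemma D_ext: "x \<in> extensional len"  if "x \<in> carrier DR" 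
  using that unfolding D_carrier PiE_def by (rule IntD2)

lemma D_eqI:
  assumes "x \<in> extensional len" "y \<in> extensional len" "\<And>k. k < Len \<D> \<Longrightarrow> x k = y k"
  shows "x = y"
  using assms by (intro extensionalityI[of _ len]) auto

lemma D_add_ext: "x \<oplus>\<^bsub>DR\<^esub> y \<in> extensional len" and D_mult_ext: "x \<otimes>\<^bsub>DR\<^esub> y \<in> extensional len"
  and ten_ext: "tn r d \<in> extensional len"
  unfolding D_of_def ten_def by auto

lemma ten_app: "k < Len \<D> \<Longrightarrow> tn r d k = cd d k \<odot> r" unfolding ten_def by simp

lemma ten_closed: "\<lbrakk>r \<in> carrier R; d \<in> carrier (Alg \<D>)\<rbrakk> \<Longrightarrow> tn r d \<in> carrier DR"
  unfolding D_carrier ten_def using coord_closed by auto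

lemma D_component: "\<lbrakk>x \<in> carrier DR; k < Len \<D>\<rbrakk> \<Longrightarrow> x k \<in> carrier R"
  unfolding D_carrier by auto

lemma eps_mult_closed: "\<lbrakk>i < Len \<D>; j < Len \<D>; k < Len \<D>\<rbrakk> \<Longrightarrow>
    cd (Eps \<D> i \<otimes>\<^bsub>Alg \<D>\<^esub> Eps \<D> j) k \<in> carrier (Base \<D>)"
  using coord_closed eps_closed by simp

lemma D_term_closed:
  assumes "x \<in> carrier DR" "y \<in> carrier DR" "i < Len \<D>" "j < Len \<D>" "k < Len \<D>"
  shows "cd (Eps \<D> i \<otimes>\<^bsub>Alg \<D>\<^esub> Eps \<D> j) k \<odot> (x i \<otimes> y j) \<in> carrier R"
  using assms D_component eps_mult_closed by simp

lemma D_add_closed: "\<lbrakk>x \<in> carrier DR; y \<in> carrier DR\<rbrakk> \<Longrightarrow> x \<oplus>\<^bsub>DR\<^esub> y \<in> carrier DR"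
  unfolding D_carrier by (auto simp: D_of_def)

lemma D_mult_closed:
  assumes "x \<in> carrier DR" "y \<in> carrier DR"
  shows "x \<otimes>\<^bsub>DR\<^esub> y \<in> carrier DR"
proof -
  have "(x \<otimes>\<^bsub>DR\<^esub> y) k \<in> carrier R" if "k < Len \<D>" for k
    unfolding D_mult[OF that] using D_term_closed[OF assms _ _ that] by (auto intro!: finsum_closed)
  then show ?thesis unfolding D_carrier using D_mult_ext by (intro PiE_I) (auto simp: extensional_def)
qed

lemma D_ldistr:
  assumes "x \<in> carrier DR" "y \<in> carrier DR" "z \<in> carrier DR"
  shows "(x \<oplus>\<^bsub>DR\<^esub> y) \<otimes>\<^bsub>DR\<^esub> z = x \<otimes>\<^bsub>DR\<^esub> z \<oplus>\<^bsub>DR\<^esub> y \<otimes>\<^bsub>DR\<^esub> z"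
proof (rule D_eqI[OF D_mult_ext D_add_ext])
  fix k assume k: "k < Len \<D>"
  let ?t = "\<lambda>x i j. cd (Eps \<D> i \<otimes>\<^bsub>Alg \<D>\<^esub> Eps \<D> j) k \<odot> (x i \<otimes> z j)"
  have c: "?t x i j \<in> carrier R" "?t y i j \<in> carrier R" if "i < Len \<D>" "j < Len \<D>" for i j
    using D_term_closed assms that k by auto
  have t: "?t (x \<oplus>\<^bsub>DR\<^esub> y) i j = ?t x i j \<oplus> ?t y i j" if "i < Len \<D>" "j < Len \<D>" for i j
    using that k assms D_component eps_mult_closed by (simp add: D_add l_distr RA.smult_r_distr)
  have "((x \<oplus>\<^bsub>DR\<^esub> y) \<otimes>\<^bsub>DR\<^esub> z) k = (\<Oplus>i\<in>len. (\<Oplus>j\<in>len. ?t x i j) \<oplus> (\<Oplus>j\<in>len. ?t y i j))"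
    unfolding D_mult[OF k]
  proof (rule finsum_cong'[OF refl])
    fix i assume i: "i \<in> len"
    have "(\<Oplus>j\<in>len. ?t (x \<oplus>\<^bsub>DR\<^esub> y) i j) = (\<Oplus>j\<in>len. ?t x i j \<oplus> ?t y i j)"
      by (rule finsum_cong'[OF refl]) (use c t i in auto)
    also have "\<dots> = (\<Oplus>j\<in>len. ?t x i j) \<oplus> (\<Oplus>j\<in>len. ?t y i j)"
      by (rule finsum_addf) (use c i in auto)
    finally show "(\<Oplus>j\<in>len. ?t (x \<oplus>\<^bsub>DR\<^esub> y) i j) = (\<Oplus>j\<in>len. ?t x i j) \<oplus> (\<Oplus>j\<in>len. ?t y i j)" .
  qed (use c in \<open>auto intro!: finsum_closed\<close>)
  also have "\<dots> = (x \<otimes>\<^bsub>DR\<^esub> z) k \<oplus> (y \<otimes>\<^bsub>DR\<^esub> z) k"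
    unfolding D_mult[OF k] by (rule finsum_addf) (use c in \<open>auto intro!: finsum_closed\<close>)
  finally show "((x \<oplus>\<^bsub>DR\<^esub> y) \<otimes>\<^bsub>DR\<^esub> z) k = (x \<otimes>\<^bsub>DR\<^esub> z \<oplus>\<^bsub>DR\<^esub> y \<otimes>\<^bsub>DR\<^esub> z) k" by (simp add: D_add k)
qed

lemma D_rdistr:
  assumes "x \<in> carrier DR" "y \<in> carrier DR" "z \<in> carrier DR"
  shows "z \<otimes>\<^bsub>DR\<^esub> (x \<oplus>\<^bsub>DR\<^esub> y) = z \<otimes>\<^bsub>DR\<^esub> x \<oplus>\<^bsub>DR\<^esub> z \<otimes>\<^bsub>DR\<^esub> y"
proof (rule D_eqI[OF D_mult_ext D_add_ext])
  fix k assume k: "k < Len \<D>"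
  let ?t = "\<lambda>x i j. cd (Eps \<D> i \<otimes>\<^bsub>Alg \<D>\<^esub> Eps \<D> j) k \<odot> (z i \<otimes> x j)"
  have c: "?t x i j \<in> carrier R" "?t y i j \<in> carrier R" if "i < Len \<D>" "j < Len \<D>" for i j
    using D_term_closed assms that k by auto
  have t: "?t (x \<oplus>\<^bsub>DR\<^esub> y) i j = ?t x i j \<oplus> ?t y i j" if "i < Len \<D>" "j < Len \<D>" for i j
    using that k assms D_component eps_mult_closed by (simp add: D_add r_distr RA.smult_r_distr)
  have "(z \<otimes>\<^bsub>DR\<^esub> (x \<oplus>\<^bsub>DR\<^esub> y)) k = (\<Oplus>i\<in>len. (\<Oplus>j\<in>len. ?t x i j) \<oplus> (\<Oplus>j\<in>len. ?t y i j))"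
    unfolding D_mult[OF k]
  proof (rule finsum_cong'[OF refl])
    fix i assume i: "i \<in> len"
    have "(\<Oplus>j\<in>len. ?t (x \<oplus>\<^bsub>DR\<^esub> y) i j) = (\<Oplus>j\<in>len. ?t x i j \<oplus> ?t y i j)"
      by (rule finsum_cong'[OF refl]) (use c t i in auto)
    also have "\<dots> = (\<Oplus>j\<in>len. ?t x i j) \<oplus> (\<Oplus>j\<in>len. ?t y i j)"
      by (rule finsum_addf) (use c i in auto)
    finally show "(\<Oplus>j\<in>len. ?t (x \<oplus>\<^bsub>DR\<^esub> y) i j) = (\<Oplus>j\<in>len. ?t x i j) \<oplus> (\<Oplus>j\<in>len. ?t y i j)" .
  qed (use c in \<open>auto intro!: finsum_closed\<close>)
  also have "\<dots> = (z \<otimes>\<^bsub>DR\<^esub> x) k \<oplus> (z \<otimes>\<^bsub>DR\<^esub> y) k"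
    unfolding D_mult[OF k] by (rule finsum_addf) (use c in \<open>auto intro!: finsum_closed\<close>)
  finally show "(z \<otimes>\<^bsub>DR\<^esub> (x \<oplus>\<^bsub>DR\<^esub> y)) k = (z \<otimes>\<^bsub>DR\<^esub> x \<oplus>\<^bsub>DR\<^esub> z \<otimes>\<^bsub>DR\<^esub> y) k" by (simp add: D_add k)
qed

lemma smult_mult_smult:
  assumes "a \<in> carrier (Base \<D>)" "b \<in> carrier (Base \<D>)" "r \<in> carrier R" "s \<in> carrier R"
  shows "(a \<odot> r) \<otimes> (b \<odot> s) = (a \<otimes>\<^bsub>Base \<D>\<^esub> b) \<odot> (r \<otimes> s)"
proof -
  have "(a \<odot> r) \<otimes> (b \<odot> s) = a \<odot> ((b \<odot> s) \<otimes> r)" using assms by (simp add: RA.smult_assoc2 m_comm)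
  also have "\<dots> = a \<odot> (b \<odot> (r \<otimes> s))" using assms by (simp add: RA.smult_assoc2 m_comm[of r s])
  finally show ?thesis using assms by (simp add: RA.smult_assoc1)
qed

text \<open>The coordinates of \<open>d\<close> and \<open>d'\<close> combine with the structure
  constants exactly as in \<open>coord_mult\<close>; the element \<open>r \<otimes> s\<close> is a
  common factor of all terms.\<close>

lemma ten_mult:
  assumes r: "r \<in> carrier R" "s \<in> carrier R" and d: "d \<in> carrier (Alg \<D>)" "d' \<in> carrier (Alg \<D>)"
  shows "tn r d \<otimes>\<^bsub>DR\<^esub> tn s d' = tn (r \<otimes> s) (d \<otimes>\<^bsub>Alg \<D>\<^esub> d')"
proof (rule D_eqI[OF D_mult_ext ten_ext])
  fix k assume k: "k < Len \<D>"
  let ?c = "\<lambda>i j. cd (Eps \<D> i \<otimes>\<^bsub>Alg \<D>\<^esub> Eps \<D> j) k \<otimes>\<^bsub>Base \<D>\<^esub> (cd d i \<otimes>\<^bsub>Base \<D>\<^esub> cd d' j)"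
  note cc = coord_closed[OF d(1)] coord_closed[OF d(2)] eps_mult_closed[OF _ _ k]
  have c: "?c i j \<in> carrier (Base \<D>)" if "i < Len \<D>" "j < Len \<D>" for i j
    using that cc by simp
  have t: "cd (Eps \<D> i \<otimes>\<^bsub>Alg \<D>\<^esub> Eps \<D> j) k \<odot> (tn r d i \<otimes> tn s d' j) = ?c i j \<odot> (r \<otimes> s)"
    if "i < Len \<D>" "j < Len \<D>" for i j
    using that cc r by (simp add: ten_app smult_mult_smult RA.smult_assoc1)
  have "(tn r d \<otimes>\<^bsub>DR\<^esub> tn s d') k = (\<Oplus>i\<in>len. (\<Oplus>\<^bsub>Base \<D>\<^esub>j\<in>len. ?c i j) \<odot> (r \<otimes> s))"
    unfolding D_mult[OF k]
  proof (rule finsum_cong'[OF refl])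
    fix i assume i: "i \<in> len"
    have "(\<Oplus>j\<in>len. cd (Eps \<D> i \<otimes>\<^bsub>Alg \<D>\<^esub> Eps \<D> j) k \<odot> (tn r d i \<otimes> tn s d' j)) = (\<Oplus>j\<in>len. ?c i j \<odot> (r \<otimes> s))"
      by (rule finsum_cong'[OF refl]) (use c t i r in auto)
    also have "\<dots> = (\<Oplus>\<^bsub>Base \<D>\<^esub>j\<in>len. ?c i j) \<odot> (r \<otimes> s)"
      by (rule RA.finsum_smult_scalar[symmetric]) (use c i r in auto)
    finally show "(\<Oplus>j\<in>len. cd (Eps \<D> i \<otimes>\<^bsub>Alg \<D>\<^esub> Eps \<D> j) k \<odot> (tn r d i \<otimes> tn s d' j))
       = (\<Oplus>\<^bsub>Base \<D>\<^esub>j\<in>len. ?c i j) \<odot> (r \<otimes> s)" .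
  qed (use c r in \<open>auto intro!: RA.smult_closed A.finsum_closed\<close>)
  also have "\<dots> = (\<Oplus>\<^bsub>Base \<D>\<^esub>i\<in>len. \<Oplus>\<^bsub>Base \<D>\<^esub>j\<in>len. ?c i j) \<odot> (r \<otimes> s)"
    by (rule RA.finsum_smult_scalar[symmetric]) (use c r in \<open>auto intro!: A.finsum_closed\<close>)
  finally show "(tn r d \<otimes>\<^bsub>DR\<^esub> tn s d') k = tn (r \<otimes> s) (d \<otimes>\<^bsub>Alg \<D>\<^esub> d') k"
    unfolding ten_app[OF k] coord_mult[OF d k] .
qed


lemma ten_add2: "\<lbrakk>r \<in> carrier R; d \<in> carrier (Alg \<D>); d' \<in> carrier (Alg \<D>)\<rbrakk> \<Longrightarrow>
    tn r (d \<oplus>\<^bsub>Alg \<D>\<^esub> d') = tn r d \<oplus>\<^bsub>DR\<^esub> tn r d'"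
  by (rule D_eqI[OF ten_ext D_add_ext]) (simp add: D_add ten_app coord_closed coord_add RA.smult_l_distr)


lemma ten_add1: "\<lbrakk>r \<in> carrier R; s \<in> carrier R; d \<in> carrier (Alg \<D>)\<rbrakk> \<Longrightarrow> tn (r \<oplus> s) d = tn r d \<oplus>\<^bsub>DR\<^esub> tn s d"
  by (rule D_eqI[OF ten_ext D_add_ext]) (simp add: D_add ten_app coord_closed RA.smult_r_distr)

lemma ten_smult: "\<lbrakk>r \<in> carrier R; d \<in> carrier (Alg \<D>); a \<in> carrier (Base \<D>)\<rbrakk> \<Longrightarrow>
    tn r (a \<odot>\<^bsub>Alg \<D>\<^esub> d) = tn (a \<odot> r) d"
  by (rule D_eqI[OF ten_ext ten_ext])
    (simp add: ten_app coord_closed coord_smult A.m_comm[of a] flip: RA.smult_assoc1)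

lemma ten_zero1: "d \<in> carrier (Alg \<D>) \<Longrightarrow> tn \<zero> d = \<zero>\<^bsub>DR\<^esub>"
  unfolding D_zero ten_def using coord_closed by auto

lemma ten_zero2: "r \<in> carrier R \<Longrightarrow> tn r \<zero>\<^bsub>Alg \<D>\<^esub> = \<zero>\<^bsub>DR\<^esub>"
  unfolding D_zero ten_def using coord_zero by auto

text \<open>A vector is the sum of its components along the basis, added one at a time. Together
  with \<open>ten_mult\<close> this reduces the multiplicative laws of \<D>(R) to those of
  \<open>R\<close> and \<D>(A).\<close>

lemma D_induct [consumes 1, case_names ten add]:
  assumes "x \<in> carrier DR"
    and ten: "\<And>r d. \<lbrakk>r \<in> carrier R; d \<in> carrier (Alg \<D>)\<rbrakk> \<Longrightarrow> P (tn r d)"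
    and add: "\<And>x y. \<lbrakk>x \<in> carrier DR; y \<in> carrier DR; P x; P y\<rbrakk> \<Longrightarrow> P (x \<oplus>\<^bsub>DR\<^esub> y)"
  shows "P x"
proof -
  let ?y = "\<lambda>n. \<lambda>k\<in>len. if k < n then x k else \<zero>"
  note xc = D_component[OF assms(1)]
  have yc: "?y n \<in> carrier DR" for n unfolding D_carrier using xc by auto
  have "P (?y n)" if "n \<le> Len \<D>" for n
    using that
  proof (induction n)
    case 0
    have "?y 0 = tn \<zero> \<zero>\<^bsub>Alg \<D>\<^esub>" using ten_zero1 D_zero by auto
    then show ?case using ten by simp
  next
    case (Suc n)
    have n: "n < Len \<D>" using Suc by simp
    have "?y (Suc n) = ?y n \<oplus>\<^bsub>DR\<^esub> tn (x n) (Eps \<D> n)"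
    proof (rule D_eqI[OF _ D_add_ext])
      fix k assume k: "k < Len \<D>"
      show "?y (Suc n) k = (?y n \<oplus>\<^bsub>DR\<^esub> tn (x n) (Eps \<D> n)) k"
        using k n xc by (auto simp: D_add ten_app coord_eps less_Suc_eq)
    qed auto
    moreover have "P (?y n)" by (rule Suc.IH) (use n in simp)
    ultimately show ?case
      using add[OF yc[of n] ten_closed[OF xc[OF n] eps_closed[OF n]] _ ten[OF xc[OF n] eps_closed[OF n]]]
      by (simp only:)
  qed
  then have "P (?y (Len \<D>))" by simp
  moreover have "?y (Len \<D>) = x" by (rule D_eqI) (use D_ext[OF assms(1)] in auto)
  ultimately show ?thesis by simp
qed

lemma D_cring: "cring DR"
proof (rule cringI[OF abelian_groupI comm_monoidI])
  fix x y z assume x: "x \<in> carrier DR" and y: "y \<in> carrier DR" and z: "z \<in> carrier DR"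
  show "x \<oplus>\<^bsub>DR\<^esub> y \<oplus>\<^bsub>DR\<^esub> z = x \<oplus>\<^bsub>DR\<^esub> (y \<oplus>\<^bsub>DR\<^esub> z)"
    by (rule D_eqI[OF D_add_ext D_add_ext]) (use D_component x y z in \<open>simp add: D_add a_assoc\<close>)
  show "(x \<oplus>\<^bsub>DR\<^esub> y) \<otimes>\<^bsub>DR\<^esub> z = x \<otimes>\<^bsub>DR\<^esub> z \<oplus>\<^bsub>DR\<^esub> y \<otimes>\<^bsub>DR\<^esub> z" by (rule D_ldistr[OF x y z])
  show "(x \<otimes>\<^bsub>DR\<^esub> y) \<otimes>\<^bsub>DR\<^esub> z = x \<otimes>\<^bsub>DR\<^esub> (y \<otimes>\<^bsub>DR\<^esub> z)"
    using x
  proof (induction rule: D_induct)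
    case r: (ten r d)
    note rc = ten_closed[OF r]
    show ?case using y
    proof (induction rule: D_induct)
      case s: (ten s e)
      note sc = ten_closed[OF s]
      show ?case using z
      proof (induction rule: D_induct)
        case (ten t f)
        then show ?case using r s by (simp add: ten_mult m_assoc DM.m_assoc)
      next
        case (add z1 z2)
        show ?case
          unfolding D_rdistr[OF add(1,2) D_mult_closed[OF rc sc]] D_rdistr[OF add(1,2) sc]
            D_rdistr[OF D_mult_closed[OF sc add(1)] D_mult_closed[OF sc add(2)] rc] add(3,4) ..
      qed
    next
      case (add y1 y2)
      show ?case
        unfolding D_rdistr[OF add(1,2) rc] D_ldistr[OF add(1,2) z]
          D_ldistr[OF D_mult_closed[OF rc add(1)] D_mult_closed[OF rc add(2)] z]
          D_rdistr[OF D_mult_closed[OF add(1) z] D_mult_closed[OF add(2) z] rc] add(3,4) ..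
    qed
  next
    case (add x1 x2)
    show ?case
      unfolding D_ldistr[OF add(1,2) y] D_ldistr[OF add(1,2) D_mult_closed[OF y z]]
        D_ldistr[OF D_mult_closed[OF add(1) y] D_mult_closed[OF add(2) y] z] add(3,4) ..
  qed
next
  fix x y assume x: "x \<in> carrier DR" and y: "y \<in> carrier DR"
  show "x \<oplus>\<^bsub>DR\<^esub> y = y \<oplus>\<^bsub>DR\<^esub> x"
    by (rule D_eqI[OF D_add_ext D_add_ext]) (use D_component x y in \<open>simp add: D_add a_comm\<close>)
  show "x \<oplus>\<^bsub>DR\<^esub> y \<in> carrier DR" by (rule D_add_closed[OF x y])
  show "x \<otimes>\<^bsub>DR\<^esub> y \<in> carrier DR" by (rule D_mult_closed[OF x y])
  show "x \<otimes>\<^bsub>DR\<^esub> y = y \<otimes>\<^bsub>DR\<^esub> x"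
    using x
  proof (induction rule: D_induct)
    case r: (ten r d)
    show ?case using y
    proof (induction rule: D_induct)
      case (ten s e) then show ?case using r by (simp add: ten_mult m_comm[of r] DM.m_comm[of d])
    next
      case (add y1 y2)
      then show ?case using D_rdistr[OF add(1,2) ten_closed[OF r]] D_ldistr[OF add(1,2) ten_closed[OF r]] by simp
    qed
  next
    case (add x1 x2)
    then show ?case using D_rdistr[OF add(1,2) y] D_ldistr[OF add(1,2) y] by simp
  qed
next
  fix x assume x: "x \<in> carrier DR"
  show "\<zero>\<^bsub>DR\<^esub> \<oplus>\<^bsub>DR\<^esub> x = x"
    by (rule D_eqI[OF D_add_ext D_ext[OF x]]) (use D_component x in \<open>simp add: D_add D_zero\<close>)
  show "\<one>\<^bsub>DR\<^esub> \<otimes>\<^bsub>DR\<^esub> x = x"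
    using x
  proof (induction rule: D_induct)
    case (ten r d) then show ?case by (simp add: D_one ten_mult)
  next
    case (add x y)
    then show ?case using D_rdistr[OF add(1,2), of "\<one>\<^bsub>DR\<^esub>"] D_one ten_closed[of \<one> "\<one>\<^bsub>Alg \<D>\<^esub>"] by simp
  qed
  have "(\<lambda>k\<in>len. \<ominus> x k) \<in> carrier DR" unfolding D_carrier using D_component x by auto
  moreover have "(\<lambda>k\<in>len. \<ominus> x k) \<oplus>\<^bsub>DR\<^esub> x = \<zero>\<^bsub>DR\<^esub>"
    by (rule D_eqI[OF D_add_ext]) (use D_component x in \<open>auto simp: D_add D_zero l_neg\<close>)
  ultimately show "\<exists>y\<in>carrier DR. y \<oplus>\<^bsub>DR\<^esub> x = \<zero>\<^bsub>DR\<^esub>" by blast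
next
  show "\<zero>\<^bsub>DR\<^esub> \<in> carrier DR" unfolding D_carrier D_zero by auto
  show "\<one>\<^bsub>DR\<^esub> \<in> carrier DR" using D_one ten_closed by simp
qed

lemma D_smult:
  assumes a: "a \<in> carrier (Base \<D>)" and x: "x \<in> carrier DR"
  shows "a \<odot>\<^bsub>DR\<^esub> x = tn (a \<odot> \<one>) \<one>\<^bsub>Alg \<D>\<^esub> \<otimes>\<^bsub>DR\<^esub> x"
proof -
  interpret D: cring DR by (rule D_cring)
  have s: "a \<odot>\<^bsub>DR\<^esub> y = (\<lambda>k\<in>len. a \<odot> y k)" for y unfolding D_of_def by simp
  show ?thesis using x
  proof (induction rule: D_induct)
    case (ten r d)
    have "a \<odot>\<^bsub>DR\<^esub> tn r d = tn (a \<odot> r) d"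
      unfolding s using a ten coord_closed
      by (intro D_eqI ten_ext) (auto simp: ten_app A.m_comm[of a] simp flip: RA.smult_assoc1)
    then show ?case using a ten by (simp add: ten_mult RA.smult_assoc2)
  next
    case (add x y)
    have "a \<odot>\<^bsub>DR\<^esub> (x \<oplus>\<^bsub>DR\<^esub> y) = a \<odot>\<^bsub>DR\<^esub> x \<oplus>\<^bsub>DR\<^esub> a \<odot>\<^bsub>DR\<^esub> y"
      unfolding s by (rule D_eqI[OF _ D_add_ext])
        (use a D_component add in \<open>auto simp: D_add RA.smult_r_distr\<close>)
    then show ?case using add D.r_distr[OF add(1,2), of "tn (a \<odot> \<one>) \<one>\<^bsub>Alg \<D>\<^esub>"] a ten_closed by simp
  qed
qed

section \<open>The maps from \<D>(R) to R, nilpotents and units\<close>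

lemma pi_ten:
  assumes i: "i \<le> Last \<D>" and r: "r \<in> carrier R" and d: "d \<in> carrier (Alg \<D>)"
  shows "pi_over \<D> R i (tn r d) = pi_base \<D> i d \<odot> r"
proof -
  interpret p: ring_hom_cring "Alg \<D>" "Base \<D>" "pi_base \<D> i" by unfold_locales (rule pi_base_hom[OF i])
  note c = coord_closed[OF d] eps_closed
  have "pi_base \<D> i d = pi_base \<D> i (\<Oplus>\<^bsub>Alg \<D>\<^esub>j\<in>len. cd d j \<odot>\<^bsub>Alg \<D>\<^esub> Eps \<D> j)" using coord(2)[OF d] by simp
  also have "\<dots> = (\<Oplus>\<^bsub>Base \<D>\<^esub>j\<in>len. (pi_base \<D> i \<circ> (\<lambda>j. cd d j \<odot>\<^bsub>Alg \<D>\<^esub> Eps \<D> j)) j)"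
    by (rule p.hom_finsum) (use c in auto)
  also have "\<dots> = (\<Oplus>\<^bsub>Base \<D>\<^esub>j\<in>len. cd d j \<otimes>\<^bsub>Base \<D>\<^esub> pi_base \<D> i (Eps \<D> j))"
    by (rule A.finsum_cong'[OF refl]) (use c pi_base_smult[OF i] in auto)
  finally have "pi_base \<D> i d \<odot> r = (\<Oplus>j\<in>len. (cd d j \<otimes>\<^bsub>Base \<D>\<^esub> pi_base \<D> i (Eps \<D> j)) \<odot> r)"
    using RA.finsum_smult_scalar[of len "\<lambda>j. cd d j \<otimes>\<^bsub>Base \<D>\<^esub> pi_base \<D> i (Eps \<D> j)" r] c r by (simp add: Pi_def)
  also have "\<dots> = (\<Oplus>j\<in>len. pi_base \<D> i (Eps \<D> j) \<odot> tn r d j)"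
    by (rule finsum_cong'[OF refl]) (use c r in \<open>auto simp: ten_app A.m_comm RA.smult_assoc1[symmetric]\<close>)
  finally show ?thesis unfolding pi_over_def by simp
qed

lemma pi_closed:
  assumes "i \<le> Last \<D>" "x \<in> carrier DR"
  shows "pi_over \<D> R i x \<in> carrier R"
  unfolding pi_over_def using ring_hom_closed[OF pi_base_hom[OF assms(1)] eps_closed] D_component[OF assms(2)]
  by (intro finsum_closed) auto

lemma pi_add:
  assumes i: "i \<le> Last \<D>" and "x \<in> carrier DR" "y \<in> carrier DR"
  shows "pi_over \<D> R i (x \<oplus>\<^bsub>DR\<^esub> y) = pi_over \<D> R i x \<oplus> pi_over \<D> R i y"
proof -
  note c = ring_hom_closed[OF pi_base_hom[OF i] eps_closed] D_component[OF assms(2)] D_component[OF assms(3)]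
  have "pi_over \<D> R i (x \<oplus>\<^bsub>DR\<^esub> y) = (\<Oplus>j\<in>len. pi_base \<D> i (Eps \<D> j) \<odot> x j \<oplus> pi_base \<D> i (Eps \<D> j) \<odot> y j)"
    unfolding pi_over_def by (rule finsum_cong'[OF refl]) (use c in \<open>auto simp: D_add RA.smult_r_distr\<close>)
  also have "\<dots> = pi_over \<D> R i x \<oplus> pi_over \<D> R i y"
    unfolding pi_over_def by (rule finsum_addf) (use c in auto)
  finally show ?thesis .
qed

lemma pi_hom:
  assumes i: "i \<le> Last \<D>"
  shows "pi_over \<D> R i \<in> ring_hom DR R"
proof (rule ring_hom_memI)
  interpret p: ring_hom_cring "Alg \<D>" "Base \<D>" "pi_base \<D> i" by unfold_locales (rule pi_base_hom[OF i])
  show "pi_over \<D> R i \<one>\<^bsub>DR\<^esub> = \<one>" unfolding D_one using pi_ten[OF i] by simp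
  fix x y assume x: "x \<in> carrier DR" and y: "y \<in> carrier DR"
  show "pi_over \<D> R i (x \<oplus>\<^bsub>DR\<^esub> y) = pi_over \<D> R i x \<oplus> pi_over \<D> R i y" by (rule pi_add[OF i x y])
  show "pi_over \<D> R i (x \<otimes>\<^bsub>DR\<^esub> y) = pi_over \<D> R i x \<otimes> pi_over \<D> R i y"
    using x
  proof (induction rule: D_induct)
    case r: (ten r d)
    show ?case using y
    proof (induction rule: D_induct)
      case (ten s e) then show ?case using r by (simp add: ten_mult pi_ten[OF i] smult_mult_smult)
    next
      case (add y1 y2)
      then show ?case
        using D_rdistr[OF add(1,2) ten_closed[OF r]] D_mult_closed[OF ten_closed[OF r]] pi_closed[OF i] ten_closed[OF r]
        by (simp add: pi_add[OF i] r_distr)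
    qed
  next
    case (add x1 x2)
    then show ?case
      using D_ldistr[OF add(1,2) y] D_mult_closed[OF _ y] pi_closed[OF i] y by (simp add: pi_add[OF i] l_distr)
  qed
qed (rule pi_closed[OF i])

text \<open>By \<open>pi_base_0\<close> the map \<pi>_0 takes the value 1 on
  \<open>Eps \<D> 0\<close> and 0 on the other basis elements. Hence prescribing operators on a ring
  is the same as prescribing a section of \<pi>_0.\<close>

lemma pi_0:
  assumes "x \<in> carrier DR"
  shows "pi_over \<D> R 0 x = x 0"
proof -
  have e: "Aug \<D> (Eps \<D> 0) = \<one>\<^bsub>Base \<D>\<^esub>" "\<And>j. j \<in> {1..<Len \<D>} \<Longrightarrow> Aug \<D> (Eps \<D> j) = \<zero>\<^bsub>Base \<D>\<^esub>"
    using op unfolding operator_data_def by auto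
  have "pi_over \<D> R 0 x = (\<Oplus>j\<in>len. if 0 = j then x j else \<zero>)"
    unfolding pi_over_def
    by (rule finsum_cong'[OF refl])
      (use D_component[OF assms] e pi_base_0 eps_closed in \<open>auto simp: Suc_le_eq\<close>)
  also have "\<dots> = x 0" using len_pos D_component[OF assms] by (intro finsum_singleton) auto
  finally show ?thesis .
qed

text \<open>A form of the Chinese remainder theorem: sum the pure tensors of the \<open>f j\<close>
  with the elements from \<open>alg_lift\<close>.\<close>

lemma D_lift:
  assumes "\<And>i. i \<le> Last \<D> \<Longrightarrow> f i \<in> carrier R"
  shows "\<exists>z\<in>carrier DR. \<forall>i\<le>Last \<D>. pi_over \<D> R i z = f i"
proof -
  interpret D: cring DR by (rule D_cring)
  obtain e where e: "\<And>j. j \<le> Last \<D> \<Longrightarrow> e j \<in> carrier (Alg \<D>)"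
    "\<And>i j. \<lbrakk>i \<le> Last \<D>; j \<le> Last \<D>\<rbrakk> \<Longrightarrow> pi_base \<D> i (e j) = (if i = j then \<one>\<^bsub>Base \<D>\<^esub> else \<zero>\<^bsub>Base \<D>\<^esub>)"
    using alg_lift by metis
  let ?z = "\<Oplus>\<^bsub>DR\<^esub>j\<in>{..Last \<D>}. tn (f j) (e j)"
  have tc: "tn (f j) (e j) \<in> carrier DR" if "j \<le> Last \<D>" for j using ten_closed assms e that by simp
  have "pi_over \<D> R i ?z = f i" if i: "i \<le> Last \<D>" for i
  proof -
    interpret p: ring_hom_cring DR R "pi_over \<D> R i" by unfold_locales (rule pi_hom[OF i])
    have "pi_over \<D> R i ?z = (\<Oplus>j\<in>{..Last \<D>}. (pi_over \<D> R i \<circ> (\<lambda>j. tn (f j) (e j))) j)"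
      by (rule p.hom_finsum) (use tc in auto)
    also have "\<dots> = (\<Oplus>j\<in>{..Last \<D>}. if i = j then f j else \<zero>)"
      by (rule finsum_cong'[OF refl]) (use assms e i in \<open>auto simp: pi_ten[OF i]\<close>)
    also have "\<dots> = f i" using assms i by (intro finsum_singleton) auto
    finally show ?thesis .
  qed
  moreover have "?z \<in> carrier DR" using tc by (intro D.finsum_closed) auto
  ultimately show ?thesis by blast
qed

text \<open>The hypothesis does not pass to the summands of \<open>x\<close>, so the induction
  proves that \<open>x\<close> minus the lift \<open>E x\<close> of its residues is nilpotent for
  every \<open>x\<close>. For a pure tensor the difference is a tensor with an element of \<D>(A)
  killed by all residue maps, which is nilpotent by \<open>alg_nilpotent\<close>. If all \<pi>_i
  kill \<open>x\<close>, then \<open>E x\<close> is zero.\<close>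

lemma D_nilpotent:
  assumes x: "x \<in> carrier DR" and ker: "\<And>i. i \<le> Last \<D> \<Longrightarrow> pi_over \<D> R i x = \<zero>"
  shows "ring.nilpotent DR x"
proof -
  interpret D: cring DR by (rule D_cring)
  obtain e where e: "\<And>j. j \<le> Last \<D> \<Longrightarrow> e j \<in> carrier (Alg \<D>)"
    "\<And>i j. \<lbrakk>i \<le> Last \<D>; j \<le> Last \<D>\<rbrakk> \<Longrightarrow> pi_base \<D> i (e j) = (if i = j then \<one>\<^bsub>Base \<D>\<^esub> else \<zero>\<^bsub>Base \<D>\<^esub>)"
    using alg_lift by metis
  define E where "E = (\<lambda>x. \<Oplus>\<^bsub>DR\<^esub>j\<in>{..Last \<D>}. tn (pi_over \<D> R j x) (e j))"
  have tc: "tn (pi_over \<D> R j x) (e j) \<in> carrier DR" if "j \<le> Last \<D>" "x \<in> carrier DR" for j x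
    using ten_closed pi_closed e that by simp
  have Ec: "E x \<in> carrier DR" if "x \<in> carrier DR" for x
    unfolding E_def using tc that by (intro D.finsum_closed) auto
  have "D.nilpotent (x \<ominus>\<^bsub>DR\<^esub> E x)"
    using x
  proof (induction rule: D_induct)
    case (ten r d)
    let ?s = "\<Oplus>\<^bsub>Alg \<D>\<^esub>j\<in>{..Last \<D>}. pi_base \<D> j d \<odot>\<^bsub>Alg \<D>\<^esub> e j"
    have pc: "pi_base \<D> j d \<in> carrier (Base \<D>)" if "j \<le> Last \<D>" for j
      using ring_hom_closed[OF pi_base_hom[OF that] ten(2)] .
    have sc: "?s \<in> carrier (Alg \<D>)" using e pc by (intro DM.finsum_closed) auto
    have ten_sum: "tn r (\<Oplus>\<^bsub>Alg \<D>\<^esub>j\<in>I. g j) = (\<Oplus>\<^bsub>DR\<^esub>j\<in>I. tn r (g j))"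
      if "finite I" "g \<in> I \<rightarrow> carrier (Alg \<D>)" for I :: "nat set" and g
      using that
    proof (induction I rule: finite_induct)
      case (insert i I)
      then have g: "g \<in> I \<rightarrow> carrier (Alg \<D>)" "g i \<in> carrier (Alg \<D>)" by auto
      then have "(\<lambda>j. tn r (g j)) \<in> I \<rightarrow> carrier DR" using ten_closed ten(1) by auto
      then show ?case using insert g ten_add2[OF ten(1) g(2) DM.finsum_closed[OF g(1)]] ten_closed[OF ten(1) g(2)]
        by simp
    qed (use ten_zero2 ten(1) in simp)
    have "E (tn r d) = (\<Oplus>\<^bsub>DR\<^esub>j\<in>{..Last \<D>}. tn r (pi_base \<D> j d \<odot>\<^bsub>Alg \<D>\<^esub> e j))"
      unfolding E_def
      by (rule D.finsum_cong'[OF refl]) (use e pc ten ten_closed in \<open>auto simp: pi_ten ten_smult\<close>)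
    also have "\<dots> = tn r ?s" by (rule ten_sum[symmetric]) (use e pc in auto)
    finally have Es: "E (tn r d) = tn r ?s" .
    define n where "n = d \<ominus>\<^bsub>Alg \<D>\<^esub> ?s"
    have n: "n \<in> carrier (Alg \<D>)" unfolding n_def using ten(2) sc by simp
    have "d = n \<oplus>\<^bsub>Alg \<D>\<^esub> ?s" unfolding n_def using ten(2) sc by (simp add: a_minus_def DM.a_assoc DM.l_neg)
    then have "tn r d = tn r n \<oplus>\<^bsub>DR\<^esub> tn r ?s" using ten_add2[OF ten(1) n sc] by simp
    then have eq: "tn r d \<ominus>\<^bsub>DR\<^esub> E (tn r d) = tn r n"
      unfolding Es using ten_closed[OF ten(1) n] ten_closed[OF ten(1) sc] by (simp add: a_minus_def D.a_assoc D.r_neg)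
    have "pi_base \<D> i n = \<zero>\<^bsub>Base \<D>\<^esub>" if i: "i \<le> Last \<D>" for i
    proof -
      interpret p: ring_hom_cring "Alg \<D>" "Base \<D>" "pi_base \<D> i" by unfold_locales (rule pi_base_hom[OF i])
      have "pi_base \<D> i ?s = (\<Oplus>\<^bsub>Base \<D>\<^esub>j\<in>{..Last \<D>}. (pi_base \<D> i \<circ> (\<lambda>j. pi_base \<D> j d \<odot>\<^bsub>Alg \<D>\<^esub> e j)) j)"
        by (rule p.hom_finsum) (use e pc in auto)
      also have "\<dots> = (\<Oplus>\<^bsub>Base \<D>\<^esub>j\<in>{..Last \<D>}. if i = j then pi_base \<D> j d else \<zero>\<^bsub>Base \<D>\<^esub>)"
        by (rule A.finsum_cong'[OF refl]) (use e pc i pi_base_smult[OF i] in auto)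
      also have "\<dots> = pi_base \<D> i d" using pc i by (intro A.finsum_singleton) auto
      finally show ?thesis unfolding n_def using sc ten(2) by (simp add: a_minus_def A.r_neg)
    qed
    then obtain k :: nat where k: "n [^]\<^bsub>Alg \<D>\<^esub> k = \<zero>\<^bsub>Alg \<D>\<^esub>" using alg_nilpotent[OF n] by blast
    have "tn r n [^]\<^bsub>DR\<^esub> (j::nat) = tn (r [^] j) (n [^]\<^bsub>Alg \<D>\<^esub> j)" for j
      by (induction j) (use ten(1) n in \<open>auto simp: D_one ten_mult\<close>)
    then have "tn r n [^]\<^bsub>DR\<^esub> k = \<zero>\<^bsub>DR\<^esub>" using k ten_zero2 ten(1) by simp
    then show ?case unfolding eq D.nilpotent_def by blast
  next
    case (add x y)
    have "E (x \<oplus>\<^bsub>DR\<^esub> y) = (\<Oplus>\<^bsub>DR\<^esub>j\<in>{..Last \<D>}. tn (pi_over \<D> R j x) (e j) \<oplus>\<^bsub>DR\<^esub> tn (pi_over \<D> R j y) (e j))"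
      unfolding E_def
      by (rule D.finsum_cong'[OF refl]) (use tc add(1,2) e pi_closed in \<open>auto simp: pi_add ten_add1\<close>)
    also have "\<dots> = E x \<oplus>\<^bsub>DR\<^esub> E y" unfolding E_def by (rule D.finsum_addf) (use tc add(1,2) in auto)
    finally have "(x \<oplus>\<^bsub>DR\<^esub> y) \<ominus>\<^bsub>DR\<^esub> E (x \<oplus>\<^bsub>DR\<^esub> y) = (x \<ominus>\<^bsub>DR\<^esub> E x) \<oplus>\<^bsub>DR\<^esub> (y \<ominus>\<^bsub>DR\<^esub> E y)"
      using add(1,2) Ec[OF add(1)] Ec[OF add(2)] by (simp add: a_minus_def D.minus_add D.a_ac)
    then show ?case using D.nilpotent_add add Ec by simp
  qed
  moreover have "E x = \<zero>\<^bsub>DR\<^esub>"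
  proof -
    have "E x = (\<Oplus>\<^bsub>DR\<^esub>j\<in>{..Last \<D>}. \<zero>\<^bsub>DR\<^esub>)"
      unfolding E_def by (rule D.finsum_cong'[OF refl]) (use ker e ten_zero1 in auto)
    then show ?thesis by simp
  qed
  ultimately show ?thesis using x by (simp add: a_minus_def)
qed

text \<open>Lifting the inverses of the \<pi>_i(x) gives a \<open>y\<close> such that x y is 1 plus
  a nilpotent element.\<close>

lemma D_unit:
  assumes F: "field R" and x: "x \<in> carrier DR" and nz: "\<And>i. i \<le> Last \<D> \<Longrightarrow> pi_over \<D> R i x \<noteq> \<zero>"
  shows "x \<in> Units DR"
proof -
  interpret D: cring DR by (rule D_cring)
  interpret F: field R by fact
  have inv: "inv (pi_over \<D> R i x) \<in> carrier R" "pi_over \<D> R i x \<otimes> inv (pi_over \<D> R i x) = \<one>" if "i \<le> Last \<D>" for i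
    using nz[OF that] pi_closed[OF that x] F.field_Units Units_inv_closed Units_r_inv by auto
  obtain y where y: "y \<in> carrier DR" "\<And>i. i \<le> Last \<D> \<Longrightarrow> pi_over \<D> R i y = inv (pi_over \<D> R i x)"
    using D_lift[of "\<lambda>i. inv (pi_over \<D> R i x)"] inv(1) by blast
  let ?n = "x \<otimes>\<^bsub>DR\<^esub> y \<ominus>\<^bsub>DR\<^esub> \<one>\<^bsub>DR\<^esub>"
  have "D.nilpotent ?n"
  proof (rule D_nilpotent)
    fix i assume i: "i \<le> Last \<D>"
    interpret p: ring_hom_cring DR R "pi_over \<D> R i" by unfold_locales (rule pi_hom[OF i])
    show "pi_over \<D> R i ?n = \<zero>" using x y inv i by (simp add: a_minus_def r_neg)
  qed (use x y in simp)
  then have "\<one>\<^bsub>DR\<^esub> \<oplus>\<^bsub>DR\<^esub> ?n \<in> Units DR" using x y D.unit_plus_nilpotent by simp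
  moreover have "\<one>\<^bsub>DR\<^esub> \<oplus>\<^bsub>DR\<^esub> ?n = x \<otimes>\<^bsub>DR\<^esub> y" 
    using x y(1) D.a_lcomm[of "\<one>\<^bsub>DR\<^esub>" "x \<otimes>\<^bsub>DR\<^esub> y" "\<ominus>\<^bsub>DR\<^esub> \<one>\<^bsub>DR\<^esub>"] by (simp add: a_minus_def D.r_neg)
  ultimately show ?thesis using D.unit_dvd[OF x y(1)] by simp
qed

end

definition D_map :: "('a, 'd, 'b) operator_data \<Rightarrow> ('r \<Rightarrow> 's) \<Rightarrow> (nat \<Rightarrow> 'r) \<Rightarrow> nat \<Rightarrow> 's" where
  "D_map \<D> h x = (\<lambda>k\<in>{..<Len \<D>}. h (x k))"

lemma (in op_data) op_algI: "algebra (Base \<D>) R \<Longrightarrow> op_alg \<D> R"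
  unfolding op_alg_def using op_data_axioms algebra.M_cring by blast

text \<open>Structure constants and residues of the basis lie in A, so an A-algebra homomorphism
  applied to each coordinate respects products and the maps \<pi>_i.\<close>

lemma (in op_alg) D_map_hom:
  assumes S: "algebra (Base \<D>) S" and h: "h \<in> algebra_hom (Base \<D>) R S"
  shows "D_map \<D> h \<in> ring_hom DR (D_of \<D> S)"
    and "\<And>i x. \<lbrakk>i \<le> Last \<D>; x \<in> carrier DR\<rbrakk> \<Longrightarrow> pi_over \<D> S i (D_map \<D> h x) = h (pi_over \<D> R i x)"
proof -
  interpret SC: cring S by (rule algebra.M_cring[OF S])
  interpret S: op_alg \<D> S by (rule op_algI[OF S])
  have hr: "h \<in> ring_hom R S" and hs: "\<And>a x. \<lbrakk>a \<in> carrier (Base \<D>); x \<in> carrier R\<rbrakk> \<Longrightarrow> h (a \<odot> x) = a \<odot>\<^bsub>S\<^esub> h x"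
    using h unfolding algebra_hom_def by auto
  interpret h: ring_hom_cring R S h by unfold_locales (rule hr)
  have ext: "D_map \<D> h x \<in> extensional len" for x unfolding D_map_def by auto
  have app: "D_map \<D> h x k = h (x k)" if "k < Len \<D>" for x k unfolding D_map_def using that by simp
  show hom: "D_map \<D> h \<in> ring_hom DR (D_of \<D> S)"
  proof (rule ring_hom_memI)
    fix x assume x: "x \<in> carrier DR"
    show "D_map \<D> h x \<in> carrier (D_of \<D> S)"
      unfolding S.D_carrier D_map_def using D_component[OF x] by auto
    fix y assume y: "y \<in> carrier DR"
    show "D_map \<D> h (x \<oplus>\<^bsub>DR\<^esub> y) = D_map \<D> h x \<oplus>\<^bsub>D_of \<D> S\<^esub> D_map \<D> h y"
      by (rule D_eqI[OF ext S.D_add_ext]) (use D_component x y in \<open>simp add: app D_add S.D_add\<close>)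
    show "D_map \<D> h (x \<otimes>\<^bsub>DR\<^esub> y) = D_map \<D> h x \<otimes>\<^bsub>D_of \<D> S\<^esub> D_map \<D> h y"
    proof (rule D_eqI[OF ext S.D_mult_ext])
      fix k assume k: "k < Len \<D>"
      let ?t = "\<lambda>i j. cd (Eps \<D> i \<otimes>\<^bsub>Alg \<D>\<^esub> Eps \<D> j) k \<odot> (x i \<otimes> y j)"
      let ?u = "\<lambda>i j. cd (Eps \<D> i \<otimes>\<^bsub>Alg \<D>\<^esub> Eps \<D> j) k \<odot>\<^bsub>S\<^esub> (h (x i) \<otimes>\<^bsub>S\<^esub> h (y j))"
      have tc: "?t i j \<in> carrier R" if "i < Len \<D>" "j < Len \<D>" for i j using D_term_closed[OF x y that k] .
      have tu: "h (?t i j) = ?u i j" if "i < Len \<D>" "j < Len \<D>" for i j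
        using D_component[OF x] D_component[OF y] eps_mult_closed[OF that k] that by (simp add: hs)
      have uc: "?u i j \<in> carrier S" if "i < Len \<D>" "j < Len \<D>" for i j using tc tu that h.hom_closed by metis
      have "h ((x \<otimes>\<^bsub>DR\<^esub> y) k) = (\<Oplus>\<^bsub>S\<^esub>i\<in>len. (h \<circ> (\<lambda>i. \<Oplus>j\<in>len. ?t i j)) i)"
        unfolding D_mult[OF k] by (rule h.hom_finsum) (use tc in \<open>auto intro!: finsum_closed\<close>)
      also have "\<dots> = (\<Oplus>\<^bsub>S\<^esub>i\<in>len. \<Oplus>\<^bsub>S\<^esub>j\<in>len. ?u i j)"
      proof (rule SC.finsum_cong'[OF refl])
        fix i assume i: "i \<in> len"
        have "h (\<Oplus>j\<in>len. ?t i j) = (\<Oplus>\<^bsub>S\<^esub>j\<in>len. (h \<circ> ?t i) j)"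
          by (rule h.hom_finsum) (use tc i in auto)
        also have "\<dots> = (\<Oplus>\<^bsub>S\<^esub>j\<in>len. ?u i j)"
          by (rule SC.finsum_cong'[OF refl]) (use tu uc i in auto)
        finally show "(h \<circ> (\<lambda>i. \<Oplus>j\<in>len. ?t i j)) i = (\<Oplus>\<^bsub>S\<^esub>j\<in>len. ?u i j)" by simp
      qed (use uc in \<open>auto intro!: SC.finsum_closed\<close>)
      also have "\<dots> = (D_map \<D> h x \<otimes>\<^bsub>D_of \<D> S\<^esub> D_map \<D> h y) k"
        unfolding S.D_mult[OF k]
      proof (rule SC.finsum_cong'[OF refl])
        fix i assume i: "i \<in> len"
        show "(\<Oplus>\<^bsub>S\<^esub>j\<in>len. ?u i j) =
          (\<Oplus>\<^bsub>S\<^esub>j\<in>len. cd (Eps \<D> i \<otimes>\<^bsub>Alg \<D>\<^esub> Eps \<D> j) k \<odot>\<^bsub>S\<^esub> (D_map \<D> h x i \<otimes>\<^bsub>S\<^esub> D_map \<D> h y j))"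
          by (rule SC.finsum_cong'[OF refl]) (use uc i in \<open>auto simp: app\<close>)
      qed (use uc in \<open>auto simp: app intro!: SC.finsum_closed\<close>)
      finally show "D_map \<D> h (x \<otimes>\<^bsub>DR\<^esub> y) k = (D_map \<D> h x \<otimes>\<^bsub>D_of \<D> S\<^esub> D_map \<D> h y) k"
        using app[OF k] by simp
    qed
  next
    show "D_map \<D> h \<one>\<^bsub>DR\<^esub> = \<one>\<^bsub>D_of \<D> S\<^esub>"
      unfolding D_one S.D_one
      by (rule D_eqI[OF ext S.ten_ext]) (use coord_closed[OF DM.one_closed] in \<open>simp add: app ten_app S.ten_app hs\<close>)
  qed
  fix i x assume i: "i \<le> Last \<D>" and x: "x \<in> carrier DR"
  note c = ring_hom_closed[OF pi_base_hom[OF i] eps_closed] D_component[OF x]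
  have "h (pi_over \<D> R i x) = (\<Oplus>\<^bsub>S\<^esub>j\<in>len. (h \<circ> (\<lambda>j. pi_base \<D> i (Eps \<D> j) \<odot> x j)) j)"
    unfolding pi_over_def by (rule h.hom_finsum) (use c in auto)
  also have "\<dots> = pi_over \<D> S i (D_map \<D> h x)"
    unfolding pi_over_def by (rule SC.finsum_cong'[OF refl]) (use c in \<open>auto simp: hs app\<close>)
  finally show "pi_over \<D> S i (D_map \<D> h x) = h (pi_over \<D> R i x)" by simp
qed

subsection \<open>Extending operators to algebraic elements\<close>

text \<open>Algebraic closedness expressed by finite sums, a form that survives the change of record
  in \<open>mod_of\<close>.\<close>

definition root_closed :: "('f, 'm) ring_scheme \<Rightarrow> bool" where
  "root_closed F \<longleftrightarrow> (\<forall>n c. 0 < (n::nat) \<and> (\<forall>i\<le>n. c i \<in> carrier F) \<and> c n \<noteq> \<zero>\<^bsub>F\<^esub> \<longrightarrow>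
     (\<exists>x\<in>carrier F. (\<Oplus>\<^bsub>F\<^esub>i\<in>{..n}. c i \<otimes>\<^bsub>F\<^esub> x [^]\<^bsub>F\<^esub> i) = \<zero>\<^bsub>F\<^esub>))"

text \<open>A partially defined operator structure. The last clause, the injectivity of each \<pi>_i
  after \<open>e\<close>, keeps the conjugates of minimal polynomials at full degree and finally
  gives injective endomorphisms.\<close>

definition phom :: "('a, 'd, 'b) operator_data \<Rightarrow> ('a, 'f) module \<Rightarrow> 'f set \<Rightarrow> ('f \<Rightarrow> nat \<Rightarrow> 'f) \<Rightarrow> bool" where
  "phom \<D> F M e \<longleftrightarrow> subring M F \<and> e \<in> ring_hom (F\<lparr>carrier := M\<rparr>) (D_of \<D> F) \<and>
     (\<forall>s\<in>M. pi_over \<D> F 0 (e s) = s) \<and>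
     (\<forall>s\<in>M. s \<noteq> \<zero>\<^bsub>F\<^esub> \<longrightarrow> (\<forall>i\<le>Last \<D>. pi_over \<D> F i (e s) \<noteq> \<zero>\<^bsub>F\<^esub>))"

lemma up_eval_comp:
  assumes "cring S" "cring T" "cring T'" "\<phi> \<in> ring_hom S T" "g \<in> ring_hom T T'"
    and "\<And>s. s \<in> carrier S \<Longrightarrow> g (\<phi> s) = \<psi> s" "y \<in> carrier T" "p \<in> carrier (UP S)"
  shows "g (UnivPoly.eval S T \<phi> y p) = UnivPoly.eval S T' \<psi> (g y) p"
proof -
  interpret g: ring_hom_cring T T' g by (intro ring_hom_cring.intro ring_hom_cring_axioms.intro assms)
  interpret S: cring S by fact
  define P where "P = UP S"
  interpret U: UP_cring S P by unfold_locales (rule P_def[THEN eq_reflection])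
  have p: "p \<in> carrier P" using assms(8) unfolding P_def .
  have pc: "p k \<in> carrier S" for k using U.coeff_closed[OF p] U.coeff_eq[OF p] by simp
  have c: "\<phi> (p k) \<in> carrier T" for k using ring_hom_closed[OF assms(4) pc] .
  have "g (UnivPoly.eval S T \<phi> y p) = g (\<Oplus>\<^bsub>T\<^esub>k\<in>{..deg S p}. \<phi> (p k) \<otimes>\<^bsub>T\<^esub> y [^]\<^bsub>T\<^esub> k)"
    unfolding U.eval_on_carrier[OF p] U.coeff_eq[OF p] ..
  also have "\<dots> = (\<Oplus>\<^bsub>T'\<^esub>k\<in>{..deg S p}. (g \<circ> (\<lambda>k. \<phi> (p k) \<otimes>\<^bsub>T\<^esub> y [^]\<^bsub>T\<^esub> k)) k)"
    by (rule g.hom_finsum) (use c assms(7) in auto)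
  also have "\<dots> = (\<Oplus>\<^bsub>T'\<^esub>k\<in>{..deg S p}. \<psi> (p k) \<otimes>\<^bsub>T'\<^esub> g y [^]\<^bsub>T'\<^esub> k)"
    by (rule g.S.finsum_cong'[OF refl])
      (use c assms(6)[OF pc] assms(7) g.hom_closed[OF c] in \<open>auto simp: g.hom_pow\<close>)
  also have "\<dots> = UnivPoly.eval S T' \<psi> (g y) p"
    unfolding U.eval_on_carrier[OF p] U.coeff_eq[OF p] ..
  finally show ?thesis .
qed

locale op_field = op_alg \<D> F for \<D> :: "('a, 'd, 'b) operator_data" and F :: "('a, 'f) module" (structure) +
  assumes fieldF: "field F" and char0: "char_zero F" and rootsF: "root_closed F"
begin

lemma domainF: "domain F" using fieldF by (simp add: field_def)

lemma field_unit: "\<lbrakk>x \<in> carrier F; x \<noteq> \<zero>\<rbrakk> \<Longrightarrow> x \<in> Units F"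
  using field.field_Units[OF fieldF] by simp

lemma unit_nonzero: "x \<in> Units F \<Longrightarrow> x \<noteq> \<zero>"
  using field.field_Units[OF fieldF] by simp

text \<open>Operators are prescribed by a pair: \<open>\<Theta>\<close> names the elements of a
  subring and \<open>\<Psi>\<close> their expansions. The kernel condition makes
  \<open>\<Psi>\<close> factor through \<open>\<Theta>\<close>.\<close>

lemma phom_of_homs:
  assumes W: "ring W" and \<Theta>: "\<Theta> \<in> ring_hom W F" and \<Psi>: "\<Psi> \<in> ring_hom W DR"
    and pi0: "\<And>w. w \<in> carrier W \<Longrightarrow> pi_over \<D> F 0 (\<Psi> w) = \<Theta> w"
    and ker: "\<And>w. \<lbrakk>w \<in> carrier W; \<Theta> w = \<zero>\<rbrakk> \<Longrightarrow> \<Psi> w = \<zero>\<^bsub>DR\<^esub>"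
    and nz: "\<And>w i. \<lbrakk>w \<in> carrier W; \<Theta> w \<noteq> \<zero>; i \<le> Last \<D>\<rbrakk> \<Longrightarrow> pi_over \<D> F i (\<Psi> w) \<noteq> \<zero>"
  shows "\<exists>e. phom \<D> F (\<Theta> ` carrier W) e \<and> (\<forall>w\<in>carrier W. e (\<Theta> w) = \<Psi> w)"
proof -
  interpret W: ring W by fact
  interpret D: cring DR by (rule D_cring)
  interpret t: ring_hom_ring W F \<Theta> by (rule ring_hom_ringI2[OF W ring_axioms \<Theta>])
  interpret p: ring_hom_ring W DR \<Psi> by (rule ring_hom_ringI2[OF W D.ring_axioms \<Psi>])
  have wd: "\<Psi> w = \<Psi> w'" if w: "w \<in> carrier W" "w' \<in> carrier W" "\<Theta> w = \<Theta> w'" for w w'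
  proof -
    have "\<Theta> (w \<ominus>\<^bsub>W\<^esub> w') = \<zero>" using w by (simp add: a_minus_def r_neg)
    then have "\<Psi> (w \<ominus>\<^bsub>W\<^esub> w') = \<zero>\<^bsub>DR\<^esub>" using ker w by simp
    then have "\<Psi> w \<oplus>\<^bsub>DR\<^esub> \<ominus>\<^bsub>DR\<^esub> \<Psi> w' = \<zero>\<^bsub>DR\<^esub>" using w by (simp add: a_minus_def)
    then show ?thesis using w p.hom_closed by (metis D.add.inv_closed D.add.inv_comm D.minus_equality D.minus_minus)
  qed
  define e where "e = (\<lambda>x. \<Psi> (SOME w. w \<in> carrier W \<and> \<Theta> w = x))"
  have e: "e (\<Theta> w) = \<Psi> w" if "w \<in> carrier W" for w
  proof -
    have "(SOME v. v \<in> carrier W \<and> \<Theta> v = \<Theta> w) \<in> carrier W \<and> \<Theta> (SOME v. v \<in> carrier W \<and> \<Theta> v = \<Theta> w) = \<Theta> w"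
      by (rule someI[of _ w]) (use that in simp)
    then show ?thesis unfolding e_def using wd that by blast
  qed
  have "subring (\<Theta> ` carrier W) F" by (rule t.img_is_subring[OF W.carrier_is_subring])
  moreover have "e \<in> ring_hom (F\<lparr>carrier := \<Theta> ` carrier W\<rparr>) DR"
  proof (rule ring_hom_memI)
    fix x assume "x \<in> carrier (F\<lparr>carrier := \<Theta> ` carrier W\<rparr>)"
    then obtain w where w: "w \<in> carrier W" "x = \<Theta> w" by auto
    show "e x \<in> carrier DR" using e w by simp
    fix y assume "y \<in> carrier (F\<lparr>carrier := \<Theta> ` carrier W\<rparr>)"
    then obtain v where v: "v \<in> carrier W" "y = \<Theta> v" by auto
    have "e (\<Theta> w \<otimes> \<Theta> v) = \<Psi> w \<otimes>\<^bsub>DR\<^esub> \<Psi> v" "e (\<Theta> w \<oplus> \<Theta> v) = \<Psi> w \<oplus>\<^bsub>DR\<^esub> \<Psi> v"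
      using e[of "w \<otimes>\<^bsub>W\<^esub> v"] e[of "w \<oplus>\<^bsub>W\<^esub> v"] w(1) v(1) by simp_all
    then show "e (x \<otimes>\<^bsub>F\<lparr>carrier := \<Theta> ` carrier W\<rparr>\<^esub> y) = e x \<otimes>\<^bsub>DR\<^esub> e y"
      "e (x \<oplus>\<^bsub>F\<lparr>carrier := \<Theta> ` carrier W\<rparr>\<^esub> y) = e x \<oplus>\<^bsub>DR\<^esub> e y" using e w v by simp_all
  next
    have "e \<one> = \<one>\<^bsub>DR\<^esub>" using e[OF W.one_closed] by simp
    then show "e \<one>\<^bsub>F\<lparr>carrier := \<Theta> ` carrier W\<rparr>\<^esub> = \<one>\<^bsub>DR\<^esub>" by simp
  qed
  ultimately have "phom \<D> F (\<Theta> ` carrier W) e"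
    unfolding phom_def using e pi0 nz by auto
  then show ?thesis using e by blast
qed

text \<open>Let \<open>f\<close> have minimal degree among the polynomials over \<open>M\<close>
  vanishing at \<open>x\<close>. Roots of its conjugates under the \<pi>_i o e lift to a common
  \<open>z\<close> in \<D>(F), an approximate root: f(z) is nilpotent and f'(z) is a unit. Newton's
  iteration makes it an exact root \<open>v\<close>, and sending \<open>x\<close> to
  \<open>v\<close> extends \<open>e\<close> to M[x].\<close>

lemma phom_step:
  assumes ph: "phom \<D> F M e" and x: "x \<in> carrier F" "algebraic_rel F M x"
  shows "\<exists>M' e'. phom \<D> F M' e' \<and> M \<subseteq> M' \<and> x \<in> M' \<and> (\<forall>s\<in>M. e' s = e s)"
proof -
  define S where "S = F\<lparr>carrier := M\<rparr>"
  have M: "subring M F" and eh: "e \<in> ring_hom S DR" and e0: "\<And>s. s \<in> M \<Longrightarrow> pi_over \<D> F 0 (e s) = s"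
    and enz: "\<And>s i. \<lbrakk>s \<in> M; s \<noteq> \<zero>; i \<le> Last \<D>\<rbrakk> \<Longrightarrow> pi_over \<D> F i (e s) \<noteq> \<zero>"
    using ph unfolding phom_def S_def by auto
  interpret FD: domain F by (rule domainF)
  interpret D: cring DR by (rule D_cring)
  interpret S: domain S unfolding S_def by (rule FD.subring_is_domain[OF M])
  have Sc: "carrier S = M" "\<zero>\<^bsub>S\<^esub> = \<zero>" "\<one>\<^bsub>S\<^esub> = \<one>" unfolding S_def by auto
  have Mc: "M \<subseteq> carrier F" using subringE(1)[OF M] .
  have idh: "id \<in> ring_hom S F" by (rule ring_hom_memI) (use Mc in \<open>auto simp: S_def\<close>)
  define P where "P = UP S"
  interpret U: UP_domain S P by unfold_locales (rule P_def[THEN eq_reflection])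
  interpret I: UP_pre_univ_prop S F id P by unfold_locales (rule idh)
  interpret E: UP_pre_univ_prop S DR e P by unfold_locales (rule eh)
  let ?x = "UnivPoly.eval S F id x"
  let ?Q = "\<lambda>f. f \<in> carrier P \<and> f \<noteq> \<zero>\<^bsub>P\<^esub> \<and> ?x f = \<zero>"
  have "\<exists>p. ?Q p"
  proof -
    obtain n c where c: "\<forall>i\<le>n. c i \<in> M" "c n \<noteq> \<zero>" "(\<Oplus>i\<in>{..n::nat}. c i \<otimes> x [^] i) = \<zero>"
      using x(2) unfolding algebraic_rel_def by blast
    define p where "p = (\<lambda>i. if i \<le> n then c i else \<zero>)"
    have "bound \<zero>\<^bsub>S\<^esub> n p" unfolding p_def Sc by (intro bound.intro) auto
    moreover have "p i \<in> carrier S" for i using c(1) S.zero_closed unfolding p_def Sc by auto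
    ultimately have "p \<in> up S" by (blast intro: mem_upI)
    then have p: "p \<in> carrier P" unfolding U.carrier_eq_up .
    have "deg S p \<le> n"
      by (rule U.deg_aboveI[OF _ p]) (simp only: U.coeff_eq[OF p], simp add: p_def Sc)
    then have "?x p = (\<Oplus>i\<in>{..n}. id (p i) \<otimes> x [^] i)" by (rule I.eval_le[OF p x(1)])
    also have "\<dots> = (\<Oplus>i\<in>{..n}. c i \<otimes> x [^] i)"
      by (rule finsum_cong'[OF refl]) (use c(1) Mc x(1) in \<open>auto simp: p_def\<close>)
    finally have "?x p = \<zero>" using c(3) by simp
    moreover have "p \<noteq> \<zero>\<^bsub>P\<^esub>"
      using U.coeff_zero[of n] fun_cong[OF U.coeff_eq[OF p], of n] c(2) by (auto simp: p_def Sc)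
    ultimately show ?thesis using p by blast
  qed
  then obtain f where f: "f \<in> carrier P" "f \<noteq> \<zero>\<^bsub>P\<^esub>" "?x f = \<zero>" and min: "\<And>g. ?Q g \<Longrightarrow> deg S f \<le> deg S g"
    using ex_has_least_nat[of ?Q _ "deg S"] by blast
  have fc: "f k \<in> carrier S" for k using U.coeff_closed[OF f(1)] U.coeff_eq[OF f(1)] by simp
  have lcf: "f (deg S f) \<noteq> \<zero>" using U.lcoeff_nonzero[OF f(2,1)] unfolding U.coeff_eq[OF f(1)] Sc .
  have dpos: "0 < deg S f"
  proof (rule ccontr)
    assume "\<not> 0 < deg S f"
    then have d: "deg S f = 0" by simp
    have "f = up_ring.monom P (up_ring.coeff P f 0) 0" by (rule U.deg_zero_impl_monom[OF f(1) d])
    then have "f = up_ring.monom P (f 0) 0" unfolding U.coeff_eq[OF f(1)] .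
    then have "?x f = f 0" using I.eval_const[OF x(1) fc[of 0]] by simp
    then show False using f(3) lcf d by simp
  qed
  define f' where "f' = up_deriv S f"
  have f': "f' \<in> carrier P" unfolding f'_def by (rule U.up_deriv_closed[OF f(1)])
  have f'd: "deg S f' < deg S f" unfolding f'_def by (rule U.deg_up_deriv[OF f(1) dpos])
  \<comment> \<open>Characteristic zero: just below the degree of \<open>f\<close>, the coefficient
    of the derivative is that degree times the leading coefficient of \<open>f\<close>.\<close>
  have f'nz: "f' \<noteq> \<zero>\<^bsub>P\<^esub>"
  proof
    assume "f' = \<zero>\<^bsub>P\<^esub>"
    then have "f' (deg S f - 1) = \<zero>" using U.coeff_zero[of "deg S f - 1"] fun_cong[OF U.coeff_eq[OF f'], of "deg S f - 1"] Sc by simp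
    then have "[deg S f] \<cdot>\<^bsub>S\<^esub> f (deg S f) = \<zero>" unfolding f'_def up_deriv_def using dpos by simp
    then have z: "[deg S f] \<cdot> f (deg S f) = \<zero>" using I.hom_add_pow[OF fc, of "deg S f" "deg S f"] by simp
    have lc: "f (deg S f) \<in> carrier F" using fc Mc Sc by auto
    have "([deg S f] \<cdot> \<one>) \<otimes> f (deg S f) = \<zero>" using z lc by (simp add: add_pow_ldistr)
    moreover have "[deg S f] \<cdot> \<one> \<noteq> \<zero>" using char0 dpos unfolding char_zero_def by blast
    ultimately show False using FD.integral[of "[deg S f] \<cdot> \<one>" "f (deg S f)"] lc lcf by auto
  qed
  have f'x: "?x f' \<noteq> \<zero>" using min[of f'] f' f'nz f'd by auto
  have sig: "pi_over \<D> F i \<circ> e \<in> ring_hom S F" if "i \<le> Last \<D>" for i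
    by (rule ring_hom_trans[OF eh pi_hom[OF that]])
  have ec: "e s \<in> carrier DR" if "s \<in> M" for s using ring_hom_closed[OF eh] that Sc by simp
  \<comment> \<open>The conjugate polynomial keeps its leading coefficient nonzero by the invariant,
    so it has a root. For i = 0 it is \<open>f\<close> itself and the root has to be
    \<open>x\<close>, since the extension must be a section of \<pi>_0.\<close>
  have root: "\<exists>y\<in>carrier F. UnivPoly.eval S F (pi_over \<D> F i \<circ> e) y f = \<zero> \<and> (i = 0 \<longrightarrow> y = x)" if i: "i \<le> Last \<D>" for i
  proof (cases "i = 0")
    case True
    interpret G: UP_pre_univ_prop S F "pi_over \<D> F i \<circ> e" P by unfold_locales (rule sig[OF i])
    have "UnivPoly.eval S F (pi_over \<D> F i \<circ> e) x f = ?x f"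
      unfolding G.eval_le[OF f(1) x(1) order_refl] I.eval_le[OF f(1) x(1) order_refl]
      by (rule finsum_cong'[OF refl]) (use e0 fc Mc x Sc True in auto)
    then show ?thesis using f(3) x(1) by auto
  next
    case False
    interpret G: UP_pre_univ_prop S F "pi_over \<D> F i \<circ> e" P by unfold_locales (rule sig[OF i])
    have "\<exists>y\<in>carrier F. (\<Oplus>k\<in>{..deg S f}. (pi_over \<D> F i \<circ> e) (f k) \<otimes> y [^] k) = \<zero>"
      using rootsF dpos enz[OF _ _ i, of "f (deg S f)"] fc lcf pi_closed[OF i ec] Sc unfolding root_closed_def by auto
    then show ?thesis using G.eval_le[OF f(1) _ order_refl] False by auto
  qed
  then obtain y where y: "\<And>i. i \<le> Last \<D> \<Longrightarrow> y i \<in> carrier F"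
    "\<And>i. i \<le> Last \<D> \<Longrightarrow> UnivPoly.eval S F (pi_over \<D> F i \<circ> e) (y i) f = \<zero>" "y 0 = x"
    by (metis le0)
  obtain z where z: "z \<in> carrier DR" "\<And>i. i \<le> Last \<D> \<Longrightarrow> pi_over \<D> F i z = y i" using D_lift[of y] y(1) by blast
  have comp: "pi_over \<D> F i (UnivPoly.eval S DR e v p) = UnivPoly.eval S F (pi_over \<D> F i \<circ> e) (pi_over \<D> F i v) p"
    if "i \<le> Last \<D>" "v \<in> carrier DR" "p \<in> carrier P" for i v p
    by (rule up_eval_comp[OF S.is_cring D_cring is_cring eh pi_hom[OF that(1)]]) (use that in \<open>auto simp: P_def\<close>)
  have evc: "UnivPoly.eval S DR e v p \<in> carrier DR" if "v \<in> carrier DR" "p \<in> carrier P" for v p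
    using ring_hom_closed[OF E.eval_ring_hom[OF that(1)] that(2)] .
  have minP: "deg S f \<le> deg S g" if "g \<in> carrier (UP S)" "g \<noteq> \<zero>\<^bsub>UP S\<^esub>" "?x g = \<zero>" for g
    using min[of g] that unfolding P_def by blast
  have "ring.nilpotent DR (UnivPoly.eval S DR e z f)"
    by (rule D_nilpotent[OF evc[OF z(1) f(1)]]) (simp add: comp z f(1) y(2))
  \<comment> \<open>The derivative has smaller degree, so it is nonzero at \<open>x\<close> by
    minimality and at each conjugate root by \<open>min_poly_transfer\<close>.\<close>
  moreover have "UnivPoly.eval S DR e z (up_deriv S f) \<in> Units DR"
    unfolding f'_def[symmetric]
  proof (rule D_unit[OF fieldF evc[OF z(1) f']])
    fix i assume i: "i \<le> Last \<D>"
    have "UnivPoly.eval S F (pi_over \<D> F i \<circ> e) (y i) f' \<in> Units F"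
    proof (rule min_poly_transfer(2)[OF S.domain_axioms domainF is_cring idh sig[OF i] x(1) y(1)[OF i], of f])
      show "f \<in> carrier (UP S)" "f \<noteq> \<zero>\<^bsub>UP S\<^esub>" "f' \<in> carrier (UP S)" using f f' unfolding P_def by auto
      show "(pi_over \<D> F i \<circ> e) s \<in> Units F" if "s \<in> carrier S" "s \<noteq> \<zero>\<^bsub>S\<^esub>" for s
        using field_unit enz[OF _ _ i] pi_closed[OF i ec] that Sc by auto
    qed (use f(3) minP y(2)[OF i] f'x in \<open>auto simp: inj_on_def\<close>)
    then show "pi_over \<D> F i (UnivPoly.eval S DR e z f') \<noteq> \<zero>"
      using comp[OF i z(1) f'] z(2)[OF i] unit_nonzero by simp
  qed
  ultimately obtain v where v: "v \<in> carrier DR" "UnivPoly.eval S DR e v f = \<zero>\<^bsub>DR\<^esub>"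
    "ring.nilpotent DR (v \<ominus>\<^bsub>DR\<^esub> z)"
    using E.eval_hensel[OF f(1) z(1)] by blast
  \<comment> \<open>Newton's correction is nilpotent, so \<pi>_0 sends it to zero in the field and
    the value \<open>x\<close> is kept.\<close>
  have v0: "pi_over \<D> F 0 v = x"
  proof -
    interpret p: ring_hom_cring DR F "pi_over \<D> F 0" by unfold_locales (rule pi_hom[OF le0])
    obtain n :: nat where n: "(v \<ominus>\<^bsub>DR\<^esub> z) [^]\<^bsub>DR\<^esub> n = \<zero>\<^bsub>DR\<^esub>" using v(3) unfolding D.nilpotent_def by blast
    have c: "pi_over \<D> F 0 v \<in> carrier F" using v(1) by simp
    have "(pi_over \<D> F 0 (v \<ominus>\<^bsub>DR\<^esub> z)) [^] n = \<zero>"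
      using n p.hom_pow[of "v \<ominus>\<^bsub>DR\<^esub> z" n] v(1) z(1) by simp
    moreover have "(a [^] k = \<zero> \<Longrightarrow> a = \<zero>)" if "a \<in> carrier F" for a and k :: nat
      using that by (induction k) (auto dest: FD.integral)
    ultimately have "pi_over \<D> F 0 (v \<ominus>\<^bsub>DR\<^esub> z) = \<zero>" using v(1) z(1) by simp
    then have "pi_over \<D> F 0 v \<ominus> x = \<zero>" using v(1) z y(3) by (simp add: a_minus_def)
    then show ?thesis using c x(1) by simp
  qed
  let ?T = "?x" and ?P = "UnivPoly.eval S DR e v"
  have Punits: "e s \<in> Units DR" if "s \<in> carrier S" "s \<noteq> \<zero>\<^bsub>S\<^esub>" for s
    by (rule D_unit[OF fieldF ec]) (use enz that Sc in auto)
  have P_f: "f \<in> carrier (UP S)" "f \<noteq> \<zero>\<^bsub>UP S\<^esub>" using f unfolding P_def by auto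
  have "inj_on id (carrier S)" by simp
  \<comment> \<open>Now with target \<D>(F): nonzero elements of M[x] go to units, which no \<pi>_i
    kills. This restores the invariant.\<close>
  note tr = min_poly_transfer[OF S.domain_axioms domainF D_cring idh eh x(1) v(1) P_f f(3) minP v(2) Punits this]
  have "\<exists>e'. phom \<D> F (?T ` carrier P) e' \<and> (\<forall>w\<in>carrier P. e' (?T w) = ?P w)"
  proof (rule phom_of_homs[OF U.P.ring_axioms I.eval_ring_hom[OF x(1)] E.eval_ring_hom[OF v(1)]])
    fix w assume w: "w \<in> carrier P"
    show "pi_over \<D> F 0 (?P w) = ?T w"
      unfolding v0[symmetric]
      by (rule up_eval_comp[OF S.is_cring D_cring is_cring eh pi_hom[OF le0]]) (use e0 v(1) w Sc in \<open>auto simp: P_def\<close>)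
    show "?P w = \<zero>\<^bsub>DR\<^esub>" if "?T w = \<zero>" using tr(1)[of w] w that unfolding P_def by blast
    show "pi_over \<D> F i (?P w) \<noteq> \<zero>" if "?T w \<noteq> \<zero>" "i \<le> Last \<D>" for i
    proof -
      interpret p: ring_hom_cring DR F "pi_over \<D> F i" by unfold_locales (rule pi_hom[OF that(2)])
      have "?P w \<in> Units DR" using tr(2)[of w] w that unfolding P_def by blast
      then obtain u where u: "u \<in> carrier DR" "?P w \<otimes>\<^bsub>DR\<^esub> u = \<one>\<^bsub>DR\<^esub>" using D.Units_r_inv_ex by blast
      then have "pi_over \<D> F i (?P w) \<otimes> pi_over \<D> F i u = \<one>"
        using evc[OF v(1) w] p.hom_mult[of "?P w" u] by simp
      then show ?thesis using u(1) by auto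
    qed
  qed
  then obtain e' where e': "phom \<D> F (?T ` carrier P) e'" "\<And>w. w \<in> carrier P \<Longrightarrow> e' (?T w) = ?P w" by blast
  have cm: "up_ring.monom P s 0 \<in> carrier P" "?T (up_ring.monom P s 0) = s" "?P (up_ring.monom P s 0) = e s"
    if "s \<in> M" for s
    using U.monom_closed I.eval_const[OF x(1)] E.eval_const[OF v(1)] that Sc by auto
  have "M \<subseteq> ?T ` carrier P" 
  proof
    show "s \<in> ?T ` carrier P" if "s \<in> M" for s using imageI[OF cm(1)[OF that], of ?T] cm(2)[OF that] by simp
  qed
  moreover have "\<forall>s\<in>M. e' s = e s" using e'(2)[OF cm(1)] by (simp add: cm(2,3))
  moreover have "x \<in> ?T ` carrier P"
  proof -
    have "?T (up_ring.monom P \<one>\<^bsub>S\<^esub> 1) = x" by (rule I.eval_monom1[OF x(1)])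
    then show ?thesis using U.monom_closed[OF S.one_closed] by (metis image_iff)
  qed
  ultimately show ?thesis using e'(1) by blast
qed

text \<open>Zorn's lemma gives a maximal structure, and \<open>phom_step\<close> leaves no algebraic
  element outside its domain.\<close>

lemma phom_maximal:
  assumes ph: "phom \<D> F M e"
  shows "\<exists>N e'. phom \<D> F N e' \<and> M \<subseteq> N \<and> (\<forall>s\<in>M. e' s = e s) \<and>
    (\<forall>x\<in>carrier F. algebraic_rel F N x \<longrightarrow> x \<in> N)"
proof -
  \<comment> \<open>A structure is recorded by the graph of \<open>e\<close> over its domain.
    Extension becomes inclusion, and the values of the total function \<open>e\<close> elsewhere are
    forgotten.\<close>
  define gr where "gr = (\<lambda>(N :: 'f set) (e :: 'f \<Rightarrow> nat \<Rightarrow> 'f). (\<lambda>s. (s, e s)) ` N)"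
  have gr_mem: "(s, y) \<in> gr N e \<longleftrightarrow> s \<in> N \<and> y = e s" for s y N e unfolding gr_def by auto
  have gr_sub: "gr N e \<subseteq> gr N' e' \<longleftrightarrow> N \<subseteq> N' \<and> (\<forall>s\<in>N. e' s = e s)" for N e N' e'
    unfolding gr_def by auto
  define A where "A = {gr N e' | N e'. phom \<D> F N e' \<and> gr M e \<subseteq> gr N e'}"
  have "\<exists>G\<in>A. \<forall>H\<in>A. G \<subseteq> H \<longrightarrow> H = G"
  proof (rule subset_Zorn_nonempty)
    show "A \<noteq> {}" using ph unfolding A_def by blast
  next
    fix C assume C: "C \<noteq> {}" "subset.chain A C"
    have CA: "C \<subseteq> A" and tot: "\<And>G H. \<lbrakk>G \<in> C; H \<in> C\<rbrakk> \<Longrightarrow> G \<subseteq> H \<or> H \<subseteq> G"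
      using C(2) unfolding pred_on.chain_def by auto
    have sv: "y = y'" if sy: "(s, y) \<in> \<Union>C" "(s, y') \<in> \<Union>C" for s y y'
    proof -
      obtain G H where GH: "G \<in> C" "(s, y) \<in> G" "H \<in> C" "(s, y') \<in> H" using sy by (elim UnionE)
      then have "\<exists>G\<in>C. (s, y) \<in> G \<and> (s, y') \<in> G" using tot[OF GH(1,3)] by blast
      then show ?thesis using CA unfolding A_def by (auto simp: gr_mem)
    qed
    define N where "N = fst ` \<Union>C"
    define e' where "e' = (\<lambda>s. THE y. (s, y) \<in> \<Union>C)"
    have e': "e' s = y" if "(s, y) \<in> \<Union>C" for s y unfolding e'_def using that sv by (intro the_equality)
    have U: "\<Union>C = gr N e'"
    proof (rule equalityI; rule subsetI)
      fix p assume p: "p \<in> \<Union>C"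
      then have "p = (fst p, e' (fst p))" using e'[of "fst p" "snd p"] by simp
      then show "p \<in> gr N e'" using p unfolding N_def gr_def by blast
    next
      fix p assume "p \<in> gr N e'"
      then obtain q where "q \<in> \<Union>C" "p = (fst q, e' (fst q))" unfolding gr_def N_def by auto
      then show "p \<in> \<Union>C" using e'[of "fst q" "snd q"] by simp
    qed
    \<comment> \<open>Any two elements of the union lie in the domain of one member of the chain,
      where all conditions on them can be checked.\<close>
    have loc: "\<exists>N0. phom \<D> F N0 e' \<and> a \<in> N0 \<and> b \<in> N0 \<and> N0 \<subseteq> N" if "a \<in> N" "b \<in> N" for a b
    proof -
      have "(a, e' a) \<in> \<Union>C" "(b, e' b) \<in> \<Union>C" using that unfolding U gr_mem by auto
      then obtain G where G: "G \<in> C" "(a, e' a) \<in> G" "(b, e' b) \<in> G" using tot by blast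
      obtain N0 e0 where N0: "G = gr N0 e0" "phom \<D> F N0 e0" using G(1) CA unfolding A_def by blast
      have sub: "gr N0 e0 \<subseteq> gr N e'" using G(1) U N0(1) by blast
      then have eq: "\<And>s. s \<in> N0 \<Longrightarrow> e' s = e0 s" and "N0 \<subseteq> N" unfolding gr_sub by auto
      have sr: "subring N0 F" and hom: "e0 \<in> ring_hom (F\<lparr>carrier := N0\<rparr>) DR" using N0(2) unfolding phom_def by auto
      have "e' \<in> ring_hom (F\<lparr>carrier := N0\<rparr>) DR"
        using ring_hom_closed[OF hom] ring_hom_mult[OF hom] ring_hom_add[OF hom] ring_hom_one[OF hom]
          eq subringE(3,6,7)[OF sr] by (intro ring_hom_memI) auto
      then have "phom \<D> F N0 e'" using N0(2) eq unfolding phom_def by auto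
      then show ?thesis using G N0(1) gr_mem \<open>N0 \<subseteq> N\<close> by blast
    qed
    have ne: "N \<noteq> {}"
    proof -
      obtain G where G: "G \<in> C" using C(1) by blast
      then obtain N0 e0 where "G = gr N0 e0" "phom \<D> F N0 e0" using CA unfolding A_def by blast
      then show ?thesis using G U subringE(2)[of N0 F] unfolding phom_def gr_def by auto
    qed
    have "phom \<D> F N e'"
      unfolding phom_def
    proof (intro conjI)
      show "subring N F"
      proof (rule subringI)
        show "N \<subseteq> carrier F" using loc subringE(1) unfolding phom_def by blast
        show "\<one> \<in> N" using ne loc subringE(3) unfolding phom_def by blast
        fix a b assume ab: "a \<in> N" "b \<in> N"
        obtain N0 where N0: "subring N0 F" "a \<in> N0" "b \<in> N0" "N0 \<subseteq> N"
          using loc[OF ab] unfolding phom_def by blast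
        show "\<ominus> a \<in> N" "a \<otimes> b \<in> N" "a \<oplus> b \<in> N"
          using subringE(5,6,7)[OF N0(1)] N0(2,3) subsetD[OF N0(4)] by simp_all
      qed
      show "e' \<in> ring_hom (F\<lparr>carrier := N\<rparr>) DR"
      proof (rule ring_hom_memI)
        fix a assume a: "a \<in> carrier (F\<lparr>carrier := N\<rparr>)"
        fix b assume b: "b \<in> carrier (F\<lparr>carrier := N\<rparr>)"
        obtain N0 where N0: "e' \<in> ring_hom (F\<lparr>carrier := N0\<rparr>) DR" "a \<in> N0" "b \<in> N0"
          using loc[of a b] a b unfolding phom_def by auto
        show "e' (a \<otimes>\<^bsub>F\<lparr>carrier := N\<rparr>\<^esub> b) = e' a \<otimes>\<^bsub>DR\<^esub> e' b" "e' (a \<oplus>\<^bsub>F\<lparr>carrier := N\<rparr>\<^esub> b) = e' a \<oplus>\<^bsub>DR\<^esub> e' b"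
          using ring_hom_mult[OF N0(1)] ring_hom_add[OF N0(1)] N0(2,3) by auto
      next
        fix a assume a: "a \<in> carrier (F\<lparr>carrier := N\<rparr>)"
        obtain N0 where N0: "e' \<in> ring_hom (F\<lparr>carrier := N0\<rparr>) DR" "a \<in> N0"
          using loc[of a a] a unfolding phom_def by auto
        show "e' a \<in> carrier DR" using ring_hom_closed[OF N0(1)] N0(2) by simp
      next
        obtain a where a: "a \<in> N" using ne by blast
        obtain N0 where N0: "e' \<in> ring_hom (F\<lparr>carrier := N0\<rparr>) DR" "a \<in> N0"
          using loc[OF a a] unfolding phom_def by auto
        show "e' \<one>\<^bsub>F\<lparr>carrier := N\<rparr>\<^esub> = \<one>\<^bsub>DR\<^esub>" using ring_hom_one[OF N0(1)] by simp
      qed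
      show "\<forall>s\<in>N. pi_over \<D> F 0 (e' s) = s" using loc unfolding phom_def by blast
      show "\<forall>s\<in>N. s \<noteq> \<zero> \<longrightarrow> (\<forall>i\<le>Last \<D>. pi_over \<D> F i (e' s) \<noteq> \<zero>)" using loc unfolding phom_def by blast
    qed
    moreover have "gr M e \<subseteq> gr N e'"
    proof -
      obtain G where "G \<in> C" using C(1) by blast
      then show ?thesis using CA U unfolding A_def by blast
    qed
    ultimately show "\<Union>C \<in> A" unfolding A_def U by blast
  qed
  then obtain G where G: "G \<in> A" "\<forall>H\<in>A. G \<subseteq> H \<longrightarrow> H = G" by (elim bexE)
  then obtain N e' where N: "G = gr N e'" "phom \<D> F N e'" "gr M e \<subseteq> gr N e'" unfolding A_def by blast
  have "x \<in> N" if x: "x \<in> carrier F" "algebraic_rel F N x" for x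
  proof -
    obtain N' e'' where N': "phom \<D> F N' e''" "N \<subseteq> N'" "x \<in> N'" "\<forall>s\<in>N. e'' s = e' s"
      using phom_step[OF N(2) x] by blast
    have sub: "gr N e' \<subseteq> gr N' e''" using N' unfolding gr_sub by blast
    then have "gr N' e'' \<in> A" using N' N(3) unfolding A_def by blast
    then have "gr N' e'' = gr N e'" using G(2) sub N(1) by blast
    then have "N' \<subseteq> N" using gr_sub[of N' e'' N e'] by blast
    then show ?thesis using N'(3) by blast
  qed
  moreover have "M \<subseteq> N" "\<forall>s\<in>M. e' s = e s" using N(3) unfolding gr_sub by auto
  ultimately show ?thesis using N(2) by blast
qed

text \<open>\<open>W\<close> with \<open>\<Theta>\<close> and \<open>\<Psi>\<close> prescribes
  operators on a subring over which \<open>F\<close> is algebraic in the sense of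
  \<open>min\<close>. Condition \<open>KW\<close> makes the prescription agree with the operators of
  \<open>K\<close> and, since the scalars come from \<open>K\<close>, also makes the result
  A-linear.\<close>

theorem extension:
  fixes K :: "('a, 'k) module" and W :: "('w, 'm) ring_scheme"
  assumes K: "D_ring \<D> K \<delta>" and \<iota>: "\<iota> \<in> algebra_hom (Base \<D>) K F" "inj_on \<iota> (carrier K)"
    and W: "ring W" and \<Theta>: "\<Theta> \<in> ring_hom W F" and \<Psi>: "\<Psi> \<in> ring_hom W DR"
    and pi0: "\<And>w. w \<in> carrier W \<Longrightarrow> pi_over \<D> F 0 (\<Psi> w) = \<Theta> w"
    and ker: "\<And>w. \<lbrakk>w \<in> carrier W; \<Theta> w = \<zero>\<rbrakk> \<Longrightarrow> \<Psi> w = \<zero>\<^bsub>DR\<^esub>"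
    and nz: "\<And>w i. \<lbrakk>w \<in> carrier W; \<Theta> w \<noteq> \<zero>; i \<le> Last \<D>\<rbrakk> \<Longrightarrow> pi_over \<D> F i (\<Psi> w) \<noteq> \<zero>"
    and KW: "\<And>k. k \<in> carrier K \<Longrightarrow> \<exists>w\<in>carrier W. \<Theta> w = \<iota> k \<and> \<Psi> w = D_map \<D> \<iota> (D_exp \<D> \<delta> k)"
    and min: "\<And>N. \<lbrakk>subring N F; \<Theta> ` carrier W \<subseteq> N; \<And>x. \<lbrakk>x \<in> carrier F; algebraic_rel F N x\<rbrakk> \<Longrightarrow> x \<in> N\<rbrakk>
      \<Longrightarrow> N = carrier F"
  shows "\<exists>\<delta>'. class_K \<D> F \<delta>' \<and> D_embedding \<D> K \<delta> F \<delta>' \<iota> \<and> (\<forall>w\<in>carrier W. D_exp \<D> \<delta>' (\<Theta> w) = \<Psi> w)"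
proof -
  interpret D: cring DR by (rule D_cring)
  interpret FD: domain F by (rule domainF)
  have algK: "algebra (Base \<D>) K" and exp: "D_exp \<D> \<delta> \<in> algebra_hom (Base \<D>) K (D_of \<D> K)"
    using K unfolding D_ring_def by auto
  interpret KC: cring K by (rule algebra.M_cring[OF algK])
  interpret KA: op_alg \<D> K by (rule op_algI[OF algK])
  obtain e0 where e0: "phom \<D> F (\<Theta> ` carrier W) e0" "\<And>w. w \<in> carrier W \<Longrightarrow> e0 (\<Theta> w) = \<Psi> w"
    using phom_of_homs[OF W \<Theta> \<Psi> pi0 ker nz] by blast
  obtain N e where N: "phom \<D> F N e" "\<Theta> ` carrier W \<subseteq> N" "\<forall>s\<in>\<Theta> ` carrier W. e s = e0 s"
    "\<forall>x\<in>carrier F. algebraic_rel F N x \<longrightarrow> x \<in> N"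
    using phom_maximal[OF e0(1)] by blast
  have "N = carrier F" using min[of N] N unfolding phom_def by blast
  moreover have "F\<lparr>carrier := carrier F\<rparr> = F" by simp
  ultimately have eh: "e \<in> ring_hom F DR" and ep: "\<And>s. s \<in> carrier F \<Longrightarrow> pi_over \<D> F 0 (e s) = s"
    and enz: "\<And>s i. \<lbrakk>s \<in> carrier F; s \<noteq> \<zero>; i \<le> Last \<D>\<rbrakk> \<Longrightarrow> pi_over \<D> F i (e s) \<noteq> \<zero>"
    using N(1) unfolding phom_def by auto
  have eW: "e (\<Theta> w) = \<Psi> w" if "w \<in> carrier W" for w using N(3) e0(2) that by auto
  have eK: "e (\<iota> k) = D_map \<D> \<iota> (D_exp \<D> \<delta> k)" if "k \<in> carrier K" for k using KW[OF that] eW by metis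
  define \<delta>' where "\<delta>' = (\<lambda>j r. e r j)"
  have ec: "e r \<in> carrier DR" if "r \<in> carrier F" for r using ring_hom_closed[OF eh that] .
  have De: "D_exp \<D> \<delta>' r = e r" if r: "r \<in> carrier F" for r
  proof (rule D_eqI[OF _ D_ext[OF ec[OF r]]])
    show "D_exp \<D> \<delta>' r \<in> extensional len" unfolding D_exp_def by auto
    show "D_exp \<D> \<delta>' r k = e r k" if "k < Len \<D>" for k
      using that ep[OF r] pi_0[OF ec[OF r]] unfolding D_exp_def \<delta>'_def by simp
  qed
  have ih: "\<iota> \<in> ring_hom K F" and isc: "\<And>a x. \<lbrakk>a \<in> carrier (Base \<D>); x \<in> carrier K\<rbrakk> \<Longrightarrow> \<iota> (a \<odot>\<^bsub>K\<^esub> x) = a \<odot> \<iota> x"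
    using \<iota>(1) unfolding algebra_hom_def by auto
  interpret i: ring_hom_cring K F \<iota> by unfold_locales (rule ih)
  \<comment> \<open>A \<open>phom\<close> is only a ring homomorphism; its A-linearity is derived
    from its value at the scalar multiples of one, which are images of elements of
    \<open>K\<close>.\<close>
  have e1: "e (a \<odot> \<one>) = a \<odot>\<^bsub>DR\<^esub> \<one>\<^bsub>DR\<^esub>" if a: "a \<in> carrier (Base \<D>)" for a
  proof -
    have "e (a \<odot> \<one>) = e (\<iota> (a \<odot>\<^bsub>K\<^esub> \<one>\<^bsub>K\<^esub>))" using isc[OF a KC.one_closed] by simp
    also have "\<dots> = D_map \<D> \<iota> (D_exp \<D> \<delta> (a \<odot>\<^bsub>K\<^esub> \<one>\<^bsub>K\<^esub>))" by (rule eK) (use a in simp)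
    also have "D_exp \<D> \<delta> (a \<odot>\<^bsub>K\<^esub> \<one>\<^bsub>K\<^esub>) = a \<odot>\<^bsub>D_of \<D> K\<^esub> D_exp \<D> \<delta> \<one>\<^bsub>K\<^esub>"
      using exp a KC.one_closed unfolding algebra_hom_def by blast
    also have "D_exp \<D> \<delta> \<one>\<^bsub>K\<^esub> = \<one>\<^bsub>D_of \<D> K\<^esub>" using exp ring_hom_one unfolding algebra_hom_def by blast
    also have "D_map \<D> \<iota> (a \<odot>\<^bsub>D_of \<D> K\<^esub> \<one>\<^bsub>D_of \<D> K\<^esub>) = a \<odot>\<^bsub>DR\<^esub> \<one>\<^bsub>DR\<^esub>"
      unfolding D_one KA.D_one
      by (auto simp: D_map_def ten_def D_of_def isc a coord_closed[OF DM.one_closed] intro!: restrict_ext)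
    finally show ?thesis .
  qed
  have oneD: "tn (a \<odot> \<one>) \<one>\<^bsub>Alg \<D>\<^esub> \<in> carrier DR" if "a \<in> carrier (Base \<D>)" for a using that ten_closed by simp
  have es: "e (a \<odot> r) = a \<odot>\<^bsub>DR\<^esub> e r" if a: "a \<in> carrier (Base \<D>)" and r: "r \<in> carrier F" for a r
  proof -
    have "e (a \<odot> r) = e ((a \<odot> \<one>) \<otimes> r)" using a r by (simp add: RA.smult_assoc2)
    also have "\<dots> = (a \<odot>\<^bsub>DR\<^esub> \<one>\<^bsub>DR\<^esub>) \<otimes>\<^bsub>DR\<^esub> e r" using ring_hom_mult[OF eh, of "a \<odot> \<one>" r] a r e1 by simp
    also have "\<dots> = a \<odot>\<^bsub>DR\<^esub> e r" using D_smult[OF a] ec[OF r] oneD[OF a] by simp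
    finally show ?thesis .
  qed
  have "D_exp \<D> \<delta>' \<in> algebra_hom (Base \<D>) F DR"
    unfolding algebra_hom_def
  proof (intro CollectI conjI ballI)
    show "D_exp \<D> \<delta>' \<in> ring_hom F DR"
      by (rule ring_hom_memI)
        (use De ec ring_hom_mult[OF eh] ring_hom_add[OF eh] ring_hom_one[OF eh] in simp_all)
    show "D_exp \<D> \<delta>' (a \<odot> x) = a \<odot>\<^bsub>DR\<^esub> D_exp \<D> \<delta>' x" if "a \<in> carrier (Base \<D>)" "x \<in> carrier F" for a x
      using that De es by simp
  qed
  moreover have "\<forall>j\<in>{1..<Len \<D>}. \<delta>' j \<in> carrier F \<rightarrow> carrier F"
    unfolding \<delta>'_def using D_component[OF ec] by auto
  ultimately have "D_ring \<D> F \<delta>'" unfolding D_ring_def using RA.algebra_axioms by blast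
  moreover have "inj_on (assoc_endo \<D> F \<delta>' i) (carrier F)" if i: "i \<le> Last \<D>" for i
  proof (rule inj_onI)
    interpret p: ring_hom_cring DR F "pi_over \<D> F i" by unfold_locales (rule pi_hom[OF i])
    interpret E: ring_hom_cring F DR e by unfold_locales (rule eh)
    fix r s assume rs: "r \<in> carrier F" "s \<in> carrier F" "assoc_endo \<D> F \<delta>' i r = assoc_endo \<D> F \<delta>' i s"
    have "pi_over \<D> F i (e (r \<ominus> s)) = \<zero>"
      using rs De ec unfolding assoc_endo_def by (simp add: a_minus_def r_neg)
    then have "r \<ominus> s = \<zero>" using enz[of "r \<ominus> s" i] rs i by auto
    then show "r = s" using rs by simp
  qed
  ultimately have "class_K \<D> F \<delta>'" unfolding class_K_def using domainF char0 by auto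
  moreover have "D_embedding \<D> K \<delta> F \<delta>' \<iota>"
  proof -
    have "\<iota> (\<delta> j x) = \<delta>' j (\<iota> x)" if "j \<in> {1..<Len \<D>}" "x \<in> carrier K" for j x
      unfolding \<delta>'_def eK[OF that(2)] using that(1) by (simp add: D_map_def D_exp_def)
    then show ?thesis unfolding D_embedding_def using \<iota> by blast
  qed
  moreover have "\<forall>w\<in>carrier W. D_exp \<D> \<delta>' (\<Theta> w) = \<Psi> w"
    using De ring_hom_closed[OF \<Theta>] eW by simp
  ultimately show ?thesis by blast
qed

end

subsection \<open>Algebraically closed hulls as algebras\<close>

text \<open>The algebraic closure is constructed as a bare ring; this record equips it with the
  scalar multiplication induced by a homomorphism from A.\<close>

definition mod_of :: "('f, 'm) ring_scheme \<Rightarrow> ('a \<Rightarrow> 'f) \<Rightarrow> ('a, 'f) module" where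
  "mod_of L g = \<lparr>carrier = carrier L, monoid.mult = monoid.mult L, one = \<one>\<^bsub>L\<^esub>,
     zero = \<zero>\<^bsub>L\<^esub>, add = add L, smult = (\<lambda>a x. g a \<otimes>\<^bsub>L\<^esub> x)\<rparr>"

lemma mod_of_simps [simp]:
  "carrier (mod_of L g) = carrier L" "monoid.mult (mod_of L g) = monoid.mult L"
  "\<one>\<^bsub>mod_of L g\<^esub> = \<one>\<^bsub>L\<^esub>" "\<zero>\<^bsub>mod_of L g\<^esub> = \<zero>\<^bsub>L\<^esub>" "add (mod_of L g) = add L"
  "a \<odot>\<^bsub>mod_of L g\<^esub> x = g a \<otimes>\<^bsub>L\<^esub> x"
  by (simp_all add: mod_of_def)

lemma mod_of_finsum: "finsum (mod_of L g) = finsum L"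
  by (intro ext) (simp add: finsum_def finprod_def)

lemma mod_of_nat_pow: "x [^]\<^bsub>mod_of L g\<^esub> (n::nat) = x [^]\<^bsub>L\<^esub> n"
  by (simp add: nat_pow_def)

lemma mod_of_cring:
  assumes "cring L"
  shows "cring (mod_of L g)"
proof -
  interpret L: cring L by fact
  show ?thesis
  proof (rule cringI)
    show "abelian_group (mod_of L g)"
      by (rule abelian_groupI) (auto simp: L.a_ac intro: L.l_neg bexI[of _ "\<ominus>\<^bsub>L\<^esub> _"])
    show "comm_monoid (mod_of L g)"
      by (rule comm_monoidI) (auto simp: L.m_ac)
  qed (auto simp: L.l_distr)
qed

lemma mod_of_field:
  assumes "field L"
  shows "field (mod_of L g)"
proof -
  interpret L: field L by fact
  interpret M: cring "mod_of L g" by (rule mod_of_cring[OF L.is_cring])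
  show ?thesis
  proof (rule M.cring_fieldI)
    have "Units (mod_of L g) = Units L" by (simp add: Units_def)
    then show "Units (mod_of L g) = carrier (mod_of L g) - {\<zero>\<^bsub>mod_of L g\<^esub>}"
      using L.field_Units by simp
  qed
qed

lemma mod_of_algebra:
  assumes "cring A" "cring L" "g \<in> ring_hom A L"
  shows "algebra A (mod_of L g)"
proof -
  interpret A: cring A by fact
  interpret L: cring L by fact
  interpret g: ring_hom_cring A L g by unfold_locales (rule assms(3))
  show ?thesis
    by (rule algebraI[OF A.is_cring mod_of_cring[OF L.is_cring]])
      (auto simp: L.l_distr L.r_distr L.m_assoc)
qed

text \<open>Positive integers are units in the field, and a homomorphism into a domain cannot send a
  unit to zero.\<close>

lemma char_zero_hom:
  assumes A: "field A" "char_zero A" and B: "domain B" and g: "g \<in> ring_hom A B"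
  shows "char_zero B"
  unfolding char_zero_def
proof (intro allI impI notI)
  interpret A: field A by fact
  interpret B: domain B by fact
  interpret g: ring_hom_cring A B g by unfold_locales (rule g)
  fix n :: nat assume n: "0 < n" "[n] \<cdot>\<^bsub>B\<^esub> \<one>\<^bsub>B\<^esub> = \<zero>\<^bsub>B\<^esub>"
  have e: "g ([n] \<cdot>\<^bsub>A\<^esub> \<one>\<^bsub>A\<^esub>) = [n] \<cdot>\<^bsub>B\<^esub> \<one>\<^bsub>B\<^esub>" by (induction n) auto
  have "[n] \<cdot>\<^bsub>A\<^esub> \<one>\<^bsub>A\<^esub> \<in> Units A" using A(2) n(1) unfolding char_zero_def A.field_Units by auto
  then have "[n] \<cdot>\<^bsub>A\<^esub> \<one>\<^bsub>A\<^esub> \<otimes>\<^bsub>A\<^esub> inv\<^bsub>A\<^esub> ([n] \<cdot>\<^bsub>A\<^esub> \<one>\<^bsub>A\<^esub>) = \<one>\<^bsub>A\<^esub>" "inv\<^bsub>A\<^esub> ([n] \<cdot>\<^bsub>A\<^esub> \<one>\<^bsub>A\<^esub>) \<in> carrier A" by simp_all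
  then have "g ([n] \<cdot>\<^bsub>A\<^esub> \<one>\<^bsub>A\<^esub>) \<otimes>\<^bsub>B\<^esub> g (inv\<^bsub>A\<^esub> ([n] \<cdot>\<^bsub>A\<^esub> \<one>\<^bsub>A\<^esub>)) = \<one>\<^bsub>B\<^esub>" "g (inv\<^bsub>A\<^esub> ([n] \<cdot>\<^bsub>A\<^esub> \<one>\<^bsub>A\<^esub>)) \<in> carrier B"
    using g.hom_mult[of "[n] \<cdot>\<^bsub>A\<^esub> \<one>\<^bsub>A\<^esub>" "inv\<^bsub>A\<^esub> ([n] \<cdot>\<^bsub>A\<^esub> \<one>\<^bsub>A\<^esub>)"] by (metis A.add.nat_pow_closed A.one_closed g.hom_one, simp)
  then show False using n(2) unfolding e by simp
qed

lemma (in op_data) algebra_hom_of_scalars: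
  assumes R: "algebra (Base \<D>) R" and S: "algebra (Base \<D>) S" and h: "h \<in> ring_hom R S"
    and scalar: "\<And>a. a \<in> carrier (Base \<D>) \<Longrightarrow> h (a \<odot>\<^bsub>R\<^esub> \<one>\<^bsub>R\<^esub>) = a \<odot>\<^bsub>S\<^esub> \<one>\<^bsub>S\<^esub>"
  shows "h \<in> algebra_hom (Base \<D>) R S"
proof -
  interpret RC: cring R by (rule algebra.M_cring[OF R])
  interpret SC: cring S by (rule algebra.M_cring[OF S])
  interpret RA: algebra "Base \<D>" R by (rule R)
  interpret SA: algebra "Base \<D>" S by (rule S)
  have "h (a \<odot>\<^bsub>R\<^esub> x) = a \<odot>\<^bsub>S\<^esub> h x" if ax: "a \<in> carrier (Base \<D>)" "x \<in> carrier R" for a x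
  proof -
    have "h (a \<odot>\<^bsub>R\<^esub> x) = h ((a \<odot>\<^bsub>R\<^esub> \<one>\<^bsub>R\<^esub>) \<otimes>\<^bsub>R\<^esub> x)" using ax by (simp add: RA.smult_assoc2)
    also have "\<dots> = h (a \<odot>\<^bsub>R\<^esub> \<one>\<^bsub>R\<^esub>) \<otimes>\<^bsub>S\<^esub> h x" by (rule ring_hom_mult[OF h]) (use ax in simp_all)
    also have "\<dots> = a \<odot>\<^bsub>S\<^esub> h x" using ax ring_hom_closed[OF h ax(2)] by (simp add: scalar SA.smult_assoc2)
    finally show ?thesis .
  qed
  then show ?thesis unfolding algebra_hom_def using h by blast
qed

lemma (in op_alg) scalar_hom: "(\<lambda>a. a \<odot> \<one>) \<in> ring_hom (Base \<D>) R"
  by (rule ring_hom_memI) (auto simp: RA.smult_l_distr RA.smult_assoc1 RA.smult_assoc2 RA.smult_one)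

text \<open>Collects what is used of the hull: enough roots, an embedding that respects scalars, and
  minimality in the form required by \<open>extension\<close>.\<close>

lemma (in op_data) hull_exists:
  fixes B :: "('c, 'm) ring_scheme"
  assumes B: "domain B" and g: "g \<in> ring_hom (Base \<D>) B"
  shows "\<exists>(F :: ('a, ((('c \<times> 'c) set list \<times> nat) multiset \<Rightarrow> ('c \<times> 'c) set)) module) h.
    op_field \<D> F \<and> h \<in> ring_hom B F \<and> inj_on h (carrier B) \<and>
    (\<forall>a\<in>carrier (Base \<D>). h (g a) = a \<odot>\<^bsub>F\<^esub> \<one>\<^bsub>F\<^esub>) \<and>
    (\<forall>N. subring N F \<and> h ` carrier B \<subseteq> N \<and> (\<forall>x\<in>carrier F. algebraic_rel F N x \<longrightarrow> x \<in> N) \<longrightarrow> N = carrier F)"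
proof -
  interpret B: domain B by fact
  define L where "L = B.ac_hull"
  define h where "h = B.hull_emb"
  define F where "F = mod_of L (h \<circ> g)"
  interpret L: algebraically_closed L unfolding L_def by (rule B.hull_algebraically_closed)
  have hL: "h \<in> ring_hom B L" and inj: "inj_on h (carrier B)"
    unfolding h_def L_def using B.hull_emb_hom B.hull_emb_inj by auto
  interpret h: ring_hom_cring B L h by unfold_locales (rule hL)
  have comp: "h \<circ> g \<in> ring_hom (Base \<D>) L" by (rule ring_hom_trans[OF g hL])
  have alg: "algebra (Base \<D>) F" unfolding F_def
    by (rule mod_of_algebra[OF A.is_cring L.is_cring comp])
  have fld: "field F" unfolding F_def by (rule mod_of_field[OF L.field_axioms])
  have hF: "h \<in> ring_hom B F" by (rule ring_hom_memI) (auto simp: F_def)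
  have gF: "h \<circ> g \<in> ring_hom (Base \<D>) F" using comp unfolding F_def ring_hom_def by simp
  have "char_zero (Base \<D>)" using op unfolding operator_data_def by blast
  then have "char_zero F" by (rule char_zero_hom[OF A.field_axioms _ field.axioms(1)[OF fld] gF])
  moreover have "root_closed F"
    unfolding root_closed_def F_def mod_of_finsum mod_of_nat_pow using L.exists_root_finsum by simp
  ultimately have op: "op_field \<D> F"
    by (intro op_field.intro op_field_axioms.intro op_algI alg fld)
  have ha: "h (g a) = a \<odot>\<^bsub>F\<^esub> \<one>\<^bsub>F\<^esub>" if "a \<in> carrier (Base \<D>)" for a
    using ring_hom_closed[OF comp that] by (simp add: F_def)
  have min: "N = carrier F" if N: "subring N F" "h ` carrier B \<subseteq> N"
    "\<And>x. \<lbrakk>x \<in> carrier F; algebraic_rel F N x\<rbrakk> \<Longrightarrow> x \<in> N" for N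
  proof -
    interpret F: field F by (rule fld)
    have Nc: "N \<subseteq> carrier L" using subringE(1)[OF N(1)] by (simp add: F_def)
    \<comment> \<open>The additive inverses of the two records are different expressions; they agree
      by uniqueness of the inverse.\<close>
    have neg: "\<ominus>\<^bsub>L\<^esub> x \<in> N" if "x \<in> N" for x
    proof -
      have "\<ominus>\<^bsub>F\<^esub> x \<in> N" by (rule subringE(5)[OF N(1) that])
      moreover have "\<ominus>\<^bsub>F\<^esub> x \<oplus>\<^bsub>L\<^esub> x = \<zero>\<^bsub>L\<^esub>" "\<ominus>\<^bsub>F\<^esub> x \<in> carrier L"
        using F.l_neg[of x] F.a_inv_closed[of x] that Nc by (auto simp: F_def)
      then have "\<ominus>\<^bsub>L\<^esub> x = \<ominus>\<^bsub>F\<^esub> x" using L.minus_equality that Nc by blast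
      ultimately show ?thesis by simp
    qed
    have "subring N L"
      by (rule L.subringI) (use subringE[OF N(1)] neg Nc in \<open>auto simp: F_def\<close>)
    moreover have "algebraic_rel F N x" if "algebraic_rel L N x" for x
      using that unfolding algebraic_rel_def F_def mod_of_finsum mod_of_nat_pow by simp
    ultimately have "N = carrier L"
      unfolding L_def using B.hull_minimal[of N] N(2,3) unfolding h_def L_def F_def by simp
    then show ?thesis by (simp add: F_def)
  qed
  show ?thesis using op hF inj ha min by (intro exI[of _ F] exI[of _ h]) blast
qed

lemma D_embedding_refl: "D_ring \<D> R \<delta> \<Longrightarrow> D_embedding \<D> R \<delta> R \<delta> (\<lambda>x. x)"
  unfolding D_embedding_def algebra_hom_def by (auto simp: ring_hom_def)

lemma D_embedding_trans:
  assumes "D_embedding \<D> K \<delta> R \<delta>' f" "D_embedding \<D> R \<delta>' S \<delta>'' g"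
  shows "D_embedding \<D> K \<delta> S \<delta>'' (g \<circ> f)"
proof -
  have f: "f \<in> ring_hom K R" "inj_on f (carrier K)" and g: "g \<in> ring_hom R S" "inj_on g (carrier R)"
    using assms unfolding D_embedding_def algebra_hom_def by auto
  have fc: "f x \<in> carrier R" if "x \<in> carrier K" for x using ring_hom_closed[OF f(1) that] .
  have "g \<circ> f \<in> ring_hom K S" by (rule ring_hom_trans[OF f(1) g(1)])
  moreover have "inj_on (g \<circ> f) (carrier K)"
    by (rule comp_inj_on[OF f(2) inj_on_subset[OF g(2)]]) (use fc in auto)
  ultimately show ?thesis using assms fc unfolding D_embedding_def algebra_hom_def by simp
qed

context op_alg
begin

lemma D_exp_0: "D_exp \<D> \<delta> r 0 = r" using len_pos by (simp add: D_exp_def)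

lemma D_exp_closed: "\<lbrakk>D_ring \<D> R \<delta>; r \<in> carrier R\<rbrakk> \<Longrightarrow> D_exp \<D> \<delta> r \<in> carrier DR"
  unfolding D_ring_def algebra_hom_def using ring_hom_closed by fastforce

lemma D_exp_hom: "D_ring \<D> R \<delta> \<Longrightarrow> D_exp \<D> \<delta> \<in> ring_hom R DR"
  unfolding D_ring_def algebra_hom_def by blast

lemma assoc_endo_0: "\<lbrakk>D_ring \<D> R \<delta>; r \<in> carrier R\<rbrakk> \<Longrightarrow> assoc_endo \<D> R \<delta> 0 r = r"
  unfolding assoc_endo_def by (simp add: pi_0 D_exp_closed D_exp_0)

lemma assoc_endo_hom: "\<lbrakk>D_ring \<D> R \<delta>; i \<le> Last \<D>\<rbrakk> \<Longrightarrow> assoc_endo \<D> R \<delta> i \<in> ring_hom R R"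
  using ring_hom_trans[OF D_exp_hom pi_hom, of \<delta> i] by (simp add: assoc_endo_def[abs_def] comp_def)


lemma assoc_endo_inj:
  assumes "class_K \<D> R \<delta>" "i \<le> Last \<D>"
  shows "inj_on (assoc_endo \<D> R \<delta> i) (carrier R)"
proof (cases "i = 0")
  case True
  then show ?thesis using assms assoc_endo_0 unfolding class_K_def by (auto simp: inj_on_def)
next
  case False
  then show ?thesis using assms unfolding class_K_def by auto
qed

end

lemma (in op_data) embedding_exp:
  assumes K: "D_ring \<D> K \<delta>" and R: "D_ring \<D> R \<delta>'" and emb: "D_embedding \<D> K \<delta> R \<delta>' \<iota>" and x: "x \<in> carrier K"
  shows "D_exp \<D> \<delta>' (\<iota> x) = D_map \<D> \<iota> (D_exp \<D> \<delta> x)"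
  unfolding D_exp_def D_map_def using emb x unfolding D_embedding_def by (auto intro!: restrict_ext)

text \<open>The case of \<open>extension\<close> in which \<open>W\<close> is the ring itself and
  the prescribed expansion is its own, pushed forward to the hull.\<close>

theorem (in op_data) class_K_hull:
  fixes R :: "('a, 'r) module"
  assumes R: "class_K \<D> R \<delta>"
  shows "\<exists>(F :: ('a, ((('r \<times> 'r) set list \<times> nat) multiset \<Rightarrow> ('r \<times> 'r) set)) module) \<delta>' h.
    op_field \<D> F \<and> class_K \<D> F \<delta>' \<and> D_embedding \<D> R \<delta> F \<delta>' h"
proof -
  have DR: "D_ring \<D> R \<delta>" and dom: "domain R" using R unfolding class_K_def by auto
  have alg: "algebra (Base \<D>) R" using DR unfolding D_ring_def by blast
  interpret R: op_alg \<D> R by (rule op_algI[OF alg])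
  obtain F :: "('a, ((('r \<times> 'r) set list \<times> nat) multiset \<Rightarrow> ('r \<times> 'r) set)) module" and h where
    F: "op_field \<D> F" and h: "h \<in> ring_hom R F" "inj_on h (carrier R)"
    and ha: "\<And>a. a \<in> carrier (Base \<D>) \<Longrightarrow> h (a \<odot>\<^bsub>R\<^esub> \<one>\<^bsub>R\<^esub>) = a \<odot>\<^bsub>F\<^esub> \<one>\<^bsub>F\<^esub>"
    and min: "\<And>N. \<lbrakk>subring N F; h ` carrier R \<subseteq> N; \<forall>x\<in>carrier F. algebraic_rel F N x \<longrightarrow> x \<in> N\<rbrakk> \<Longrightarrow> N = carrier F"
    using hull_exists[OF dom R.scalar_hom] by metis
  interpret F: op_field \<D> F by (rule F)
  interpret h: ring_hom_cring R F h by unfold_locales (rule h(1))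
  have halg: "h \<in> algebra_hom (Base \<D>) R F" by (rule algebra_hom_of_scalars[OF alg F.RA.algebra_axioms h(1) ha])
  have Dm: "D_map \<D> h \<in> ring_hom (D_of \<D> R) (D_of \<D> F)"
    and pm: "\<And>i x. \<lbrakk>i \<le> Last \<D>; x \<in> carrier (D_of \<D> R)\<rbrakk> \<Longrightarrow> pi_over \<D> F i (D_map \<D> h x) = h (pi_over \<D> R i x)"
    using R.D_map_hom[OF F.RA.algebra_axioms halg] by auto
  define \<Psi> where "\<Psi> = D_map \<D> h \<circ> D_exp \<D> \<delta>"
  have \<Psi>: "\<Psi> \<in> ring_hom R (D_of \<D> F)"
    unfolding \<Psi>_def by (rule ring_hom_trans[OF R.D_exp_hom[OF DR] Dm])
  have piP: "pi_over \<D> F i (\<Psi> r) = h (assoc_endo \<D> R \<delta> i r)" if "i \<le> Last \<D>" "r \<in> carrier R" for i r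
    using pm[OF that(1) R.D_exp_closed[OF DR that(2)]] unfolding \<Psi>_def assoc_endo_def by simp
  interpret P: ring_hom_ring R "D_of \<D> F" \<Psi>
    by (rule ring_hom_ringI2[OF R.R.ring_axioms cring.axioms(1)[OF F.D_cring] \<Psi>])
  have "\<exists>\<delta>'. class_K \<D> F \<delta>' \<and> D_embedding \<D> R \<delta> F \<delta>' h \<and> (\<forall>w\<in>carrier R. D_exp \<D> \<delta>' (h w) = \<Psi> w)"
  proof (rule F.extension[OF DR halg h(2) R.R.ring_axioms h(1) \<Psi>])
    fix w assume w: "w \<in> carrier R"
    show "pi_over \<D> F 0 (\<Psi> w) = h w" using piP[OF le0 w] R.assoc_endo_0[OF DR w] by simp
    have hz: "x = \<zero>\<^bsub>R\<^esub>" if "h x = \<zero>\<^bsub>F\<^esub>" "x \<in> carrier R" for x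
      using inj_onD[OF h(2), of x "\<zero>\<^bsub>R\<^esub>"] that by simp
    show "\<Psi> w = \<zero>\<^bsub>D_of \<D> F\<^esub>" if "h w = \<zero>\<^bsub>F\<^esub>" using hz[OF that w] by simp
    show "pi_over \<D> F i (\<Psi> w) \<noteq> \<zero>\<^bsub>F\<^esub>" if "h w \<noteq> \<zero>\<^bsub>F\<^esub>" "i \<le> Last \<D>" for i
    proof
      interpret s: ring_hom_cring R R "assoc_endo \<D> R \<delta> i" by unfold_locales (rule R.assoc_endo_hom[OF DR that(2)])
      assume "pi_over \<D> F i (\<Psi> w) = \<zero>\<^bsub>F\<^esub>"
      then have "assoc_endo \<D> R \<delta> i w = \<zero>\<^bsub>R\<^esub>" using piP[OF that(2) w] hz w by simp
      then have "w = \<zero>\<^bsub>R\<^esub>" using inj_onD[OF R.assoc_endo_inj[OF R that(2)], of w "\<zero>\<^bsub>R\<^esub>"] w by simp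
      then show False using that(1) by simp
    qed
    show "\<exists>v\<in>carrier R. h v = h w \<and> \<Psi> v = D_map \<D> h (D_exp \<D> \<delta> w)" using w unfolding \<Psi>_def by auto
  qed (use min in blast)
  then show ?thesis using F by blast
qed

subsection \<open>Terms, embeddings and the size of extensions\<close>

text \<open>The universes of substructures, closed under every function symbol of the language. As
  zero and subtraction are among the symbols, such a set is a subring.\<close>

definition D_closed :: "('a, 'd, 'b) operator_data \<Rightarrow> ('a, 'r) module \<Rightarrow> (nat \<Rightarrow> 'r \<Rightarrow> 'r) \<Rightarrow> 'r set \<Rightarrow> bool" where
  "D_closed \<D> R \<delta> S \<longleftrightarrow> S \<subseteq> carrier R \<and> \<zero>\<^bsub>R\<^esub> \<in> S \<and> \<one>\<^bsub>R\<^esub> \<in> S \<and>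
     (\<forall>x\<in>S. \<forall>y\<in>S. x \<oplus>\<^bsub>R\<^esub> y \<in> S \<and> x \<ominus>\<^bsub>R\<^esub> y \<in> S \<and> x \<otimes>\<^bsub>R\<^esub> y \<in> S) \<and>
     (\<forall>x\<in>S. (\<forall>a\<in>carrier (Base \<D>). a \<odot>\<^bsub>R\<^esub> x \<in> S) \<and> (\<forall>j\<in>{1..<Len \<D>}. \<delta> j x \<in> S))"

lemma D_closed_carrier:
  assumes "D_ring \<D> R \<delta>"
  shows "D_closed \<D> R \<delta> (carrier R)"
proof -
  have alg: "algebra (Base \<D>) R" using assms unfolding D_ring_def by blast
  interpret R: cring R by (rule algebra.M_cring[OF alg])
  interpret A: algebra "Base \<D>" R by (rule alg)
  show ?thesis using assms unfolding D_closed_def D_ring_def by auto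
qed

lemma dterm_val_closed:
  assumes "D_closed \<D> R \<delta> S" "\<And>c. c \<in> C \<Longrightarrow> \<iota> c \<in> S" "\<And>i. v i \<in> S" "dterm_over \<D> C s"
  shows "dterm_val R \<delta> \<iota> v s \<in> S"
  using assms(4) by (induction s) (use assms(1-3) in \<open>auto simp: D_closed_def\<close>)

lemma D_closed_values:
  assumes R: "D_ring \<D> R \<delta>" "\<And>c. c \<in> C \<Longrightarrow> \<iota> c \<in> carrier R" "\<And>i. v i \<in> carrier R"
  shows "D_closed \<D> R \<delta> (dterm_val R \<delta> \<iota> v ` {s. dterm_over \<D> C s})"
proof -
  let ?S = "dterm_val R \<delta> \<iota> v ` {s. dterm_over \<D> C s}"
  have I: "dterm_val R \<delta> \<iota> v s \<in> ?S" if "dterm_over \<D> C s" for s using that by blast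
  show ?thesis
    unfolding D_closed_def
  proof (intro conjI ballI)
    show "?S \<subseteq> carrier R" by (auto intro!: dterm_val_closed[OF D_closed_carrier[OF R(1)] R(2,3)])
    show "\<zero>\<^bsub>R\<^esub> \<in> ?S" "\<one>\<^bsub>R\<^esub> \<in> ?S" using I[of Zero] I[of One] by simp_all
    fix x assume "x \<in> ?S"
    then obtain s where s: "dterm_over \<D> C s" "x = dterm_val R \<delta> \<iota> v s" by blast
    show "a \<odot>\<^bsub>R\<^esub> x \<in> ?S" if "a \<in> carrier (Base \<D>)" for a using I[of "Scale a s"] s that by simp
    show "\<delta> j x \<in> ?S" if "j \<in> {1..<Len \<D>}" for j using I[of "Deriv j s"] s that by simp
    fix y assume "y \<in> ?S"
    then obtain u where u: "dterm_over \<D> C u" "y = dterm_val R \<delta> \<iota> v u" by blast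
    show "x \<oplus>\<^bsub>R\<^esub> y \<in> ?S" "x \<ominus>\<^bsub>R\<^esub> y \<in> ?S" "x \<otimes>\<^bsub>R\<^esub> y \<in> ?S"
      using I[of "Plus s u"] I[of "Minus s u"] I[of "Times s u"] s u by simp_all
  qed
qed

lemma dterm_val_embedding:
  assumes R: "D_ring \<D> R \<delta>" and S: "D_ring \<D> S \<delta>'" and g: "D_embedding \<D> R \<delta> S \<delta>' g"
    and v: "\<And>c. c \<in> C \<Longrightarrow> \<iota> c \<in> carrier R" "\<And>i. v i \<in> carrier R" and s: "dterm_over \<D> C s"
  shows "dterm_val S \<delta>' (\<lambda>c. g (\<iota> c)) (\<lambda>i. g (v i)) s = g (dterm_val R \<delta> \<iota> v s)"
proof -
  have alg: "algebra (Base \<D>) R" "algebra (Base \<D>) S" using R S unfolding D_ring_def by auto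
  interpret R: cring R by (rule algebra.M_cring[OF alg(1)])
  interpret S: cring S by (rule algebra.M_cring[OF alg(2)])
  have gh: "g \<in> ring_hom R S" using g unfolding D_embedding_def algebra_hom_def by auto
  interpret g: ring_hom_cring R S g by unfold_locales (rule gh)
  have c: "dterm_val R \<delta> \<iota> v s \<in> carrier R" if "dterm_over \<D> C s" for s
    by (rule dterm_val_closed[OF D_closed_carrier[OF R] v that])
  show ?thesis using s
    by (induction s) (use c g in \<open>auto simp: D_embedding_def algebra_hom_def a_minus_def\<close>)
qed

lemma qf_holds_embedding:
  assumes R: "D_ring \<D> R \<delta>" and S: "D_ring \<D> S \<delta>'" and g: "D_embedding \<D> R \<delta> S \<delta>' g"
    and v: "\<And>c. c \<in> C \<Longrightarrow> \<iota> c \<in> carrier R" "\<And>i. v i \<in> carrier R" and \<phi>: "qf_over \<D> C \<phi>"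
  shows "qf_holds S \<delta>' (\<lambda>c. g (\<iota> c)) (\<lambda>i. g (v i)) \<phi> \<longleftrightarrow> qf_holds R \<delta> \<iota> v \<phi>"
  using \<phi>
proof (induction \<phi>)
  case (Eq s u)
  have gi: "inj_on g (carrier R)" using g unfolding D_embedding_def by blast
  have "dterm_val R \<delta> \<iota> v s \<in> carrier R" "dterm_val R \<delta> \<iota> v u \<in> carrier R"
    using dterm_val_closed[OF D_closed_carrier[OF R], where C = C and \<iota> = \<iota> and v = v] v Eq by simp_all
  then show ?case
    using Eq dterm_val_embedding[OF R S g v, where s = s] dterm_val_embedding[OF R S g v, where s = u] inj_onD[OF gi] by auto
qed auto

section \<open>Copies of substructures in another type\<close>

definition transport :: "('a, 'r) module \<Rightarrow> 'r set \<Rightarrow> ('r \<Rightarrow> 'u) \<Rightarrow> ('a, 'u) module" where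
  "transport R S j = (let g = inv_into S j in
     \<lparr>carrier = j ` S, monoid.mult = (\<lambda>x y. j (g x \<otimes>\<^bsub>R\<^esub> g y)), one = j \<one>\<^bsub>R\<^esub>,
      zero = j \<zero>\<^bsub>R\<^esub>, add = (\<lambda>x y. j (g x \<oplus>\<^bsub>R\<^esub> g y)), smult = (\<lambda>a x. j (a \<odot>\<^bsub>R\<^esub> g x))\<rparr>)"

text \<open>Membership in the class is expressed by universal axioms, with the additive inverse
  written by subtraction, and such axioms pass to substructures. Identities are checked in
  \<open>R\<close> after applying the injective map \<open>g\<close>.\<close>

lemma (in op_data) class_K_transport:
  fixes R :: "('a, 'r) module" and j :: "'r \<Rightarrow> 'u"
  assumes R: "class_K \<D> R \<delta>" and S: "D_closed \<D> R \<delta> S" and j: "inj_on j S"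
  defines "g \<equiv> inv_into S j"
  defines "T \<equiv> transport R S j" and "\<delta>T \<equiv> (\<lambda>k x. j (\<delta> k (g x)))"
  shows "class_K \<D> T \<delta>T" and "D_embedding \<D> T \<delta>T R \<delta> g"
proof -
  have DR: "D_ring \<D> R \<delta>" and dom: "domain R" and ch: "char_zero R" using R unfolding class_K_def by auto
  have alg: "algebra (Base \<D>) R" using DR unfolding D_ring_def by blast
  interpret R: op_alg \<D> R by (rule op_algI[OF alg])
  have gj [simp]: "g (j x) = x" if "x \<in> S" for x using that j unfolding g_def by simp
  have T: "carrier T = j ` S" "x \<otimes>\<^bsub>T\<^esub> y = j (g x \<otimes>\<^bsub>R\<^esub> g y)" "x \<oplus>\<^bsub>T\<^esub> y = j (g x \<oplus>\<^bsub>R\<^esub> g y)"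
    "\<one>\<^bsub>T\<^esub> = j \<one>\<^bsub>R\<^esub>" "\<zero>\<^bsub>T\<^esub> = j \<zero>\<^bsub>R\<^esub>" "a \<odot>\<^bsub>T\<^esub> x = j (a \<odot>\<^bsub>R\<^esub> g x)" for x y a
    unfolding T_def transport_def g_def Let_def by simp_all
  have Sc: "x \<in> carrier R" if "x \<in> S" for x using that S unfolding D_closed_def by auto
  have Scl [simp]: "\<zero>\<^bsub>R\<^esub> \<in> S" "\<one>\<^bsub>R\<^esub> \<in> S" "\<lbrakk>x \<in> S; y \<in> S\<rbrakk> \<Longrightarrow> x \<oplus>\<^bsub>R\<^esub> y \<in> S" "\<lbrakk>x \<in> S; y \<in> S\<rbrakk> \<Longrightarrow> x \<ominus>\<^bsub>R\<^esub> y \<in> S"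
    "\<lbrakk>x \<in> S; y \<in> S\<rbrakk> \<Longrightarrow> x \<otimes>\<^bsub>R\<^esub> y \<in> S" "\<lbrakk>a \<in> carrier (Base \<D>); x \<in> S\<rbrakk> \<Longrightarrow> a \<odot>\<^bsub>R\<^esub> x \<in> S"
    "\<lbrakk>k \<in> {1..<Len \<D>}; x \<in> S\<rbrakk> \<Longrightarrow> \<delta> k x \<in> S" for x y a k
    using S unfolding D_closed_def by blast+
  have neg: "\<exists>y\<in>S. y \<oplus>\<^bsub>R\<^esub> x = \<zero>\<^bsub>R\<^esub>" if "x \<in> S" for x
    using Scl(4)[OF Scl(1) that] Sc[OF that] by (intro bexI[of _ "\<ominus>\<^bsub>R\<^esub> x"]) (simp_all add: a_minus_def R.l_neg)
  have cT: "cring T"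
  proof (rule cringI)
    show "abelian_group T"
    proof (rule abelian_groupI)
      fix x assume "x \<in> carrier T"
      then obtain x' where x': "x' \<in> S" "x = j x'" unfolding T by blast
      then obtain y where "y \<in> S" "y \<oplus>\<^bsub>R\<^esub> x' = \<zero>\<^bsub>R\<^esub>" using neg by blast
      then have "j y \<in> carrier T" "j y \<oplus>\<^bsub>T\<^esub> x = \<zero>\<^bsub>T\<^esub>" using x' by (auto simp: T)
      then show "\<exists>y\<in>carrier T. y \<oplus>\<^bsub>T\<^esub> x = \<zero>\<^bsub>T\<^esub>" by blast
    qed (auto simp: T R.a_ac Sc)
    show "comm_monoid T" by (rule comm_monoidI) (auto simp: T R.m_ac Sc)
  qed (auto simp: T R.l_distr Sc)
  interpret T: cring T by (rule cT)
  have aT: "algebra (Base \<D>) T"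
    by (rule algebraI[OF A.is_cring cT])
      (auto simp: T Sc R.RA.smult_l_distr R.RA.smult_r_distr R.RA.smult_assoc1 R.RA.smult_assoc2 R.RA.smult_one)
  interpret T: op_alg \<D> T by (rule op_algI[OF aT])
  have gh: "g \<in> algebra_hom (Base \<D>) T R"
    unfolding algebra_hom_def by (auto simp: T Sc intro!: ring_hom_memI)
  have gi: "inj_on g (carrier T)" by (rule inj_onI) (auto simp: T)
  have gr: "g \<in> ring_hom T R" using gh unfolding algebra_hom_def by auto
  interpret g: ring_hom_cring T R g by unfold_locales (rule gr)
  have gT: "g x \<in> S" if "x \<in> carrier T" for x using that by (auto simp: T)
  have dT: "\<delta>T k x \<in> carrier T" "g (\<delta>T k x) = \<delta> k (g x)" if "k \<in> {1..<Len \<D>}" "x \<in> carrier T" for k x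
    using gT[OF that(2)] that(1) unfolding \<delta>T_def by (auto simp: T)
  have Dm: "D_map \<D> g \<in> ring_hom (D_of \<D> T) (D_of \<D> R)"
    and pm: "\<And>i x. \<lbrakk>i \<le> Last \<D>; x \<in> carrier (D_of \<D> T)\<rbrakk> \<Longrightarrow> pi_over \<D> R i (D_map \<D> g x) = g (pi_over \<D> T i x)"
    using T.D_map_hom[OF alg gh] by auto
  have De: "D_map \<D> g (D_exp \<D> \<delta>T x) = D_exp \<D> \<delta> (g x)" if "x \<in> carrier T" for x
    unfolding D_map_def D_exp_def using dT(2)[OF _ that] by (auto intro!: restrict_ext)
  \<comment> \<open>The induced map on coordinate vectors is injective as well, so identities in
    \<D>(T) can be verified in \<D>(R).\<close>
  have inj: "x = y" if "x \<in> carrier (D_of \<D> T)" "y \<in> carrier (D_of \<D> T)" "D_map \<D> g x = D_map \<D> g y" for x y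
  proof (rule T.D_eqI[OF T.D_ext[OF that(1)] T.D_ext[OF that(2)]])
    fix k assume k: "k < Len \<D>"
    then have "g (x k) = g (y k)" using fun_cong[OF that(3), of k] unfolding D_map_def by simp
    then show "x k = y k" using inj_onD[OF gi] T.D_component[OF that(1) k] T.D_component[OF that(2) k] by blast
  qed
  have ec: "D_exp \<D> \<delta>T x \<in> carrier (D_of \<D> T)" if "x \<in> carrier T" for x
    unfolding T.D_carrier D_exp_def using dT(1)[OF _ that] that by auto
  interpret DT: cring "D_of \<D> T" by (rule T.D_cring)
  interpret m: ring_hom_cring "D_of \<D> T" "D_of \<D> R" "D_map \<D> g"
    by (intro ring_hom_cring.intro ring_hom_cring_axioms.intro T.D_cring R.D_cring Dm)
  have eh: "D_exp \<D> \<delta> \<in> ring_hom R (D_of \<D> R)" by (rule R.D_exp_hom[OF DR])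
  have "D_exp \<D> \<delta>T \<in> algebra_hom (Base \<D>) T (D_of \<D> T)"
    unfolding algebra_hom_def
  proof (intro CollectI conjI ballI)
    show "D_exp \<D> \<delta>T \<in> ring_hom T (D_of \<D> T)"
    proof (rule ring_hom_memI)
      fix x y assume xy: "x \<in> carrier T" "y \<in> carrier T"
      show "D_exp \<D> \<delta>T x \<in> carrier (D_of \<D> T)" using ec xy by simp
      show "D_exp \<D> \<delta>T (x \<otimes>\<^bsub>T\<^esub> y) = D_exp \<D> \<delta>T x \<otimes>\<^bsub>D_of \<D> T\<^esub> D_exp \<D> \<delta>T y"
        by (rule inj) (use xy ec in \<open>simp_all add: De ring_hom_mult[OF eh]\<close>)
      show "D_exp \<D> \<delta>T (x \<oplus>\<^bsub>T\<^esub> y) = D_exp \<D> \<delta>T x \<oplus>\<^bsub>D_of \<D> T\<^esub> D_exp \<D> \<delta>T y"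
        by (rule inj) (use xy ec in \<open>simp_all add: De ring_hom_add[OF eh]\<close>)
    next
      show "D_exp \<D> \<delta>T \<one>\<^bsub>T\<^esub> = \<one>\<^bsub>D_of \<D> T\<^esub>"
        by (rule inj) (use ec in \<open>simp_all add: De ring_hom_one[OF eh]\<close>)
    qed
    fix a x assume ax: "a \<in> carrier (Base \<D>)" "x \<in> carrier T"
    have sm: "a \<odot>\<^bsub>D_of \<D> T\<^esub> D_exp \<D> \<delta>T x \<in> carrier (D_of \<D> T)"
      using ax T.D_component[OF ec[OF ax(2)]] unfolding T.D_carrier by (auto simp: D_of_def)
    have "D_map \<D> g (a \<odot>\<^bsub>D_of \<D> T\<^esub> D_exp \<D> \<delta>T x) = a \<odot>\<^bsub>D_of \<D> R\<^esub> D_map \<D> g (D_exp \<D> \<delta>T x)"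
      using gh ax T.D_component[OF ec[OF ax(2)]] unfolding algebra_hom_def D_map_def
      by (auto simp: D_of_def intro!: restrict_ext)
    also have "\<dots> = D_map \<D> g (D_exp \<D> \<delta>T (a \<odot>\<^bsub>T\<^esub> x))"
      using De ax gh DR unfolding algebra_hom_def D_ring_def by simp
    finally show "D_exp \<D> \<delta>T (a \<odot>\<^bsub>T\<^esub> x) = a \<odot>\<^bsub>D_of \<D> T\<^esub> D_exp \<D> \<delta>T x"
      using inj[OF ec sm] ax by simp
  qed
  then have "D_ring \<D> T \<delta>T" unfolding D_ring_def using aT dT by auto
  moreover have "domain T"
  proof (rule domainI[OF cT])
    show "\<one>\<^bsub>T\<^esub> \<noteq> \<zero>\<^bsub>T\<^esub>" using g.hom_one g.hom_zero domain.one_not_zero[OF dom] by metis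
    fix a b assume ab: "a \<otimes>\<^bsub>T\<^esub> b = \<zero>\<^bsub>T\<^esub>" "a \<in> carrier T" "b \<in> carrier T"
    then have "g a \<otimes>\<^bsub>R\<^esub> g b = \<zero>\<^bsub>R\<^esub>" using g.hom_mult[of a b] by simp
    then have "g a = \<zero>\<^bsub>R\<^esub> \<or> g b = \<zero>\<^bsub>R\<^esub>" using domain.integral[OF dom] ab by simp
    then show "a = \<zero>\<^bsub>T\<^esub> \<or> b = \<zero>\<^bsub>T\<^esub>" using inj_onD[OF gi, of _ "\<zero>\<^bsub>T\<^esub>"] ab by auto
  qed
  moreover have "char_zero T"
    unfolding char_zero_def
  proof (intro allI impI notI)
    fix n :: nat assume n: "0 < n" "[n] \<cdot>\<^bsub>T\<^esub> \<one>\<^bsub>T\<^esub> = \<zero>\<^bsub>T\<^esub>"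
    have "g ([n] \<cdot>\<^bsub>T\<^esub> \<one>\<^bsub>T\<^esub>) = [n] \<cdot>\<^bsub>R\<^esub> \<one>\<^bsub>R\<^esub>" by (induction n) auto
    then show False using n ch unfolding char_zero_def by auto
  qed
  moreover have "inj_on (assoc_endo \<D> T \<delta>T i) (carrier T)" if "i \<le> Last \<D>" for i
  proof (rule inj_onI)
    have ga: "g (assoc_endo \<D> T \<delta>T i x) = assoc_endo \<D> R \<delta> i (g x)" if "x \<in> carrier T" for x
      unfolding assoc_endo_def using pm[OF \<open>i \<le> Last \<D>\<close> ec[OF that]] De[OF that] by simp
    fix x y assume xy: "x \<in> carrier T" "y \<in> carrier T" "assoc_endo \<D> T \<delta>T i x = assoc_endo \<D> T \<delta>T i y"
    then have "assoc_endo \<D> R \<delta> i (g x) = assoc_endo \<D> R \<delta> i (g y)" using ga by metis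
    then have "g x = g y" using inj_onD[OF R.assoc_endo_inj[OF R that]] xy(1,2) by simp
    then show "x = y" using inj_onD[OF gi] xy by blast
  qed
  ultimately show "class_K \<D> T \<delta>T" unfolding class_K_def by auto
  show "D_embedding \<D> T \<delta>T R \<delta> g" unfolding D_embedding_def using gh gi dT(2) by auto
qed

section \<open>Downward Loewenheim-Skolem\<close>

text \<open>Codes terms by elements of the parameter set, given a pairing \<open>p\<close>, distinct
  elements \<open>n i\<close> and an embedding \<open>h\<close> of the scalars. The first component
  of a code identifies the constructor.\<close>

primrec dterm_code :: "('k \<times> 'k \<Rightarrow> 'k) \<Rightarrow> (nat \<Rightarrow> 'k) \<Rightarrow> ('a \<Rightarrow> 'k) \<Rightarrow> ('a, 'k) dterm \<Rightarrow> 'k" where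
  "dterm_code p n h (Var i) = p (n 0, n i)"
| "dterm_code p n h (Param c) = p (n 1, c)"
| "dterm_code p n h Zero = p (n 2, n 0)"
| "dterm_code p n h One = p (n 3, n 0)"
| "dterm_code p n h (Plus s u) = p (n 4, p (dterm_code p n h s, dterm_code p n h u))"
| "dterm_code p n h (Minus s u) = p (n 5, p (dterm_code p n h s, dterm_code p n h u))"
| "dterm_code p n h (Times s u) = p (n 6, p (dterm_code p n h s, dterm_code p n h u))"
| "dterm_code p n h (Scale a s) = p (n 7, p (h a, dterm_code p n h s))"
| "dterm_code p n h (Deriv j s) = p (n 8, p (n j, dterm_code p n h s))"

lemma dterm_code_inj:
  assumes p: "inj_on p (C \<times> C)" "\<And>x. x \<in> C \<times> C \<Longrightarrow> p x \<in> C" and n: "inj n" "\<And>i. n i \<in> C"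
    and h: "inj_on h (carrier (Base \<D>))" "\<And>a. a \<in> carrier (Base \<D>) \<Longrightarrow> h a \<in> C"
  shows "inj_on (dterm_code p n h) {s. dterm_over \<D> C s}"
proof (rule inj_onI)
  have c: "dterm_code p n h s \<in> C" if "dterm_over \<D> C s" for s
    using that by (induction s) (auto intro!: p(2) n(2) h(2))
  have pe: "p (x, y) = p (x', y') \<longleftrightarrow> x = x' \<and> y = y'" if "x \<in> C" "y \<in> C" "x' \<in> C" "y' \<in> C" for x y x' y'
    using inj_onD[OF p(1), of "(x, y)" "(x', y')"] that by auto
  have pc: "p (x, y) \<in> C" if "x \<in> C" "y \<in> C" for x y using p(2) that by simp
  have ne: "n i = n k \<longleftrightarrow> i = k" for i k using n(1) by (simp add: inj_eq)
  have he: "h a = h b \<longleftrightarrow> a = b" if "a \<in> carrier (Base \<D>)" "b \<in> carrier (Base \<D>)" for a b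
    using h(1) that by (auto dest: inj_onD)
  have "s = u" if "dterm_over \<D> C s" "dterm_over \<D> C u" "dterm_code p n h s = dterm_code p n h u" for s u
    using that
  proof (induction s arbitrary: u)
    case (Var i) then show ?case by (cases u) (simp_all add: c pe pc ne he n(2) h(2))
  next
    case (Param c) then show ?case by (cases u) (simp_all add: c pe pc ne he n(2) h(2))
  next
    case Zero then show ?case by (cases u) (simp_all add: c pe pc ne he n(2) h(2))
  next
    case One then show ?case by (cases u) (simp_all add: c pe pc ne he n(2) h(2))
  next
    case (Plus s1 s2) show ?case using Plus.prems by (cases u) (auto simp: c pe pc ne he n(2) h(2) intro: Plus.IH)
  next
    case (Minus s1 s2) show ?case using Minus.prems by (cases u) (auto simp: c pe pc ne he n(2) h(2) intro: Minus.IH)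
  next
    case (Times s1 s2) show ?case using Times.prems by (cases u) (auto simp: c pe pc ne he n(2) h(2) intro: Times.IH)
  next
    case (Scale a s1) show ?case using Scale.prems by (cases u) (auto simp: c pe pc ne he n(2) h(2) intro: Scale.IH)
  next
    case (Deriv j s1) show ?case using Deriv.prems by (cases u) (auto simp: c pe pc ne he n(2) h(2) intro: Deriv.IH)
  qed
  then show "s = u" if "s \<in> {s. dterm_over \<D> C s}" "u \<in> {s. dterm_over \<D> C s}"
    "dterm_code p n h s = dterm_code p n h u" for s u using that by simp
qed

text \<open>Makes the ring infinite, so that pairs of its elements can be coded by its
  elements.\<close>

lemma (in op_alg) char_zero_inj:
  assumes "char_zero R"
  shows "inj (\<lambda>n::nat. [n] \<cdot> \<one>)"
proof -
  have False if "m < n" "[m] \<cdot> \<one> = [n] \<cdot> \<one>" for m n :: nat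
  proof -
    have "[n] \<cdot> \<one> = ([m] \<cdot> \<one>) \<oplus> ([(n - m)] \<cdot> \<one>)" using that(1) by (simp add: add.nat_pow_mult)
    then have "[(n - m)] \<cdot> \<one> = \<zero>" using that(2) by simp
    then show False using assms that(1) unfolding char_zero_def by simp
  qed
  then show ?thesis by (intro injI) (metis linorder_neqE_nat)
qed

text \<open>Nonzero scalars are invertible, so none of them can kill the unit. In particular A
  embeds in \<open>K\<close>, as the coding of scalar multiplication requires.\<close>

lemma (in op_alg) base_inj:
  assumes "\<one> \<noteq> \<zero>"
  shows "inj_on (\<lambda>a. a \<odot> \<one>) (carrier (Base \<D>))"
proof (rule inj_onI)
  fix a b assume ab: "a \<in> carrier (Base \<D>)" "b \<in> carrier (Base \<D>)" "a \<odot> \<one> = b \<odot> \<one>"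
  define c where "c = a \<ominus>\<^bsub>Base \<D>\<^esub> b"
  have c: "c \<in> carrier (Base \<D>)" "c \<odot> \<one> = \<zero>" unfolding c_def using ab
    by (auto simp: a_minus_def RA.smult_l_distr RA.smult_l_minus r_neg)
  have "c = \<zero>\<^bsub>Base \<D>\<^esub>"
  proof (rule ccontr)
    assume "c \<noteq> \<zero>\<^bsub>Base \<D>\<^esub>"
    then have "c \<in> Units (Base \<D>)" using c(1) A.field_Units by simp
    then have "inv\<^bsub>Base \<D>\<^esub> c \<otimes>\<^bsub>Base \<D>\<^esub> c = \<one>\<^bsub>Base \<D>\<^esub>" "inv\<^bsub>Base \<D>\<^esub> c \<in> carrier (Base \<D>)" by simp_all
    then have "\<one> = inv\<^bsub>Base \<D>\<^esub> c \<odot> (c \<odot> \<one>)" using c(1) by (simp add: RA.smult_assoc1[symmetric] RA.smult_one)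
    then show False using c(2) assms \<open>inv\<^bsub>Base \<D>\<^esub> c \<in> carrier (Base \<D>)\<close> by simp
  qed
  then show "a = b" using ab(1,2) unfolding c_def by simp
qed

text \<open>Frees the extension from the type \<open>'u\<close>, in which the hulls constructed
  below do not live. A quantifier-free formula true in \<open>R\<close> remains true in the
  substructure formed by the values of terms, and a copy of this substructure in \<open>'u\<close>
  is an admissible extension of \<open>K\<close>.\<close>

theorem (in op_data) existentially_closed_any:
  fixes K :: "('a, 'k) module" and R :: "('a, 'r) module"
  assumes ec: "existentially_closed TYPE('u) \<D> K \<delta>" and f: "\<exists>f :: 'k \<Rightarrow> 'u. inj_on f (carrier K)"
    and K: "class_K \<D> K \<delta>" and R: "class_K \<D> R \<delta>'" and \<iota>: "D_embedding \<D> K \<delta> R \<delta>' \<iota>"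
    and \<phi>: "qf_over \<D> (carrier K) \<phi>" and v: "\<And>i. v i \<in> carrier R" "qf_holds R \<delta>' \<iota> v \<phi>"
  shows "\<exists>w. (\<forall>i. w i \<in> carrier K) \<and> qf_holds K \<delta> (\<lambda>c. c) w \<phi>"
proof -
  have DK: "D_ring \<D> K \<delta>" and domK: "domain K" and chK: "char_zero K" using K unfolding class_K_def by auto
  have DR: "D_ring \<D> R \<delta>'" using R unfolding class_K_def by auto
  have algK: "algebra (Base \<D>) K" using DK unfolding D_ring_def by blast
  have algR: "algebra (Base \<D>) R" using DR unfolding D_ring_def by blast
  interpret K: op_alg \<D> K by (rule op_algI[OF algK])
  interpret R: op_alg \<D> R by (rule op_algI[OF algR])
  obtain f :: "'k \<Rightarrow> 'u" where f: "inj_on f (carrier K)" using f by blast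
  have ia: "\<iota> \<in> algebra_hom (Base \<D>) K R" using \<iota> unfolding D_embedding_def by blast
  then have ih: "\<iota> \<in> ring_hom K R" unfolding algebra_hom_def by auto
  have ic: "\<iota> c \<in> carrier R" if "c \<in> carrier K" for c using ring_hom_closed[OF ih that] .
  let ?n = "\<lambda>i::nat. [i] \<cdot>\<^bsub>K\<^esub> \<one>\<^bsub>K\<^esub>" and ?h = "\<lambda>a. a \<odot>\<^bsub>K\<^esub> \<one>\<^bsub>K\<^esub>"
  have n: "inj ?n" by (rule K.char_zero_inj[OF chK])
  have h: "inj_on ?h (carrier (Base \<D>))" by (rule K.base_inj[OF domain.one_not_zero[OF domK]])
  \<comment> \<open>The integer multiples of one make \<open>K\<close> infinite; this provides the
    pairing \<open>p\<close> for the codes.\<close>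
  have "range ?n \<subseteq> carrier K" by auto
  then have "infinite (carrier K)" using n range_inj_infinite infinite_super by blast
  then have "(card_of (carrier K \<times> carrier K), card_of (carrier K)) \<in> ordLeq" using card_of_Times_same_infinite ordIso_iff_ordLeq by blast
  then obtain p where p: "inj_on p (carrier K \<times> carrier K)" "p ` (carrier K \<times> carrier K) \<subseteq> carrier K"
    using card_of_ordLeq by metis
  \<comment> \<open>The values of terms form a substructure no larger than \<open>K\<close>, so it has a copy in \<open>'u\<close>.\<close>
  let ?O = "{s. dterm_over \<D> (carrier K) s}"
  let ?V = "dterm_val R \<delta>' \<iota> v"
  define S where "S = ?V ` ?O"
  have code: "inj_on (dterm_code p ?n ?h) ?O" by (rule dterm_code_inj[OF p(1) _ n _ h]) (use p(2) in auto)
  have codec: "dterm_code p ?n ?h s \<in> carrier K" if "dterm_over \<D> (carrier K) s" for s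
    using that
  proof -
    have "p x \<in> carrier K" if "x \<in> carrier K \<times> carrier K" for x using p(2) that by blast
    then show ?thesis using that by (induction s) simp_all
  qed
  define j where "j = (\<lambda>x. f (dterm_code p ?n ?h (inv_into ?O ?V x)))"
  have j: "inj_on j S"
  proof (rule inj_onI)
    fix x y assume xy: "x \<in> S" "y \<in> S" "j x = j y"
    let ?s = "inv_into ?O ?V x" and ?u = "inv_into ?O ?V y"
    have su: "?s \<in> ?O" "?u \<in> ?O" "?V ?s = x" "?V ?u = y"
      using xy(1,2) inv_into_into[of _ ?V ?O] f_inv_into_f[of _ ?V ?O] unfolding S_def by blast+
    have "dterm_code p ?n ?h ?s = dterm_code p ?n ?h ?u"
      by (rule inj_onD[OF f]) (use xy(3) codec su(1,2) in \<open>simp_all add: j_def\<close>)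
    then have "?s = ?u" by (rule inj_onD[OF code _ su(1,2)])
    then have "?V ?s = ?V ?u" by (rule arg_cong)
    then show "x = y" unfolding su(3,4) .
  qed
  have Sc: "D_closed \<D> R \<delta>' S" unfolding S_def by (rule D_closed_values[OF DR ic v(1)])
  define g where "g = inv_into S j"
  define T where "T = transport R S j"
  define \<delta>T where "\<delta>T = (\<lambda>k x. j (\<delta>' k (g x)))"
  have T: "class_K \<D> T \<delta>T" "D_embedding \<D> T \<delta>T R \<delta>' g"
    unfolding T_def \<delta>T_def g_def by (rule class_K_transport[OF R Sc j])+
  have gj: "g (j x) = x" if "x \<in> S" for x using that j unfolding g_def by simp
  have Tc: "carrier T = j ` S" unfolding T_def transport_def Let_def by simp
  have Scl: "\<one>\<^bsub>R\<^esub> \<in> S" "\<lbrakk>x \<in> S; y \<in> S\<rbrakk> \<Longrightarrow> x \<oplus>\<^bsub>R\<^esub> y \<in> S" "\<lbrakk>x \<in> S; y \<in> S\<rbrakk> \<Longrightarrow> x \<otimes>\<^bsub>R\<^esub> y \<in> S"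
    "\<lbrakk>a \<in> carrier (Base \<D>); x \<in> S\<rbrakk> \<Longrightarrow> a \<odot>\<^bsub>R\<^esub> x \<in> S" for x y a
    using Sc unfolding D_closed_def by blast+
  have iS: "\<iota> c \<in> S" if "c \<in> carrier K" for c
    unfolding S_def using that by (intro image_eqI[of _ _ "Param c"]) auto
  have vS: "v i \<in> S" for i unfolding S_def by (intro image_eqI[of _ _ "Var i"]) auto
  have jT: "j x \<in> carrier T" if "x \<in> S" for x using that Tc by simp
  have gi: "inj_on g (carrier T)" and ga: "g \<in> algebra_hom (Base \<D>) T R"
    using T(2) unfolding D_embedding_def by auto
  have DT: "D_ring \<D> T \<delta>T" using T(1) unfolding class_K_def by auto
  have algT: "algebra (Base \<D>) T" using DT unfolding D_ring_def by blast
  interpret T: op_alg \<D> T by (rule op_algI[OF algT])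
  have gr: "g \<in> ring_hom T R" using ga unfolding algebra_hom_def by auto
  let ?i = "\<lambda>c. j (\<iota> c)"
  have icT: "?i c \<in> carrier T" if "c \<in> carrier K" for c using iS[OF that] Tc by auto
  have inj: "x = y" if "x \<in> carrier T" "y \<in> carrier T" "g x = g y" for x y using inj_onD[OF gi] that by blast
  have "?i \<in> algebra_hom (Base \<D>) K T"
    unfolding algebra_hom_def
  proof (intro CollectI conjI ballI)
    show "?i \<in> ring_hom K T"
    proof (rule ring_hom_memI)
      fix x y assume xy: "x \<in> carrier K" "y \<in> carrier K"
      show "?i x \<in> carrier T" by (rule icT[OF xy(1)])
      show "?i (x \<otimes>\<^bsub>K\<^esub> y) = ?i x \<otimes>\<^bsub>T\<^esub> ?i y"
        by (rule inj) (use xy icT in \<open>simp_all add: gj iS Scl jT ring_hom_mult[OF gr] ring_hom_mult[OF ih]\<close>)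
      show "?i (x \<oplus>\<^bsub>K\<^esub> y) = ?i x \<oplus>\<^bsub>T\<^esub> ?i y"
        by (rule inj) (use xy icT in \<open>simp_all add: gj iS Scl jT ring_hom_add[OF gr] ring_hom_add[OF ih]\<close>)
    next
      show "?i \<one>\<^bsub>K\<^esub> = \<one>\<^bsub>T\<^esub>"
        by (rule inj) (use icT in \<open>simp_all add: gj iS Scl jT ring_hom_one[OF gr] ring_hom_one[OF ih]\<close>)
    qed
    fix a x assume ax: "a \<in> carrier (Base \<D>)" "x \<in> carrier K"
    show "?i (a \<odot>\<^bsub>K\<^esub> x) = a \<odot>\<^bsub>T\<^esub> ?i x"
      by (rule inj) (use ax icT ga ia in \<open>simp_all add: gj iS Scl jT algebra_hom_def\<close>)
  qed
  moreover have "inj_on ?i (carrier K)"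
  proof (rule inj_onI)
    fix x y assume xy: "x \<in> carrier K" "y \<in> carrier K" "?i x = ?i y"
    have "g (?i x) = g (?i y)" by (rule arg_cong[OF xy(3)])
    then have "\<iota> x = \<iota> y" unfolding gj[OF iS[OF xy(1)]] gj[OF iS[OF xy(2)]] .
    moreover have "inj_on \<iota> (carrier K)" using \<iota> unfolding D_embedding_def by blast
    ultimately show "x = y" using inj_onD xy(1,2) by metis
  qed
  moreover have "\<forall>k\<in>{1..<Len \<D>}. \<forall>x\<in>carrier K. ?i (\<delta> k x) = \<delta>T k (?i x)"
    using \<iota> gj[OF iS] unfolding \<delta>T_def D_embedding_def by simp
  ultimately have emb: "D_embedding \<D> K \<delta> T \<delta>T ?i" unfolding D_embedding_def by blast
  have "qf_holds T \<delta>T ?i (\<lambda>i. j (v i)) \<phi>"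
  proof -
    \<comment> \<open>The maps \<open>j\<close> and \<open>g\<close> are mutually inverse only over
      \<open>S\<close>, so parameters and variables are compared through membership of their values
      in \<open>S\<close>.\<close>
    have eq: "dterm_val R \<delta>' (\<lambda>c. g (?i c)) (\<lambda>i. g (j (v i))) s = ?V s" if "dterm_over \<D> (carrier K) s" for s
      using that by (induction s) (auto simp: gj iS vS)
    have "qf_holds R \<delta>' (\<lambda>c. g (?i c)) (\<lambda>i. g (j (v i))) \<psi> \<longleftrightarrow> qf_holds R \<delta>' \<iota> v \<psi>"
      if "qf_over \<D> (carrier K) \<psi>" for \<psi>
      using that by (induction \<psi>) (auto simp: eq)
    then show ?thesis
      using qf_holds_embedding[where \<iota> = ?i and v = "\<lambda>i. j (v i)" and C = "carrier K", OF DT DR T(2) icT] vS jT \<phi> v(2) by auto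
  qed
  moreover have "\<forall>i. j (v i) \<in> carrier T" using vS Tc by auto
  ultimately have "ex_sentence_true T \<delta>T ?i \<phi>" unfolding ex_sentence_true_def
    by (intro exI[of _ "\<lambda>i. j (v i)"]) simp
  then have "ex_sentence_true K \<delta> (\<lambda>c. c) \<phi>"
    using ec T(1) emb \<phi> unfolding existentially_closed_def by blast
  then show ?thesis unfolding ex_sentence_true_def .
qed

subsection \<open>Prolongations\<close>

lemma primeideal_preimage:
  assumes R: "cring R" and S: "cring S" and f: "f \<in> ring_hom R S" and p: "primeideal p S"
  shows "primeideal {x \<in> carrier R. f x \<in> p} R"
proof -
  interpret R: cring R by fact
  interpret S: cring S by fact
  interpret f: ring_hom_cring R S f by unfold_locales (rule f)
  interpret p: primeideal p S by fact
  show ?thesis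
  proof (rule primeidealI)
    show "ideal {x \<in> carrier R. f x \<in> p} R"
    proof (rule idealI[OF R.ring_axioms])
      show "subgroup {x \<in> carrier R. f x \<in> p} (add_monoid R)"
        by (rule subgroup.intro) (auto simp: a_inv_def[symmetric])
    qed (auto simp: p.I_l_closed p.I_r_closed)
    show "carrier R \<noteq> {x \<in> carrier R. f x \<in> p}"
    proof
      assume eq: "carrier R = {x \<in> carrier R. f x \<in> p}"
      have "\<one>\<^bsub>R\<^esub> \<in> {x \<in> carrier R. f x \<in> p}" using R.one_closed by (simp only: eq[symmetric])
      then have "\<one>\<^bsub>S\<^esub> \<in> p" by simp
      then show False using p.one_imp_carrier p.I_notcarr by simp
    qed
    show "a \<in> {x \<in> carrier R. f x \<in> p} \<or> b \<in> {x \<in> carrier R. f x \<in> p}"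
      if "a \<in> carrier R" "b \<in> carrier R" "a \<otimes>\<^bsub>R\<^esub> b \<in> {x \<in> carrier R. f x \<in> p}" for a b
      using that p.I_prime[of "f a" "f b"] by auto
  qed (rule R)
qed

lemma primeideal_kernel:
  assumes "cring R" "domain S" "f \<in> ring_hom R S"
  shows "primeideal {x \<in> carrier R. f x = \<zero>\<^bsub>S\<^esub>} R"
  using primeideal_preimage[OF assms(1) _ assms(3) domain.zeroprimeideal[OF assms(2)]]
    domain.axioms(1)[OF assms(2)] by simp

locale D_domain = op_data \<D> for \<D> :: "('a, 'd, 'b) operator_data" +
  fixes K :: "('a, 'k) module" and \<delta> :: "nat \<Rightarrow> 'k \<Rightarrow> 'k"
  assumes K: "class_K \<D> K \<delta>"
begin

lemma DK: "D_ring \<D> K \<delta>" and domK: "domain K" and chK: "char_zero K"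
  using K unfolding class_K_def by auto

lemma algK: "algebra (Base \<D>) K" using DK unfolding D_ring_def by blast

end

sublocale D_domain \<subseteq> K: op_alg \<D> K by (rule op_algI[OF algK])

sublocale D_domain \<subseteq> MB: mpoly_base K by unfold_locales

context D_domain
begin

abbreviation "U n \<equiv> mpoly K {..<n::nat}"
abbreviation "PR n \<equiv> prol_ring \<D> K n"
abbreviation "pv n \<equiv> prol_vars \<D> n"
abbreviation "Cn \<equiv> ring.indexed_const K"
abbreviation "Vr \<equiv> ring.indexed_var K"
abbreviation "\<tau> i \<equiv> assoc_endo \<D> K \<delta> i"
text \<open>The conjugate of a polynomial by \<sigma>_i; the conjugates of the elements of
  \<open>I\<close> define the conjugate variety.\<close>

definition "cj i P = (\<lambda>m. \<tau> i (P m))"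
abbreviation "prol n \<equiv> prol_coeff \<D> K \<delta> n"
abbreviation "gen k \<equiv> generic_point \<D> K k"

lemma PR_algebra: "algebra (Base \<D>) (PR n)"
  unfolding prol_ring_def by (rule MB.mpoly_algebra[OF algK])

lemma PR_op_alg: "op_alg \<D> (PR n)" by (rule op_algI[OF PR_algebra])

lemma PR_cring: "cring (PR n)" and U_cring: "cring (U n)"
  unfolding prol_ring_def by (rule MB.mpoly_cring)+

lemma mpoly_smult: "a \<odot>\<^bsub>mpoly K V\<^esub> P = (\<lambda>m. a \<odot>\<^bsub>K\<^esub> P m)"
  unfolding mpoly_def by simp

lemma const_algebra_hom: "Cn \<in> algebra_hom (Base \<D>) K (mpoly K V)"
  unfolding algebra_hom_def
  by (auto simp: MB.const_hom mpoly_smult MB.indexed_const_mono mmono_def)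

lemma mpoly_eval_algebra_hom:
  assumes S: "algebra (Base \<D>) S" and h: "h \<in> algebra_hom (Base \<D>) K S" and y: "y \<in> V \<rightarrow> carrier S"
  shows "mpoly_eval K S h y \<in> algebra_hom (Base \<D>) (mpoly K V) S"
proof -
  interpret S: cring S by (rule algebra.M_cring[OF S])
  have hr: "h \<in> ring_hom K S" using h unfolding algebra_hom_def by auto
  show ?thesis
  proof (rule algebra_hom_of_scalars[OF MB.mpoly_algebra[OF algK] S MB.mpoly_eval_hom[OF S.is_cring hr y]])
    fix a assume a: "a \<in> carrier (Base \<D>)"
    have "a \<odot>\<^bsub>mpoly K V\<^esub> \<one>\<^bsub>mpoly K V\<^esub> = Cn (a \<odot>\<^bsub>K\<^esub> \<one>\<^bsub>K\<^esub>)"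
      using const_algebra_hom[of V] ring_hom_one[OF MB.const_hom, of V] a unfolding algebra_hom_def by simp
    then show "mpoly_eval K S h y (a \<odot>\<^bsub>mpoly K V\<^esub> \<one>\<^bsub>mpoly K V\<^esub>) = a \<odot>\<^bsub>S\<^esub> \<one>\<^bsub>S\<^esub>"
      using h a ring_hom_one[OF hr] unfolding algebra_hom_def by (simp add: MB.mpoly_eval_const[OF S.is_cring hr])
  qed
qed

lemma gen_closed: "k < n \<Longrightarrow> gen k \<in> carrier (D_of \<D> (PR n))"
proof -
  interpret P: op_alg \<D> "PR n" by (rule PR_op_alg)
  show "k < n \<Longrightarrow> gen k \<in> carrier (D_of \<D> (PR n))"
    unfolding P.D_carrier unfolding generic_point_def prol_ring_def
    by (auto intro!: MB.var_closed simp: prol_vars_def)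
qed

lemma coeff_hom: "D_map \<D> Cn \<circ> D_exp \<D> \<delta> \<in> ring_hom K (D_of \<D> (PR n))"
  by (rule ring_hom_trans[OF K.D_exp_hom[OF DK] K.D_map_hom(1)[OF PR_algebra]])
    (simp add: prol_ring_def const_algebra_hom)

lemma prol_eq: "prol n = mpoly_eval K (D_of \<D> (PR n)) (D_map \<D> Cn \<circ> D_exp \<D> \<delta>) (generic_point \<D> K)"
  unfolding prol_coeff_def D_map_def comp_def ..

lemma prol_hom: "prol n \<in> ring_hom (U n) (D_of \<D> (PR n))"
  unfolding prol_eq
  by (rule MB.mpoly_eval_hom[OF op_alg.D_cring[OF PR_op_alg] coeff_hom]) (auto simp: gen_closed)

lemma prol_const: "c \<in> carrier K \<Longrightarrow> prol n (Cn c) = D_map \<D> Cn (D_exp \<D> \<delta> c)"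
  unfolding prol_eq using MB.mpoly_eval_const[OF op_alg.D_cring[OF PR_op_alg] coeff_hom] by simp

lemma prol_var: "k < n \<Longrightarrow> prol n (Vr k) = gen k"
  unfolding prol_eq
  using MB.mpoly_eval_var[OF op_alg.D_cring[OF PR_op_alg] coeff_hom, of "generic_point \<D> K" k] gen_closed by simp

text \<open>The universal property of the prolongation: a homomorphism from K[x] to \<D>(S) over the
  operators of \<open>K\<close> comes from the homomorphism \<open>g\<close> that takes the
  variables (j, k) to the coordinates of the image of the k-th variable.\<close>

lemma prol_eval:
  assumes S: "algebra (Base \<D>) S" and E: "E \<in> ring_hom (U n) (D_of \<D> S)" and g: "g \<in> algebra_hom (Base \<D>) (PR n) S"
    and Ec: "\<And>c. c \<in> carrier K \<Longrightarrow> E (Cn c) = (\<lambda>j\<in>{..<Len \<D>}. g (Cn (D_exp \<D> \<delta> c j)))"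
    and Ev: "\<And>k. k < n \<Longrightarrow> E (Vr k) = (\<lambda>j\<in>{..<Len \<D>}. g (Vr (j, k)))"
    and P: "P \<in> carrier (U n)"
  shows "E P = D_map \<D> g (prol n P)"
proof -
  interpret S: op_alg \<D> S by (rule op_algI[OF S])
  have "E P = (D_map \<D> g \<circ> prol n) P"
  proof (rule MB.mpoly_hom_unique[OF cring.axioms(1)[OF S.D_cring] E _ _ _ P])
    show "D_map \<D> g \<circ> prol n \<in> ring_hom (U n) (D_of \<D> S)"
      by (rule ring_hom_trans[OF prol_hom op_alg.D_map_hom(1)[OF PR_op_alg S g]])
    show "E (Cn c) = (D_map \<D> g \<circ> prol n) (Cn c)" if "c \<in> carrier K" for c
      using Ec[OF that] prol_const[OF that] by (auto simp: D_map_def intro!: restrict_ext)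
    show "E (Vr k) = (D_map \<D> g \<circ> prol n) (Vr k)" if "k \<in> {..<n}" for k
      using that Ev[of k] prol_var[of k n] by (auto simp: D_map_def generic_point_def intro!: restrict_ext)
  qed
  then show ?thesis by simp
qed

lemma prol_closed: "\<lbrakk>P \<in> carrier (U n); j < Len \<D>\<rbrakk> \<Longrightarrow> prol n P j \<in> carrier (PR n)"
  using op_alg.D_component[OF PR_op_alg ring_hom_closed[OF prol_hom]] by blast

text \<open>The comorphism of the i-th projection of the prolongation, on the level of the ambient
  polynomial rings.\<close>

abbreviation "pull n i \<equiv> mpoly_eval K (PR n) Cn (\<lambda>k. pi_over \<D> (PR n) i (gen k))"

lemma pull_hom: "i \<le> Last \<D> \<Longrightarrow> pull n i \<in> ring_hom (U n) (PR n)"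
  using MB.const_hom[of "pv n"] op_alg.pi_closed[OF PR_op_alg _ gen_closed]
  by (intro MB.mpoly_eval_hom[OF PR_cring]) (auto simp: prol_ring_def)

lemma \<tau>_hom: "i \<le> Last \<D> \<Longrightarrow> \<tau> i \<in> ring_hom K K"
  by (rule K.assoc_endo_hom[OF DK])

lemma conj_hom: "i \<le> Last \<D> \<Longrightarrow> cj i \<in> ring_hom (mpoly K V) (mpoly K V)"
  unfolding cj_def[abs_def] by (rule MB.mpoly_map_hom[OF K.R.is_cring \<tau>_hom])

lemma \<tau>_01: "i \<le> Last \<D> \<Longrightarrow> \<tau> i \<zero>\<^bsub>K\<^esub> = \<zero>\<^bsub>K\<^esub>" "i \<le> Last \<D> \<Longrightarrow> \<tau> i \<one>\<^bsub>K\<^esub> = \<one>\<^bsub>K\<^esub>"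
  using ring_hom_zero[OF \<tau>_hom K.R.ring_axioms K.R.ring_axioms] ring_hom_one[OF \<tau>_hom] by auto

lemma conj_const: "i \<le> Last \<D> \<Longrightarrow> cj i (Cn c) = Cn (\<tau> i c)"
  and conj_var: "i \<le> Last \<D> \<Longrightarrow> cj i (Vr v) = Vr v"
  unfolding MB.indexed_const_mono MB.indexed_var_mono mmono_def cj_def using \<tau>_01 by auto

text \<open>On a constant both sides apply \<sigma>_i, and on a variable both give the i-th
  projection of the generic point. This is why the projection carries the prolongation into the
  conjugate variety.\<close>

lemma pull_conj:
  assumes i: "i \<le> Last \<D>" and P: "P \<in> carrier (U n)"
  shows "pull n i (cj i P) = pi_over \<D> (PR n) i (prol n P)"
proof -
  have "(pull n i \<circ> cj i) P = (pi_over \<D> (PR n) i \<circ> prol n) P"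
  proof (rule MB.mpoly_hom_unique[OF cring.axioms(1)[OF PR_cring] _ _ _ _ P])
    show "pull n i \<circ> cj i \<in> ring_hom (U n) (PR n)" by (rule ring_hom_trans[OF conj_hom[OF i] pull_hom[OF i]])
    show "pi_over \<D> (PR n) i \<circ> prol n \<in> ring_hom (U n) (PR n)"
      by (rule ring_hom_trans[OF prol_hom op_alg.pi_hom[OF PR_op_alg i]])
    show "(pull n i \<circ> cj i) (Cn c) = (pi_over \<D> (PR n) i \<circ> prol n) (Cn c)" if c: "c \<in> carrier K" for c
    proof -
      have "pull n i (Cn (\<tau> i c)) = Cn (\<tau> i c)"
        by (rule MB.mpoly_eval_const[OF PR_cring])
          (use MB.const_hom ring_hom_closed[OF \<tau>_hom[OF i] c] in \<open>auto simp: prol_ring_def\<close>)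
      moreover have "pi_over \<D> (PR n) i (D_map \<D> Cn (D_exp \<D> \<delta> c)) = Cn (\<tau> i c)"
        using K.D_map_hom(2)[OF PR_algebra _ i K.D_exp_closed[OF DK c], of Cn n]
        by (simp add: prol_ring_def const_algebra_hom assoc_endo_def)
      ultimately show ?thesis by (simp add: conj_const[OF i] prol_const[OF c])
    qed
    show "(pull n i \<circ> cj i) (Vr k) = (pi_over \<D> (PR n) i \<circ> prol n) (Vr k)" if "k \<in> {..<n}" for k
    proof -
      have "pull n i (Vr k) = pi_over \<D> (PR n) i (gen k)"
        by (rule MB.mpoly_eval_var[OF PR_cring])
          (use MB.const_hom op_alg.pi_closed[OF PR_op_alg i gen_closed] that in \<open>auto simp: prol_ring_def\<close>)
      then show ?thesis using prol_var[of k n] that by (simp add: conj_var[OF i])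
    qed
  qed
  then show ?thesis by simp
qed

lemma pi_hat_eq: "pi_hat \<D> K n i p = {P \<in> carrier (U n). pull n i P \<in> p}"
  unfolding pi_hat_def ..

lemma pi_over_in_ideal:
  assumes "ideal J (PR n)" "x \<in> carrier (D_of \<D> (PR n))" "\<And>j. j < Len \<D> \<Longrightarrow> x j \<in> J" "i \<le> Last \<D>"
  shows "pi_over \<D> (PR n) i x \<in> J"
proof -
  interpret J: ideal J "PR n" by fact
  interpret P: op_alg \<D> "PR n" by (rule PR_op_alg)
  have "a \<odot>\<^bsub>PR n\<^esub> y \<in> J" if "a \<in> carrier (Base \<D>)" "y \<in> J" for a y
  proof -
    have y: "y \<in> carrier (PR n)" using that(2) J.a_Hcarr by simp
    have "a \<odot>\<^bsub>PR n\<^esub> y = (a \<odot>\<^bsub>PR n\<^esub> \<one>\<^bsub>PR n\<^esub>) \<otimes>\<^bsub>PR n\<^esub> y" using that(1) y by (simp add: P.RA.smult_assoc2)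
    then show ?thesis using J.I_l_closed[OF that(2)] that(1) by simp
  qed
  moreover have "pi_base \<D> i (Eps \<D> j) \<in> carrier (Base \<D>)" if "j < Len \<D>" for j
    using ring_hom_closed[OF pi_base_hom[OF assms(4)]] eps_closed[OF that] .
  moreover have "finsum (PR n) f A \<in> J" if "finite A" "f \<in> A \<rightarrow> J" for f and A :: "nat set"
    using that
  proof (induction A)
    case (insert a A)
    then have "f \<in> A \<rightarrow> carrier (PR n)" "f a \<in> carrier (PR n)" by (auto simp: Pi_iff intro: J.a_Hcarr)
    then have "finsum (PR n) f (insert a A) = f a \<oplus>\<^bsub>PR n\<^esub> finsum (PR n) f A"
      by (rule J.finsum_insert[OF insert(1,2)])
    then show ?case using insert by simp
  qed simp
  ultimately show ?thesis unfolding pi_over_def using assms(3) by (simp add: Pi_iff)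
qed

lemma prol_ideal_subset:
  assumes "I \<subseteq> carrier (U n)" "ideal J (PR n)"
  shows "prol_ideal \<D> K \<delta> n I \<subseteq> J \<longleftrightarrow> (\<forall>P\<in>I. \<forall>j<Len \<D>. prol n P j \<in> J)"
proof -
  interpret P: cring "PR n" by (rule PR_cring)
  have "{prol n P j |P j. P \<in> I \<and> j < Len \<D>} \<subseteq> carrier (PR n)" using assms(1) prol_closed by blast
  then have "prol_ideal \<D> K \<delta> n I \<subseteq> J \<longleftrightarrow> {prol n P j |P j. P \<in> I \<and> j < Len \<D>} \<subseteq> J"
    unfolding prol_ideal_def using P.Idl_subset_ideal[OF assms(2)] by blast
  then show ?thesis by blast
qed

section \<open>The map nabla and specialization of points\<close>

lemma nabla_closed:
  assumes "D_ring \<D> S \<delta>'" "\<And>k. k < n \<Longrightarrow> c k \<in> carrier S"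
  shows "nabla \<D> \<delta>' n c \<in> pv n \<rightarrow> carrier S"
  using assms unfolding nabla_def prol_vars_def D_ring_def by fastforce

text \<open>The instance of \<open>prol_eval\<close> at nabla(c). The equations of the prolongation
  at nabla(c) are the coordinates of e(P(c)), so nabla sends points of a variety into its
  prolongation.\<close>

lemma exp_eval:
  assumes S: "D_ring \<D> S \<delta>'" and \<iota>: "D_embedding \<D> K \<delta> S \<delta>' \<iota>" and c: "\<And>k. k < n \<Longrightarrow> c k \<in> carrier S"
    and P: "P \<in> carrier (U n)"
  shows "D_exp \<D> \<delta>' (mpoly_eval K S \<iota> c P) = D_map \<D> (mpoly_eval K S \<iota> (nabla \<D> \<delta>' n c)) (prol n P)"
proof -
  have alg: "algebra (Base \<D>) S" using S unfolding D_ring_def by blast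
  interpret S: op_alg \<D> S by (rule op_algI[OF alg])
  have ia: "\<iota> \<in> algebra_hom (Base \<D>) K S" using \<iota> unfolding D_embedding_def by blast
  then have ih: "\<iota> \<in> ring_hom K S" unfolding algebra_hom_def by auto
  have cP: "c \<in> {..<n} \<rightarrow> carrier S" using c by auto
  have nc: "nabla \<D> \<delta>' n c \<in> pv n \<rightarrow> carrier S" by (rule nabla_closed[OF S c])
  let ?g = "mpoly_eval K S \<iota> (nabla \<D> \<delta>' n c)"
  have "(D_exp \<D> \<delta>' \<circ> mpoly_eval K S \<iota> c) P = D_map \<D> ?g (prol n P)"
  proof (rule prol_eval[OF alg _ _ _ _ P])
    show "D_exp \<D> \<delta>' \<circ> mpoly_eval K S \<iota> c \<in> ring_hom (U n) (D_of \<D> S)"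
      by (rule ring_hom_trans[OF MB.mpoly_eval_hom[OF S.R.is_cring ih cP] S.D_exp_hom[OF S]])
    show "?g \<in> algebra_hom (Base \<D>) (PR n) S"
      unfolding prol_ring_def by (rule mpoly_eval_algebra_hom[OF alg ia nc])
    show "(D_exp \<D> \<delta>' \<circ> mpoly_eval K S \<iota> c) (Cn d) = (\<lambda>j\<in>{..<Len \<D>}. ?g (Cn (D_exp \<D> \<delta> d j)))"
      if d: "d \<in> carrier K" for d
    proof -
      have "D_exp \<D> \<delta>' (\<iota> d) = D_map \<D> \<iota> (D_exp \<D> \<delta> d)" by (rule embedding_exp[OF DK S \<iota> d])
      then show ?thesis
        using K.D_component[OF K.D_exp_closed[OF DK d]] d
        by (auto simp: D_map_def MB.mpoly_eval_const[OF S.R.is_cring ih] intro!: restrict_ext)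
    qed
    show "(D_exp \<D> \<delta>' \<circ> mpoly_eval K S \<iota> c) (Vr k) = (\<lambda>j\<in>{..<Len \<D>}. ?g (Vr (j, k)))" if k: "k < n" for k
    proof -
      have "?g (Vr (j, k)) = nabla \<D> \<delta>' n c (j, k)" if "j < Len \<D>" for j
        by (rule MB.mpoly_eval_var[OF S.R.is_cring ih]) (use nc k that in \<open>auto simp: prol_vars_def\<close>)
      then show ?thesis using k c
        by (auto simp: MB.mpoly_eval_var[OF S.R.is_cring ih] D_exp_def nabla_def prol_vars_def intro!: restrict_ext)
    qed
  qed
  then show ?thesis by simp
qed


text \<open>The endomorphism with index 0 is the identity and the others are onto by inversivity, so
  each coefficient has a preimage.\<close>

lemma conj_surj:
  assumes inv: "inversive \<D> K \<delta>" and i: "i \<le> Last \<D>" and Q: "Q \<in> carrier (mpoly K V)"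
  shows "\<exists>P\<in>carrier (mpoly K V). cj i P = Q"
proof -
  have "\<tau> i ` carrier K = carrier K"
  proof (cases "i = 0")
    case True
    then show ?thesis using K.assoc_endo_0[OF DK] by simp
  next
    case False
    then show ?thesis using inv i unfolding inversive_def by simp
  qed
  then have img: "carrier K \<subseteq> \<tau> i ` carrier K" by simp
  have ex: "\<exists>x\<in>carrier K. \<tau> i x = c" if "c \<in> carrier K" for c using subsetD[OF img that] by auto
  show ?thesis using Q
  proof (induction rule: MB.mpoly_induct)
    case (mono c m)
    then obtain x where x: "x \<in> carrier K" "\<tau> i x = c" using ex by blast
    have "cj i (mmono K x m) = mmono K c m" using \<tau>_01[OF i] x(2) by (auto simp: mmono_def cj_def)
    then show ?case using MB.mono_closed[OF x(1) mono(2)] by blast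
  next
    case (add P Q)
    then obtain P' Q' where PQ: "P' \<in> carrier (mpoly K V)" "cj i P' = P" "Q' \<in> carrier (mpoly K V)" "cj i Q' = Q" by blast
    have "cj i (P' \<oplus>\<^bsub>mpoly K V\<^esub> Q') = cj i P' \<oplus>\<^bsub>mpoly K V\<^esub> cj i Q'"
      by (rule ring_hom_add[OF conj_hom[OF i] PQ(1,3)])
    then show ?case unfolding PQ(2,4) using MB.mpoly_add_closed[OF PQ(1,3)] by blast
  qed
qed

text \<open>Density holds because the contraction of \<open>J\<close>, the generic point of the
  second variety, lies in the set of conjugates of elements of \<open>I\<close>. Indeed a
  \<open>Q\<close> in the contraction is the conjugate of some \<open>P\<close> by inversivity;
  pulled back and evaluated at nabla(c) it becomes \<sigma>_i(P(c)), and injectivity gives P(c) = 0.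
  So every prime above the conjugate of \<open>I\<close> contains the contraction and lies in each
  closed set through it.\<close>

theorem geometric_specialization:
  assumes inv: "inversive \<D> K \<delta>" and geo: "geometric_axiom \<D> K \<delta>"
    and F: "class_K \<D> F \<delta>'" and \<iota>: "D_embedding \<D> K \<delta> F \<delta>' \<iota>" and c: "\<And>k. k < n \<Longrightarrow> c k \<in> carrier F"
  shows "\<exists>b. (\<forall>k<n. b k \<in> carrier K) \<and>
    (\<forall>P\<in>carrier (PR n). mpoly_eval K F \<iota> (nabla \<D> \<delta>' n c) P = \<zero>\<^bsub>F\<^esub> \<longrightarrow>
      mpoly_eval K K (\<lambda>c. c) (nabla \<D> \<delta> n b) P = \<zero>\<^bsub>K\<^esub>)"
proof -
  have DF: "D_ring \<D> F \<delta>'" and domF: "domain F" using F unfolding class_K_def by auto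
  have alg: "algebra (Base \<D>) F" using DF unfolding D_ring_def by blast
  interpret F: op_alg \<D> F by (rule op_algI[OF alg])
  interpret P: op_alg \<D> "PR n" by (rule PR_op_alg)
  have ia: "\<iota> \<in> algebra_hom (Base \<D>) K F" using \<iota> unfolding D_embedding_def by blast
  then have ih: "\<iota> \<in> ring_hom K F" unfolding algebra_hom_def by auto
  have cP: "c \<in> {..<n} \<rightarrow> carrier F" using c by auto
  note nc = nabla_closed[OF DF c]
  let ?f = "mpoly_eval K F \<iota> c" and ?g = "mpoly_eval K F \<iota> (nabla \<D> \<delta>' n c)"
  have fh: "?f \<in> ring_hom (U n) F" by (rule MB.mpoly_eval_hom[OF F.R.is_cring ih cP])
  have ga: "?g \<in> algebra_hom (Base \<D>) (PR n) F" unfolding prol_ring_def by (rule mpoly_eval_algebra_hom[OF alg ia nc])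
  then have gh: "?g \<in> ring_hom (PR n) F" unfolding algebra_hom_def by auto
  define I where "I = {P \<in> carrier (U n). ?f P = \<zero>\<^bsub>F\<^esub>}"
  define J where "J = {P \<in> carrier (PR n). ?g P = \<zero>\<^bsub>F\<^esub>}"
  have I: "primeideal I (U n)" unfolding I_def by (rule primeideal_kernel[OF U_cring domF fh])
  have J: "primeideal J (PR n)" unfolding J_def by (rule primeideal_kernel[OF PR_cring domF gh])
  have iJ: "ideal J (PR n)" using J by (rule primeideal.axioms(1))
  have ex: "D_map \<D> ?g (prol n P) = D_exp \<D> \<delta>' (?f P)" if "P \<in> carrier (U n)" for P
    using exp_eval[OF DF \<iota> c that] by simp
  have sub: "prol n P j \<in> J" if P: "P \<in> I" and j: "j < Len \<D>" for P j
  proof -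
    have "D_exp \<D> \<delta>' \<zero>\<^bsub>F\<^esub> = \<zero>\<^bsub>D_of \<D> F\<^esub>"
      by (rule ring_hom_zero[OF F.D_exp_hom[OF DF] F.R.ring_axioms cring.axioms(1)[OF F.D_cring]])
    then have "D_map \<D> ?g (prol n P) j = \<zero>\<^bsub>F\<^esub>" using ex[of P] P j unfolding I_def by (simp add: F.D_zero)
    then show ?thesis using j P prol_closed[of P n j] unfolding J_def I_def D_map_def by simp
  qed
  have dense: "zariski_dense (U n) (pi_hat \<D> K n i ` spec_zeros (PR n) J) (conj_space \<D> K \<delta> n i I)"
    if i: "i \<le> Last \<D>" for i
    unfolding zariski_dense_def
  proof
    show "pi_hat \<D> K n i ` spec_zeros (PR n) J \<subseteq> conj_space \<D> K \<delta> n i I"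
    proof (rule image_subsetI)
      fix p assume "p \<in> spec_zeros (PR n) J"
      then have p: "primeideal p (PR n)" "J \<subseteq> p" unfolding spec_zeros_def by auto
      have "primeideal (pi_hat \<D> K n i p) (U n)"
        unfolding pi_hat_eq by (rule primeideal_preimage[OF U_cring PR_cring pull_hom[OF i] p(1)])
      moreover have "cj i P \<in> pi_hat \<D> K n i p" if "P \<in> I" for P
      proof -
        have P: "P \<in> carrier (U n)" using that unfolding I_def by simp
        have "pi_over \<D> (PR n) i (prol n P) \<in> p"
          by (rule pi_over_in_ideal[OF primeideal.axioms(1)[OF p(1)] ring_hom_closed[OF prol_hom P] _ i])
            (use sub that p(2) in blast)
        then show ?thesis unfolding pi_hat_eq using pull_conj[OF i P] ring_hom_closed[OF conj_hom[OF i] P] by simp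
      qed
      ultimately show "pi_hat \<D> K n i p \<in> conj_space \<D> K \<delta> n i I"
        unfolding conj_space_def spec_zeros_def cj_def by blast
    qed
    have "Q \<in> cj i ` I" if Q: "Q \<in> pi_hat \<D> K n i J" for Q
    proof -
      have Qc: "Q \<in> carrier (U n)" "pull n i Q \<in> J" using Q unfolding pi_hat_eq by auto
      obtain P where P: "P \<in> carrier (U n)" "cj i P = Q" using conj_surj[OF inv i Qc(1)] by blast
      have fP: "?f P \<in> carrier F" by (rule ring_hom_closed[OF fh P(1)])
      have "assoc_endo \<D> F \<delta>' i (?f P) = pi_over \<D> F i (D_map \<D> ?g (prol n P))"
        unfolding assoc_endo_def ex[OF P(1)] ..
      also have "\<dots> = ?g (pi_over \<D> (PR n) i (prol n P))"
        by (rule P.D_map_hom(2)[OF alg ga i ring_hom_closed[OF prol_hom P(1)]])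
      also have "\<dots> = \<zero>\<^bsub>F\<^esub>" using Qc(2) P(2) pull_conj[OF i P(1)] unfolding J_def by simp
      also have "\<dots> = assoc_endo \<D> F \<delta>' i \<zero>\<^bsub>F\<^esub>"
        using ring_hom_zero[OF F.assoc_endo_hom[OF DF i] F.R.ring_axioms F.R.ring_axioms] by simp
      finally have "?f P = \<zero>\<^bsub>F\<^esub>"
        using inj_onD[OF F.assoc_endo_inj[OF F i] _ fP F.R.zero_closed] by blast
      then show ?thesis using P unfolding I_def by blast
    qed
    then have hJ: "pi_hat \<D> K n i J \<subseteq> cj i ` I" by blast
    have JJ: "J \<in> spec_zeros (PR n) J" using J unfolding spec_zeros_def by simp
    show "conj_space \<D> K \<delta> n i I \<subseteq> spec_closure (U n) (pi_hat \<D> K n i ` spec_zeros (PR n) J)"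
    proof
      fix q assume "q \<in> conj_space \<D> K \<delta> n i I"
      then have q: "primeideal q (U n)" "cj i ` I \<subseteq> q" unfolding conj_space_def spec_zeros_def cj_def by auto
      have "q \<in> Z" if Z: "spec_closed (U n) Z" "pi_hat \<D> K n i ` spec_zeros (PR n) J \<subseteq> Z" for Z
      proof -
        obtain S where S: "Z = spec_zeros (U n) S" using Z(1) unfolding spec_closed_def by blast
        have "pi_hat \<D> K n i J \<in> Z" using Z(2) JJ by blast
        then have "S \<subseteq> pi_hat \<D> K n i J" unfolding S spec_zeros_def by simp
        then show "q \<in> Z" unfolding S spec_zeros_def using q hJ by blast
      qed
      then show "q \<in> spec_closure (U n) (pi_hat \<D> K n i ` spec_zeros (PR n) J)" unfolding spec_closure_def by blast
    qed
  qed
  have "\<exists>a\<in>rational_points K {..<n} I. nabla \<D> \<delta> n a \<in> rational_points K (pv n) J"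
  proof (rule geo[unfolded geometric_axiom_def, rule_format], intro conjI allI impI)
    show "prol_ideal \<D> K \<delta> n I \<subseteq> J" using prol_ideal_subset[OF _ iJ, of I] sub unfolding I_def by blast
  qed (rule prime_irreducible_variety[OF I] prime_irreducible_variety[OF J] dense)+
  then obtain b where b: "b \<in> rational_points K {..<n} I" "nabla \<D> \<delta> n b \<in> rational_points K (pv n) J" by blast
  then show ?thesis unfolding rational_points_def J_def by (intro exI[of _ b]) auto
qed

end

subsection \<open>The axioms imply existential closedness\<close>

primrec subterms :: "('a, 'k) dterm \<Rightarrow> ('a, 'k) dterm set" where
  "subterms (Var i) = {Var i}"
| "subterms (Param c) = {Param c}"
| "subterms Zero = {Zero}"
| "subterms One = {One}"
| "subterms (Plus s u) = insert (Plus s u) (subterms s \<union> subterms u)"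
| "subterms (Minus s u) = insert (Minus s u) (subterms s \<union> subterms u)"
| "subterms (Times s u) = insert (Times s u) (subterms s \<union> subterms u)"
| "subterms (Scale a s) = insert (Scale a s) (subterms s)"
| "subterms (Deriv j s) = insert (Deriv j s) (subterms s)"

primrec qf_terms :: "('a, 'k) qf_formula \<Rightarrow> ('a, 'k) dterm set" where
  "qf_terms (Eq s u) = subterms s \<union> subterms u"
| "qf_terms (Neg \<phi>) = qf_terms \<phi>"
| "qf_terms (Conj \<phi> \<psi>) = qf_terms \<phi> \<union> qf_terms \<psi>"
| "qf_terms (Disj \<phi> \<psi>) = qf_terms \<phi> \<union> qf_terms \<psi>"

lemma subterms_self: "s \<in> subterms s" by (cases s) auto

lemma subterms_trans: "s \<in> subterms u \<Longrightarrow> subterms s \<subseteq> subterms u"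
  by (induction u) auto

lemma subterms_over: "\<lbrakk>dterm_over \<D> C u; s \<in> subterms u\<rbrakk> \<Longrightarrow> dterm_over \<D> C s"
  by (induction u) auto

lemma qf_terms_subterms: "s \<in> qf_terms \<phi> \<Longrightarrow> subterms s \<subseteq> qf_terms \<phi>"
  by (induction \<phi>) (use subterms_trans in \<open>fastforce+\<close>)

lemma qf_terms_over: "\<lbrakk>qf_over \<D> C \<phi>; s \<in> qf_terms \<phi>\<rbrakk> \<Longrightarrow> dterm_over \<D> C s"
  by (induction \<phi>) (use subterms_over in auto)

lemma finite_qf_terms: "finite (qf_terms \<phi>)"
proof -
  have "finite (subterms s)" for s :: "('a, 'b) dterm" by (induction s) auto
  then show ?thesis by (induction \<phi>) auto
qed

context D_domain
begin

text \<open>Each step in evaluating a subterm is a polynomial relation between entries of nabla(c);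
  applying an operator means passing from the coordinate (0, k) to (j, k). Such relations survive
  specialization, and inequations survive because the inverses of the differences are among the
  entries of \<open>c\<close>.\<close>

lemma qf_specialization:
  assumes inv: "inversive \<D> K \<delta>" and geo: "geometric_axiom \<D> K \<delta>"
    and F: "class_K \<D> F \<delta>'" "field F" and \<iota>: "D_embedding \<D> K \<delta> F \<delta>' \<iota>" and v: "\<And>i. v i \<in> carrier F"
    and \<phi>: "qf_over \<D> (carrier K) \<phi>" "qf_holds F \<delta>' \<iota> v \<phi>"
  shows "ex_sentence_true K \<delta> (\<lambda>c. c) \<phi>"
proof -
  have DF: "D_ring \<D> F \<delta>'" using F(1) unfolding class_K_def by auto
  have alg: "algebra (Base \<D>) F" using DF unfolding D_ring_def by blast
  interpret F: op_alg \<D> F by (rule op_algI[OF alg])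
  interpret FF: field F by (rule F(2))
  interpret KD: domain K by (rule domK)
  have ia: "\<iota> \<in> algebra_hom (Base \<D>) K F" using \<iota> unfolding D_embedding_def by blast
  then have ih: "\<iota> \<in> ring_hom K F" unfolding algebra_hom_def by auto
  have ic: "\<iota> c \<in> carrier F" if "c \<in> carrier K" for c using ring_hom_closed[OF ih that] .
  let ?v = "dterm_val F \<delta>' \<iota> v"
  define T where "T = qf_terms \<phi>"
  have Tc: "?v s \<in> carrier F" if "s \<in> T" for s
    by (rule dterm_val_closed[OF D_closed_carrier[OF DF] ic v])
      (use qf_terms_over[OF \<phi>(1)] that in \<open>auto simp: T_def\<close>)
  define d where "d = (\<lambda>(s, u). inv\<^bsub>F\<^esub> (?v s \<ominus>\<^bsub>F\<^esub> ?v u))"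
  define S where "S = {(s, u) \<in> T \<times> T. ?v s \<noteq> ?v u}"
  have Ssub: "S \<subseteq> T \<times> T" unfolding S_def by auto
  have fin: "finite T" unfolding T_def by (rule finite_qf_terms)
  have d: "d (s, u) \<in> carrier F" "d (s, u) \<otimes>\<^bsub>F\<^esub> (?v s \<ominus>\<^bsub>F\<^esub> ?v u) = \<one>\<^bsub>F\<^esub>" if "(s, u) \<in> S" for s u
  proof -
    have "?v s \<ominus>\<^bsub>F\<^esub> ?v u \<in> Units F" using that Tc unfolding S_def FF.field_Units by auto
    then show "d (s, u) \<in> carrier F" "d (s, u) \<otimes>\<^bsub>F\<^esub> (?v s \<ominus>\<^bsub>F\<^esub> ?v u) = \<one>\<^bsub>F\<^esub>" unfolding d_def by simp_all
  qed
  have fC: "finite (?v ` T \<union> d ` S)" using fin finite_subset[OF Ssub] by simp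
  from finite_imp_nat_seg_image_inj_on[OF fC] obtain n :: nat and c where c: "?v ` T \<union> d ` S = c ` {k. k < n}"
    by (elim exE conjE) (rule that)
  have "c k \<in> carrier F" if k: "k < n" for k
  proof -
    have "c k \<in> ?v ` T \<union> d ` S" unfolding c using k by simp
    then show ?thesis
    proof
      assume "c k \<in> d ` S"
      then obtain s u where "(s, u) \<in> S" "c k = d (s, u)" by (metis imageE surj_pair)
      then show ?thesis using d(1) by simp
    qed (use Tc in auto)
  qed
  note cc = this
  have "\<exists>b. (\<forall>k<n. b k \<in> carrier K) \<and>
    (\<forall>P\<in>carrier (PR n). mpoly_eval K F \<iota> (nabla \<D> \<delta>' n c) P = \<zero>\<^bsub>F\<^esub> \<longrightarrow>
      mpoly_eval K K (\<lambda>c. c) (nabla \<D> \<delta> n b) P = \<zero>\<^bsub>K\<^esub>)"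
    by (rule geometric_specialization[OF inv geo F(1) \<iota>]) (rule cc)
  then obtain b where b': "\<forall>k<n. b k \<in> carrier K"
    "\<forall>P\<in>carrier (PR n). mpoly_eval K F \<iota> (nabla \<D> \<delta>' n c) P = \<zero>\<^bsub>F\<^esub> \<longrightarrow>
      mpoly_eval K K (\<lambda>c. c) (nabla \<D> \<delta> n b) P = \<zero>\<^bsub>K\<^esub>"
    by (elim exE conjE) (rule that)
  have b: "k < n \<Longrightarrow> b k \<in> carrier K"
    "\<lbrakk>P \<in> carrier (PR n); mpoly_eval K F \<iota> (nabla \<D> \<delta>' n c) P = \<zero>\<^bsub>F\<^esub>\<rbrakk> \<Longrightarrow>
      mpoly_eval K K (\<lambda>c. c) (nabla \<D> \<delta> n b) P = \<zero>\<^bsub>K\<^esub>" for k P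
    using b'(1) bspec[OF b'(2)] by simp_all
  let ?g = "mpoly_eval K F \<iota> (nabla \<D> \<delta>' n c)" and ?h = "mpoly_eval K K (\<lambda>c. c) (nabla \<D> \<delta> n b)"
  have idh: "(\<lambda>c. c) \<in> ring_hom K K" by (simp add: ring_hom_def)
  have nc: "nabla \<D> \<delta>' n c \<in> pv n \<rightarrow> carrier F" by (rule nabla_closed[OF DF cc])
  have nb: "nabla \<D> \<delta> n b \<in> pv n \<rightarrow> carrier K" by (rule nabla_closed[OF DK b(1)])
  interpret P: op_alg \<D> "PR n" by (rule PR_op_alg)
  interpret G: ring_hom_cring "PR n" F ?g
    by unfold_locales (unfold prol_ring_def, rule MB.mpoly_eval_hom[OF F.R.is_cring ih nc])
  interpret H: ring_hom_cring "PR n" K ?h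
    by unfold_locales (unfold prol_ring_def, rule MB.mpoly_eval_hom[OF K.R.is_cring idh nb])
  have ga: "?g (a \<odot>\<^bsub>PR n\<^esub> P) = a \<odot>\<^bsub>F\<^esub> ?g P" "?h (a \<odot>\<^bsub>PR n\<^esub> P) = a \<odot>\<^bsub>K\<^esub> ?h P"
    if "a \<in> carrier (Base \<D>)" "P \<in> carrier (PR n)" for a P
    using mpoly_eval_algebra_hom[OF alg ia nc] mpoly_eval_algebra_hom[OF algK _ nb, of "\<lambda>c. c"] that idh
    unfolding prol_ring_def algebra_hom_def by auto
  \<comment> \<open>Equalities are transferred from \<open>F\<close> to \<open>K\<close> only. The
    reverse direction for atomic formulas is what the adjoined inverses are for.\<close>
  have tr: "?h P = ?h Q" if "P \<in> carrier (PR n)" "Q \<in> carrier (PR n)" "?g P = ?g Q" for P Q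
  proof -
    have "?g (P \<ominus>\<^bsub>PR n\<^esub> Q) = \<zero>\<^bsub>F\<^esub>" using that by (simp add: a_minus_def F.R.r_neg)
    then have "?h (P \<ominus>\<^bsub>PR n\<^esub> Q) = \<zero>\<^bsub>K\<^esub>" using b(2) that by simp
    then have "?h P \<ominus>\<^bsub>K\<^esub> ?h Q = \<zero>\<^bsub>K\<^esub>" using that by (simp add: a_minus_def)
    then show ?thesis using that by simp
  qed
  define x where "x = (\<lambda>k::nat. Vr (0::nat, k))"
  have vc: "Vr (j, k) \<in> carrier (PR n)" "?g (Vr (j, k)) = nabla \<D> \<delta>' n c (j, k)" "?h (Vr (j, k)) = nabla \<D> \<delta> n b (j, k)"
    if "j < Len \<D>" "k < n" for j k
    unfolding prol_ring_def using that nc nb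
    by (auto simp: prol_vars_def intro!: MB.var_closed MB.mpoly_eval_var[OF F.R.is_cring ih]
        MB.mpoly_eval_var[OF K.R.is_cring idh])
  have xc [simp]: "x k \<in> carrier (PR n)" "?g (x k) = c k" "?h (x k) = b k" if "k < n" for k
    unfolding x_def using vc[OF len_pos that] that len_pos by (auto simp: nabla_def prol_vars_def)
  have nabla_j: "nabla \<D> \<delta>' n c (j, k) = \<delta>' j (c k)" "nabla \<D> \<delta> n b (j, k) = \<delta> j (b k)"
    if "j < Len \<D>" "0 < j" "k < n" for j k
    using that by (simp_all add: nabla_def prol_vars_def)
  \<comment> \<open>Positions are assigned to values rather than to terms, so terms with equal
    values automatically receive equal values in \<open>K\<close>.\<close>
  define pos where "pos = (\<lambda>y. SOME k. k < n \<and> c k = y)"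
  have pos': "pos y < n \<and> c (pos y) = y" if y: "y \<in> ?v ` T \<union> d ` S" for y
  proof -
    have "\<exists>k. k < n \<and> c k = y" using y unfolding c by blast
    then show ?thesis unfolding pos_def by (rule someI_ex)
  qed
  have pos [simp]: "pos (?v s) < n" "c (pos (?v s)) = ?v s" if "s \<in> T" for s using pos'[of "?v s"] that by auto
  \<comment> \<open>An assignment is total; variables that do not occur in the formula are given the
    value zero.\<close>
  define w where "w = (\<lambda>i. if Var i \<in> T then b (pos (v i)) else \<zero>\<^bsub>K\<^esub>)"
  let ?w = "dterm_val K \<delta> (\<lambda>c. c) w"
  have sub: "subterms s \<subseteq> T" if "s \<in> T" for s using qf_terms_subterms that unfolding T_def by blast
  have val: "?w s = b (pos (?v s))" if "s \<in> T" for s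
    using that
  proof (induction s)
    case (Var i)
    then show ?case by (simp add: w_def)
  next
    case (Param p)
    have p: "p \<in> carrier K" using qf_terms_over[OF \<phi>(1) Param[unfolded T_def]] by simp
    have "?g (Cn p) = \<iota> p" "?h (Cn p) = p" "Cn p \<in> carrier (PR n)"
      using MB.mpoly_eval_const[OF F.R.is_cring ih p] MB.mpoly_eval_const[OF K.R.is_cring idh p] MB.const_closed[OF p]
      unfolding prol_ring_def by auto
    then show ?case using tr[of "x (pos (?v (Param p)))" "Cn p"] pos[OF Param] by simp
  next
    case Zero
    then show ?case using tr[of "x (pos (?v Zero))" "\<zero>\<^bsub>PR n\<^esub>"] pos[OF Zero] by simp
  next
    case One
    then show ?case using tr[of "x (pos (?v One))" "\<one>\<^bsub>PR n\<^esub>"] pos[OF One] by simp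
  next
    case (Plus s u)
    have "s \<in> T" "u \<in> T" using sub[OF Plus.prems] subterms_self[of s] subterms_self[of u] by auto
    then show ?case
      using tr[of "x (pos (?v (Plus s u)))" "x (pos (?v s)) \<oplus>\<^bsub>PR n\<^esub> x (pos (?v u))"] pos[OF Plus.prems] Plus.IH by simp
  next
    case (Minus s u)
    have "s \<in> T" "u \<in> T" using sub[OF Minus.prems] subterms_self[of s] subterms_self[of u] by auto
    then show ?case
      using tr[of "x (pos (?v (Minus s u)))" "x (pos (?v s)) \<ominus>\<^bsub>PR n\<^esub> x (pos (?v u))"] pos[OF Minus.prems] Minus.IH
      by (simp add: a_minus_def)
  next
    case (Times s u)
    have "s \<in> T" "u \<in> T" using sub[OF Times.prems] subterms_self[of s] subterms_self[of u] by auto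
    then show ?case
      using tr[of "x (pos (?v (Times s u)))" "x (pos (?v s)) \<otimes>\<^bsub>PR n\<^esub> x (pos (?v u))"] pos[OF Times.prems] Times.IH by simp
  next
    case (Scale a s)
    have s: "s \<in> T" using sub[OF Scale.prems] subterms_self[of s] by auto
    have a: "a \<in> carrier (Base \<D>)" using qf_terms_over[OF \<phi>(1) Scale.prems[unfolded T_def]] by simp
    show ?case
      using tr[of "x (pos (?v (Scale a s)))" "a \<odot>\<^bsub>PR n\<^esub> x (pos (?v s))"] pos[OF Scale.prems] Scale.IH s a by (simp add: ga)
  next
    case (Deriv j s)
    have s: "s \<in> T" using sub[OF Deriv.prems] subterms_self[of s] by auto
    have j: "j < Len \<D>" "j \<noteq> 0" using qf_terms_over[OF \<phi>(1) Deriv.prems[unfolded T_def]] by auto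
    show ?case
      using tr[of "x (pos (?v (Deriv j s)))" "Vr (j, pos (?v s))"] pos[OF Deriv.prems] Deriv.IH s j
      by (simp add: vc nabla_j)
  qed
  have wc: "w i \<in> carrier K" for i using b(1)[of "pos (v i)"] pos[of "Var i"] by (simp add: w_def)
  have atom: "?w s = ?w u \<longleftrightarrow> ?v s = ?v u" if su: "s \<in> T" "u \<in> T" for s u
  proof
    show "?v s = ?v u \<Longrightarrow> ?w s = ?w u" using val su by simp
    assume eq: "?w s = ?w u"
    show "?v s = ?v u"
    proof (rule ccontr)
      assume "?v s \<noteq> ?v u"
      then have S: "(s, u) \<in> S" using su unfolding S_def by simp
      have p: "pos (d (s, u)) < n" "c (pos (d (s, u))) = d (s, u)" using pos'[of "d (s, u)"] S by auto
      have "?h (x (pos (d (s, u))) \<otimes>\<^bsub>PR n\<^esub> (x (pos (?v s)) \<ominus>\<^bsub>PR n\<^esub> x (pos (?v u)))) = ?h \<one>\<^bsub>PR n\<^esub>"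
        by (rule tr) (use p su d(2)[OF S] in \<open>simp_all add: a_minus_def\<close>)
      then have "b (pos (d (s, u))) \<otimes>\<^bsub>K\<^esub> (?w s \<ominus>\<^bsub>K\<^esub> ?w u) = \<one>\<^bsub>K\<^esub>" using p su by (simp add: val a_minus_def)
      moreover have "?w u \<in> carrier K" using val su b(1) by simp
      ultimately show False using eq b(1)[OF p(1)] by (simp add: a_minus_def K.R.r_neg)
    qed
  qed
  have "qf_holds K \<delta> (\<lambda>c. c) w \<psi> \<longleftrightarrow> qf_holds F \<delta>' \<iota> v \<psi>" if "qf_terms \<psi> \<subseteq> T" for \<psi>
    using that by (induction \<psi>) (auto simp: atom[OF subsetD[OF _ subterms_self] subsetD[OF _ subterms_self]])
  then have "qf_holds K \<delta> (\<lambda>c. c) w \<phi>" using \<phi>(2) unfolding T_def by blast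
  then show ?thesis unfolding ex_sentence_true_def using wc by blast
qed

text \<open>Passing to the hull of the extension gives a field, in which the inverses used by
  \<open>qf_specialization\<close> exist.\<close>

theorem existentially_closedI:
  assumes "inversive \<D> K \<delta>" "geometric_axiom \<D> K \<delta>"
  shows "existentially_closed TYPE('u) \<D> K \<delta>"
  unfolding existentially_closed_def
proof (intro allI impI)
  fix R :: "('a, 'u) module" and \<delta>' and \<iota> :: "'k \<Rightarrow> 'u" and \<phi> :: "('a, 'k) qf_formula"
  assume A: "class_K \<D> R \<delta>' \<and> D_embedding \<D> K \<delta> R \<delta>' \<iota> \<and> qf_over \<D> (carrier K) \<phi> \<and> ex_sentence_true R \<delta>' \<iota> \<phi>"
  then obtain v where v: "\<And>i. v i \<in> carrier R" "qf_holds R \<delta>' \<iota> v \<phi>" unfolding ex_sentence_true_def by blast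
  obtain F :: "('a, ((('u \<times> 'u) set list \<times> nat) multiset \<Rightarrow> ('u \<times> 'u) set)) module" and \<delta>F h where
    F: "op_field \<D> F" "class_K \<D> F \<delta>F" and h: "D_embedding \<D> R \<delta>' F \<delta>F h"
    using class_K_hull A by blast
  have DR: "D_ring \<D> R \<delta>'" "D_ring \<D> F \<delta>F" using A F(2) unfolding class_K_def by auto
  have \<iota>: "\<iota> \<in> ring_hom K R" using A unfolding D_embedding_def algebra_hom_def by auto
  have hr: "h \<in> ring_hom R F" using h unfolding D_embedding_def algebra_hom_def by auto
  show "ex_sentence_true K \<delta> (\<lambda>c. c) \<phi>"
  proof (rule qf_specialization[OF assms F(2) op_field.fieldF[OF F(1)]])
    show "D_embedding \<D> K \<delta> F \<delta>F (h \<circ> \<iota>)" using D_embedding_trans A h by blast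
    show "h (v i) \<in> carrier F" for i using ring_hom_closed[OF hr v(1)] .
    show "qf_over \<D> (carrier K) \<phi>" using A by blast
    show "qf_holds F \<delta>F (h \<circ> \<iota>) (\<lambda>i. h (v i)) \<phi>"
      using qf_holds_embedding[where \<iota> = \<iota> and C = "carrier K", OF DR h ring_hom_closed[OF \<iota>] v(1)] A v(2)
      by (simp add: comp_def)
  qed
qed

end

subsection \<open>Existentially closed rings are algebraically closed and inversive\<close>

primrec tpow :: "nat \<Rightarrow> ('a, 'k) dterm" where
  "tpow 0 = One"
| "tpow (Suc n) = Times (tpow n) (Var 0)"

primrec tpoly :: "(nat \<Rightarrow> 'k) \<Rightarrow> nat \<Rightarrow> ('a, 'k) dterm" where
  "tpoly c 0 = Zero"
| "tpoly c (Suc n) = Plus (tpoly c n) (Times (Param (c n)) (tpow n))"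

text \<open>At length \<open>Len \<D>\<close> this term expresses \<sigma>_i of the variable 0, a
  linear combination of the variable and its derivatives. The summand with index 0 is the variable
  itself, because the operators start at index 1.\<close>

primrec tendo :: "('a, 'd, 'b) operator_data \<Rightarrow> nat \<Rightarrow> nat \<Rightarrow> ('a, 'k) dterm" where
  "tendo \<D> i 0 = Zero"
| "tendo \<D> i (Suc n) = Plus (tendo \<D> i n)
     (Scale (pi_base \<D> i (Eps \<D> n)) (if n = 0 then Var 0 else Deriv n (Var 0)))"

lemma tpoly_over: "(\<And>i. i < n \<Longrightarrow> c i \<in> C) \<Longrightarrow> dterm_over \<D> C (tpoly c n)"
proof -
  have "dterm_over \<D> C (tpow n)" for n by (induction n) auto
  then show "(\<And>i. i < n \<Longrightarrow> c i \<in> C) \<Longrightarrow> dterm_over \<D> C (tpoly c n)" by (induction n) auto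
qed

lemma (in op_alg) tpoly_val:
  assumes "\<And>i. i < n \<Longrightarrow> \<iota> (c i) \<in> carrier R" "v 0 \<in> carrier R"
  shows "dterm_val R \<delta> \<iota> v (tpoly c n) = (\<Oplus>i\<in>{..<n}. \<iota> (c i) \<otimes> v 0 [^] i)"
proof -
  have p: "dterm_val R \<delta> \<iota> v (tpow k) = v 0 [^] k" for k by (induction k) auto
  show ?thesis using assms(1)
  proof (induction n)
    case (Suc n)
    have "(\<Oplus>i\<in>{..<Suc n}. \<iota> (c i) \<otimes> v 0 [^] i) = \<iota> (c n) \<otimes> v 0 [^] n \<oplus> (\<Oplus>i\<in>{..<n}. \<iota> (c i) \<otimes> v 0 [^] i)"
      unfolding lessThan_Suc by (rule finsum_insert) (use Suc.prems assms(2) in auto)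
    moreover have "(\<Oplus>i\<in>{..<n}. \<iota> (c i) \<otimes> v 0 [^] i) \<in> carrier R"
      by (rule finsum_closed) (use Suc.prems assms(2) in auto)
    ultimately show ?case using Suc assms(2) by (simp add: p a_comm)
  qed simp
qed

lemma (in op_data) tendo_over: "\<lbrakk>i \<le> Last \<D>; n \<le> Len \<D>\<rbrakk> \<Longrightarrow> dterm_over \<D> C (tendo \<D> i n)"
  using ring_hom_closed[OF pi_base_hom eps_closed] by (induction n) auto

lemma (in op_alg) tendo_val:
  assumes D: "D_ring \<D> R \<delta>" and i: "i \<le> Last \<D>" and v: "v 0 \<in> carrier R"
  shows "dterm_val R \<delta> \<iota> v (tendo \<D> i (Len \<D>)) = assoc_endo \<D> R \<delta> i (v 0)"
proof -
  let ?f = "\<lambda>j. pi_base \<D> i (Eps \<D> j) \<odot> D_exp \<D> \<delta> (v 0) j"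
  have c: "?f j \<in> carrier R" if "j < Len \<D>" for j
    using D_component[OF D_exp_closed[OF D v] that] ring_hom_closed[OF pi_base_hom[OF i] eps_closed[OF that]] by simp
  have "dterm_val R \<delta> \<iota> v (tendo \<D> i n) = (\<Oplus>j\<in>{..<n}. ?f j)" if "n \<le> Len \<D>" for n
    using that
  proof (induction n)
    case (Suc n)
    have "(\<Oplus>j\<in>{..<Suc n}. ?f j) = ?f n \<oplus> (\<Oplus>j\<in>{..<n}. ?f j)"
      unfolding lessThan_Suc by (rule finsum_insert) (use Suc.prems c in auto)
    moreover have "(\<Oplus>j\<in>{..<n}. ?f j) \<in> carrier R" by (rule finsum_closed) (use Suc.prems c in auto)
    moreover have "dterm_val R \<delta> \<iota> v (if n = 0 then Var 0 else Deriv n (Var 0)) = D_exp \<D> \<delta> (v 0) n"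
      using Suc.prems by (simp add: D_exp_def)
    ultimately show ?case using Suc c[of n] by (simp add: a_comm)
  qed simp
  then show ?thesis unfolding assoc_endo_def pi_over_def by simp
qed

text \<open>Over an algebraically closed field \<open>f\<close> splits, and no linear factor
  vanishes at an element outside the image of the field; such an element is transcendental. The
  induction removes one root at a time.\<close>

lemma UP_eval_nonzero:
  assumes K: "algebraically_closed K" and T: "domain T" and g: "g \<in> ring_hom K T" "inj_on g (carrier K)"
    and x: "x \<in> carrier T" "x \<notin> g ` carrier K" and f: "f \<in> carrier (UP K)" "f \<noteq> \<zero>\<^bsub>UP K\<^esub>"
  shows "UnivPoly.eval K T g x f \<noteq> \<zero>\<^bsub>T\<^esub>"
proof -
  interpret K: algebraically_closed K by fact
  interpret T: domain T by fact
  define P where "P = UP K"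
  interpret U: UP_domain K P by unfold_locales (rule P_def[THEN eq_reflection])
  interpret E: UP_pre_univ_prop K T g P by unfold_locales (rule g(1))
  interpret I: UP_pre_univ_prop K K id P by unfold_locales (simp add: ring_hom_def)
  interpret h: ring_hom_cring P T "UnivPoly.eval K T g x" by unfold_locales (rule E.eval_ring_hom[OF x(1)])
  have "UnivPoly.eval K T g x f \<noteq> \<zero>\<^bsub>T\<^esub>" if "f \<in> carrier P" "f \<noteq> \<zero>\<^bsub>P\<^esub>" for f
    using that
  proof (induction "deg K f" arbitrary: f rule: less_induct)
    case less
    have fk: "f k \<in> carrier K" for k using U.coeff_closed[OF less(2)] U.coeff_eq[OF less(2)] by simp
    have lc: "f (deg K f) \<noteq> \<zero>\<^bsub>K\<^esub>" using U.lcoeff_nonzero[OF less(3,2)] unfolding U.coeff_eq[OF less(2)] .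
    show ?case
    proof (cases "deg K f = 0")
      case True
      have "f = up_ring.monom P (up_ring.coeff P f 0) 0" by (rule U.deg_zero_impl_monom[OF less(2) True])
      then have "f = up_ring.monom P (f 0) 0" unfolding U.coeff_eq[OF less(2)] .
      then have "UnivPoly.eval K T g x f = g (f 0)" using E.eval_const[OF x(1) fk[of 0]] by simp
      moreover have "g (f 0) \<noteq> g \<zero>\<^bsub>K\<^esub>" using inj_onD[OF g(2), of "f 0" "\<zero>\<^bsub>K\<^esub>"] fk lc True by auto
      ultimately show ?thesis by simp
    next
      case False
      obtain r where r: "r \<in> carrier K" "(\<Oplus>\<^bsub>K\<^esub>i\<in>{..deg K f}. f i \<otimes>\<^bsub>K\<^esub> r [^]\<^bsub>K\<^esub> i) = \<zero>\<^bsub>K\<^esub>"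
        using K.exists_root_finsum[of "deg K f" f] False fk lc by auto
      then have root: "UnivPoly.eval K K id r f = \<zero>\<^bsub>K\<^esub>" using I.eval_le[OF less(2) r(1) order_refl] by simp
      let ?l = "up_ring.monom P \<one>\<^bsub>K\<^esub> 1 \<ominus>\<^bsub>P\<^esub> up_ring.monom P r 0"
      have nt: "carrier K \<noteq> {\<zero>\<^bsub>K\<^esub>}" using K.one_not_zero K.one_closed by blast
      obtain q where q: "q \<in> carrier P" "f = ?l \<otimes>\<^bsub>P\<^esub> q"
        using U.remainder_theorem[OF less(2) r(1) nt] r(1) unfolding root by (auto simp: U.monom_zero)
      have l: "?l \<in> carrier P" using r(1) by simp
      have qz: "q \<noteq> \<zero>\<^bsub>P\<^esub>" using q less(3) l by auto
      have dl: "deg K ?l = 1" by (rule U.deg_minus_monom[OF r(1) nt])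
      have lz: "?l \<noteq> \<zero>\<^bsub>P\<^esub>" using dl U.deg_zero by auto
      have "deg K f = deg K ?l + deg K q" unfolding q(2) by (rule U.deg_mult[OF lz qz l q(1)])
      then have "UnivPoly.eval K T g x q \<noteq> \<zero>\<^bsub>T\<^esub>" using less(1)[OF _ q(1) qz] dl by simp
      moreover have "UnivPoly.eval K T g x ?l = x \<ominus>\<^bsub>T\<^esub> g r"
        using E.eval_monom1[OF x(1)] E.eval_const[OF x(1) r(1)] r(1) by (simp add: a_minus_def)
      moreover have "x \<ominus>\<^bsub>T\<^esub> g r \<noteq> \<zero>\<^bsub>T\<^esub>" using x r(1) by auto
      ultimately have "UnivPoly.eval K T g x ?l \<otimes>\<^bsub>T\<^esub> UnivPoly.eval K T g x q \<noteq> \<zero>\<^bsub>T\<^esub>"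
        using T.integral[OF _ h.hom_closed[OF l] h.hom_closed[OF q(1)]] by metis
      then show ?thesis unfolding q(2) h.hom_mult[OF l q(1)] .
    qed
  qed
  then show ?thesis using f unfolding P_def by blast
qed

context D_domain
begin

lemma D_map_exp_hom:
  assumes "algebra (Base \<D>) F" "\<iota> \<in> algebra_hom (Base \<D>) K F"
  shows "D_map \<D> \<iota> \<circ> D_exp \<D> \<delta> \<in> ring_hom K (D_of \<D> F)"
    and "\<lbrakk>i \<le> Last \<D>; k \<in> carrier K\<rbrakk> \<Longrightarrow> pi_over \<D> F i ((D_map \<D> \<iota> \<circ> D_exp \<D> \<delta>) k) = \<iota> (\<tau> i k)"
  using ring_hom_trans[OF K.D_exp_hom[OF DK] K.D_map_hom(1)[OF assms]]
    K.D_map_hom(2)[OF assms _ K.D_exp_closed[OF DK]] by (auto simp: assoc_endo_def)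

text \<open>The hull contains inverses and roots, and their existence is an existential sentence
  with parameters. Inverses come first, since the criterion for algebraic closedness is about
  fields.\<close>

lemma existentially_closed_alg_closed:
  assumes ec: "existentially_closed TYPE('u) \<D> K \<delta>" and f: "\<exists>f :: 'k \<Rightarrow> 'u. inj_on f (carrier K)"
  shows "algebraically_closed K"
proof -
  note ecd = existentially_closed_any[OF ec f K]
  obtain F :: "('a, ((('k \<times> 'k) set list \<times> nat) multiset \<Rightarrow> ('k \<times> 'k) set)) module" and \<delta>F h where
    F: "op_field \<D> F" "class_K \<D> F \<delta>F" and h: "D_embedding \<D> K \<delta> F \<delta>F h"
    using class_K_hull[OF K] by blast
  interpret F: op_field \<D> F by (rule F(1))
  interpret FF: field F by (rule F.fieldF)
  interpret KD: domain K by (rule domK)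
  have hr: "h \<in> ring_hom K F" and hi: "inj_on h (carrier K)" using h unfolding D_embedding_def algebra_hom_def by auto
  interpret h: ring_hom_cring K F h by unfold_locales (rule hr)
  have hz: "h x \<noteq> \<zero>\<^bsub>F\<^esub>" if "x \<in> carrier K" "x \<noteq> \<zero>\<^bsub>K\<^esub>" for x
    using inj_onD[OF hi, of x "\<zero>\<^bsub>K\<^esub>"] that by auto
  have "x \<in> Units K" if x: "x \<in> carrier K" "x \<noteq> \<zero>\<^bsub>K\<^esub>" for x
  proof -
    have u: "h x \<in> Units F" using hz[OF x] x(1) FF.field_Units by simp
    have "\<exists>w. (\<forall>i. w i \<in> carrier K) \<and> qf_holds K \<delta> (\<lambda>c. c) w (Eq (Times (Param x) (Var 0)) One)"
      by (rule ecd[OF F(2) h, where v = "\<lambda>i. inv\<^bsub>F\<^esub> h x"]) (use u x(1) in auto)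
    then obtain w where "\<forall>i. w i \<in> carrier K" "qf_holds K \<delta> (\<lambda>c. c) w (Eq (Times (Param x) (Var 0)) One)" by blast
    then have "w 0 \<in> carrier K" "x \<otimes>\<^bsub>K\<^esub> w 0 = \<one>\<^bsub>K\<^esub>" by auto
    then show ?thesis using x(1) K.R.m_comm[of x "w 0"] unfolding Units_def by auto
  qed
  then have "Units K = carrier K - {\<zero>\<^bsub>K\<^esub>}" using KD.zero_not_one by (auto simp: Units_def)
  then interpret KF: field K by (rule cring.cring_fieldI[OF K.R.is_cring])
  show ?thesis
  proof (rule KF.algebraically_closedI)
    fix p assume p: "p \<in> carrier (poly_ring K)" "degree p > 1"
    have pc: "set p \<subseteq> carrier K" and ne: "p \<noteq> []" and lz: "hd p \<noteq> \<zero>\<^bsub>K\<^esub>"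
      using p unfolding univ_poly_carrier[symmetric] polynomial_def by auto
    let ?c = "ring.coeff K p"
    have cK: "?c i \<in> carrier K" for i using ring.coeff_in_carrier[OF K.R.ring_axioms pc] .
    have lc: "?c (degree p) \<noteq> \<zero>\<^bsub>K\<^esub>" using ring.lead_coeff_simp[OF K.R.ring_axioms ne] lz by simp
    have len: "{..<length p} = {..degree p}" using lessThan_Suc_atMost[of "degree p"] ne by simp
    have "\<exists>y\<in>carrier F. (\<Oplus>\<^bsub>F\<^esub>i\<in>{..degree p}. h (?c i) \<otimes>\<^bsub>F\<^esub> y [^]\<^bsub>F\<^esub> i) = \<zero>\<^bsub>F\<^esub>"
      by (rule F.rootsF[unfolded root_closed_def, rule_format]) (use p(2) hz[OF cK lc] cK in auto)
    then obtain y where y: "y \<in> carrier F" "(\<Oplus>\<^bsub>F\<^esub>i\<in>{..degree p}. h (?c i) \<otimes>\<^bsub>F\<^esub> y [^]\<^bsub>F\<^esub> i) = \<zero>\<^bsub>F\<^esub>" by blast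
    have "\<exists>w. (\<forall>i. w i \<in> carrier K) \<and> qf_holds K \<delta> (\<lambda>c. c) w (Eq (tpoly ?c (length p)) Zero)"
    proof (rule ecd[OF F(2) h, where v = "\<lambda>i. y"])
      show "qf_over \<D> (carrier K) (Eq (tpoly ?c (length p)) Zero)" by (simp add: tpoly_over cK)
      show "qf_holds F \<delta>F h (\<lambda>i. y) (Eq (tpoly ?c (length p)) Zero)"
        using F.tpoly_val[of "length p" h ?c "\<lambda>i. y"] y cK unfolding len by simp
    qed (use y in simp)
    then obtain w where "\<forall>i. w i \<in> carrier K" "qf_holds K \<delta> (\<lambda>c. c) w (Eq (tpoly ?c (length p)) Zero)" by blast
    then have w: "w 0 \<in> carrier K" "dterm_val K \<delta> (\<lambda>c. c) w (tpoly ?c (length p)) = \<zero>\<^bsub>K\<^esub>" by auto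
    have "ring.eval K p (w 0) = \<zero>\<^bsub>K\<^esub>"
      using cring.eval_eq_finsum[OF K.R.is_cring pc w(1)] K.tpoly_val[of "length p" "\<lambda>c. c" ?c w] w cK by simp
    then show "\<exists>x\<in>carrier K. ring.eval K p x = \<zero>\<^bsub>K\<^esub>" using w(1) by blast
  qed
qed

text \<open>If \<open>x\<close> were not a value of \<sigma>_i, adjoin an indeterminate
  \<open>y\<close> with \<sigma>_i(y) = x and \<sigma>_j(y) = y for all other j. Then \<sigma>_i
  stays injective: its image of the algebraically closed field \<open>K\<close> does not contain
  \<open>x\<close>, so \<open>x\<close> is transcendental over it.\<close>

lemma existentially_closed_inversive:
  assumes ec: "existentially_closed TYPE('u) \<D> K \<delta>" and f: "\<exists>f :: 'k \<Rightarrow> 'u. inj_on f (carrier K)"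
  shows "inversive \<D> K \<delta>"
  unfolding inversive_def
proof
  fix i assume i1: "i \<in> {1..Last \<D>}"
  then have i: "i \<le> Last \<D>" "i \<noteq> 0" by auto
  have ac: "algebraically_closed K" by (rule existentially_closed_alg_closed[OF ec f])
  interpret KD: domain K by (rule domK)
  have "x \<in> \<tau> i ` carrier K" if x: "x \<in> carrier K" for x
  proof (rule ccontr)
    assume nx: "x \<notin> \<tau> i ` carrier K"
    define P where "P = UP K"
    interpret U: UP_domain K P by unfold_locales (rule P_def[THEN eq_reflection])
    have Ph: "(\<lambda>c. up_ring.monom P c 0) \<in> ring_hom K P"
      by (rule ring_hom_memI) (auto simp: U.monom_one U.monom_mult[of _ _ 0 0, simplified])
    have g: "(\<lambda>a. up_ring.monom P (a \<odot>\<^bsub>K\<^esub> \<one>\<^bsub>K\<^esub>) 0) \<in> ring_hom (Base \<D>) P"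
      using ring_hom_trans[OF K.scalar_hom Ph] by (simp add: comp_def)
    have domP: "domain P" ..
    obtain F :: "('a, ((((nat \<Rightarrow> 'k) \<times> (nat \<Rightarrow> 'k)) set list \<times> nat) multiset \<Rightarrow> ((nat \<Rightarrow> 'k) \<times> (nat \<Rightarrow> 'k)) set)) module" and e where
      F: "op_field \<D> F" and e: "e \<in> ring_hom P F" "inj_on e (carrier P)"
      and ea: "\<And>a. a \<in> carrier (Base \<D>) \<Longrightarrow> e (up_ring.monom P (a \<odot>\<^bsub>K\<^esub> \<one>\<^bsub>K\<^esub>) 0) = a \<odot>\<^bsub>F\<^esub> \<one>\<^bsub>F\<^esub>"
      and min: "\<And>N. \<lbrakk>subring N F; e ` carrier P \<subseteq> N; \<forall>x\<in>carrier F. algebraic_rel F N x \<longrightarrow> x \<in> N\<rbrakk> \<Longrightarrow> N = carrier F"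
      using hull_exists[OF domP g] by metis
    interpret F: op_field \<D> F by (rule F)
    interpret FD: domain F by (rule F.domainF)
    interpret e: ring_hom_cring P F e by unfold_locales (rule e(1))
    define \<iota> where "\<iota> = (\<lambda>c. e (up_ring.monom P c 0))"
    have mi: "c = d" if "up_ring.monom P c 0 = up_ring.monom P d 0" "c \<in> carrier K" "d \<in> carrier K" for c d
      using U.monom_inj[of 0] that by (auto dest: inj_onD)
    have \<iota>r: "\<iota> \<in> ring_hom K F" using ring_hom_trans[OF Ph e(1)] by (simp add: \<iota>_def comp_def)
    have \<iota>i: "inj_on \<iota> (carrier K)"
      by (rule inj_onI) (use inj_onD[OF e(2)] mi in \<open>simp add: \<iota>_def\<close>)
    have \<iota>a: "\<iota> \<in> algebra_hom (Base \<D>) K F"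
      by (rule algebra_hom_of_scalars[OF algK F.RA.algebra_axioms \<iota>r]) (simp add: \<iota>_def ea)
    note \<phi>h = D_map_exp_hom[OF F.RA.algebra_axioms \<iota>a]
    let ?\<phi> = "D_map \<D> \<iota> \<circ> D_exp \<D> \<delta>"
    define y where "y = e (up_ring.monom P \<one>\<^bsub>K\<^esub> 1)"
    have y: "y \<in> carrier F" unfolding y_def by simp
    have \<iota>c: "\<iota> c \<in> carrier F" if "c \<in> carrier K" for c using ring_hom_closed[OF \<iota>r that] .
    have yn: "y \<noteq> \<iota> c" if c: "c \<in> carrier K" for c
    proof
      assume "y = \<iota> c"
      then have "up_ring.monom P \<one>\<^bsub>K\<^esub> 1 = up_ring.monom P c 0" unfolding y_def \<iota>_def using inj_onD[OF e(2)] c by simp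
      then have "up_ring.coeff P (up_ring.monom P \<one>\<^bsub>K\<^esub> 1) 1 = up_ring.coeff P (up_ring.monom P c 0) 1" by simp
      then show False using c by simp
    qed
    \<comment> \<open>As i is positive, \<pi>_0(z) is \<open>y\<close>, which a section of \<pi>_0
      has to satisfy.\<close>
    have "\<exists>z\<in>carrier (D_of \<D> F). \<forall>j\<le>Last \<D>. pi_over \<D> F j z = (if j = i then \<iota> x else y)"
      by (rule F.D_lift) (use \<iota>c[OF x] y in simp)
    then obtain z where z: "z \<in> carrier (D_of \<D> F)" "\<And>j. j \<le> Last \<D> \<Longrightarrow> pi_over \<D> F j z = (if j = i then \<iota> x else y)" by blast
    interpret DF: cring "D_of \<D> F" by (rule F.D_cring)
    interpret EP: UP_pre_univ_prop K "D_of \<D> F" ?\<phi> P by unfold_locales (rule \<phi>h(1))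
    interpret I: UP_pre_univ_prop K F \<iota> P by unfold_locales (rule \<iota>r)
    let ?\<Psi> = "UnivPoly.eval K (D_of \<D> F) ?\<phi> z"
    have piP: "pi_over \<D> F j (?\<Psi> w) = UnivPoly.eval K F (\<iota> \<circ> \<tau> j) (if j = i then \<iota> x else y) w"
      if "j \<le> Last \<D>" "w \<in> carrier P" for j w
      unfolding z(2)[OF that(1), symmetric]
      by (rule up_eval_comp[OF K.R.is_cring F.D_cring F.R.is_cring \<phi>h(1) F.pi_hom[OF that(1)]])
        (use \<phi>h(2)[OF that(1)] z(1) that(2) in \<open>auto simp: P_def\<close>)
    have ee: "e w = UnivPoly.eval K F \<iota> y w" if "w \<in> carrier P" for w
    proof (rule I.UP_hom_unique[OF e.ring_hom_cring_axioms _ _ _ _ _ that y])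
      show "ring_hom_cring P F (UnivPoly.eval K F \<iota> y)"
        by (intro ring_hom_cring.intro ring_hom_cring_axioms.intro U.P.is_cring F.R.is_cring I.eval_ring_hom[OF y])
      show "UnivPoly.eval K F \<iota> y (up_ring.monom P \<one>\<^bsub>K\<^esub> (Suc 0)) = y" using I.eval_monom1[OF y] by simp
      show "UnivPoly.eval K F \<iota> y (up_ring.monom P r 0) = \<iota> r" if "r \<in> carrier K" for r
        by (rule I.eval_const[OF y that])
    qed (simp_all add: y_def \<iota>_def)
    have e0: "w = \<zero>\<^bsub>P\<^esub>" if "e w = \<zero>\<^bsub>F\<^esub>" "w \<in> carrier P" for w using inj_onD[OF e(2), of w "\<zero>\<^bsub>P\<^esub>"] that by simp
    interpret Ps: ring_hom_cring P "D_of \<D> F" ?\<Psi> by unfold_locales (rule EP.eval_ring_hom[OF z(1)])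
    have "\<exists>\<delta>'. class_K \<D> F \<delta>' \<and> D_embedding \<D> K \<delta> F \<delta>' \<iota> \<and> (\<forall>w\<in>carrier P. D_exp \<D> \<delta>' (e w) = ?\<Psi> w)"
    proof (rule F.extension[OF DK \<iota>a \<iota>i U.P.ring_axioms e(1) Ps.homh])
      fix w assume w: "w \<in> carrier P"
      have "UnivPoly.eval K F (\<iota> \<circ> \<tau> 0) y w = UnivPoly.eval K F \<iota> y w"
        using up_eval_comp[OF K.R.is_cring K.R.is_cring F.R.is_cring \<tau>_hom[OF le0] \<iota>r, of "\<iota>"] 
        unfolding UnivPoly.eval_def P_def[symmetric]
        using w K.assoc_endo_0[OF DK] U.coeff_closed[OF w] \<iota>c y by (auto intro!: F.R.finsum_cong')
      then show "pi_over \<D> F 0 (?\<Psi> w) = e w" using piP[OF le0 w] i(2) ee[OF w] by simp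
      show "?\<Psi> w = \<zero>\<^bsub>D_of \<D> F\<^esub>" if "e w = \<zero>\<^bsub>F\<^esub>" using e0[OF that w] by simp
      show "pi_over \<D> F j (?\<Psi> w) \<noteq> \<zero>\<^bsub>F\<^esub>" if "e w \<noteq> \<zero>\<^bsub>F\<^esub>" "j \<le> Last \<D>" for j
        unfolding piP[OF that(2) w]
      proof (rule UP_eval_nonzero[OF ac FD.domain_axioms ring_hom_trans[OF \<tau>_hom[OF that(2)] \<iota>r]])
        show "inj_on (\<iota> \<circ> \<tau> j) (carrier K)"
          by (rule comp_inj_on[OF K.assoc_endo_inj[OF K that(2)] inj_on_subset[OF \<iota>i]])
            (use ring_hom_closed[OF \<tau>_hom[OF that(2)]] in auto)
        show "(if j = i then \<iota> x else y) \<in> carrier F" using \<iota>c[OF x] y by simp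
        show "(if j = i then \<iota> x else y) \<notin> (\<iota> \<circ> \<tau> j) ` carrier K"
        proof
          assume "(if j = i then \<iota> x else y) \<in> (\<iota> \<circ> \<tau> j) ` carrier K"
          then obtain c where c: "c \<in> carrier K" "(if j = i then \<iota> x else y) = \<iota> (\<tau> j c)" by auto
          have tc: "\<tau> j c \<in> carrier K" using ring_hom_closed[OF \<tau>_hom[OF that(2)] c(1)] .
          show False
          proof (cases "j = i")
            case True
            then have "x = \<tau> i c" using inj_onD[OF \<iota>i, of x "\<tau> j c"] c(2) x tc by simp
            then show False using nx c(1) by blast
          qed (use yn[OF tc] c(2) in simp)
        qed
        show "w \<in> carrier (UP K)" "w \<noteq> \<zero>\<^bsub>UP K\<^esub>" using w that(1) unfolding P_def[symmetric] by auto
      qed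
    next
      fix k assume k: "k \<in> carrier K"
      show "\<exists>w\<in>carrier P. e w = \<iota> k \<and> ?\<Psi> w = D_map \<D> \<iota> (D_exp \<D> \<delta> k)"
        by (rule bexI[of _ "up_ring.monom P k 0"]) (use EP.eval_const[OF z(1) k] k in \<open>auto simp: \<iota>_def\<close>)
    qed (use min in blast)
    then obtain \<delta>' where d: "class_K \<D> F \<delta>'" "D_embedding \<D> K \<delta> F \<delta>' \<iota>" "\<And>w. w \<in> carrier P \<Longrightarrow> D_exp \<D> \<delta>' (e w) = ?\<Psi> w" by blast
    have DF: "D_ring \<D> F \<delta>'" using d(1) unfolding class_K_def by auto
    have "\<exists>w. (\<forall>i. w i \<in> carrier K) \<and> qf_holds K \<delta> (\<lambda>c. c) w (Eq (tendo \<D> i (Len \<D>)) (Param x))"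
    proof (rule existentially_closed_any[OF ec f K d(1,2), where v = "\<lambda>i. y"])
      have "assoc_endo \<D> F \<delta>' i y = pi_over \<D> F i z"
        unfolding assoc_endo_def y_def using d(3)[of "up_ring.monom P \<one>\<^bsub>K\<^esub> 1"] EP.eval_monom1[OF z(1)] by simp
      then show "qf_holds F \<delta>' \<iota> (\<lambda>i. y) (Eq (tendo \<D> i (Len \<D>)) (Param x))"
        using F.tendo_val[OF DF i(1), of "\<lambda>i. y"] y z(2)[OF i(1)] by simp
    qed (use tendo_over[OF i(1) order_refl] x y in auto)
    then obtain w where "\<forall>i. w i \<in> carrier K" "qf_holds K \<delta> (\<lambda>c. c) w (Eq (tendo \<D> i (Len \<D>)) (Param x))" by blast
    then have w: "w 0 \<in> carrier K" "dterm_val K \<delta> (\<lambda>c. c) w (tendo \<D> i (Len \<D>)) = x" by simp_all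
    then have "\<tau> i (w 0) = x" using K.tendo_val[where v = w and \<iota> = "\<lambda>c. c", OF DK i(1)] by simp
    then show False using nx w(1) by blast
  qed
  then show "\<tau> i ` carrier K = carrier K" using ring_hom_closed[OF \<tau>_hom[OF i(1)]] by blast
qed

end

subsection \<open>Ideals of polynomials are finitely generated\<close>

text \<open>Induction on the number of variables. Forgetting \<open>v\<close>, a finite
  \<open>C\<close> bounds all of \<open>A\<close> from below; its members involve \<open>v\<close>
  at most \<open>k\<close> times, so they already divide the monomials in which \<open>v\<close>
  occurs more often. For each exponent up to \<open>k\<close> a finite set is added.\<close>

lemma dickson:
  assumes "finite V" "\<And>m. m \<in> A \<Longrightarrow> set_mset m \<subseteq> V"
  shows "\<exists>B. finite B \<and> B \<subseteq> A \<and> (\<forall>m\<in>A. \<exists>b\<in>B. b \<subseteq># m)"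
  using assms
proof (induction V arbitrary: A rule: finite_induct)
  case empty
  then have "A \<subseteq> {{#}}" by auto
  then show ?case by (intro exI[of _ A]) (auto intro: finite_subset)
next
  case (insert v V)
  define r where "r = filter_mset (\<lambda>x. x \<noteq> v)"
  have le: "c \<subseteq># m" if "r c \<subseteq># r m" "count c v \<le> count m v" for c m
  proof (rule mset_subset_eqI)
    fix x show "count c x \<le> count m x"
      using mset_subset_eq_count[OF that(1), of x] that(2) unfolding r_def by (cases "x = v") auto
  qed
  have basis: "\<exists>C. finite C \<and> C \<subseteq> A' \<and> (\<forall>m\<in>A'. \<exists>c\<in>C. r c \<subseteq># r m)" if "A' \<subseteq> A" for A'
  proof -
    have "set_mset m \<subseteq> V" if "m \<in> r ` A'" for m using that \<open>A' \<subseteq> A\<close> insert.prems unfolding r_def by fastforce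
    then obtain B where B: "finite B" "B \<subseteq> r ` A'" "\<forall>m\<in>r ` A'. \<exists>b\<in>B. b \<subseteq># m" using insert.IH[of "r ` A'"] by blast
    then obtain C where "C \<subseteq> A'" "finite C" "B = r ` C" using finite_subset_image by metis
    then show ?thesis using B(3) by (intro exI[of _ C]) auto
  qed
  obtain C where C: "finite C" "C \<subseteq> A" "\<forall>m\<in>A. \<exists>c\<in>C. r c \<subseteq># r m" using basis[of A] by blast
  obtain k where k: "\<forall>c\<in>C. count c v \<le> k"
    using finite_nat_set_iff_bounded_le[of "(\<lambda>c. count c v) ` C"] C(1) by auto
  \<comment> \<open>Slices with fixed exponent \<open>j\<close> of \<open>v\<close>; within a slice,
    divisibility is decided by the other variables.\<close>
  have "\<forall>j. \<exists>C. finite C \<and> C \<subseteq> {m \<in> A. count m v = j} \<and> (\<forall>m\<in>{m \<in> A. count m v = j}. \<exists>c\<in>C. r c \<subseteq># r m)"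
    by (intro allI basis) blast
  from choice[OF this] obtain D where D': "\<forall>j. finite (D j) \<and> D j \<subseteq> {m \<in> A. count m v = j} \<and>
    (\<forall>m\<in>{m \<in> A. count m v = j}. \<exists>c\<in>D j. r c \<subseteq># r m)" by (elim exE) (rule that)
  have D: "finite (D j)" "D j \<subseteq> {m \<in> A. count m v = j}"
    "\<forall>m\<in>{m \<in> A. count m v = j}. \<exists>c\<in>D j. r c \<subseteq># r m" for j using spec[OF D', of j] by blast+
  have "\<exists>b\<in>C \<union> (\<Union>j\<le>k. D j). b \<subseteq># m" if m: "m \<in> A" for m
  proof (cases "count m v \<le> k")
    case True
    obtain c where "c \<in> D (count m v)" "r c \<subseteq># r m" using D(3)[of "count m v"] m by blast
    moreover then have "count c v = count m v" using D(2) by blast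
    ultimately show ?thesis using le[of c m] True by auto
  next
    case False
    obtain c where c: "c \<in> C" "r c \<subseteq># r m" using C(3) m by blast
    then have "c \<subseteq># m" using le[of c m] k False by fastforce
    then show ?thesis using c(1) by blast
  qed
  moreover have "C \<union> (\<Union>j\<le>k. D j) \<subseteq> A" using C(2) D(2) by blast
  ultimately show ?case using C(1) D(1) by (intro exI[of _ "C \<union> (\<Union>j\<le>k. D j)"]) simp
qed

lemma (in mpoly_base) mono_mult_coeff:
  assumes "c \<in> carrier R" "Q \<in> carrier (mpoly R V)"
  shows "(mmono R c d \<otimes>\<^bsub>mpoly R V\<^esub> Q) m = (if d \<subseteq># m then c \<otimes> Q (m - d) else \<zero>)"
proof -
  have Q: "Q x \<in> carrier R" for x by (rule mpoly_carrierD(2)[OF assms(2)])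
  have "(mmono R c d \<otimes>\<^bsub>mpoly R V\<^esub> Q) m = (\<Oplus>m'\<in>{m'. m' \<subseteq># m}. if d = m' then c \<otimes> Q (m - m') else \<zero>)"
    unfolding mpoly_mult by (rule finsum_cong'[OF refl]) (use assms(1) Q in \<open>auto simp: mmono_def\<close>)
  also have "\<dots> = (if d \<subseteq># m then c \<otimes> Q (m - d) else \<zero>)"
  proof (cases "d \<subseteq># m")
    case True
    have "(\<Oplus>m'\<in>{m'. m' \<subseteq># m}. if d = m' then c \<otimes> Q (m - m') else \<zero>) = c \<otimes> Q (m - d)"
      by (rule add.finprod_singleton) (use True assms(1) Q finite_submultisets in auto)
    then show ?thesis using True by simp
  next
    case False
    have "(\<Oplus>m'\<in>{m'. m' \<subseteq># m}. if d = m' then c \<otimes> Q (m - m') else \<zero>) = (\<Oplus>m'\<in>{m'. m' \<subseteq># m}. \<zero>)"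
      by (rule finsum_cong'[OF refl]) (use False in auto)
    then show ?thesis using False by simp
  qed
  finally show ?thesis .
qed

text \<open>Division by polynomials whose leading monomials form a finite Dickson basis of those of
  \<open>J\<close>; it terminates because the monomial order is well-founded. For the prolongation
  the variables are pairs in lexicographic order. Generation is stated through ideals containing
  \<open>J0\<close>, the form applied below to the ideal of polynomials vanishing at a
  point.\<close>

lemma ideal_finitely_generated:
  fixes R :: "('a, 'r) module" and V :: "'v::wellorder set"
  assumes "field R" and V: "finite V" and J: "ideal J (mpoly R V)"
  shows "\<exists>J0. finite J0 \<and> J0 \<subseteq> J \<and> (\<forall>I. ideal I (mpoly R V) \<and> J0 \<subseteq> I \<longrightarrow> J \<subseteq> I)"
proof -
  interpret R: field R by fact
  interpret B: mpoly_base R ..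
  interpret M: cring "mpoly R V" by (rule B.mpoly_cring)
  interpret J: ideal J "mpoly R V" by (rule J)
  let ?Z = "\<zero>\<^bsub>mpoly R V\<^esub>"
  define lm where "lm = (\<lambda>P :: 'v multiset \<Rightarrow> 'r. Max {m. P m \<noteq> \<zero>\<^bsub>R\<^esub>})"
  have lm: "P (lm P) \<noteq> \<zero>\<^bsub>R\<^esub>" "\<And>m. P m \<noteq> \<zero>\<^bsub>R\<^esub> \<Longrightarrow> m \<le> lm P" if P: "P \<in> carrier (mpoly R V)" "P \<noteq> ?Z" for P
  proof -
    have f: "finite {m. P m \<noteq> \<zero>\<^bsub>R\<^esub>}" by (rule B.mpoly_carrierD(1)[OF P(1)])
    moreover have "{m. P m \<noteq> \<zero>\<^bsub>R\<^esub>} \<noteq> {}" using P(2) unfolding B.mpoly_zero by auto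
    ultimately show "P (lm P) \<noteq> \<zero>\<^bsub>R\<^esub>" using Max_in unfolding lm_def by blast
    show "\<And>m. P m \<noteq> \<zero>\<^bsub>R\<^esub> \<Longrightarrow> m \<le> lm P" unfolding lm_def using f by simp
  qed
  have Jc: "P \<in> carrier (mpoly R V)" if "P \<in> J" for P using that by (rule J.a_Hcarr)
  have "\<exists>B. finite B \<and> B \<subseteq> lm ` (J - {?Z}) \<and> (\<forall>m\<in>lm ` (J - {?Z}). \<exists>b\<in>B. b \<subseteq># m)"
  proof (rule dickson[OF V])
    fix m assume "m \<in> lm ` (J - {?Z})"
    then obtain P where P: "P \<in> J" "P \<noteq> ?Z" "m = lm P" by blast
    show "set_mset m \<subseteq> V" unfolding P(3) by (rule B.mpoly_carrierD(3)[OF Jc[OF P(1)] lm(1)[OF Jc[OF P(1)] P(2)]])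
  qed
  then obtain B where B: "finite B" "B \<subseteq> lm ` (J - {?Z})" "\<forall>m\<in>lm ` (J - {?Z}). \<exists>b\<in>B. b \<subseteq># m" by blast
  then obtain J0 where J0: "J0 \<subseteq> J - {?Z}" "finite J0" "B = lm ` J0" using finite_subset_image by metis
  have "P \<in> I" if I: "ideal I (mpoly R V)" "J0 \<subseteq> I" and P: "P \<in> J" for I P
  proof (cases "P = ?Z")
    case True
    then show ?thesis using additive_subgroup.zero_closed[OF ideal.axioms(1)[OF I(1)]] by simp
  next
    case False
    interpret I: ideal I "mpoly R V" by (rule I(1))
    show ?thesis using P False
    proof (induction "lm P" arbitrary: P rule: less_induct)
      case less
      have Pc: "P \<in> carrier (mpoly R V)" by (rule Jc[OF less(2)])
      obtain g where g: "g \<in> J0" "lm g \<subseteq># lm P" using B(3) J0(3) less(2,3) by blast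
      have gJ: "g \<in> J" "g \<noteq> ?Z" "g \<in> carrier (mpoly R V)" using g(1) J0(1) Jc by auto
      have gu: "g (lm g) \<in> Units R" using lm(1)[OF gJ(3,2)] B.mpoly_carrierD(2)[OF gJ(3)] R.field_Units by simp
      define d where "d = lm P - lm g"
      define c where "c = P (lm P) \<otimes>\<^bsub>R\<^esub> inv\<^bsub>R\<^esub> g (lm g)"
      have c: "c \<in> carrier R" unfolding c_def using B.mpoly_carrierD(2)[OF Pc] gu by simp
      have lmP: "lm P = lm g + d" unfolding d_def using g(2) by simp
      have "set_mset (lm P) \<subseteq> V" using lm(1)[OF Pc less(3)] B.mpoly_carrierD(3)[OF Pc] by blast
      then have "set_mset d \<subseteq> V" unfolding lmP by simp
      then have Mc: "mmono R c d \<in> carrier (mpoly R V)" "mmono R (\<ominus>\<^bsub>R\<^esub> c) d \<in> carrier (mpoly R V)"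
        using c by (auto intro: B.mono_closed)
      \<comment> \<open>Cancels the leading term of \<open>P\<close>: \<open>d\<close> is the
        quotient of the leading monomials and \<open>c\<close> that of the leading
        coefficients.\<close>
      define P' where "P' = P \<oplus>\<^bsub>mpoly R V\<^esub> mmono R (\<ominus>\<^bsub>R\<^esub> c) d \<otimes>\<^bsub>mpoly R V\<^esub> g"
      have P': "P' m = P m \<oplus>\<^bsub>R\<^esub> (if d \<subseteq># m then \<ominus>\<^bsub>R\<^esub> c \<otimes>\<^bsub>R\<^esub> g (m - d) else \<zero>\<^bsub>R\<^esub>)" for m
        unfolding P'_def B.mpoly_add using B.mono_mult_coeff[OF _ gJ(3), of "\<ominus>\<^bsub>R\<^esub> c" d m] c by simp
      have P'J: "P' \<in> J" unfolding P'_def by (intro J.a_closed less(2) J.I_l_closed gJ(1) Mc(2))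
      have z: "P' (lm P) = \<zero>\<^bsub>R\<^esub>"
      proof -
        have "c \<otimes>\<^bsub>R\<^esub> g (lm g) = P (lm P)"
          unfolding c_def using gu B.mpoly_carrierD(2)[OF Pc, of "lm P"] R.Units_closed[OF gu] by (simp add: R.m_assoc)
        moreover have "lm P - d = lm g" "d \<subseteq># lm P" unfolding lmP by simp_all
        ultimately show ?thesis using c R.Units_closed[OF gu] B.mpoly_carrierD(2)[OF Pc, of "lm P"]
          by (simp add: P' R.l_minus R.r_neg)
      qed
      have le: "m \<le> lm P" if m: "P' m \<noteq> \<zero>\<^bsub>R\<^esub>" for m
      proof (cases "P m = \<zero>\<^bsub>R\<^esub>")
        case True
        then have d: "d \<subseteq># m" "g (m - d) \<noteq> \<zero>\<^bsub>R\<^esub>" using m c unfolding P' by (auto split: if_splits)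
        then have "m - d \<le> lm g" using lm(2)[OF gJ(3,2)] by blast
        then have "m - d + d \<le> lm g + d" by (rule add_right_mono)
        then show ?thesis using d(1) unfolding lmP by simp
      qed (use lm(2)[OF Pc less(3)] in blast)
      have "P' \<in> I"
      proof (cases "P' = ?Z")
        case False
        have "lm P' \<le> lm P" "lm P' \<noteq> lm P" using lm(1)[OF Jc[OF P'J] False] le z by auto
        then show ?thesis using less(1)[OF _ P'J False] by simp
      qed (use I.zero_closed in simp)
      moreover have "mmono R c d \<otimes>\<^bsub>mpoly R V\<^esub> g \<in> I" using I.I_l_closed[OF _ Mc(1)] g(1) I(2) by blast
      ultimately have "P' \<oplus>\<^bsub>mpoly R V\<^esub> mmono R c d \<otimes>\<^bsub>mpoly R V\<^esub> g \<in> I" by (rule I.a_closed)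
      moreover have "P' \<oplus>\<^bsub>mpoly R V\<^esub> mmono R c d \<otimes>\<^bsub>mpoly R V\<^esub> g = P"
        unfolding B.mpoly_add using c B.mpoly_carrierD(2)[OF gJ(3)] B.mpoly_carrierD(2)[OF Pc]
        by (auto simp: P' B.mono_mult_coeff[OF c gJ(3)] R.a_assoc R.l_minus R.l_neg)
      ultimately show ?case by simp
    qed
  qed
  then show ?thesis using J0 by (intro exI[of _ J0]) blast
qed

section \<open>Vanishing of an ideal as an existential sentence\<close>

primrec all_zero :: "('a, 'k) dterm list \<Rightarrow> ('a, 'k) qf_formula" where
  "all_zero [] = Eq Zero Zero"
| "all_zero (t # ts) = Conj (Eq t Zero) (all_zero ts)"

lemma all_zero_over: "qf_over \<D> C (all_zero ts) \<longleftrightarrow> (\<forall>t\<in>set ts. dterm_over \<D> C t)"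
  by (induction ts) auto

lemma all_zero_holds: "qf_holds R \<delta> \<iota> v (all_zero ts) \<longleftrightarrow> (\<forall>t\<in>set ts. dterm_val R \<delta> \<iota> v t = \<zero>\<^bsub>R\<^esub>)"
  by (induction ts) auto

context D_domain
begin

lemma id_embedding: "D_embedding \<D> K \<delta> K \<delta> (\<lambda>c. c)" by (rule D_embedding_refl[OF DK])

lemma mono_val:
  assumes F: "D_ring \<D> F \<delta>'" and \<iota>: "D_embedding \<D> K \<delta> F \<delta>' \<iota>" and v: "\<And>i. v i \<in> carrier F"
  shows "c \<in> carrier K \<Longrightarrow> mpoly_eval K F \<iota> (nabla \<D> \<delta>' n v) (mmono K c {#}) = \<iota> c"
    and "\<lbrakk>P \<in> carrier (PR n); x \<in> pv n\<rbrakk> \<Longrightarrow> mpoly_eval K F \<iota> (nabla \<D> \<delta>' n v) (P \<otimes>\<^bsub>PR n\<^esub> Vr x) =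
      mpoly_eval K F \<iota> (nabla \<D> \<delta>' n v) P \<otimes>\<^bsub>F\<^esub> dterm_val F \<delta>' \<iota> v (if fst x = 0 then Var (snd x) else Deriv (fst x) (Var (snd x)))"
    and "\<lbrakk>P \<in> carrier (PR n); Q \<in> carrier (PR n)\<rbrakk> \<Longrightarrow> mpoly_eval K F \<iota> (nabla \<D> \<delta>' n v) (P \<oplus>\<^bsub>PR n\<^esub> Q) =
      mpoly_eval K F \<iota> (nabla \<D> \<delta>' n v) P \<oplus>\<^bsub>F\<^esub> mpoly_eval K F \<iota> (nabla \<D> \<delta>' n v) Q"
proof -
  let ?e = "mpoly_eval K F \<iota> (nabla \<D> \<delta>' n v)" and ?x = "\<lambda>x. dterm_val F \<delta>' \<iota> v (if fst x = 0 then Var (snd x) else Deriv (fst x) (Var (snd x)))"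
  have alg: "algebra (Base \<D>) F" using F unfolding D_ring_def by blast
  interpret F: cring F by (rule algebra.M_cring[OF alg])
  have ih: "\<iota> \<in> ring_hom K F" using \<iota> unfolding D_embedding_def algebra_hom_def by auto
  have nc: "nabla \<D> \<delta>' n v \<in> pv n \<rightarrow> carrier F" by (rule nabla_closed[OF F v])
  have eh: "?e \<in> ring_hom (PR n) F"
    unfolding prol_ring_def by (rule MB.mpoly_eval_hom[OF F.is_cring ih nc])
  show "c \<in> carrier K \<Longrightarrow> ?e (mmono K c {#}) = \<iota> c"
    using MB.mpoly_eval_const[OF F.is_cring ih] unfolding MB.indexed_const_mono .
  show "?e (P \<otimes>\<^bsub>PR n\<^esub> Vr x) =
      ?e P \<otimes>\<^bsub>F\<^esub> ?x x"
    if "P \<in> carrier (PR n)" "x \<in> pv n"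
  proof -
    have "Vr x \<in> carrier (PR n)" unfolding prol_ring_def by (rule MB.var_closed[OF that(2)])
    moreover have "?e (Vr x) = nabla \<D> \<delta>' n v x"
      by (rule MB.mpoly_eval_var[OF F.is_cring ih]) (use nc that(2) in auto)
    moreover have "nabla \<D> \<delta>' n v x = ?x x"
      using that(2) by (cases x) (simp add: nabla_def)
    ultimately show ?thesis using ring_hom_mult[OF eh that(1)] by simp
  qed
  show "\<lbrakk>P \<in> carrier (PR n); Q \<in> carrier (PR n)\<rbrakk> \<Longrightarrow> ?e (P \<oplus>\<^bsub>PR n\<^esub> Q) =
      ?e P \<oplus>\<^bsub>F\<^esub> ?e Q"
    by (rule ring_hom_add[OF eh])
qed

text \<open>A coordinate (j, k) of nabla(v) is the variable \<open>k\<close> or its j-th derivative,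
  so equations for nabla(v) are formulas of the language. A single term has to serve in both
  structures, because it enters a sentence that is moved between them.\<close>

lemma poly_term:
  assumes F: "D_ring \<D> F \<delta>'" and \<iota>: "D_embedding \<D> K \<delta> F \<delta>' \<iota>" and P: "P \<in> carrier (PR n)"
  shows "\<exists>t. dterm_over \<D> (carrier K) t \<and>
    (\<forall>v. (\<forall>i. v i \<in> carrier F) \<longrightarrow> dterm_val F \<delta>' \<iota> v t = mpoly_eval K F \<iota> (nabla \<D> \<delta>' n v) P) \<and>
    (\<forall>v. (\<forall>i. v i \<in> carrier K) \<longrightarrow> dterm_val K \<delta> (\<lambda>c. c) v t = mpoly_eval K K (\<lambda>c. c) (nabla \<D> \<delta> n v) P)"
    (is "\<exists>t. ?T P t")
  using P[unfolded prol_ring_def]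
proof (induction rule: MB.mpoly_induct)
  case (mono c m)
  note F1 = mono_val[OF F \<iota>] and K1 = mono_val[OF DK id_embedding]
  show ?case using mono(2)
  proof (induction m)
    case empty
    have "?T (mmono K c {#}) (Param c)" using F1(1) K1(1) mono(1) by simp
    then show ?case by blast
  next
    case (add x m)
    then obtain t where t: "?T (mmono K c m) t" by auto
    have x: "x \<in> pv n" "set_mset m \<subseteq> pv n" using add.prems by auto
    have "mmono K c (add_mset x m) = mmono K c m \<otimes>\<^bsub>PR n\<^esub> Vr x"
      using MB.mono_mult[OF mono(1) K.one_closed, where m = m and n = "{#x#}" and V = "pv n"] mono(1) unfolding MB.indexed_var_mono prol_ring_def by simp
    moreover have "mmono K c m \<in> carrier (PR n)" unfolding prol_ring_def by (rule MB.mono_closed[OF mono(1) x(2)])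
    ultimately have "?T (mmono K c (add_mset x m)) (Times t (if fst x = 0 then Var (snd x) else Deriv (fst x) (Var (snd x))))"
      using t x(1) F1(2) K1(2) by (auto simp: prol_vars_def)
    then show ?case by blast
  qed
next
  case (add P Q)
  then obtain s t where st: "?T P s" "?T Q t" by blast
  have PQ: "P \<in> carrier (PR n)" "Q \<in> carrier (PR n)" using add unfolding prol_ring_def by auto
  have "?T (P \<oplus>\<^bsub>mpoly K (pv n)\<^esub> Q) (Plus s t)"
    using st mono_val(3)[OF F \<iota> _ PQ] mono_val(3)[OF DK id_embedding _ PQ] by (simp add: prol_ring_def)
  then show ?case by blast
qed

text \<open>Finitely many equations express that nabla of a tuple annihilates \<open>J\<close>, so
  existential closedness provides a solution in \<open>K\<close>. That the tuple lies on the variety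
  of \<open>I\<close> follows because the zeroth coordinate of e(P(a)) is P(a).\<close>

lemma ec_rational_point:
  assumes ec: "existentially_closed TYPE('u) \<D> K \<delta>" and f: "\<exists>f :: 'k \<Rightarrow> 'u. inj_on f (carrier K)"
    and J: "ideal J (PR n)" and I: "I \<subseteq> carrier (U n)" "prol_ideal \<D> K \<delta> n I \<subseteq> J"
    and F: "class_K \<D> F \<delta>'" and \<iota>: "D_embedding \<D> K \<delta> F \<delta>' \<iota>" and c: "\<And>k. c k \<in> carrier F"
    and zero: "\<And>P. P \<in> J \<Longrightarrow> mpoly_eval K F \<iota> (nabla \<D> \<delta>' n c) P = \<zero>\<^bsub>F\<^esub>"
  shows "\<exists>a\<in>rational_points K {..<n} I. nabla \<D> \<delta> n a \<in> rational_points K (pv n) J"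
proof -
  have fK: "field K" using existentially_closed_alg_closed[OF ec f] unfolding algebraically_closed_def by simp
  have DF: "D_ring \<D> F \<delta>'" using F unfolding class_K_def by auto
  have Jc: "P \<in> carrier (PR n)" if "P \<in> J" for P
    using additive_subgroup.a_Hcarr[OF ideal.axioms(1)[OF J] that] .
  have "finite (pv n)" unfolding prol_vars_def by simp
  from ideal_finitely_generated[OF fK this J[unfolded prol_ring_def]] obtain J0 where
    J0': "finite J0 \<and> J0 \<subseteq> J \<and> (\<forall>I. ideal I (mpoly K (pv n)) \<and> J0 \<subseteq> I \<longrightarrow> J \<subseteq> I)" by (elim exE) (rule that)
  then have J0: "finite J0" "J0 \<subseteq> J" by simp_all
  have J03: "J \<subseteq> I" if "ideal I (PR n)" "J0 \<subseteq> I" for I using J0' that unfolding prol_ring_def by blast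
  define T where "T = (\<lambda>P t. dterm_over \<D> (carrier K) t \<and>
    (\<forall>v. (\<forall>i. v i \<in> carrier F) \<longrightarrow> dterm_val F \<delta>' \<iota> v t = mpoly_eval K F \<iota> (nabla \<D> \<delta>' n v) P) \<and>
    (\<forall>v. (\<forall>i. v i \<in> carrier K) \<longrightarrow> dterm_val K \<delta> (\<lambda>c. c) v t = mpoly_eval K K (\<lambda>c. c) (nabla \<D> \<delta> n v) P))"
  have "\<forall>P\<in>J. \<exists>t. T P t" unfolding T_def using poly_term[OF DF \<iota> Jc] by blast
  from bchoice[OF this] obtain t where t': "\<forall>P\<in>J. T P (t P)" by (elim exE) (rule that)
  have t: "T P (t P)" if "P \<in> J" for P using bspec[OF t' that] .
  obtain Ps where Ps: "set Ps = J0" using finite_list[OF J0(1)] by blast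
  have PJ: "P \<in> J" if "P \<in> set Ps" for P using that Ps J0(2) by blast
  have "\<exists>w. (\<forall>i. w i \<in> carrier K) \<and> qf_holds K \<delta> (\<lambda>c. c) w (all_zero (map t Ps))"
    by (rule existentially_closed_any[OF ec f K F \<iota> _ c])
      (use t[OF PJ] zero[OF PJ] c in \<open>auto simp: all_zero_over all_zero_holds T_def\<close>)
  then obtain w where w: "\<And>i. w i \<in> carrier K" "\<And>P. P \<in> J0 \<Longrightarrow> dterm_val K \<delta> (\<lambda>c. c) w (t P) = \<zero>\<^bsub>K\<^esub>"
    unfolding all_zero_holds using Ps by auto
  \<comment> \<open>Rational points are extensional tuples, while \<open>w\<close> assigns values to
    all variables.\<close>
  define a where "a = restrict w {..<n}"
  have na: "nabla \<D> \<delta> n a = nabla \<D> \<delta> n w"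
    unfolding nabla_def a_def prol_vars_def by (auto intro!: restrict_ext)
  let ?e = "mpoly_eval K K (\<lambda>c. c) (nabla \<D> \<delta> n a)"
  have idh: "(\<lambda>c. c) \<in> ring_hom K K" by (simp add: ring_hom_def)
  have nc: "nabla \<D> \<delta> n w \<in> pv n \<rightarrow> carrier K" by (rule nabla_closed[OF DK w(1)])
  have eh: "?e \<in> ring_hom (PR n) K"
    unfolding na prol_ring_def by (rule MB.mpoly_eval_hom[OF K.R.is_cring idh nc])
  have "J \<subseteq> {P \<in> carrier (PR n). ?e P = \<zero>\<^bsub>K\<^esub>}"
  proof (rule J03[OF primeideal.axioms(1)[OF primeideal_kernel[OF PR_cring domK eh]]])
    show "J0 \<subseteq> {P \<in> carrier (PR n). ?e P = \<zero>\<^bsub>K\<^esub>}"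
    proof
      fix P assume P: "P \<in> J0"
      then have "T P (t P)" "P \<in> carrier (PR n)" using t Jc J0(2) by auto
      then show "P \<in> {P \<in> carrier (PR n). ?e P = \<zero>\<^bsub>K\<^esub>}" using w(2)[OF P] w(1) unfolding na T_def by simp
    qed
  qed
  then have ez: "?e P = \<zero>\<^bsub>K\<^esub>" if "P \<in> J" for P using that by blast
  have ac: "a k \<in> carrier K" if "k < n" for k using w(1) that unfolding a_def by simp
  have "mpoly_eval K K (\<lambda>c. c) a P = \<zero>\<^bsub>K\<^esub>" if P: "P \<in> I" for P
  proof -
    have "prol n P 0 \<in> J" using prol_ideal_subset[OF I(1) J] I(2) P len_pos by blast
    then have "D_map \<D> ?e (prol n P) 0 = \<zero>\<^bsub>K\<^esub>" using ez len_pos unfolding D_map_def by simp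
    moreover have "D_exp \<D> \<delta> (mpoly_eval K K (\<lambda>c. c) a P) = D_map \<D> ?e (prol n P)"
      by (rule exp_eval[OF DK id_embedding ac]) (use P I(1) in auto)
    ultimately show ?thesis using K.D_exp_0[of \<delta> "mpoly_eval K K (\<lambda>c. c) a P"] by simp
  qed
  then have "a \<in> rational_points K {..<n} I"
    unfolding rational_points_def using ac by (auto simp: a_def)
  moreover have "nabla \<D> \<delta> n a \<in> rational_points K (pv n) J"
  proof -
    have "nabla \<D> \<delta> n w \<in> extensional (pv n)" unfolding nabla_def by simp
    then have "nabla \<D> \<delta> n a \<in> pv n \<rightarrow>\<^sub>E carrier K" unfolding na PiE_iff using nc by blast
    then show ?thesis unfolding rational_points_def using ez by blast
  qed
  ultimately show ?thesis by blast
qed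

end

subsection \<open>Algebraic independence\<close>

lemma (in mpoly_base) mset_pow_var:
  assumes "f ` set_mset m \<subseteq> V"
  shows "mset_pow (mpoly R V) (\<lambda>v. indexed_var (f v)) m = mmono R \<one> (image_mset f m)"
  using assms
proof (induction m)
  case empty
  interpret M: cring "mpoly R V" by (rule mpoly_cring)
  show ?case by (simp add: mpoly_one)
next
  case (add x m)
  interpret M: cring "mpoly R V" by (rule mpoly_cring)
  have cl: "(\<lambda>v. indexed_var (f v)) \<in> set_mset (add_mset x m) \<rightarrow> carrier (mpoly R V)"
    using add.prems by (auto intro: var_closed)
  have "mset_pow (mpoly R V) (\<lambda>v. indexed_var (f v)) ({#x#} + m) =
    mset_pow (mpoly R V) (\<lambda>v. indexed_var (f v)) {#x#} \<otimes>\<^bsub>mpoly R V\<^esub> mset_pow (mpoly R V) (\<lambda>v. indexed_var (f v)) m"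
    by (rule M.mset_pow_add[OF cl]) auto
  also have "mset_pow (mpoly R V) (\<lambda>v. indexed_var (f v)) {#x#} = mmono R \<one> {#f x#}"
    using M.mset_pow_single[of "\<lambda>v. indexed_var (f v)" x] cl by (simp add: indexed_var_mono)
  finally show ?case using add mono_mult[where c = \<one> and d = \<one> and m = "{#f x#}" and n = "image_mset f m" and V = V] by simp
qed

text \<open>An injective renaming keeps distinct monomials distinct, so the coefficients can still
  be read off after the substitution.\<close>

lemma eval_shift_coeff:
  fixes R :: "('a, 'r) module" and Q :: "('a, 'q) module" and V :: "'v set" and f :: "'v \<Rightarrow> 'w"
  assumes R: "cring R" and Q: "cring Q" and l: "l \<in> ring_hom R Q" and f: "inj_on f V"
    and P: "P \<in> carrier (mpoly R V)" and m: "set_mset m \<subseteq> V"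
  shows "mpoly_eval R (mpoly Q UNIV) (ring.indexed_const Q \<circ> l) (\<lambda>v. ring.indexed_var Q (f v)) P (image_mset f m) = l (P m)"
proof -
  interpret R: cring R by fact
  interpret Q: cring Q by fact
  interpret RB: mpoly_base R ..
  interpret QB: mpoly_base Q ..
  interpret l: ring_hom_cring R Q l by unfold_locales (rule l)
  have M: "cring (mpoly Q (UNIV :: 'w set))" by (rule QB.mpoly_cring)
  have h: "ring.indexed_const Q \<circ> l \<in> ring_hom R (mpoly Q (UNIV :: 'w set))" by (rule ring_hom_trans[OF l QB.const_hom])
  have y: "(\<lambda>v. ring.indexed_var Q (f v)) \<in> V \<rightarrow> carrier (mpoly Q (UNIV :: 'w set))" by (auto intro: QB.var_closed)
  define E where "E = mpoly_eval R (mpoly Q UNIV) (ring.indexed_const Q \<circ> l) (\<lambda>v. ring.indexed_var Q (f v))"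
  have "E P (image_mset f m) = l (P m)" using P
  proof (induction rule: RB.mpoly_induct)
    case (mono c k)
    have inv: "image_mset (inv_into V f) (image_mset f x) = x" if "set_mset x \<subseteq> V" for x
    proof -
      have "image_mset (inv_into V f \<circ> f) x = image_mset id x"
        by (rule image_mset_cong) (use that f in auto)
      then show ?thesis by (simp add: multiset.map_comp)
    qed
    have inj: "image_mset f m = image_mset f k \<longleftrightarrow> m = k" using inv[OF m] inv[OF mono(2)] by metis
    have "E (mmono R c k) =
      mmono Q (l c) {#} \<otimes>\<^bsub>mpoly Q (UNIV :: 'w set)\<^esub> mmono Q \<one>\<^bsub>Q\<^esub> (image_mset f k)"
      unfolding E_def using RB.mpoly_eval_mono[OF M h y mono] QB.mset_pow_var[of f k UNIV] by (simp add: QB.indexed_const_mono)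
    also have "\<dots> = mmono Q (l c) (image_mset f k)" using mono(1) by (simp add: QB.mono_mult)
    finally have "E (mmono R c k) (image_mset f m) = mmono Q (l c) (image_mset f k) (image_mset f m)" by simp
    also have "\<dots> = l (mmono R c k m)" by (simp add: mmono_def inj)
    finally show ?case .
  next
    case (add P P')
    have "E (P \<oplus>\<^bsub>mpoly R V\<^esub> P') =
      E P \<oplus>\<^bsub>mpoly Q UNIV\<^esub>
      E P'"
      unfolding E_def by (rule RB.mpoly_eval_add[OF M h y add(1,2)])
    then have "E (P \<oplus>\<^bsub>mpoly R V\<^esub> P') (image_mset f m) = E P (image_mset f m) \<oplus>\<^bsub>Q\<^esub> E P' (image_mset f m)"
      by (simp only: QB.mpoly_add)
    also have "\<dots> = l ((P \<oplus>\<^bsub>mpoly R V\<^esub> P') m)"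
      using add(3,4) RB.mpoly_carrierD(2)[OF add(1), of m] RB.mpoly_carrierD(2)[OF add(2), of m]
      by (simp add: RB.mpoly_add)
    finally show ?case .
  qed
  then show ?thesis unfolding E_def .
qed

text \<open>Elements of \<open>F\<close> coming from distinct indeterminates over \<open>Q\<close>
  are independent over every ring embedded in \<open>Q\<close>. The embedding and the renaming are
  parameters because independence is needed over the images of one subring under the various \<pi>_i
  o e.\<close>

lemma shift_eval_zero:
  fixes R :: "('a, 'r) module" and Q :: "('a, 'q) module" and V :: "'v set" and f :: "'v \<Rightarrow> 'w"
  assumes R: "cring R" and Q: "cring Q" and F: "cring F" and l: "l \<in> ring_hom R Q" "inj_on l (carrier R)" and f: "inj_on f V"
    and h: "h \<in> ring_hom (mpoly Q UNIV) F" "inj_on h (carrier (mpoly Q (UNIV :: 'w set)))"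
    and g: "g \<in> ring_hom R F" "\<And>c. c \<in> carrier R \<Longrightarrow> g c = h (ring.indexed_const Q (l c))"
    and y: "\<And>v. v \<in> V \<Longrightarrow> y v = h (ring.indexed_var Q (f v))"
    and P: "P \<in> carrier (mpoly R V)" "mpoly_eval R F g y P = \<zero>\<^bsub>F\<^esub>"
  shows "P = \<zero>\<^bsub>mpoly R V\<^esub>"
proof -
  interpret R: cring R by fact
  interpret Q: cring Q by fact
  interpret F: cring F by fact
  interpret RB: mpoly_base R ..
  interpret QB: mpoly_base Q ..
  interpret M: cring "mpoly Q (UNIV :: 'w set)" by (rule QB.mpoly_cring)
  interpret h: ring_hom_cring "mpoly Q (UNIV :: 'w set)" F h by unfold_locales (rule h(1))
  interpret l: ring_hom_cring R Q l by unfold_locales (rule l(1))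
  let ?e = "mpoly_eval R (mpoly Q (UNIV :: 'w set)) (ring.indexed_const Q \<circ> l) (\<lambda>v. ring.indexed_var Q (f v))"
  have h': "ring.indexed_const Q \<circ> l \<in> ring_hom R (mpoly Q (UNIV :: 'w set))" by (rule ring_hom_trans[OF l(1) QB.const_hom])
  have vc: "ring.indexed_var Q w \<in> carrier (mpoly Q (UNIV :: 'w set))" for w by (simp add: QB.var_closed)
  have eh: "?e \<in> ring_hom (mpoly R V) (mpoly Q (UNIV :: 'w set))"
    by (rule RB.mpoly_eval_hom[OF M.is_cring h']) (use vc in auto)
  have yc: "y v \<in> carrier F" if "v \<in> V" for v using y[OF that] vc by simp
  have "mpoly_eval R F g y P = (h \<circ> ?e) P"
  proof (rule RB.mpoly_hom_unique[OF F.ring_axioms _ ring_hom_trans[OF eh h(1)] _ _ P(1)])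
    show "mpoly_eval R F g y \<in> ring_hom (mpoly R V) F" by (rule RB.mpoly_eval_hom[OF F g(1)]) (use yc in auto)
    show "mpoly_eval R F g y (ring.indexed_const R c) = (h \<circ> ?e) (ring.indexed_const R c)" if "c \<in> carrier R" for c
      by (simp add: RB.mpoly_eval_const[OF F g(1) that] RB.mpoly_eval_const[OF M.is_cring h' that] g(2)[OF that])
    show "mpoly_eval R F g y (ring.indexed_var R v) = (h \<circ> ?e) (ring.indexed_var R v)" if "v \<in> V" for v
      using RB.mpoly_eval_var[OF F g(1), of y v, OF yc[OF that]] y[OF that]
        RB.mpoly_eval_var[OF M.is_cring h', of "\<lambda>v. ring.indexed_var Q (f v)" v] vc by simp
  qed
  then have "h (?e P) = h \<zero>\<^bsub>mpoly Q (UNIV :: 'w set)\<^esub>" using P(2) by simp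
  then have e0: "?e P = \<zero>\<^bsub>mpoly Q (UNIV :: 'w set)\<^esub>"
    using inj_onD[OF h(2) _ ring_hom_closed[OF eh P(1)] M.zero_closed] by blast
  have "P m = \<zero>\<^bsub>R\<^esub>" for m
  proof (cases "set_mset m \<subseteq> V")
    case True
    have "l (P m) = \<zero>\<^bsub>Q\<^esub>"
      using eval_shift_coeff[OF R Q l(1) f P(1) True] unfolding e0 by (simp add: QB.mpoly_zero)
    then show ?thesis using inj_onD[OF l(2), of "P m" "\<zero>\<^bsub>R\<^esub>"] RB.mpoly_carrierD(2)[OF P(1), of m] by simp
  next
    case False
    then show ?thesis using RB.mpoly_carrierD(3)[OF P(1)] by blast
  qed
  then show ?thesis unfolding RB.mpoly_zero by blast
qed

text \<open>The coefficient of the k-th power of \<open>v\<close>, as a polynomial in the other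
  variables.\<close>

definition split_poly :: "('a, 'r) module \<Rightarrow> 'v \<Rightarrow> nat \<Rightarrow> ('v multiset \<Rightarrow> 'r) \<Rightarrow> 'v multiset \<Rightarrow> 'r" where
  "split_poly R v k P = (\<lambda>m. if v \<in># m then \<zero>\<^bsub>R\<^esub> else P (m + replicate_mset k v))"

lemma (in cring) mset_pow_replicate: "y v \<in> carrier R \<Longrightarrow> mset_pow R y (replicate_mset k v) = y v [^] k"
  by (cases k) (simp_all add: mset_pow_def)

context mpoly_base
begin

lemma split_poly_mono:
  "split_poly R v k (mmono R c m) =
    (if k = count m v then mmono R c (filter_mset (\<lambda>x. x \<noteq> v) m) else \<zero>\<^bsub>mpoly R V\<^esub>)"
proof
  fix x
  let ?m = "filter_mset (\<lambda>x. x \<noteq> v) m"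
  have m: "m = ?m + replicate_mset (count m v) v"
    by (rule multiset_eqI) simp
  have "x + replicate_mset k v = m \<longleftrightarrow> k = count m v \<and> x = ?m" if "v \<notin># x"
  proof
    assume "x + replicate_mset k v = m"
    then have e: "m = x + replicate_mset k v" by simp
    have "count m v = k" using that by (simp add: e not_in_iff)
    moreover have "?m = x" by (rule multiset_eqI) (use that in \<open>auto simp: e not_in_iff\<close>)
    ultimately show "k = count m v \<and> x = ?m" by simp
  qed (use m in simp)
  then show "split_poly R v k (mmono R c m) x =
    (if k = count m v then mmono R c ?m else \<zero>\<^bsub>mpoly R V\<^esub>) x"
    unfolding split_poly_def mmono_def mpoly_zero by auto
qed

text \<open>Expansion in powers of \<open>v\<close>. The upper limit is arbitrary beyond some
  \<open>n0\<close>, so that the expansions of two summands can be given a common one.\<close>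

lemma split_poly_eval:
  assumes v: "v \<notin> V" and S: "cring S" and h: "h \<in> ring_hom R S" and y: "y \<in> insert v V \<rightarrow> carrier S"
    and P: "P \<in> carrier (mpoly R (insert v V))"
  shows "(\<forall>k. split_poly R v k P \<in> carrier (mpoly R V)) \<and>
    (\<exists>n0. \<forall>n\<ge>n0. mpoly_eval R S h y P =
      (\<Oplus>\<^bsub>S\<^esub>k\<in>{..n}. mpoly_eval R S h y (split_poly R v k P) \<otimes>\<^bsub>S\<^esub> y v [^]\<^bsub>S\<^esub> k))"
proof -
  let ?e = "mpoly_eval R S h y"
  interpret S: cring S by fact
  have yV: "y \<in> V \<rightarrow> carrier S" and yv: "y v \<in> carrier S" using y by auto
  interpret M: cring "mpoly R V" by (rule mpoly_cring)
  interpret E: ring_hom_cring "mpoly R V" S "?e"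
    by unfold_locales (rule mpoly_eval_hom[OF S h yV])
  have hc: "h c \<in> carrier S" if "c \<in> carrier R" for c using ring_hom_closed[OF h that] .
  show ?thesis using P
  proof (induction rule: mpoly_induct)
    case (mono c m)
    let ?m = "filter_mset (\<lambda>x. x \<noteq> v) m"
    have mV: "set_mset ?m \<subseteq> V" using mono(2) by auto
    have sp: "split_poly R v k (mmono R c m) = (if k = count m v then mmono R c ?m else \<zero>\<^bsub>mpoly R V\<^esub>)" for k
      by (rule split_poly_mono)
    have mc: "mmono R c ?m \<in> carrier (mpoly R V)" by (rule mono_closed[OF mono(1) mV])
    have m: "m = ?m + replicate_mset (count m v) v" by (rule multiset_eqI) simp
    have "mset_pow S y (?m + replicate_mset (count m v) v) = mset_pow S y ?m \<otimes>\<^bsub>S\<^esub> mset_pow S y (replicate_mset (count m v) v)"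
      by (rule S.mset_pow_add[OF y]) (use mV in auto)
    then have "mset_pow S y m = mset_pow S y ?m \<otimes>\<^bsub>S\<^esub> y v [^]\<^bsub>S\<^esub> count m v"
      unfolding m[symmetric] S.mset_pow_replicate[of y v, OF yv] .
    moreover have "mset_pow S y ?m \<in> carrier S" by (rule S.mset_pow_closed) (use y mono(2) in auto)
    ultimately have ev: "?e (mmono R c m) = ?e (mmono R c ?m) \<otimes>\<^bsub>S\<^esub> y v [^]\<^bsub>S\<^esub> count m v"
      unfolding mpoly_eval_mono[OF S h y mono] mpoly_eval_mono[OF S h yV mono(1) mV]
      using hc[OF mono(1)] yv by (simp add: S.m_assoc)
    have "?e (mmono R c m) =
      (\<Oplus>\<^bsub>S\<^esub>k\<in>{..n}. ?e (split_poly R v k (mmono R c m)) \<otimes>\<^bsub>S\<^esub> y v [^]\<^bsub>S\<^esub> k)" if n: "n \<ge> count m v" for n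
    proof -
      have "(\<Oplus>\<^bsub>S\<^esub>k\<in>{..n}. ?e (split_poly R v k (mmono R c m)) \<otimes>\<^bsub>S\<^esub> y v [^]\<^bsub>S\<^esub> k) =
        (\<Oplus>\<^bsub>S\<^esub>k\<in>{..n}. if count m v = k then ?e (mmono R c ?m) \<otimes>\<^bsub>S\<^esub> y v [^]\<^bsub>S\<^esub> k else \<zero>\<^bsub>S\<^esub>)"
        by (rule S.finsum_cong'[OF refl]) (use mc yv in \<open>auto simp: sp\<close>)
      also have "\<dots> = ?e (mmono R c ?m) \<otimes>\<^bsub>S\<^esub> y v [^]\<^bsub>S\<^esub> count m v"
        by (rule S.add.finprod_singleton) (use n mc yv in auto)
      finally show ?thesis using ev by simp
    qed
    then show ?case using sp mc by auto
  next
    case (add P Q)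
    let ?A = "mpoly R (insert v V)"
    have sp: "split_poly R v k (P \<oplus>\<^bsub>?A\<^esub> Q) = split_poly R v k P \<oplus>\<^bsub>mpoly R V\<^esub> split_poly R v k Q" for k
      unfolding split_poly_def mpoly_add by auto
    have cl: "split_poly R v k P \<in> carrier (mpoly R V)" "split_poly R v k Q \<in> carrier (mpoly R V)" for k using add(3,4) by auto
    obtain a b where ab: "\<forall>n\<ge>a. ?e P = (\<Oplus>\<^bsub>S\<^esub>k\<in>{..n}. ?e (split_poly R v k P) \<otimes>\<^bsub>S\<^esub> y v [^]\<^bsub>S\<^esub> k)"
      "\<forall>n\<ge>b. ?e Q = (\<Oplus>\<^bsub>S\<^esub>k\<in>{..n}. ?e (split_poly R v k Q) \<otimes>\<^bsub>S\<^esub> y v [^]\<^bsub>S\<^esub> k)"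
      using add(3,4) by blast
    have ev: "?e (P \<oplus>\<^bsub>?A\<^esub> Q) =
      (\<Oplus>\<^bsub>S\<^esub>k\<in>{..n}. ?e (split_poly R v k (P \<oplus>\<^bsub>?A\<^esub> Q)) \<otimes>\<^bsub>S\<^esub> y v [^]\<^bsub>S\<^esub> k)" if n: "n \<ge> max a b" for n
    proof -
      have "(\<Oplus>\<^bsub>S\<^esub>k\<in>{..n}. ?e (split_poly R v k (P \<oplus>\<^bsub>?A\<^esub> Q)) \<otimes>\<^bsub>S\<^esub> y v [^]\<^bsub>S\<^esub> k) =
        (\<Oplus>\<^bsub>S\<^esub>k\<in>{..n}. ?e (split_poly R v k P) \<otimes>\<^bsub>S\<^esub> y v [^]\<^bsub>S\<^esub> k \<oplus>\<^bsub>S\<^esub>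
          ?e (split_poly R v k Q) \<otimes>\<^bsub>S\<^esub> y v [^]\<^bsub>S\<^esub> k)"
        by (rule S.finsum_cong'[OF refl]) (use cl yv in \<open>auto simp: sp S.l_distr\<close>)
      also have "\<dots> = ?e P \<oplus>\<^bsub>S\<^esub> ?e Q"
        using ab n cl yv by (subst S.finsum_addf) auto
      finally show ?thesis using mpoly_eval_add[OF S h y add(1,2)] by simp
    qed
    have "split_poly R v k (P \<oplus>\<^bsub>?A\<^esub> Q) \<in> carrier (mpoly R V)" for k
      unfolding sp by (rule mpoly_add_closed[OF cl])
    then show ?case using ev by blast
  qed
qed

end

text \<open>The relation is cut at its last nonzero coefficient, since \<open>algebraic_rel\<close>
  demands a nonzero leading one.\<close>

lemma (in cring) algebraic_relI:
  assumes M: "M \<subseteq> carrier R" "\<And>k. c k \<in> M" and x: "x \<in> carrier R"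
    and z: "(\<Oplus>k\<in>{..n::nat}. c k \<otimes> x [^] k) = \<zero>" and nz: "k \<le> n" "c k \<noteq> \<zero>"
  shows "algebraic_rel R M x"
proof -
  define d where "d = Max {k. k \<le> n \<and> c k \<noteq> \<zero>}"
  have fin: "finite {k. k \<le> n \<and> c k \<noteq> \<zero>}" by (rule finite_subset[of _ "{..n}"]) auto
  have "d \<in> {k. k \<le> n \<and> c k \<noteq> \<zero>}" unfolding d_def by (rule Max_in[OF fin]) (use nz in blast)
  then have d: "d \<le> n" "c d \<noteq> \<zero>" by auto
  have big: "c k = \<zero>" if "d < k" "k \<le> n" for k
  proof (rule ccontr)
    assume "c k \<noteq> \<zero>"
    then have "k \<le> d" using Max_ge[OF fin, of k] that(2) unfolding d_def by simp
    then show False using that(1) by simp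
  qed
  have cc: "c k \<in> carrier R" for k using M by blast
  have "(\<Oplus>k\<in>{..n}. c k \<otimes> x [^] k) = (\<Oplus>k\<in>{..d}. c k \<otimes> x [^] k)"
    by (rule add.finprod_mono_neutral_cong_right) (use d(1) big cc x in \<open>auto simp: not_le\<close>)
  then show ?thesis unfolding algebraic_rel_def using z d(2) M(2) by metis
qed

text \<open>A nonzero relation has a nonzero coefficient at some power of \<open>v\<close>, and
  independence of the elements indexed by \<open>V\<close> makes the value of this coefficient
  nonzero.\<close>

lemma (in mpoly_base) dependent_algebraic:
  assumes v: "v \<notin> V" and S: "cring S" and h: "h \<in> ring_hom R S" and y: "y \<in> insert v V \<rightarrow> carrier S"
    and P: "P \<in> carrier (mpoly R (insert v V))" "P \<noteq> \<zero>\<^bsub>mpoly R (insert v V)\<^esub>" "mpoly_eval R S h y P = \<zero>\<^bsub>S\<^esub>"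
    and indep: "\<And>Q. \<lbrakk>Q \<in> carrier (mpoly R V); mpoly_eval R S h y Q = \<zero>\<^bsub>S\<^esub>\<rbrakk> \<Longrightarrow> Q = \<zero>\<^bsub>mpoly R V\<^esub>"
  shows "algebraic_rel S (mpoly_eval R S h y ` carrier (mpoly R V)) (y v)"
proof -
  interpret S: cring S by fact
  have yV: "y \<in> V \<rightarrow> carrier S" and yv: "y v \<in> carrier S" using y by auto
  obtain n0 where cl: "\<And>k. split_poly R v k P \<in> carrier (mpoly R V)"
    and n0: "\<And>n. n \<ge> n0 \<Longrightarrow> mpoly_eval R S h y P =
      (\<Oplus>\<^bsub>S\<^esub>k\<in>{..n}. mpoly_eval R S h y (split_poly R v k P) \<otimes>\<^bsub>S\<^esub> y v [^]\<^bsub>S\<^esub> k)"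
    using split_poly_eval[OF v S h y P(1)] by blast
  obtain m where m: "P m \<noteq> \<zero>" using P(2) unfolding mpoly_zero by blast
  let ?k = "count m v" and ?m = "filter_mset (\<lambda>x. x \<noteq> v) m"
  have "m = ?m + replicate_mset ?k v" by (rule multiset_eqI) simp
  then have "split_poly R v ?k P ?m \<noteq> \<zero>" using m unfolding split_poly_def by simp
  then have "split_poly R v ?k P \<noteq> \<zero>\<^bsub>mpoly R V\<^esub>" unfolding mpoly_zero by auto
  then have nz: "mpoly_eval R S h y (split_poly R v ?k P) \<noteq> \<zero>\<^bsub>S\<^esub>" using indep[OF cl] by blast
  show ?thesis
  proof (rule S.algebraic_relI[OF _ _ yv])
    show "mpoly_eval R S h y ` carrier (mpoly R V) \<subseteq> carrier S"
      using ring_hom_closed[OF mpoly_eval_hom[OF S h yV]] by blast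
    show "(\<Oplus>\<^bsub>S\<^esub>k\<in>{..max n0 ?k}. mpoly_eval R S h y (split_poly R v k P) \<otimes>\<^bsub>S\<^esub> y v [^]\<^bsub>S\<^esub> k) = \<zero>\<^bsub>S\<^esub>"
      using n0[of "max n0 ?k"] P(3) by simp
  qed (use cl nz in auto)
qed

subsection \<open>Existentially closed rings satisfy the geometric axiom\<close>

text \<open>A homomorphism with values in an embedded ring factors through the embedding. This is
  used to invert \<sigma>_i and to regard \<pi>_i o e as a map into the coordinate ring of a
  variety.\<close>

lemma inv_into_hom:
  assumes S: "ring S" and Q: "ring Q" and F: "ring F" and \<kappa>: "\<kappa> \<in> ring_hom Q F" "inj_on \<kappa> (carrier Q)"
    and \<phi>: "\<phi> \<in> ring_hom S F" "\<And>s. s \<in> carrier S \<Longrightarrow> \<phi> s \<in> \<kappa> ` carrier Q"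
  shows "(\<lambda>s. inv_into (carrier Q) \<kappa> (\<phi> s)) \<in> ring_hom S Q"
    and "s \<in> carrier S \<Longrightarrow> \<kappa> (inv_into (carrier Q) \<kappa> (\<phi> s)) = \<phi> s"
proof -
  interpret S: ring S by fact
  interpret Q: ring Q by fact
  define l where "l = (\<lambda>s. inv_into (carrier Q) \<kappa> (\<phi> s))"
  have lc: "l s \<in> carrier Q" and kl: "\<kappa> (l s) = \<phi> s" if "s \<in> carrier S" for s
    using inv_into_into[OF \<phi>(2)[OF that]] f_inv_into_f[OF \<phi>(2)[OF that]] unfolding l_def by auto
  show "s \<in> carrier S \<Longrightarrow> \<kappa> (inv_into (carrier Q) \<kappa> (\<phi> s)) = \<phi> s" using kl unfolding l_def .
  have eq: "x = z" if "x \<in> carrier Q" "z \<in> carrier Q" "\<kappa> x = \<kappa> z" for x z using inj_onD[OF \<kappa>(2)] that by blast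
  have "l \<in> ring_hom S Q"
  proof (rule ring_hom_memI)
    fix x y assume xy: "x \<in> carrier S" "y \<in> carrier S"
    show "l x \<in> carrier Q" by (rule lc[OF xy(1)])
    show "l (x \<otimes>\<^bsub>S\<^esub> y) = l x \<otimes>\<^bsub>Q\<^esub> l y"
      by (rule eq) (use xy lc in \<open>simp_all add: kl ring_hom_mult[OF \<kappa>(1)] ring_hom_mult[OF \<phi>(1)]\<close>)
    show "l (x \<oplus>\<^bsub>S\<^esub> y) = l x \<oplus>\<^bsub>Q\<^esub> l y"
      by (rule eq) (use xy lc in \<open>simp_all add: kl ring_hom_add[OF \<kappa>(1)] ring_hom_add[OF \<phi>(1)]\<close>)
  next
    show "l \<one>\<^bsub>S\<^esub> = \<one>\<^bsub>Q\<^esub>"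
      by (rule eq) (use lc in \<open>simp_all add: kl ring_hom_one[OF \<kappa>(1)] ring_hom_one[OF \<phi>(1)]\<close>)
  qed
  then show "(\<lambda>s. inv_into (carrier Q) \<kappa> (\<phi> s)) \<in> ring_hom S Q" unfolding l_def .
qed

lemma mod_of_domain:
  assumes "domain L"
  shows "domain (mod_of L g)"
proof -
  interpret L: domain L by fact
  show ?thesis
    by (rule domainI[OF mod_of_cring[OF L.is_cring]]) (use L.integral in auto)
qed

lemma (in mpoly_base) mpoly_eval_comp:
  assumes T: "cring T" and T': "cring T'" and h: "h \<in> ring_hom R T" "h' \<in> ring_hom R T'" and \<phi>: "\<phi> \<in> ring_hom T T'"
    and y: "\<And>v. v \<in> V \<Longrightarrow> y v \<in> carrier T" and c: "\<And>c. c \<in> carrier R \<Longrightarrow> \<phi> (h c) = h' c"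
    and y': "\<And>v. v \<in> V \<Longrightarrow> \<phi> (y v) = y' v" and P: "P \<in> carrier (mpoly R V)"
  shows "\<phi> (mpoly_eval R T h y P) = mpoly_eval R T' h' y' P"
proof -
  interpret T': cring T' by fact
  have yc: "y' v \<in> carrier T'" if "v \<in> V" for v using ring_hom_closed[OF \<phi> y[OF that]] y'[OF that] by simp
  have "(\<phi> \<circ> mpoly_eval R T h y) P = mpoly_eval R T' h' y' P"
  proof (rule mpoly_hom_unique[OF T'.ring_axioms _ _ _ _ P])
    show "\<phi> \<circ> mpoly_eval R T h y \<in> ring_hom (mpoly R V) T'"
      by (rule ring_hom_trans[OF mpoly_eval_hom[OF T h(1)] \<phi>]) (use y in auto)
    show "mpoly_eval R T' h' y' \<in> ring_hom (mpoly R V) T'" by (rule mpoly_eval_hom[OF T' h(2)]) (use yc in auto)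
    show "(\<phi> \<circ> mpoly_eval R T h y) (indexed_const d) = mpoly_eval R T' h' y' (indexed_const d)" if "d \<in> carrier R" for d
      by (simp add: mpoly_eval_const[OF T h(1) that] mpoly_eval_const[OF T' h(2) that] c[OF that])
    show "(\<phi> \<circ> mpoly_eval R T h y) (indexed_var v) = mpoly_eval R T' h' y' (indexed_var v)" if "v \<in> V" for v
      using mpoly_eval_var[OF T h(1), of y v, OF y[OF that]] mpoly_eval_var[OF T' h(2), of y' v, OF yc[OF that]] y'[OF that] by simp
  qed
  then show ?thesis by simp
qed

lemma (in mpoly_base) mpoly_hom_in_subring:
  assumes f: "f \<in> ring_hom (mpoly R V) T" and N: "subring N T"
    and c: "\<And>c. c \<in> carrier R \<Longrightarrow> f (indexed_const c) \<in> N" and v: "\<And>v. v \<in> V \<Longrightarrow> f (indexed_var v) \<in> N"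
    and P: "P \<in> carrier (mpoly R V)"
  shows "f P \<in> N"
  using P
proof (induction rule: mpoly_induct)
  case (mono c m)
  show ?case using mono(2)
  proof (induction m)
    case empty
    then show ?case using c[OF mono(1)] by (simp add: indexed_const_mono)
  next
    case (add x m)
    then have m: "set_mset m \<subseteq> V" and x: "x \<in> V" by auto
    have "mmono R c (add_mset x m) = mmono R c m \<otimes>\<^bsub>mpoly R V\<^esub> indexed_var x"
      using mono_mult[where m = m and n = "{#x#}" and V = V, OF mono(1) one_closed] mono(1) unfolding indexed_var_mono by simp
    moreover have "f (mmono R c m \<otimes>\<^bsub>mpoly R V\<^esub> indexed_var x) = f (mmono R c m) \<otimes>\<^bsub>T\<^esub> f (indexed_var x)"
      by (rule ring_hom_mult[OF f mono_closed[OF mono(1) m] var_closed[OF x]])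
    ultimately show ?case using subringE(6)[OF N add.IH[OF m] v[OF x]] by simp
  qed
next
  case (add P Q)
  then show ?case using ring_hom_add[OF f add(1,2)] subringE(7)[OF N add(3,4)] by simp
qed

type_synonym 'b hull_elem = "(('b \<times> 'b) set list \<times> nat) multiset \<Rightarrow> ('b \<times> 'b) set"

context D_domain
begin

text \<open>As \<sigma>_i is bijective, the conjugate of \<open>I\<close> is a prime; it appears as
  the preimage \<open>q\<close> of \<open>I\<close> under the inverse of conjugation. It is a point
  of the conjugate variety, so by density it belongs to the closed set defined by the contraction of
  \<open>J\<close>, that is, it contains the contraction. Undoing the conjugation gives the
  claim.\<close>

lemma dense_preimage:
  assumes inv: "inversive \<D> K \<delta>" and I: "primeideal I (U n)" and J: "primeideal J (PR n)" and i: "i \<le> Last \<D>"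
    and dense: "zariski_dense (U n) (pi_hat \<D> K n i ` spec_zeros (PR n) J) (conj_space \<D> K \<delta> n i I)"
    and P: "P \<in> carrier (U n)" "pull n i (cj i P) \<in> J"
  shows "P \<in> I"
proof -
  let ?l = "\<lambda>c. inv_into (carrier K) (\<tau> i) c"
  have surj: "c \<in> \<tau> i ` carrier K" if "c \<in> carrier K" for c
  proof (cases "i = 0")
    case True
    then show ?thesis using K.assoc_endo_0[OF DK that] that by (metis image_eqI)
  next
    case False
    then have "\<tau> i ` carrier K = carrier K" using inv i unfolding inversive_def by simp
    then show ?thesis using that by simp
  qed
  have "(\<lambda>c. inv_into (carrier K) (\<tau> i) (id c)) \<in> ring_hom K K"
    by (rule inv_into_hom(1)[OF K.R.ring_axioms K.R.ring_axioms K.R.ring_axioms \<tau>_hom[OF i] K.assoc_endo_inj[OF K i]])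
      (use surj in \<open>auto simp: ring_hom_def\<close>)
  then have l: "?l \<in> ring_hom K K" by simp
  define \<psi> where "\<psi> = (\<lambda>(Q :: nat multiset \<Rightarrow> 'k) m. ?l (Q m))"
  have \<psi>: "\<psi> \<in> ring_hom (U n) (U n)" unfolding \<psi>_def by (rule MB.mpoly_map_hom[OF K.R.is_cring l])
  have inv: "\<psi> (cj i Q) = Q" if "Q \<in> carrier (U n)" for Q
    unfolding \<psi>_def cj_def using inv_into_f_f[OF K.assoc_endo_inj[OF K i] MB.mpoly_carrierD(2)[OF that]] by simp
  define q where "q = {Q \<in> carrier (U n). \<psi> Q \<in> I}"
  have q: "primeideal q (U n)" unfolding q_def by (rule primeideal_preimage[OF U_cring U_cring \<psi> I])
  have Ic: "Q \<in> carrier (U n)" if "Q \<in> I" for Q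
    using additive_subgroup.a_Hcarr[OF ideal.axioms(1)[OF primeideal.axioms(1)[OF I]] that] .
  have cc: "cj i Q \<in> carrier (U n)" if "Q \<in> carrier (U n)" for Q by (rule ring_hom_closed[OF conj_hom[OF i] that])
  have "cj i Q \<in> q" if "Q \<in> I" for Q unfolding q_def using inv[OF Ic[OF that]] cc[OF Ic[OF that]] that by simp
  then have "q \<in> conj_space \<D> K \<delta> n i I" unfolding conj_space_def spec_zeros_def cj_def using q by blast
  then have "q \<in> spec_closure (U n) (pi_hat \<D> K n i ` spec_zeros (PR n) J)" using dense unfolding zariski_dense_def by blast
  moreover have "spec_closed (U n) (spec_zeros (U n) (pi_hat \<D> K n i J))"
    unfolding spec_closed_def by (intro exI[of _ "pi_hat \<D> K n i J"] conjI refl) (auto simp: pi_hat_eq)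
  moreover have "pi_hat \<D> K n i ` spec_zeros (PR n) J \<subseteq> spec_zeros (U n) (pi_hat \<D> K n i J)"
  proof (rule image_subsetI)
    fix p assume "p \<in> spec_zeros (PR n) J"
    then have p: "primeideal p (PR n)" "J \<subseteq> p" unfolding spec_zeros_def by auto
    have "primeideal (pi_hat \<D> K n i p) (U n)"
      unfolding pi_hat_eq by (rule primeideal_preimage[OF U_cring PR_cring pull_hom[OF i] p(1)])
    then show "pi_hat \<D> K n i p \<in> spec_zeros (U n) (pi_hat \<D> K n i J)"
      unfolding spec_zeros_def pi_hat_eq using p(2) by blast
  qed
  ultimately have "q \<in> spec_zeros (U n) (pi_hat \<D> K n i J)" unfolding spec_closure_def by blast
  moreover have "cj i P \<in> pi_hat \<D> K n i J" unfolding pi_hat_eq using cc[OF P(1)] P(2) by simp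
  ultimately have "cj i P \<in> q" unfolding spec_zeros_def by blast
  then show ?thesis unfolding q_def using inv[OF P(1)] by simp
qed

text \<open>Hypothesis \<open>dn\<close> is density in usable form. A polynomial whose expansion at
  the generic point is killed by one \<pi>_i lies in \<open>I\<close>, and then its whole expansion
  is zero. This makes the operators on the subring generated by the base point well defined and all
  \<pi>_i o e injective there.\<close>

lemma generic_point_exists:
  assumes ec: "existentially_closed TYPE('u) \<D> K \<delta>" and f: "\<exists>f :: 'k \<Rightarrow> 'u. inj_on f (carrier K)"
    and I: "primeideal I (U n)" and J: "primeideal J (PR n)" and sub: "prol_ideal \<D> K \<delta> n I \<subseteq> J"
    and dn: "\<And>i P. \<lbrakk>i \<le> Last \<D>; P \<in> carrier (U n); pull n i (cj i P) \<in> J\<rbrakk> \<Longrightarrow> P \<in> I"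
  shows "\<exists>a\<in>rational_points K {..<n} I. nabla \<D> \<delta> n a \<in> rational_points K (pv n) J"
proof -
  have iJ: "ideal J (PR n)" using J by (rule primeideal.axioms(1))
  have Ic: "I \<subseteq> carrier (U n)"
    using additive_subgroup.a_Hcarr[OF ideal.axioms(1)[OF primeideal.axioms(1)[OF I]]] by blast
  interpret J: primeideal J "PR n" by (rule J)
  interpret P: op_alg \<D> "PR n" by (rule PR_op_alg)
  interpret KD: domain K by (rule domK)
  have fK: "field K" using existentially_closed_alg_closed[OF ec f] unfolding algebraically_closed_def by simp
  let ?u = "\<lambda>a. a \<odot>\<^bsub>K\<^esub> \<one>\<^bsub>K\<^esub>"
  have Cnh: "Cn \<in> ring_hom K (PR n)" unfolding prol_ring_def by (rule MB.const_hom)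
  define \<pi> where "\<pi> = (\<lambda>P. J +>\<^bsub>PR n\<^esub> P)"
  \<comment> \<open>The coordinate ring of the variety of \<open>J\<close>, a domain since
    \<open>J\<close> is prime, with the scalars acting through the constants.\<close>
  define Q where "Q = mod_of (PR n Quot J) (\<lambda>a. \<pi> (Cn (?u a)))"
  have domQ: "domain Q" unfolding Q_def by (rule mod_of_domain[OF J.quotient_is_domain])
  interpret Q: domain Q by (rule domQ)
  interpret QB: mpoly_base Q ..
  have \<pi>h: "\<pi> \<in> ring_hom (PR n) Q"
    using J.rcos_ring_hom unfolding \<pi>_def Q_def ring_hom_def by simp
  interpret \<pi>: ring_hom_cring "PR n" Q \<pi> by unfold_locales (rule \<pi>h)
  have \<pi>0: "\<pi> P = \<zero>\<^bsub>Q\<^esub> \<longleftrightarrow> P \<in> J" if "P \<in> carrier (PR n)" for P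
  proof -
    have "\<zero>\<^bsub>Q\<^esub> = J" unfolding Q_def FactRing_def by simp
    then show ?thesis unfolding \<pi>_def using J.rcos_const_imp_mem[OF that] J.a_rcos_const[of P] by auto
  qed
  have \<pi>s: "x \<in> \<pi> ` carrier (PR n)" if "x \<in> carrier Q" for x
    using that unfolding Q_def \<pi>_def FactRing_def A_RCOSETS_def' by auto
  define B where "B = mpoly Q (UNIV :: nat set)"
  let ?c = "ring.indexed_const Q :: _ \<Rightarrow> nat multiset \<Rightarrow> _" and ?x = "ring.indexed_var Q :: nat \<Rightarrow> _"
  have domB: "domain B" unfolding B_def by (rule mpoly_domain[OF domQ])
  interpret BD: domain B by (rule domB)
  have ch: "?c \<in> ring_hom Q B" unfolding B_def by (rule QB.const_hom)
  have g0: "?c \<circ> (\<pi> \<circ> (Cn \<circ> ?u)) \<in> ring_hom (Base \<D>) B"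
    by (intro ring_hom_trans[OF ring_hom_trans[OF ring_hom_trans[OF K.scalar_hom Cnh] \<pi>h] ch])
  from hull_exists[OF domB g0] obtain F :: "('a, (nat multiset \<Rightarrow> ((nat \<times> nat) multiset \<Rightarrow> 'k) set) hull_elem) module" and h where
    F: "op_field \<D> F" and h: "h \<in> ring_hom B F" "inj_on h (carrier B)"
    and ha: "\<And>a. a \<in> carrier (Base \<D>) \<Longrightarrow> h ((?c \<circ> (\<pi> \<circ> (Cn \<circ> ?u))) a) = a \<odot>\<^bsub>F\<^esub> \<one>\<^bsub>F\<^esub>"
    and min: "\<And>N. \<lbrakk>subring N F; h ` carrier B \<subseteq> N; \<forall>x\<in>carrier F. algebraic_rel F N x \<longrightarrow> x \<in> N\<rbrakk> \<Longrightarrow> N = carrier F"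
    by (elim exE conjE) (rule that, assumption+, blast+)
  interpret F: op_field \<D> F by (rule F)
  interpret FD: domain F by (rule F.domainF)
  interpret DF: cring "D_of \<D> F" by (rule F.D_cring)
  define \<kappa> where "\<kappa> = h \<circ> ?c"
  have \<kappa>h: "\<kappa> \<in> ring_hom Q F" unfolding \<kappa>_def by (rule ring_hom_trans[OF ch h(1)])
  have \<kappa>i: "inj_on \<kappa> (carrier Q)"
    unfolding \<kappa>_def
  proof (rule comp_inj_on[OF _ inj_on_subset[OF h(2)]])
    show "inj_on ?c (carrier Q)" by (rule inj_onI) (auto simp: QB.indexed_const_mono mmono_def dest: fun_cong[of _ _ "{#}"])
    show "?c ` carrier Q \<subseteq> carrier B" using ring_hom_closed[OF ch] by auto
  qed
  \<comment> \<open>Evaluation at the generic point of the variety: its kernel is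
    \<open>J\<close>.\<close>
  define g where "g = \<kappa> \<circ> \<pi>"
  have gh: "g \<in> ring_hom (PR n) F" unfolding g_def by (rule ring_hom_trans[OF \<pi>h \<kappa>h])
  interpret g: ring_hom_cring "PR n" F g by unfold_locales (rule gh)
  have g0z: "g P = \<zero>\<^bsub>F\<^esub> \<longleftrightarrow> P \<in> J" if "P \<in> carrier (PR n)" for P
  proof -
    have "\<kappa> (\<pi> P) = \<zero>\<^bsub>F\<^esub> \<longleftrightarrow> \<pi> P = \<zero>\<^bsub>Q\<^esub>"
      using inj_onD[OF \<kappa>i, of "\<pi> P" "\<zero>\<^bsub>Q\<^esub>"] ring_hom_zero[OF \<kappa>h Q.ring_axioms F.R.ring_axioms] that by auto
    then show ?thesis unfolding g_def using \<pi>0[OF that] by simp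
  qed
  have ga: "g \<in> algebra_hom (Base \<D>) (PR n) F"
  proof (rule algebra_hom_of_scalars[OF PR_algebra F.RA.algebra_axioms gh])
    fix a assume a: "a \<in> carrier (Base \<D>)"
    have "a \<odot>\<^bsub>PR n\<^esub> \<one>\<^bsub>PR n\<^esub> = Cn (?u a)"
      using const_algebra_hom[of "pv n"] ring_hom_one[OF Cnh] a unfolding algebra_hom_def prol_ring_def by simp
    then show "g (a \<odot>\<^bsub>PR n\<^esub> \<one>\<^bsub>PR n\<^esub>) = a \<odot>\<^bsub>F\<^esub> \<one>\<^bsub>F\<^esub>" using ha[OF a] unfolding g_def \<kappa>_def by simp
  qed
  define \<iota> where "\<iota> = g \<circ> Cn"
  have \<iota>h: "\<iota> \<in> ring_hom K F" unfolding \<iota>_def by (rule ring_hom_trans[OF Cnh gh])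
  have \<iota>a: "\<iota> \<in> algebra_hom (Base \<D>) K F"
    using ga const_algebra_hom[of "pv n"] \<iota>h ring_hom_closed[OF Cnh] unfolding algebra_hom_def \<iota>_def prol_ring_def by simp
  have \<iota>i: "inj_on \<iota> (carrier K)"
  proof (rule inj_onI)
    interpret i: ring_hom_cring K F \<iota> by unfold_locales (rule \<iota>h)
    fix x y assume xy: "x \<in> carrier K" "y \<in> carrier K" "\<iota> x = \<iota> y"
    have z: "\<iota> (x \<ominus>\<^bsub>K\<^esub> y) = \<zero>\<^bsub>F\<^esub>" using xy by (simp add: a_minus_def F.R.r_neg)
    have "x \<ominus>\<^bsub>K\<^esub> y = \<zero>\<^bsub>K\<^esub>"
    proof (rule ccontr)
      assume "x \<ominus>\<^bsub>K\<^esub> y \<noteq> \<zero>\<^bsub>K\<^esub>"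
      then have u: "x \<ominus>\<^bsub>K\<^esub> y \<in> Units K" using field.field_Units[OF fK] xy by simp
      then have "\<iota> (x \<ominus>\<^bsub>K\<^esub> y) \<otimes>\<^bsub>F\<^esub> \<iota> (inv\<^bsub>K\<^esub> (x \<ominus>\<^bsub>K\<^esub> y)) = \<one>\<^bsub>F\<^esub>"
        using i.hom_mult[of "x \<ominus>\<^bsub>K\<^esub> y" "inv\<^bsub>K\<^esub> (x \<ominus>\<^bsub>K\<^esub> y)"] xy by (simp del: i.hom_mult)
      then show False using u unfolding z by simp
    qed
    then show "x = y" using xy by simp
  qed
  note \<phi>h = D_map_exp_hom[OF F.RA.algebra_axioms \<iota>a]
  \<comment> \<open>The generic point read as an n-tuple over \<D>(F). It is going to be the
    expansion of the base point.\<close>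
  define \<beta> where "\<beta> = (\<lambda>k. \<lambda>j\<in>{..<Len \<D>}. g (Vr (j, k)))"
  have Vc: "Vr (j, k) \<in> carrier (PR n)" if "j < Len \<D>" "k < n" for j k
    unfolding prol_ring_def by (rule MB.var_closed) (use that in \<open>simp add: prol_vars_def\<close>)
  have \<beta>c: "\<beta> \<in> {..<n} \<rightarrow> carrier (D_of \<D> F)" unfolding \<beta>_def F.D_carrier using Vc by auto
  define E where "E = mpoly_eval K (D_of \<D> F) (D_map \<D> \<iota> \<circ> D_exp \<D> \<delta>) \<beta>"
  have Eh: "E \<in> ring_hom (U n) (D_of \<D> F)" unfolding E_def by (rule MB.mpoly_eval_hom[OF F.D_cring \<phi>h(1) \<beta>c])
  have Ec: "E (Cn c) = D_map \<D> \<iota> (D_exp \<D> \<delta> c)" if "c \<in> carrier K" for c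
    unfolding E_def using MB.mpoly_eval_const[OF F.D_cring \<phi>h(1) that] by simp
  have Ev: "E (Vr k) = \<beta> k" if "k < n" for k
    unfolding E_def by (rule MB.mpoly_eval_var[OF F.D_cring \<phi>h(1)]) (use \<beta>c that in auto)
  have EP: "E P = D_map \<D> g (prol n P)" if "P \<in> carrier (U n)" for P
    by (rule prol_eval[OF F.RA.algebra_axioms Eh ga _ _ that])
      (auto simp: Ec Ev \<beta>_def D_map_def \<iota>_def intro!: restrict_ext)
  have piE: "pi_over \<D> F i (E P) = \<kappa> (\<pi> (pull n i (cj i P)))" if "i \<le> Last \<D>" "P \<in> carrier (U n)" for i P
    unfolding EP[OF that(2)] pull_conj[OF that]
    using P.D_map_hom(2)[OF F.RA.algebra_axioms ga that(1) ring_hom_closed[OF prol_hom that(2)]] by (simp add: g_def)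
  have pc: "pull n i (cj i P) \<in> carrier (PR n)" if "i \<le> Last \<D>" "P \<in> carrier (U n)" for i P
    by (rule ring_hom_closed[OF pull_hom[OF that(1)] ring_hom_closed[OF conj_hom[OF that(1)] that(2)]])
  define \<Theta>0 where "\<Theta>0 = pi_over \<D> F 0 \<circ> E"
  have \<Theta>0h: "\<Theta>0 \<in> ring_hom (U n) F" unfolding \<Theta>0_def by (rule ring_hom_trans[OF Eh F.pi_hom[OF le0]])
  \<comment> \<open>With \<open>EI\<close> below, the kernels of all \<pi>_i o E coincide with
    \<open>I\<close>.\<close>
  have piz: "P \<in> I" if "i \<le> Last \<D>" "P \<in> carrier (U n)" "pi_over \<D> F i (E P) = \<zero>\<^bsub>F\<^esub>" for i P
    using dn[OF that(1,2)] g0z[OF pc[OF that(1,2)]] that(3) piE[OF that(1,2)] unfolding g_def by simp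
  have EI: "E P = \<zero>\<^bsub>D_of \<D> F\<^esub>" if P: "P \<in> I" for P
  proof -
    have "prol n P j \<in> J" if "j < Len \<D>" for j using prol_ideal_subset[OF Ic iJ] sub P that by blast
    then have "g (prol n P j) = \<zero>\<^bsub>F\<^esub>" if "j < Len \<D>" for j using g0z[OF J.a_Hcarr] that by blast
    moreover have "P \<in> carrier (U n)" using P Ic by blast
    ultimately show ?thesis by (auto simp: EP D_map_def F.D_zero intro!: restrict_ext)
  qed
  have "\<exists>e. phom \<D> F (\<Theta>0 ` carrier (U n)) e \<and> (\<forall>w\<in>carrier (U n). e (\<Theta>0 w) = E w)"
  proof (rule F.phom_of_homs[OF cring.axioms(1)[OF U_cring] \<Theta>0h Eh])
    fix w assume w: "w \<in> carrier (U n)"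
    show "pi_over \<D> F 0 (E w) = \<Theta>0 w" unfolding \<Theta>0_def by simp
    show "E w = \<zero>\<^bsub>D_of \<D> F\<^esub>" if "\<Theta>0 w = \<zero>\<^bsub>F\<^esub>" using EI piz[OF le0 w] that unfolding \<Theta>0_def by simp
    show "pi_over \<D> F i (E w) \<noteq> \<zero>\<^bsub>F\<^esub>" if "\<Theta>0 w \<noteq> \<zero>\<^bsub>F\<^esub>" "i \<le> Last \<D>" for i
    proof
      assume "pi_over \<D> F i (E w) = \<zero>\<^bsub>F\<^esub>"
      then have "E w = \<zero>\<^bsub>D_of \<D> F\<^esub>" using EI piz[OF that(2) w] by blast
      then have "\<Theta>0 w = \<zero>\<^bsub>F\<^esub>"
        unfolding \<Theta>0_def using ring_hom_zero[OF F.pi_hom[OF le0] DF.ring_axioms F.R.ring_axioms] by simp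
      then show False using that(1) by simp
    qed
  qed
  then obtain e where e: "phom \<D> F (\<Theta>0 ` carrier (U n)) e" "\<And>w. w \<in> carrier (U n) \<Longrightarrow> e (\<Theta>0 w) = E w" by blast
  define S where "S = F\<lparr>carrier := \<Theta>0 ` carrier (U n)\<rparr>"
  have sS: "subring (carrier S) F" and eh: "e \<in> ring_hom S (D_of \<D> F)" and e0: "\<And>s. s \<in> carrier S \<Longrightarrow> pi_over \<D> F 0 (e s) = s"
    and enz: "\<And>s i. \<lbrakk>s \<in> carrier S; s \<noteq> \<zero>\<^bsub>F\<^esub>; i \<le> Last \<D>\<rbrakk> \<Longrightarrow> pi_over \<D> F i (e s) \<noteq> \<zero>\<^bsub>F\<^esub>"
    using e(1) unfolding phom_def S_def by auto
  interpret S: domain S using FD.subring_is_domain[OF sS] unfolding S_def by simp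
  interpret SB: mpoly_base S ..
  have Sz: "\<zero>\<^bsub>S\<^esub> = \<zero>\<^bsub>F\<^esub>" unfolding S_def by simp
  have idh: "id \<in> ring_hom S F" using subringE(1)[OF sS] unfolding S_def ring_hom_def by auto
  have ph: "pi_over \<D> F i \<circ> e \<in> ring_hom S F" if "i \<le> Last \<D>" for i by (rule ring_hom_trans[OF eh F.pi_hom[OF that]])
  \<comment> \<open>Each \<pi>_i o e maps \<open>S\<close> into the copy of \<open>Q\<close> inside
    \<open>F\<close>, so it factors through \<open>Q\<close>. Over the image the adjoined
    indeterminates remain independent.\<close>
  define l where "l = (\<lambda>i s. inv_into (carrier Q) \<kappa> ((pi_over \<D> F i \<circ> e) s))"
  have range: "(pi_over \<D> F i \<circ> e) s \<in> \<kappa> ` carrier Q" if i: "i \<le> Last \<D>" and s: "s \<in> carrier S" for i s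
  proof -
    obtain P where P: "P \<in> carrier (U n)" "s = \<Theta>0 P" using s unfolding S_def by auto
    then have "(pi_over \<D> F i \<circ> e) s = \<kappa> (\<pi> (pull n i (cj i P)))" using e(2) piE[OF i] by simp
    then show ?thesis using pc[OF i P(1)] by simp
  qed
  have l: "l i \<in> ring_hom S Q" "\<And>s. s \<in> carrier S \<Longrightarrow> \<kappa> (l i s) = (pi_over \<D> F i \<circ> e) s" if "i \<le> Last \<D>" for i
    using inv_into_hom[OF S.ring_axioms Q.ring_axioms F.R.ring_axioms \<kappa>h \<kappa>i ph[OF that] range[OF that]]
    unfolding l_def by auto
  have li: "inj_on (l i) (carrier S)" if i: "i \<le> Last \<D>" for i
  proof (rule inj_onI)
    interpret p: ring_hom_cring S F "pi_over \<D> F i \<circ> e" by unfold_locales (rule ph[OF i])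
    fix x y assume xy: "x \<in> carrier S" "y \<in> carrier S" "l i x = l i y"
    then have "(pi_over \<D> F i \<circ> e) x = (pi_over \<D> F i \<circ> e) y" using l(2)[OF i] by metis
    then have "(pi_over \<D> F i \<circ> e) (x \<ominus>\<^bsub>S\<^esub> y) = \<zero>\<^bsub>F\<^esub>" using xy p.hom_closed[OF xy(2)] by (simp add: a_minus_def F.R.r_neg del: comp_apply)
    then have "x \<ominus>\<^bsub>S\<^esub> y = \<zero>\<^bsub>S\<^esub>" using enz[of "x \<ominus>\<^bsub>S\<^esub> y" i] xy i Sz by auto
    then show "x = y" using xy by simp
  qed
  define t where "t = (\<lambda>v. h (?x v))"
  have xc: "?x v \<in> carrier B" for v unfolding B_def by (simp add: QB.var_closed)
  have tc: "t v \<in> carrier F" for v unfolding t_def by (rule ring_hom_closed[OF h(1) xc])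
  \<comment> \<open>Independence of the indeterminates \<open>t v\<close> over the image of
    \<open>S\<close> under \<pi>_i o e, which is \<open>S\<close> itself for i = 0. The renaming
    \<open>r\<close> is used with the shift by \<open>N\<close> for the basis and with the identity
    for its images.\<close>
  have ind: "w = \<zero>\<^bsub>mpoly S V\<^esub>"
    if "i \<le> Last \<D>" "inj_on r V" "\<phi> \<in> ring_hom S F" "\<And>s. s \<in> carrier S \<Longrightarrow> \<phi> s = (pi_over \<D> F i \<circ> e) s"
      "\<And>v. v \<in> V \<Longrightarrow> y v = t (r v)" "w \<in> carrier (mpoly S V)" "mpoly_eval S F \<phi> y w = \<zero>\<^bsub>F\<^esub>"
    for i and r :: "nat \<Rightarrow> nat" and V \<phi> y w
    by (rule shift_eval_zero[OF S.is_cring Q.is_cring F.R.is_cring l(1)[OF that(1)] li[OF that(1)] that(2)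
          h(1)[unfolded B_def] h(2)[unfolded B_def] that(3) _ _ that(6,7)])
      (use that(4,5) l(2)[OF that(1)] in \<open>simp_all add: t_def \<kappa>_def\<close>)
  have "finite (pv n)" unfolding prol_vars_def by simp
  from finite_imp_nat_seg_image_inj_on[OF this] obtain N :: nat and bb where bb: "pv n = bb ` {v. v < N}"
    by (elim exE conjE) (rule that)
  \<comment> \<open>The \<open>t v\<close> serve twice: as values of \<open>\<pi>\<^sub>i \<circ> e\<close> on the transcendence basis \<open>V\<close> below, whence the
    independent family has to be as long as \<open>V\<close>, and, shifted by \<open>N\<close>, as elements of \<open>V\<close>.\<close>
  define y where "y = (\<lambda>v. if v < N then g (Vr (bb v)) else t (v - N))"
  have yc: "y v \<in> carrier F" for v
  proof (cases "v < N")
    case True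
    then have "bb v \<in> pv n" unfolding bb by blast
    then have "Vr (bb v) \<in> carrier (PR n)" unfolding prol_ring_def by (rule MB.var_closed)
    then show ?thesis using True unfolding y_def by simp
  qed (simp add: y_def tc)
  define indep where "indep = (\<lambda>V. \<forall>w\<in>carrier (mpoly S V). mpoly_eval S F id y w = \<zero>\<^bsub>F\<^esub> \<longrightarrow> w = \<zero>\<^bsub>mpoly S V\<^esub>)"
  have "indep ({} \<union> {N..})"
    unfolding indep_def
  proof (intro ballI impI)
    fix w assume w: "w \<in> carrier (mpoly S ({} \<union> {N..}))" "mpoly_eval S F id y w = \<zero>\<^bsub>F\<^esub>"
    show "w = \<zero>\<^bsub>mpoly S ({} \<union> {N..})\<^esub>"
      by (rule ind[OF le0 _ idh _ _ w, of "\<lambda>v. v - N"]) (auto simp: inj_on_def y_def e0)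
  qed
  then have ne: "{A. A \<subseteq> {..<N} \<and> indep (A \<union> {N..})} \<noteq> {}" by blast
  have fin: "finite {A. A \<subseteq> {..<N} \<and> indep (A \<union> {N..})}" by simp
  \<comment> \<open>All indeterminates are kept and only the finitely many coordinates of the
    generic point compete for a place in the basis, so a maximal independent set exists by
    finiteness.\<close>
  from finite_has_maximal[OF fin ne] obtain A where A': "A \<in> {A. A \<subseteq> {..<N} \<and> indep (A \<union> {N..})}"
    "\<forall>A'\<in>{A. A \<subseteq> {..<N} \<and> indep (A \<union> {N..})}. A \<subseteq> A' \<longrightarrow> A = A'" by (elim bexE) (rule that)
  then have A: "A \<subseteq> {..<N}" "indep (A \<union> {N..})" by simp_all
  have Amax: "A = A'" if "A' \<subseteq> {..<N}" "indep (A' \<union> {N..})" "A \<subseteq> A'" for A'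
    using bspec[OF A'(2), of A'] that by simp
  define V where "V = A \<union> {N..}"
  have iV: "w = \<zero>\<^bsub>mpoly S V\<^esub>" if "w \<in> carrier (mpoly S V)" "mpoly_eval S F id y w = \<zero>\<^bsub>F\<^esub>" for w
    using A(2) that unfolding indep_def V_def by blast
  define \<Theta> where "\<Theta> = mpoly_eval S F id y"
  have alg: "algebraic_rel F (\<Theta> ` carrier (mpoly S V)) (y v)" if v: "v < N" "v \<notin> V" for v
  proof -
    have "\<not> indep (insert v A \<union> {N..})" using Amax[of "insert v A"] A(1) v unfolding V_def by auto
    then obtain w where w: "w \<in> carrier (mpoly S (insert v V))" "mpoly_eval S F id y w = \<zero>\<^bsub>F\<^esub>" "w \<noteq> \<zero>\<^bsub>mpoly S (insert v V)\<^esub>"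
      unfolding indep_def V_def by auto
    show ?thesis
      unfolding \<Theta>_def by (rule SB.dependent_algebraic[OF v(2) F.R.is_cring idh _ w(1,3,2) iV]) (use yc in auto)
  qed
  have \<Theta>h: "\<Theta> \<in> ring_hom (mpoly S V) F" unfolding \<Theta>_def by (rule SB.mpoly_eval_hom[OF F.R.is_cring idh]) (use yc in auto)
  have \<Theta>c: "\<Theta> (ring.indexed_const S s) = s" if "s \<in> carrier S" for s
    unfolding \<Theta>_def using SB.mpoly_eval_const[OF F.R.is_cring idh that] by simp
  have \<Theta>v: "\<Theta> (ring.indexed_var S v) = y v" for v
    unfolding \<Theta>_def by (rule SB.mpoly_eval_var[OF F.R.is_cring idh yc])
  \<comment> \<open>\<pi>_0 has to return the basis element, while every other \<pi>_i sends it to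
    the indeterminate with the same index.\<close>
  have "\<exists>z\<in>carrier (D_of \<D> F). \<forall>i\<le>Last \<D>. pi_over \<D> F i z = (if i = 0 then y v else t v)" for v
    by (rule F.D_lift) (use yc tc in simp)
  then have "\<forall>v. \<exists>z. z \<in> carrier (D_of \<D> F) \<and> (\<forall>i\<le>Last \<D>. pi_over \<D> F i z = (if i = 0 then y v else t v))" by blast
  from choice[OF this] obtain z where z': "\<forall>v. z v \<in> carrier (D_of \<D> F) \<and>
    (\<forall>i\<le>Last \<D>. pi_over \<D> F i (z v) = (if i = 0 then y v else t v))" by (elim exE) (rule that)
  have z: "z v \<in> carrier (D_of \<D> F)" "i \<le> Last \<D> \<Longrightarrow> pi_over \<D> F i (z v) = (if i = 0 then y v else t v)" for v i
    using spec[OF z', of v] by simp_all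
  define \<Psi> where "\<Psi> = mpoly_eval S (D_of \<D> F) e z"
  have \<Psi>h: "\<Psi> \<in> ring_hom (mpoly S V) (D_of \<D> F)" unfolding \<Psi>_def by (rule SB.mpoly_eval_hom[OF F.D_cring eh]) (use z in auto)
  have \<Psi>c: "\<Psi> (ring.indexed_const S s) = e s" if "s \<in> carrier S" for s
    unfolding \<Psi>_def by (rule SB.mpoly_eval_const[OF F.D_cring eh that])
  have MS: "ring (mpoly S V)" using SB.mpoly_cring by (rule cring.axioms(1))
  have pi0: "pi_over \<D> F 0 (\<Psi> w) = \<Theta> w" if "w \<in> carrier (mpoly S V)" for w
    unfolding \<Psi>_def \<Theta>_def
    by (rule SB.mpoly_eval_comp[OF F.D_cring F.R.is_cring eh idh F.pi_hom[OF le0] _ _ _ that]) (use z e0 in auto)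
  have S\<Theta>0: "\<Theta>0 P \<in> carrier S" if "P \<in> carrier (U n)" for P unfolding S_def using that by simp
  have Uc: "Cn k \<in> carrier (U n)" if "k \<in> carrier K" for k by (rule MB.const_closed[OF that])
  have \<Theta>0c: "\<Theta>0 (Cn k) = \<iota> k" if "k \<in> carrier K" for k
    using \<phi>h(2)[OF le0 that] Ec[OF that] K.assoc_endo_0[OF DK that] unfolding \<Theta>0_def by simp
  have "\<exists>\<delta>'. class_K \<D> F \<delta>' \<and> D_embedding \<D> K \<delta> F \<delta>' \<iota> \<and> (\<forall>w\<in>carrier (mpoly S V). D_exp \<D> \<delta>' (\<Theta> w) = \<Psi> w)"
  proof (rule F.extension[OF DK \<iota>a \<iota>i MS \<Theta>h \<Psi>h pi0])
    fix w assume w: "w \<in> carrier (mpoly S V)"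
    show "\<Psi> w = \<zero>\<^bsub>D_of \<D> F\<^esub>" if "\<Theta> w = \<zero>\<^bsub>F\<^esub>"
      using iV[OF w that[unfolded \<Theta>_def]] ring_hom_zero[OF \<Psi>h MS DF.ring_axioms] by simp
    show "pi_over \<D> F i (\<Psi> w) \<noteq> \<zero>\<^bsub>F\<^esub>" if nz: "\<Theta> w \<noteq> \<zero>\<^bsub>F\<^esub>" and i: "i \<le> Last \<D>" for i
    proof (cases "i = 0")
      case True
      then show ?thesis using pi0[OF w] nz by simp
    next
      case False
      show ?thesis
      proof
        assume "pi_over \<D> F i (\<Psi> w) = \<zero>\<^bsub>F\<^esub>"
        moreover have "pi_over \<D> F i (\<Psi> w) = mpoly_eval S F (pi_over \<D> F i \<circ> e) t w"
          unfolding \<Psi>_def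
          by (rule SB.mpoly_eval_comp[OF F.D_cring F.R.is_cring eh ph[OF i] F.pi_hom[OF i] _ _ _ w]) (use z i False in auto)
        ultimately have "w = \<zero>\<^bsub>mpoly S V\<^esub>" by (intro ind[OF i _ ph[OF i] _ _ w, of id t]) auto
        then show False using nz ring_hom_zero[OF \<Theta>h MS F.R.ring_axioms] by simp
      qed
    qed
  next
    fix k assume k: "k \<in> carrier K"
    let ?w = "ring.indexed_const S (\<iota> k)"
    have ik: "\<iota> k \<in> carrier S" using S\<Theta>0[OF Uc[OF k]] \<Theta>0c[OF k] by simp
    have "e (\<iota> k) = D_map \<D> \<iota> (D_exp \<D> \<delta> k)" using e(2)[OF Uc[OF k]] \<Theta>0c[OF k] Ec[OF k] by simp
    then show "\<exists>w\<in>carrier (mpoly S V). \<Theta> w = \<iota> k \<and> \<Psi> w = D_map \<D> \<iota> (D_exp \<D> \<delta> k)"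
      using SB.const_closed[OF ik] \<Theta>c[OF ik] \<Psi>c[OF ik] by metis
  next
    \<comment> \<open>A subring closed under algebraic elements that contains \<open>S\<close> and
      the basis contains the remaining coordinates by \<open>alg\<close>, hence the copy of
      \<open>Q\<close>, and with the indeterminates the whole image of \<open>B\<close>.\<close>
    fix M assume M: "subring M F" "\<Theta> ` carrier (mpoly S V) \<subseteq> M" "\<And>x. \<lbrakk>x \<in> carrier F; algebraic_rel F M x\<rbrakk> \<Longrightarrow> x \<in> M"
    have SM: "s \<in> M" if "s \<in> carrier S" for s
      using imageI[OF SB.const_closed[OF that, of V], of \<Theta>] \<Theta>c[OF that] M(2) by auto
    have VM: "y v \<in> M" if "v \<in> V" for v
      using imageI[OF SB.var_closed[OF that], of \<Theta>] \<Theta>v[of v] M(2) by auto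
    have yM: "y v \<in> M" for v
    proof (cases "v \<in> V")
      case False
      then have "v < N" unfolding V_def by auto
      then have "algebraic_rel F (\<Theta> ` carrier (mpoly S V)) (y v)" using alg False by blast
      then have "algebraic_rel F M (y v)" using M(2) unfolding algebraic_rel_def by (meson subsetD)
      then show ?thesis using M(3) yc by blast
    qed (rule VM)
    have gM: "g P \<in> M" if "P \<in> carrier (PR n)" for P
    proof (rule MB.mpoly_hom_in_subring[OF gh[unfolded prol_ring_def] M(1) _ _ that[unfolded prol_ring_def]])
      show "g (Cn c) \<in> M" if "c \<in> carrier K" for c
        using SM[OF S\<Theta>0[OF Uc[OF that]]] \<Theta>0c[OF that] unfolding \<iota>_def by simp
      show "g (Vr x) \<in> M" if x: "x \<in> pv n" for x
      proof -
        obtain v where "v < N" "x = bb v" using x unfolding bb by blast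
        then show ?thesis using yM[of v] unfolding y_def by simp
      qed
    qed
    have "h P \<in> M" if "P \<in> carrier B" for P
    proof (rule QB.mpoly_hom_in_subring[OF h(1)[unfolded B_def] M(1) _ _ that[unfolded B_def]])
      show "h (?c c) \<in> M" if c: "c \<in> carrier Q" for c
      proof -
        obtain P where "P \<in> carrier (PR n)" "c = \<pi> P" using \<pi>s[OF c] by blast
        then show ?thesis using gM[of P] unfolding g_def \<kappa>_def by simp
      qed
      show "h (?x v) \<in> M" for v using yM[of "v + N"] unfolding y_def t_def by simp
    qed
    then show "M = carrier F" by (intro min M(1)) (use M(3) in auto)
  qed
  then obtain \<delta>' where \<delta>': "class_K \<D> F \<delta>'" "D_embedding \<D> K \<delta> F \<delta>' \<iota>"
    "\<And>w. w \<in> carrier (mpoly S V) \<Longrightarrow> D_exp \<D> \<delta>' (\<Theta> w) = \<Psi> w" by blast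
  \<comment> \<open>The tuple is padded with zeros beyond \<open>n\<close>, since an assignment
    gives values to all variables.\<close>
  define c where "c = (\<lambda>k. if k < n then \<Theta>0 (Vr k) else \<zero>\<^bsub>F\<^esub>)"
  have UV: "Vr k \<in> carrier (U n)" if "k < n" for k by (rule MB.var_closed) (use that in simp)
  have cc: "c k \<in> carrier F" for k unfolding c_def using ring_hom_closed[OF \<Theta>0h UV] by simp
  have exp: "D_exp \<D> \<delta>' (c k) = \<beta> k" if k: "k < n" for k
  proof -
    have s: "c k \<in> carrier S" unfolding c_def using S\<Theta>0[OF UV[OF k]] k by simp
    have "D_exp \<D> \<delta>' (c k) = e (c k)" using \<delta>'(3)[OF SB.const_closed[OF s]] \<Theta>c[OF s] \<Psi>c[OF s] by simp
    then show ?thesis using e(2)[OF UV[OF k]] Ev[OF k] k unfolding c_def by simp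
  qed
  have nab: "nabla \<D> \<delta>' n c x = g (Vr x)" if x: "x \<in> pv n" for x
  proof -
    obtain j k where jk: "x = (j, k)" "j < Len \<D>" "k < n" using x unfolding prol_vars_def by blast
    have "nabla \<D> \<delta>' n c x = D_exp \<D> \<delta>' (c k) j" using jk x by (simp add: nabla_def D_exp_def)
    then show ?thesis using exp[OF jk(3)] jk by (simp add: \<beta>_def)
  qed
  have DF: "D_ring \<D> F \<delta>'" using \<delta>'(1) unfolding class_K_def by auto
  have nc: "nabla \<D> \<delta>' n c \<in> pv n \<rightarrow> carrier F" by (rule nabla_closed[OF DF cc])
  show ?thesis
  proof (rule ec_rational_point[OF ec f iJ Ic sub \<delta>'(1,2) cc])
    fix P assume P: "P \<in> J"
    then have Pc: "P \<in> carrier (PR n)" by (rule J.a_Hcarr)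
    have "mpoly_eval K F \<iota> (nabla \<D> \<delta>' n c) P = g P"
    proof (rule MB.mpoly_hom_unique[OF F.R.ring_axioms _ gh[unfolded prol_ring_def] _ _ Pc[unfolded prol_ring_def]])
      show "mpoly_eval K F \<iota> (nabla \<D> \<delta>' n c) \<in> ring_hom (mpoly K (pv n)) F" by (rule MB.mpoly_eval_hom[OF F.R.is_cring \<iota>h nc])
      show "mpoly_eval K F \<iota> (nabla \<D> \<delta>' n c) (Cn d) = g (Cn d)" if "d \<in> carrier K" for d
        using MB.mpoly_eval_const[OF F.R.is_cring \<iota>h that] by (simp add: \<iota>_def)
      show "mpoly_eval K F \<iota> (nabla \<D> \<delta>' n c) (Vr x) = g (Vr x)" if "x \<in> pv n" for x
        using MB.mpoly_eval_var[OF F.R.is_cring \<iota>h, of "nabla \<D> \<delta>' n c" x, OF funcset_mem[OF nc that]] nab[OF that] by simp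
    qed
    then show "mpoly_eval K F \<iota> (nabla \<D> \<delta>' n c) P = \<zero>\<^bsub>F\<^esub>" using g0z[OF Pc] P by simp
  qed
qed

theorem existentially_closed_geometric:
  assumes ec: "existentially_closed TYPE('u) \<D> K \<delta>" and f: "\<exists>f :: 'k \<Rightarrow> 'u. inj_on f (carrier K)"
  shows "geometric_axiom \<D> K \<delta>"
  unfolding geometric_axiom_def
proof (intro allI impI)
  fix n I J
  assume A: "irreducible_variety (U n) I \<and> irreducible_variety (PR n) J \<and> prol_ideal \<D> K \<delta> n I \<subseteq> J \<and>
    (\<forall>i\<le>Last \<D>. zariski_dense (U n) (pi_hat \<D> K n i ` spec_zeros (PR n) J) (conj_space \<D> K \<delta> n i I))"
  have I: "primeideal I (U n)" using cring.irreducible_variety_prime[OF U_cring] A by blast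
  have J: "primeideal J (PR n)" using cring.irreducible_variety_prime[OF PR_cring] A by blast
  show "\<exists>a\<in>rational_points K {..<n} I. nabla \<D> \<delta> n a \<in> rational_points K (pv n) J"
    by (rule generic_point_exists[OF ec f I J])
      (use A dense_preimage[OF existentially_closed_inversive[OF ec f] I J] in blast)+
qed

end

theorem theorem4p6:
  fixes \<D> :: "('a, 'd, 'b) operator_data"
    and K :: "('a, 'k) module"
    and \<delta> :: "nat \<Rightarrow> 'k \<Rightarrow> 'k"
  assumes "operator_data \<D>"
    and "class_K \<D> K \<delta>"
    and "\<exists>f :: 'k \<Rightarrow> 'u. inj_on f (carrier K)"
  shows "existentially_closed TYPE('u) \<D> K \<delta> \<longleftrightarrow>
    algebraically_closed K \<and> inversive \<D> K \<delta> \<and> geometric_axiom \<D> K \<delta>"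
proof -
  interpret D_domain \<D> K \<delta>
    by (intro D_domain.intro op_data.intro D_domain_axioms.intro assms)
  show ?thesis
    using existentially_closedI existentially_closed_alg_closed[OF _ assms(3)]
      existentially_closed_inversive[OF _ assms(3)] existentially_closed_geometric[OF _ assms(3)] by blast
qed

end
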